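(* Let $A$ be an expansive dilation on $\mathbb{R}^n$ and let $p(\cdot)\in C^{\log}$ satisfy $0<p_-\le p_+\le1$. Then there exists a positive constant $C$ (independent of $f$) such that, for any $f\in\mathcal{H}^{p(\cdot)}_A(\mathbb{R}^n)$, there exists a continuous function $F$ on $\mathbb{R}^n$ such that $\widehat f=F$ in $\mathcal{S}'(\mathbb{R}^n)$ and $$\left[\int_{\mathbb{R}^n}|F(x)|^{p_+}\min\left\{[\rho_{A^*}(x)]^{p_+-1-p_+/p_-},\,[\rho_{A^*}(x)]^{p_+-2}\right\}dx\right]^{1/p_+}\le C\,\|f\|_{\mathcal{H}^{p(\cdot)}_A},$$ where $A^*$ denotes the transposed matrix of $A$ and $\widehat f$ is the Fourier transform of $f$.
   Context: Dilations. A real $n\times n$ matrix $A$ is an expansive dilation if all its eigenvalues $\lambda$ satisfy $|\lambda|>1$. Put $b:=|\det A|$. Let $\lambda_-$ be a fixed number with $1<\lambda_-<\min\{|\lambda|:\lambda\text{ an eigenvalue of }A\}$ (equality with the minimum is allowed if $A$ is diagonalizable over $\mathbb{C}$). There exist $r\in(1,\infty)$ and an ellipsoid $\Delta=\{x\in\mathbb{R}^n:|Px|<1\}$, with $P$ a non-degenerate $n\times n$ matrix, such that $|\Delta|=1$ and $\Delta\subset r\Delta\subset A\Delta$; fix these and set $B_k:=A^k\Delta$ for $k\in\mathbb{Z}$, so $|B_k|=b^k$. The step quasi-norm is $\rho(x)=\rho_A(x):=b^k$ if $x\in B_{k+1}\setminus B_k$ ($k\in\mathbb{Z}$), and $\rho_A(0):=0$.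 $\rho_{A^*}$ is the step quasi-norm defined in the same way from the dilation $A^*$ (the transpose of $A$, with $|\det A^*|=b$). Variable exponents. A variable exponent is a measurable function $p(\cdot):\mathbb{R}^n\to(0,\infty)$; $p_-:=\operatorname{ess\,inf}p$, $p_+:=\operatorname{ess\,sup}p$, $\underline{p}:=\min\{p_-,1\}$; $\mathcal{P}$ is the set of variable exponents with $0<p_-\le p_+<\infty$. For $p(\cdot)\in\mathcal P$, $\|f\|_{L^{p(\cdot)}}:=\inf\{\lambda\in(0,\infty):\int_{\mathbb{R}^n}(|f(x)|/\lambda)^{p(x)}dx\le1\}$, and $L^{p(\cdot)}$ is the set of measurable $f$ with $\int_{\mathbb{R}^n}|f(x)|^{p(x)}dx<\infty$. $p(\cdot)\in C^{\log}$ means that $p(\cdot)\in\mathcal{P}$ and there exist positive constants $C_{\log}(p),C_\infty$ and $p_\infty\in\mathbb{R}$ such that for all $x,y\in\mathbb{R}^n$: $|p(x)-p(y)|\le C_{\log}(p)/\log(e+1/\rho(x-y))$ and $|p(x)-p_\infty|\le C_\infty/\log(e+\rho(x))$. Hardy space. $\mathcal{S}$ is the Schwartz space and $\mathcal{S}'$ the space of tempered distributions. For $N\in\mathbb{N}$, $\mathcal{S}_N$ is the set of $\varphi\in\mathcal{S}$ with $\sup_{x}[\rho(x)]^\ell|\partial^\alpha\varphi(x)|\le1$ for all multi-indices $|\alpha|\le N$ and integers $0\le\ell\le N$. For $\varphi\in\mathcal S$, $\varphi_k(x):=b^{-k}\varphi(A^{-k}x)$. For $f\in\mathcal{S}'$,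 $M_N(f)(x):=\sup_{\varphi\in\mathcal{S}_N}\sup_{k\in\mathbb{Z},\,y\in x+B_k}|f*\varphi_k(y)|$. Fix an integer $N\ge\lfloor(1/\underline{p}-1)\ln b/\ln\lambda_-\rfloor+2$. Then $\mathcal{H}^{p(\cdot)}_A:=\{f\in\mathcal{S}':M_N(f)\in L^{p(\cdot)}\}$ with $\|f\|_{\mathcal{H}^{p(\cdot)}_A}:=\|M_N(f)\|_{L^{p(\cdot)}}$. The Fourier transform is $\widehat f(x)=\int_{\mathbb{R}^n}f(\xi)e^{-2\pi i\langle x,\xi\rangle}d\xi$ for integrable $f$, extended to $\mathcal{S}'$ by duality. *)

theory Defs
  imports "HOL-Analysis.Analysis" "HOL-Probability.Essential_Supremum"
begin

definition complex_matrix :: "real^'n^'n \<Rightarrow> complex^'n^'n" where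
  "complex_matrix A = map_matrix complex_of_real A"

definition complex_eigenvalue :: "real^'n^'n \<Rightarrow> complex \<Rightarrow> bool" where
  "complex_eigenvalue A l \<longleftrightarrow> (\<exists>v. v \<noteq> 0 \<and> complex_matrix A *v v = l *s v)"

definition expansive_dilation :: "real^'n^'n \<Rightarrow> bool" where
  "expansive_dilation A \<longleftrightarrow> (\<forall>l. complex_eigenvalue A l \<longrightarrow> 1 < cmod l)"

definition diagonalizable_complex :: "real^'n^'n \<Rightarrow> bool" where
  "diagonalizable_complex A \<longleftrightarrow>
     (\<exists>Q D :: complex^'n^'n. invertible Q \<and> (\<forall>i j. i \<noteq> j \<longrightarrow> D $ i $ j = 0)
        \<and> complex_matrix A = Q ** D ** matrix_inv Q)"

definition lower_eigen_bound :: "real^'n^'n \<Rightarrow> real \<Rightarrow> bool" where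
  "lower_eigen_bound A lm \<longleftrightarrow> 1 < lm \<and>
     ((\<forall>l. complex_eigenvalue A l \<longrightarrow> lm < cmod l) \<or>
      (diagonalizable_complex A \<and> (\<forall>l. complex_eigenvalue A l \<longrightarrow> lm \<le> cmod l)))"

text \<open>Integer powers of a matrix with respect to \<open>**\<close>; the library operation \<open>^\<close> on
  \<^typ>\<open>real^'n^'n\<close> is the componentwise power.\<close>

definition matrix_powi :: "real^'n^'n \<Rightarrow> int \<Rightarrow> real^'n^'n" where
  "matrix_powi A k =
     (if 0 \<le> k then (((**) A) ^^ nat k) (mat 1) else (((**) (matrix_inv A)) ^^ nat (- k)) (mat 1))"

definition dilation_ellipsoid :: "real^'n^'n \<Rightarrow> (real^'n) set \<Rightarrow> bool" where
  "dilation_ellipsoid A \<Delta> \<longleftrightarrow>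
     (\<exists>(P :: real^'n^'n) (r :: real). invertible P \<and> 1 < r \<and> \<Delta> = {x. norm (P *v x) < 1}
        \<and> emeasure lebesgue \<Delta> = 1
        \<and> \<Delta> \<subseteq> (\<lambda>x. r *\<^sub>R x) ` \<Delta> \<and> (\<lambda>x. r *\<^sub>R x) ` \<Delta> \<subseteq> (\<lambda>x. A *v x) ` \<Delta>)"

definition dilated_ball :: "real^'n^'n \<Rightarrow> (real^'n) set \<Rightarrow> int \<Rightarrow> (real^'n) set" where
  "dilated_ball A \<Delta> k = (\<lambda>x. matrix_powi A k *v x) ` \<Delta>"

definition step_quasi_norm :: "real^'n^'n \<Rightarrow> (real^'n) set \<Rightarrow> real^'n \<Rightarrow> real" where
  "step_quasi_norm A \<Delta> x =
     (if x = 0 then 0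
      else \<bar>det A\<bar> powi (THE k. x \<in> dilated_ball A \<Delta> (k + 1) - dilated_ball A \<Delta> k))"

definition ess_plus :: "(real^'n \<Rightarrow> real) \<Rightarrow> ereal" where
  "ess_plus p = esssup lebesgue (\<lambda>x. ereal (p x))"

definition ess_minus :: "(real^'n \<Rightarrow> real) \<Rightarrow> ereal" where
  "ess_minus p = - esssup lebesgue (\<lambda>x. - ereal (p x))"

definition variable_exponents :: "(real^'n \<Rightarrow> real) set" where
  "variable_exponents =
     {p. p \<in> borel_measurable lebesgue \<and> (\<forall>x. 0 < p x)
         \<and> 0 < ess_minus p \<and> ess_minus p \<le> ess_plus p \<and> ess_plus p < \<infinity>}"

text \<open>The essential bounds as real numbers; meaningful for members of
  \<^const>\<open>variable_exponents\<close>, where they are finite.\<close>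

definition p_plus :: "(real^'n \<Rightarrow> real) \<Rightarrow> real" where
  "p_plus p = real_of_ereal (ess_plus p)"

definition p_minus :: "(real^'n \<Rightarrow> real) \<Rightarrow> real" where
  "p_minus p = real_of_ereal (ess_minus p)"

definition p_underline :: "(real^'n \<Rightarrow> real) \<Rightarrow> real" where
  "p_underline p = min (p_minus p) 1"

text \<open>For \<open>x = y\<close> the first inequality holds trivially, with \<open>1 / 0 = 0\<close> as with \<open>1 / 0 = \<infinity>\<close>.\<close>

definition log_holder :: "real^'n^'n \<Rightarrow> (real^'n) set \<Rightarrow> (real^'n \<Rightarrow> real) set" where
  "log_holder A \<Delta> =
     {p \<in> variable_exponents.
        \<exists>Clog > 0. \<exists>Cinf > 0. \<exists>pinf :: real. \<forall>x y.
           \<bar>p x - p y\<bar> \<le> Clog / ln (exp 1 + 1 / step_quasi_norm A \<Delta> (x - y))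
         \<and> \<bar>p x - pinf\<bar> \<le> Cinf / ln (exp 1 + step_quasi_norm A \<Delta> x)}"

text \<open>Maximal functions may take the value \<open>\<infinity>\<close>, so the variable Lebesgue space is set up for
  \<open>[0,\<infinity>]\<close>-valued functions (standing for \<open>|f|\<close>). The power is only used for exponents \<open>> 0\<close>.\<close>

definition enn_powr :: "ennreal \<Rightarrow> real \<Rightarrow> ennreal" where
  "enn_powr x a = (if x = top then top else ennreal (enn2real x powr a))"

definition Lvar :: "(real^'n \<Rightarrow> real) \<Rightarrow> (real^'n \<Rightarrow> ennreal) set" where
  "Lvar p = {g \<in> borel_measurable lebesgue. (\<integral>\<^sup>+ x. enn_powr (g x) (p x) \<partial>lebesgue) < \<infinity>}"

definition Lvar_norm :: "(real^'n \<Rightarrow> real) \<Rightarrow> (real^'n \<Rightarrow> ennreal) \<Rightarrow> ennreal" where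
  "Lvar_norm p g =
     Inf {ennreal l | l. 0 < l \<and> (\<integral>\<^sup>+ x. enn_powr (g x / ennreal l) (p x) \<partial>lebesgue) \<le> 1}"

definition partial_deriv :: "'n \<Rightarrow> (real^'n \<Rightarrow> complex) \<Rightarrow> real^'n \<Rightarrow> complex" where
  "partial_deriv i \<phi> x = vector_derivative (\<lambda>t. \<phi> (x + t *\<^sub>R axis i 1)) (at 0)"

definition iter_partial :: "'n list \<Rightarrow> (real^'n \<Rightarrow> complex) \<Rightarrow> real^'n \<Rightarrow> complex" where
  "iter_partial is \<phi> = foldr partial_deriv is \<phi>"

definition smooth_fun :: "(real^'n \<Rightarrow> complex) \<Rightarrow> bool" where
  "smooth_fun \<phi> \<longleftrightarrow> (\<forall>is x. iter_partial is \<phi> differentiable (at x))"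

text \<open>Multi-indices are functions \<open>\<alpha> :: 'n \<Rightarrow> nat\<close>. As \<^typ>\<open>'n\<close> carries no order,
  \<open>\<partial>\<^sup>\<alpha>\<close> differentiates \<open>\<alpha> i\<close> times in the \<open>i\<close>-th variable in some chosen order; for
  smooth functions the order is immaterial.\<close>

definition mi_deriv :: "('n \<Rightarrow> nat) \<Rightarrow> (real^'n \<Rightarrow> complex) \<Rightarrow> real^'n \<Rightarrow> complex" where
  "mi_deriv \<alpha> \<phi> = iter_partial (SOME is. \<forall>i. count_list is i = \<alpha> i) \<phi>"

definition mi_abs :: "('n::finite \<Rightarrow> nat) \<Rightarrow> nat" where
  "mi_abs \<alpha> = (\<Sum>i\<in>UNIV. \<alpha> i)"

definition mi_power :: "real^'n \<Rightarrow> ('n \<Rightarrow> nat) \<Rightarrow> real" where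
  "mi_power x \<beta> = (\<Prod>i\<in>UNIV. (x $ i) ^ \<beta> i)"

definition schwartz_space :: "(real^'n \<Rightarrow> complex) set" where
  "schwartz_space =
     {\<phi>. smooth_fun \<phi> \<and> (\<forall>\<alpha> \<beta>. bounded (range (\<lambda>x. mi_power x \<beta> *\<^sub>R mi_deriv \<alpha> \<phi> x)))}"

definition schwartz_seminorm ::
  "('n \<Rightarrow> nat) \<Rightarrow> ('n \<Rightarrow> nat) \<Rightarrow> (real^'n \<Rightarrow> complex) \<Rightarrow> real" where
  "schwartz_seminorm \<alpha> \<beta> \<phi> = (SUP x. norm (mi_power x \<beta> *\<^sub>R mi_deriv \<alpha> \<phi> x))"

definition schwartz_topology :: "(real^'n \<Rightarrow> complex) topology" where
  "schwartz_topology = topology_generated_by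
     {{\<psi> \<in> schwartz_space. schwartz_seminorm \<alpha> \<beta> (\<lambda>x. \<psi> x - \<phi> x) < e} | \<alpha> \<beta> \<phi> e.
        \<phi> \<in> schwartz_space \<and> 0 < e}"

text \<open>Functionals are total functions in HOL; only their values on \<^const>\<open>schwartz_space\<close> matter.\<close>

definition tempered_distributions :: "((real^'n \<Rightarrow> complex) \<Rightarrow> complex) set" where
  "tempered_distributions =
     {f. (\<forall>\<phi>\<in>schwartz_space. \<forall>\<psi>\<in>schwartz_space. f (\<lambda>x. \<phi> x + \<psi> x) = f \<phi> + f \<psi>)
       \<and> (\<forall>c. \<forall>\<phi>\<in>schwartz_space. f (\<lambda>x. c * \<phi> x) = c * f \<phi>)
       \<and> continuous_map schwartz_topology euclidean f}"

definition convolution ::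
  "((real^'n \<Rightarrow> complex) \<Rightarrow> complex) \<Rightarrow> (real^'n \<Rightarrow> complex) \<Rightarrow> real^'n \<Rightarrow> complex" where
  "convolution f \<phi> y = f (\<lambda>z. \<phi> (y - z))"

definition fourier :: "(real^'n \<Rightarrow> complex) \<Rightarrow> real^'n \<Rightarrow> complex" where
  "fourier \<phi> x =
     (LINT \<xi>|lebesgue. \<phi> \<xi> * exp (- 2 * of_real pi * \<i> * of_real (x \<bullet> \<xi>)))"

definition fourier_dist ::
  "((real^'n \<Rightarrow> complex) \<Rightarrow> complex) \<Rightarrow> (real^'n \<Rightarrow> complex) \<Rightarrow> complex" where
  "fourier_dist f \<phi> = f (fourier \<phi>)"

text \<open>Equality in \<open>\<S>'\<close> of a distribution with a function. Integrability against every Schwartz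
  function is demanded because the Bochner integral of a non-integrable function is \<open>0\<close>.\<close>

definition dist_eq_fun ::
  "((real^'n \<Rightarrow> complex) \<Rightarrow> complex) \<Rightarrow> (real^'n \<Rightarrow> complex) \<Rightarrow> bool" where
  "dist_eq_fun g F \<longleftrightarrow>
     (\<forall>\<phi>\<in>schwartz_space. integrable lebesgue (\<lambda>x. F x * \<phi> x)
        \<and> g \<phi> = (LINT x|lebesgue. F x * \<phi> x))"

definition schwartz_N ::
  "real^'n^'n \<Rightarrow> (real^'n) set \<Rightarrow> nat \<Rightarrow> (real^'n \<Rightarrow> complex) set" where
  "schwartz_N A \<Delta> N =
     {\<phi> \<in> schwartz_space. \<forall>\<alpha> l. mi_abs \<alpha> \<le> N \<longrightarrow> l \<le> N \<longrightarrow>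
        (SUP x. ennreal (step_quasi_norm A \<Delta> x ^ l * norm (mi_deriv \<alpha> \<phi> x))) \<le> 1}"

definition dilate_fun ::
  "real^'n^'n \<Rightarrow> int \<Rightarrow> (real^'n \<Rightarrow> complex) \<Rightarrow> real^'n \<Rightarrow> complex" where
  "dilate_fun A k \<phi> x = of_real (\<bar>det A\<bar> powi (- k)) * \<phi> (matrix_powi A (- k) *v x)"

definition grand_maximal ::
  "real^'n^'n \<Rightarrow> (real^'n) set \<Rightarrow> nat \<Rightarrow> ((real^'n \<Rightarrow> complex) \<Rightarrow> complex) \<Rightarrow> real^'n \<Rightarrow> ennreal"
where
  "grand_maximal A \<Delta> N f x =
     (SUP \<phi> \<in> schwartz_N A \<Delta> N. SUP k. SUP y \<in> (\<lambda>z. x + z) ` dilated_ball A \<Delta> k.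
        ennreal (norm (convolution f (dilate_fun A k \<phi>) y)))"

definition hardy_space ::
  "real^'n^'n \<Rightarrow> (real^'n) set \<Rightarrow> nat \<Rightarrow> (real^'n \<Rightarrow> real) \<Rightarrow> ((real^'n \<Rightarrow> complex) \<Rightarrow> complex) set"
where
  "hardy_space A \<Delta> N p = {f \<in> tempered_distributions. grand_maximal A \<Delta> N f \<in> Lvar p}"

definition hardy_norm ::
  "real^'n^'n \<Rightarrow> (real^'n) set \<Rightarrow> nat \<Rightarrow> (real^'n \<Rightarrow> real) \<Rightarrow> ((real^'n \<Rightarrow> complex) \<Rightarrow> complex) \<Rightarrow> ennreal"
where
  "hardy_norm A \<Delta> N p f = Lvar_norm p (grand_maximal A \<Delta> N f)"

end

(* Let G_j be the (-j)-th power of A^*, and let u_j be the convolution of f with the kernel whose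
   Fourier transform is the Gaussian exp(-pi |G_j xi|^2). Up to a constant, this kernel is a dilate
   of an element of S_N, so |u_j(y)| is bounded by M_N(f) on y + B_{-j}. Hence M_N(f) >= |u_j(y)| on
   a set of measure b^{-j}, which bounds |u_j| by the value at b^{-j} of the decreasing rearrangement
   of M_N(f). In particular u_j is bounded and integrable, its Fourier transform is continuous and
   the quotient F of it by the Gaussian does not depend on j and represents the Fourier transform
   of f. On the j-th shell of the dual dilation the Gaussian is bounded below, so there F is
   comparable to the Fourier transform of u_j, whose L^2 norm is at most that of u_j by Bessel's
   inequality, hence at most that of M_N(f) truncated at a majorant tau_j of the rearrangement. The
   pointwise bound v^p <= t^p + t^(p-2) v^2 with t = b^{-j} tau_j estimates the integral of |F|^{p_+}
   over the shell. If tau_j is chosen to grow geometrically, these estimates can be summed over j,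
   with the exponent p_+ for j < 0 and p_- for j >= 0, which explains the two weights. *)
theory Submission
  imports Defs "HOL-Probability.Probability"
begin

section \<open>Fourier integrals and Gaussians\<close>

text \<open>The maximal function is divided by a number \<open>l\<close> that makes its modular at
  most one; the estimate is proved with a constant independent of \<open>l\<close>, and the infimum
  over \<open>l\<close> is the norm, so \<open>F\<close> is built without \<open>l\<close>. The
  obstacle is that the modular mixes exponents between \<open>p_-\<close> and \<open>p_+\<close>;
  cutting the normalised maximal function \<open>h\<close> at height one separates them: the part
  below one is controlled with \<open>p_+\<close>, the part above with \<open>p_-\<close>. For
  \<open>j < 0\<close> the bound on \<open>u_j\<close> comes from sets of measure greater than one,
  whereas \<open>h\<close> reaches one only on a set of measure at most one, so the upper part does
  not enter there. That \<open>p_+\<close> is at most one makes \<open>u_j\<close> integrable: where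
  \<open>h < 1\<close>, the modular dominates \<open>|u_j|\<close>. A second obstacle:
  \<open>f\<close> is only a continuous functional, but has to be interchanged with integrals of
  characters. Continuity is restated as a bound by weighted derivatives in single coordinate
  directions, and the interchange is a limit of finite sums. Geometric growth of
  \<open>\<tau>_j\<close> lets the squares of the truncations of \<open>h\<close>, weighted by
  powers of \<open>\<tau>_j\<close>, sum pointwise to a multiple of a power of
  \<open>h\<close>.\<close>

lemma axis_image_Basis: "(Basis :: (real^'n) set) = (\<lambda>i. axis i 1) ` UNIV"
  by (auto simp: Basis_vec_def)

lemma inj_axis_one: "inj (\<lambda>i. axis i (1::real) :: real^'n)"
  by (auto simp: inj_on_def axis_eq_axis)

text \<open>\<open>lborel\<close> on \<open>real^'n\<close> is the image of a product measure over
  the set \<open>Basis\<close>, so this is the product rule for integrals once the factors are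
  indexed by the basis vectors \<open>axis i 1\<close> instead of the coordinates
  \<open>i\<close>.\<close>

lemma integrable_vec_prod:
  fixes f :: "'n::finite \<Rightarrow> real \<Rightarrow> 'a::{real_normed_field,banach,second_countable_topology}"
  assumes f: "\<And>i. integrable lborel (f i)"
  shows "integrable (lborel :: (real^'n) measure) (\<lambda>x. \<Prod>i\<in>UNIV. f i (x $ i))"
    and "(LINT x|(lborel :: (real^'n) measure). (\<Prod>i\<in>UNIV. f i (x $ i))) = (\<Prod>i\<in>UNIV. integral\<^sup>L lborel (f i))"
proof -
  interpret product_sigma_finite "\<lambda>_::real^'n. lborel :: real measure" by standard
  let ?B = "Basis :: (real^'n) set"
  define T :: "(real^'n \<Rightarrow> real) \<Rightarrow> real^'n" where "T = (\<lambda>g. \<Sum>b\<in>Basis. g b *\<^sub>R b)"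
  define F where "F b = f (inv (\<lambda>i. axis i (1::real) :: real^'n) b)" for b
  have Fa: "F (axis i 1) = f i" for i
    by (simp add: F_def inv_f_f[OF inj_axis_one])
  have Ff: "integrable lborel (F b)" for b
    using f by (simp add: F_def)
  have [measurable]: "f i \<in> borel_measurable borel" for i
    using borel_measurable_integrable[OF f[of i]] by simp
  have Tm[measurable]: "T \<in> (\<Pi>\<^sub>M b\<in>?B. lborel) \<rightarrow>\<^sub>M borel"
    unfolding T_def by measurable
  have Ti: "T g $ i = g (axis i 1)" for g i
  proof -
    have "T g $ i = T g \<bullet> axis i 1" by (simp add: inner_axis)
    also have "\<dots> = g (axis i 1)"
      unfolding T_def by (rule inner_sum_left_Basis) (simp add: axis_image_Basis)
    finally show ?thesis .
  qed
  have pr: "(\<Prod>i\<in>UNIV. f i (T g $ i)) = (\<Prod>b\<in>?B. F b (g b))" for g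
    unfolding axis_image_Basis by (simp add: prod.reindex[OF inj_axis_one] Fa Ti)
  have lb: "lborel = distr (\<Pi>\<^sub>M b\<in>?B. lborel) borel T"
    unfolding T_def by (rule lborel_eq)
  have meas[measurable]: "(\<lambda>x::real^'n. \<Prod>i\<in>UNIV. f i (x $ i)) \<in> borel_measurable borel"
    by measurable
  show "integrable (lborel :: (real^'n) measure) (\<lambda>x. \<Prod>i\<in>UNIV. f i (x $ i))"
    by (subst lb, subst integrable_distr_eq[OF Tm])
       (auto simp: pr intro!: product_integrable_prod Ff)
  show "(LINT x|(lborel :: (real^'n) measure). (\<Prod>i\<in>UNIV. f i (x $ i))) = (\<Prod>i\<in>UNIV. integral\<^sup>L lborel (f i))"
  proof -
    have "(\<Prod>b\<in>?B. integral\<^sup>L lborel (F b)) = (\<Prod>i\<in>UNIV. integral\<^sup>L lborel (f i))"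
      unfolding axis_image_Basis by (simp add: prod.reindex[OF inj_axis_one] Fa)
    then show ?thesis
      by (subst lb, subst integral_distr[OF Tm]) (auto simp: pr product_integral_prod Ff)
  qed
qed

text \<open>The sign in the exponent is positive, so the Fourier transform of the theorem pairs a
  function with \<open>chi \<xi> (- x)\<close>, and its inverse with
  \<open>chi \<xi> x\<close>.\<close>

definition chi :: "'a::real_inner \<Rightarrow> 'a \<Rightarrow> complex" where
  "chi t x = cis (2 * pi * (t \<bullet> x))"

lemma norm_chi [simp]: "norm (chi t x) = 1" by (simp add: chi_def)
lemma chi_add: "chi (s + t) x = chi s x * chi t x"
  by (simp add: chi_def inner_add_left distrib_left cis_mult)
lemma chi_add_right: "chi t (x + y) = chi t x * chi t y"
  by (simp add: chi_def inner_add_right distrib_left cis_mult)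
lemma chi_commute: "chi s t = chi t s" by (simp add: chi_def inner_commute)
lemma chi_0 [simp]: "chi 0 x = 1" "chi x 0 = 1" by (simp_all add: chi_def)
lemma chi_minus: "chi (- t) x = chi t (- x)" by (simp add: chi_def)
lemma cnj_chi: "cnj (chi t x) = chi (- t) x" by (simp add: chi_def cis_cnj)
lemma continuous_chi [continuous_intros]:
  "continuous_on S f \<Longrightarrow> continuous_on S g \<Longrightarrow> continuous_on S (\<lambda>x. chi (f x) (g x))"
  unfolding chi_def cis_conv_exp by (intro continuous_intros)
lemma measurable_chi [measurable]:
  fixes f :: "'b \<Rightarrow> 'a::euclidean_space"
  assumes [measurable]: "f \<in> borel_measurable M" "g \<in> borel_measurable M"
  shows "(\<lambda>x. chi (f x) (g x)) \<in> borel_measurable M"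
  unfolding chi_def cis_conv_exp by measurable
lemma chi_prod: "chi t x = (\<Prod>i\<in>UNIV. cis (2 * pi * (t $ i * x $ i)))" for t :: "real^'n"
  by (simp add: chi_def inner_vec_def sum_distrib_left cis_conv_exp exp_sum flip: exp_sum)

text \<open>The characteristic function of the standard normal distribution, rescaled: the
  substitution of \<open>c * x\<close> for \<open>x\<close> with \<open>c = sqrt (2 * pi)\<close>
  turns its density into \<open>exp (- pi * x^2) / c\<close>.\<close>

lemma gauss_1d:
  "integrable lborel (\<lambda>x::real. complex_of_real (exp (- pi * x\<^sup>2)) * cis (2 * pi * (t * x)))"
  "(LINT x|lborel. complex_of_real (exp (- pi * x\<^sup>2)) * cis (2 * pi * (t * x))) = complex_of_real (exp (- pi * t\<^sup>2))"
proof -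
  define c where "c = sqrt (2 * pi)"
  have c: "c > 0" "c\<^sup>2 = 2 * pi" by (simp_all add: c_def)
  let ?g = "\<lambda>x. std_normal_density x *\<^sub>R cis (c * t * x)"
  have n1: "integrable lborel std_normal_density" by (rule integrable_normal_density) simp
  have i1: "integrable lborel ?g"
    by (rule Bochner_Integration.integrable_bound[OF n1]) (auto simp: cis_conv_exp normal_density_nonneg)
  have eq: "c *\<^sub>R ?g (0 + c * x) = complex_of_real (exp (- pi * x\<^sup>2)) * cis (2 * pi * (t * x))" for x
  proof -
    have "c * t * (c * x) = c\<^sup>2 * (t * x)" by (simp add: power2_eq_square)
    also have "\<dots> = 2 * pi * (t * x)" by (simp only: c(2))
    finally have a: "c * t * (c * x) = 2 * pi * (t * x)" .
    have b: "std_normal_density (c * x) = exp (- pi * x\<^sup>2) / c"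
      by (simp add: std_normal_density_def power_mult_distrib c flip: c_def)
    show ?thesis
      unfolding add_0 a b using c(1) by (simp add: scaleR_conv_of_real)
  qed
  have "integrable lborel (\<lambda>x. c *\<^sub>R ?g (0 + c * x))"
    by (intro integrable_scaleR_right lborel_integrable_real_affine i1) (use c in auto)
  then show "integrable lborel (\<lambda>x::real. complex_of_real (exp (- pi * x\<^sup>2)) * cis (2 * pi * (t * x)))"
    unfolding eq .
  have "(LINT x|lborel. ?g x) = char std_normal_distribution (c * t)"
    unfolding char_def
    by (subst integral_density) (auto simp: cis_conv_exp normal_density_nonneg mult_ac)
  also have "\<dots> = complex_of_real (exp (- pi * t\<^sup>2))"
    by (simp add: char_std_normal_distribution power_mult_distrib c)
  finally have "(LINT x|lborel. ?g x) = complex_of_real (exp (- pi * t\<^sup>2))" .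
  moreover have "(LINT x|lborel. ?g x) = c *\<^sub>R (LINT x|lborel. ?g (0 + c * x))"
    using lborel_integral_real_affine[of c ?g 0] c by simp
  moreover have "c *\<^sub>R (LINT x|lborel. ?g (0 + c * x)) = (LINT x|lborel. c *\<^sub>R ?g (0 + c * x))"
    by (rule integral_scaleR_right[symmetric])
  ultimately show "(LINT x|lborel. complex_of_real (exp (- pi * x\<^sup>2)) * cis (2 * pi * (t * x))) = complex_of_real (exp (- pi * t\<^sup>2))"
    by (simp only: eq)
qed

lemma gauss_prod: "exp (- pi * (norm x)\<^sup>2) = (\<Prod>i\<in>UNIV. exp (- pi * (x $ i)\<^sup>2))" for x :: "real^'n"
  by (simp add: norm_vec_def L2_set_def sum_nonneg sum_distrib_left flip: exp_sum)

lemma gauss_chi: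
  fixes t :: "real^'n"
  shows "integrable lborel (\<lambda>x. complex_of_real (exp (- pi * (norm x)\<^sup>2)) * chi t x)"
    and "(LINT x|lborel. complex_of_real (exp (- pi * (norm x)\<^sup>2)) * chi t x) = complex_of_real (exp (- pi * (norm t)\<^sup>2))"
proof -
  have eq: "complex_of_real (exp (- pi * (norm x)\<^sup>2)) * chi t x
     = (\<Prod>i\<in>UNIV. complex_of_real (exp (- pi * (x $ i)\<^sup>2)) * cis (2 * pi * (t $ i * x $ i)))" for x
    unfolding gauss_prod chi_prod by (simp add: prod.distrib)
  show "integrable lborel (\<lambda>x. complex_of_real (exp (- pi * (norm x)\<^sup>2)) * chi t x)"
    unfolding eq by (intro integrable_vec_prod gauss_1d)
  show "(LINT x|lborel. complex_of_real (exp (- pi * (norm x)\<^sup>2)) * chi t x) = complex_of_real (exp (- pi * (norm t)\<^sup>2))"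
    unfolding eq by (subst integrable_vec_prod(2)) (simp_all only: gauss_1d gauss_prod of_real_prod)
qed

section \<open>Translations and linear changes of variables\<close>

lemma integral_translate:
  fixes f :: "'a::euclidean_space \<Rightarrow> 'b::{banach,second_countable_topology}"
  assumes [measurable]: "f \<in> borel_measurable borel"
  shows "(LINT x|lborel. f (a + x)) = (LINT x|lborel. f x)"
    "integrable lborel (\<lambda>x. f (a + x)) \<longleftrightarrow> integrable lborel f"
  by (subst (2) lborel_distr_plus[of a, symmetric], simp add: integral_distr,
      subst (2) lborel_distr_plus[of a, symmetric], simp add: integrable_distr_eq)

lemma nn_integral_translate:
  fixes f :: "'a::euclidean_space \<Rightarrow> ennreal"
  assumes [measurable]: "f \<in> borel_measurable borel"
  shows "(\<integral>\<^sup>+x. f (a + x) \<partial>lborel) = (\<integral>\<^sup>+x. f x \<partial>lborel)"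
  by (subst (2) lborel_distr_plus[of a, symmetric], simp add: nn_integral_distr)

text \<open>With all coordinates but \<open>m\<close> frozen, the shear translates the coordinate
  \<open>m\<close> by \<open>c * x $ n\<close>, a constant because \<open>n\<close> differs from
  \<open>m\<close>. Integrating this coordinate innermost reduces the claim to translation
  invariance on the line.\<close>

lemma nn_integral_shear:
  fixes f :: "real^'n \<Rightarrow> ennreal"
  assumes mn: "m \<noteq> n" and f[measurable]: "f \<in> borel_measurable borel"
  shows "(\<integral>\<^sup>+x. f x \<partial>lborel) = (\<integral>\<^sup>+x. f (x + axis m (c * x $ n)) \<partial>lborel)"
proof -
  interpret product_sigma_finite "\<lambda>_::real^'n. lborel :: real measure" by standard
  let ?B = "Basis :: (real^'n) set"
  let ?m = "axis m (1::real) :: real^'n" and ?n = "axis n (1::real) :: real^'n"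
  have mB: "?m \<in> ?B" "?n \<in> ?B" by (simp_all add: axis_image_Basis)
  have nem: "?n \<noteq> ?m" using mn by (simp add: axis_eq_axis)
  define T :: "(real^'n \<Rightarrow> real) \<Rightarrow> real^'n" where "T = (\<lambda>g. \<Sum>b\<in>Basis. g b *\<^sub>R b)"
  have Tm[measurable]: "T \<in> (\<Pi>\<^sub>M b\<in>?B. lborel) \<rightarrow>\<^sub>M borel"
    unfolding T_def by measurable
  have lb: "lborel = distr (\<Pi>\<^sub>M b\<in>?B. lborel) borel T"
    unfolding T_def by (rule lborel_eq)
  have Ti: "T g $ i = g (axis i 1)" for g i
  proof -
    have "T g $ i = T g \<bullet> axis i 1" by (simp add: inner_axis)
    also have "\<dots> = g (axis i 1)"
      unfolding T_def by (rule inner_sum_left_Basis) (simp add: axis_image_Basis)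
    finally show ?thesis .
  qed
  have sh[measurable]: "(\<lambda>x::real^'n. x + axis m (c * x $ n)) \<in> borel_measurable borel"
  proof -
    have "axis m (c * x $ n) = (c * x $ n) *\<^sub>R ?m" for x :: "real^'n"
      by (auto simp: axis_def vec_eq_iff)
    then show ?thesis by (auto intro!: borel_measurable_continuous_onI continuous_intros)
  qed
  have ins: "insert ?m (?B - {?m}) = ?B" using mB by auto
  have split: "(\<integral>\<^sup>+x. g x \<partial>(\<Pi>\<^sub>M b\<in>?B. lborel)) = (\<integral>\<^sup>+x. (\<integral>\<^sup>+y. g (x(?m := y)) \<partial>lborel) \<partial>(\<Pi>\<^sub>M b\<in>?B - {?m}. lborel))"
    if "g \<in> borel_measurable (\<Pi>\<^sub>M b\<in>?B. lborel)" for g :: "(real^'n \<Rightarrow> real) \<Rightarrow> ennreal"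
    using product_nn_integral_insert[of "?B - {?m}" ?m g, unfolded ins] that by simp
  have Tc: "T (x(?m := y)) + axis m (c * T (x(?m := y)) $ n) = T (x(?m := c * x ?n + y))" for x :: "real^'n \<Rightarrow> real" and y
    using mn nem by (auto simp: vec_eq_iff Ti axis_def axis_eq_axis)
  have "(\<integral>\<^sup>+x. f (x + axis m (c * x $ n)) \<partial>lborel)
      = (\<integral>\<^sup>+x. (\<integral>\<^sup>+y. f (T (x(?m := c * x ?n + y))) \<partial>lborel) \<partial>(\<Pi>\<^sub>M b\<in>?B - {?m}. lborel))"
    by (subst lb) (simp add: nn_integral_distr split Tc)
  also have "\<dots> = (\<integral>\<^sup>+x. (\<integral>\<^sup>+y. f (T (x(?m := y))) \<partial>lborel) \<partial>(\<Pi>\<^sub>M b\<in>?B - {?m}. lborel))"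
  proof (rule nn_integral_cong)
    fix x :: "real^'n \<Rightarrow> real" assume x: "x \<in> space (\<Pi>\<^sub>M b\<in>?B - {?m}. lborel)"
    have 1: "(\<lambda>y. x(?m := y)) \<in> lborel \<rightarrow>\<^sub>M (\<Pi>\<^sub>M b\<in>?B. lborel)"
      using measurable_fun_upd[of ?B "?B - {?m}" ?m "\<lambda>_. x" lborel "\<lambda>_. lborel" "\<lambda>y. y"] x ins by (auto simp: measurable_const)
    have "(\<lambda>y. f (T (x(?m := y)))) \<in> borel_measurable lborel"
      using measurable_compose[OF measurable_compose[OF 1 Tm] f] .
    then show "(\<integral>\<^sup>+y. f (T (x(?m := c * x ?n + y))) \<partial>lborel) = (\<integral>\<^sup>+y. f (T (x(?m := y))) \<partial>lborel)"
      using nn_integral_translate[of "\<lambda>y. f (T (x(?m := y)))" "c * x ?n"] by simp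
  qed
  also have "\<dots> = (\<integral>\<^sup>+x. f x \<partial>lborel)"
    by (subst lb) (simp add: nn_integral_distr split)
  finally show ?thesis by simp
qed

lemma matrix_vector_borel [measurable]: "(*v) (T :: real^'n^'m) \<in> borel \<rightarrow>\<^sub>M borel"
  by (intro borel_measurable_continuous_onI continuous_intros)

text \<open>Induction over elementary matrices: products, a matrix with a zero row (excluded by
  invertibility), diagonal matrices, transpositions of columns and shears. \<open>f\<close> is
  generalised because a product needs the claim for its second factor with
  \<open>\<lambda>x. f (A *v x)\<close>.\<close>

lemma nn_integral_linear_subst:
  fixes T :: "real^'n^'n"
  assumes "invertible T" and "f \<in> borel_measurable borel"
  shows "(\<integral>\<^sup>+x. f x \<partial>lborel) = ennreal \<bar>det T\<bar> * (\<integral>\<^sup>+x. f (T *v x) \<partial>lborel)"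
  using assms
proof (induction T arbitrary: f rule: induct_matrix_elementary)
  case (1 A B)
  have "det A * det B \<noteq> 0" using 1(3) by (simp add: invertible_det_nz det_mul)
  then have inv: "invertible A" "invertible B" by (auto simp: invertible_det_nz)
  have [measurable]: "f \<in> borel_measurable borel" by fact
  show ?case
    using 1(1)[OF inv(1) 1(4)] 1(2)[OF inv(2), of "\<lambda>x. f (A *v x)"]
    by (simp add: det_mul abs_mult ennreal_mult matrix_vector_mul_assoc mult.assoc)
next
  case (2 A i)
  then show ?case by (simp add: invertible_det_nz det_zero_row)
next
  case (3 A)
  have [measurable]: "f \<in> borel_measurable borel" by fact
  have d: "det A = (\<Prod>i\<in>UNIV. A $ i $ i)" using 3(1) by (rule det_diagonal)
  \<comment> \<open>\<open>lborel_affine_euclidean\<close> takes scaling factors indexed by basis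
    vectors; \<open>c\<close> is the linear form whose value at \<open>axis i 1\<close> is the
    diagonal entry.\<close>
  define c where "c b = (\<Sum>i\<in>UNIV. A $ i $ i * b $ i)" for b :: "real^'n"
  have ca: "c (axis i 1) = A $ i $ i" for i
    by (simp add: c_def axis_def if_distrib cong: if_cong)
  have nz: "A $ i $ i \<noteq> 0" for i using 3(2) d by (simp add: invertible_det_nz)
  have T: "0 + (\<Sum>j\<in>Basis. (c j * (x \<bullet> j)) *\<^sub>R j) = A *v x" for x
  proof -
    have "(\<Sum>j\<in>Basis. (c j * (x \<bullet> j)) *\<^sub>R j) = (\<Sum>i\<in>UNIV. (A $ i $ i * x $ i) *\<^sub>R axis i 1)"
      unfolding axis_image_Basis by (simp add: sum.reindex[OF inj_axis_one] ca inner_axis)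
    moreover have "(A *v x) $ i = A $ i $ i * x $ i" for i
      unfolding matrix_vector_mult_def using 3(1) by (simp, subst sum.remove[of _ i]) (auto intro!: sum.neutral)
    ultimately show ?thesis
      by (simp add: vec_eq_iff axis_def if_distrib cong: if_cong)
  qed
  have "c j \<noteq> 0" if "j \<in> Basis" for j using that nz by (auto simp: axis_image_Basis ca)
  then have "lborel = density (distr lborel borel ((*v) A)) (\<lambda>_. (\<Prod>j\<in>Basis. \<bar>c j\<bar>))"
    using lborel_affine_euclidean[of c 0] unfolding T by simp
  also have "(\<Prod>j\<in>Basis. \<bar>c j\<bar>) = \<bar>det A\<bar>"
    unfolding axis_image_Basis d by (simp add: prod.reindex[OF inj_axis_one] ca abs_prod)
  finally have lbA: "lborel = density (distr lborel borel ((*v) A)) (\<lambda>_. \<bar>det A\<bar>)" .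
  show ?case
    by (subst lbA) (simp add: nn_integral_density nn_integral_distr nn_integral_cmult)
next
  case (4 m n)
  let ?t = "Transposition.transpose m n"
  let ?P = "(\<chi> i j. mat 1 $ i $ ?t j) :: real^'n^'n"
  have [measurable]: "f \<in> borel_measurable borel" by fact
  have P: "(?P *v x) $ i = x $ ?t i" for x i
  proof -
    have "(?P *v x) $ i = (\<Sum>j\<in>UNIV. if j = ?t i then x $ j else 0)"
      unfolding matrix_vector_mult_def vec_lambda_beta
      by (rule sum.cong) (auto simp: mat_def)
    then show ?thesis by simp
  qed
  have bij: "bij ?t" by simp
  have inv2: "?t (?t i) = i" for i by simp
  have dP: "\<bar>det ?P\<bar> = 1"
    by (simp add: det_permute_columns permutes_swap_id sign_swap_id abs_mult)
  have lbP: "lborel = distr lborel borel ((*v) ?P)"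
  proof (rule lborel_eqI)
    fix l u :: "real^'n" assume le: "\<And>b. b \<in> Basis \<Longrightarrow> l \<bullet> b \<le> u \<bullet> b"
    have le': "l $ i \<le> u $ i" for i
      using le[of "axis i 1"] by (simp add: axis_image_Basis inner_axis)
    have vim: "(*v) ?P -` box l u = box (\<chi> i. l $ ?t i) (\<chi> i. u $ ?t i)"
      by (auto simp: mem_box_cart P) (metis inv2)+
    have "emeasure lborel (box (\<chi> i. l $ ?t i) (\<chi> i. u $ ?t i)) = (\<Prod>i\<in>UNIV. (u - l) $ ?t i)"
      unfolding emeasure_lborel_box_eq using le'
      by (auto simp: axis_image_Basis inner_axis prod.reindex[OF inj_axis_one])
    also have "(\<Prod>i\<in>UNIV. (u - l) $ ?t i) = (\<Prod>i\<in>UNIV. (u - l) $ i)"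
      by (rule prod.reindex_bij_betw[OF bij])
    also have "\<dots> = (\<Prod>b\<in>Basis. (u - l) \<bullet> b)"
      by (simp add: axis_image_Basis inner_axis prod.reindex[OF inj_axis_one])
    finally show "emeasure (distr lborel borel ((*v) ?P)) (box l u) = (\<Prod>b\<in>Basis. (u - l) \<bullet> b)"
      by (simp add: emeasure_distr vim)
  qed simp
  show ?case
    using nn_integral_distr[of "(*v) ?P" lborel borel f] by (simp add: dP flip: lbP)
next
  case (5 m n c)
  let ?E = "(\<chi> i j. if i = m \<and> j = n then c else of_bool (i = j)) :: real^'n^'n"
  have E: "?E *v x = x + axis m (c * x $ n)" for x
  proof -
    have "(?E *v x) $ i = (\<Sum>j\<in>UNIV. (if j = i then x $ j else 0) + (if j = n then (if i = m then c * x $ j else 0) else 0))" for i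
      unfolding matrix_vector_mult_def using 5(1) by (auto intro!: sum.cong)
    then show ?thesis by (simp add: vec_eq_iff sum.distrib axis_def)
  qed
  have "det (\<chi> k. if k = m then row m (mat 1) + c *s row n (mat 1) else row k (mat 1 :: real^'n^'n)) = 1"
    using det_row_operation[OF 5(1), of "mat 1" c] by simp
  moreover have "(\<chi> k. if k = m then row m (mat 1) + c *s row n (mat 1) else row k (mat 1 :: real^'n^'n)) = ?E"
    using 5(1) by (auto simp: vec_eq_iff row_def mat_def)
  ultimately have "det ?E = 1" by simp
  then show ?case using nn_integral_shear[OF 5(1,3), of c] by (simp add: E)
qed

text \<open>The substitution rule as an identity of measures, from which both the value of an
  integral and the integrability of a complex function can be transferred.\<close>

lemma lborel_linear:
  fixes T :: "real^'n^'n"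
  assumes T: "invertible T"
  shows "(lborel :: (real^'n) measure) = density (distr lborel borel ((*v) T)) (\<lambda>_. ennreal \<bar>det T\<bar>)"
proof (rule measure_eqI)
  fix X assume X: "X \<in> sets (lborel :: (real^'n) measure)"
  then have [measurable]: "X \<in> sets borel" by simp
  have "(\<integral>\<^sup>+x. indicator X (T *v x) \<partial>lborel) = emeasure (distr lborel borel ((*v) T)) X"
    using nn_integral_distr[of "(*v) T" lborel borel "indicator X"] by simp
  then show "emeasure lborel X = emeasure (density (distr lborel borel ((*v) T)) (\<lambda>_. ennreal \<bar>det T\<bar>)) X"
    using nn_integral_linear_subst[OF T, of "indicator X"] X
    by (simp add: emeasure_density nn_integral_distr nn_integral_cmult)
qed simp

lemma integral_linear_subst:
  fixes T :: "real^'n^'n" and f :: "real^'n \<Rightarrow> complex"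
  assumes T: "invertible T" and f[measurable]: "f \<in> borel_measurable borel"
  shows "(LINT x|lborel. f x) = \<bar>det T\<bar> * (LINT x|lborel. f (T *v x))"
    and "integrable lborel f \<longleftrightarrow> integrable lborel (\<lambda>x. f (T *v x))"
proof -
  have m[measurable]: "(*v) T \<in> borel \<rightarrow>\<^sub>M borel"
    by (intro borel_measurable_continuous_onI continuous_intros)
  have "det T \<noteq> 0" using T by (simp add: invertible_det_nz)
  show "(LINT x|lborel. f x) = \<bar>det T\<bar> * (LINT x|lborel. f (T *v x))"
    using \<open>det T \<noteq> 0\<close> by (subst lborel_linear[OF T]) (simp add: integral_density integral_distr scaleR_conv_of_real)
  have "integrable lborel f \<longleftrightarrow> integrable lborel (\<lambda>x. \<bar>det T\<bar> *\<^sub>R f (T *v x))"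
    by (subst lborel_linear[OF T]) (simp add: integrable_density integrable_distr_eq)
  also have "\<dots> \<longleftrightarrow> integrable lborel (\<lambda>x. f (T *v x))"
    using integrable_scaleR_right[of "inverse \<bar>det T\<bar>" lborel "\<lambda>x. \<bar>det T\<bar> *\<^sub>R f (T *v x)"] \<open>det T \<noteq> 0\<close>
    by (auto intro: integrable_scaleR_right)
  finally show "integrable lborel f \<longleftrightarrow> integrable lborel (\<lambda>x. f (T *v x))" .
qed

text \<open>Source and frequency space may differ: \<open>s\<close> embeds the former in the latter. The Fourier
  transform is the case \<open>s = uminus\<close>.\<close>

definition FTs :: "'b measure \<Rightarrow> ('b \<Rightarrow> 'a::euclidean_space) \<Rightarrow> ('b \<Rightarrow> complex) \<Rightarrow> 'a \<Rightarrow> complex" where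
  "FTs M s w \<xi> = (LINT x|M. w x * chi \<xi> (s x))"

section \<open>Bounds and derivatives of Fourier integrals\<close>

lemma norm_integral_le:
  fixes f :: "'b \<Rightarrow> 'c::{banach,second_countable_topology}"
  assumes "integrable M f" "integrable M g" "\<And>x. norm (f x) \<le> g x"
  shows "norm (integral\<^sup>L M f) \<le> integral\<^sup>L M g"
  by (rule order_trans[OF integral_norm_bound integral_mono]) (use assms in auto)

lemma FTs_integrable:
  fixes s :: "'b \<Rightarrow> 'a::euclidean_space"
  assumes "integrable M w" and [measurable]: "s \<in> borel_measurable M"
  shows "integrable M (\<lambda>x. w x * chi \<xi> (s x))"
proof -
  have [measurable]: "w \<in> borel_measurable M" using assms by auto
  have "(\<lambda>x. w x * chi \<xi> (s x)) \<in> borel_measurable M" by measurable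
  with assms(1) show ?thesis
    by (rule Bochner_Integration.integrable_bound) (auto simp: norm_mult)
qed

lemma FTs_bound:
  assumes "integrable M w" and [measurable]: "s \<in> borel_measurable M"
  shows "norm (FTs M s w \<xi>) \<le> (LINT x|M. norm (w x))"
proof -
  have "norm (FTs M s w \<xi>) \<le> (LINT x|M. norm (w x * chi \<xi> (s x)))"
    unfolding FTs_def by (rule integral_norm_bound)
  then show ?thesis by (simp add: norm_mult)
qed

lemma FTs_continuous:
  assumes w: "integrable M w" and [measurable]: "s \<in> borel_measurable M"
  shows "continuous_on UNIV (FTs M s w)"
proof (rule continuous_at_imp_continuous_on, safe)
  fix \<xi>
  have "(\<lambda>i. FTs M s w (X i)) \<longlonglongrightarrow> FTs M s w \<xi>" if X: "X \<longlonglongrightarrow> \<xi>" for X :: "nat \<Rightarrow> _"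
    unfolding FTs_def
  proof (rule integral_dominated_convergence[where w="\<lambda>x. norm (w x)"])
    have [measurable]: "w \<in> borel_measurable M" using w by auto
    show "(\<lambda>x. w x * chi \<xi> (s x)) \<in> borel_measurable M" "(\<lambda>x. w x * chi (X i) (s x)) \<in> borel_measurable M" for i
      by measurable
    show "AE x in M. (\<lambda>i. w x * chi (X i) (s x)) \<longlonglongrightarrow> w x * chi \<xi> (s x)"
      unfolding chi_def cis_conv_exp by (intro AE_I2 tendsto_intros X)
  qed (use w in \<open>auto simp: norm_mult\<close>)
  then show "isCont (FTs M s w) \<xi>" by (auto simp: continuous_at_sequentially o_def)
qed

lemma integrable_moment_le:
  fixes w v :: "'b \<Rightarrow> complex"
  assumes "integrable M (\<lambda>x. (1 + norm (s x)) ^ m * norm (w x))"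
    and [measurable]: "v \<in> borel_measurable M"
    and le: "\<And>x. norm (v x) \<le> C * ((1 + norm (s x)) ^ m * norm (w x))"
  shows "integrable M v"
proof (rule Bochner_Integration.integrable_bound)
  show "integrable M (\<lambda>x. C * ((1 + norm (s x)) ^ m * norm (w x)))"
    using assms(1) by (rule integrable_mult_right)
  show "AE x in M. norm (v x) \<le> norm (C * ((1 + norm (s x)) ^ m * norm (w x)))"
    by (intro AE_I2) (metis le real_norm_def abs_ge_self order_trans)
qed measurable

lemma cis_remainder: "cmod (cis t - 1 - \<i> * t) \<le> t\<^sup>2 / 2"
  using iexp_approx1[of t 1] by (simp add: cis_conv_exp power2_eq_square diff_diff_eq)

text \<open>Differentiation under the integral sign: \<open>cis t\<close> differs from
  \<open>1 + \<i> * t\<close> by at most \<open>t^2 / 2\<close>, so the second moment bounds the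
  error of the linear approximation by \<open>K * norm (y - \<xi>)^2\<close>.\<close>

lemma FTs_has_derivative:
  fixes s :: "'b \<Rightarrow> 'a::euclidean_space"
  assumes s[measurable]: "s \<in> borel_measurable M" and w[measurable]: "w \<in> borel_measurable M"
    and i2: "integrable M (\<lambda>x. (1 + norm (s x)) ^ 2 * norm (w x))"
  shows "(FTs M s w has_derivative (\<lambda>h. LINT x|M. w x * (2 * pi * \<i> * (h \<bullet> s x)) * chi \<xi> (s x))) (at \<xi>)"
proof -
  have le1: "(1::real) \<le> (1 + norm (s x)) ^ 2" "norm (s x) \<le> (1 + norm (s x)) ^ 2" "(norm (s x))\<^sup>2 \<le> (1 + norm (s x)) ^ 2" for x
    by (simp_all add: power2_sum)
  have iw: "integrable M (\<lambda>x. w x * chi \<eta> (s x))" for \<eta>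
    by (rule integrable_moment_le[OF i2, where C=1]) (use mult_right_mono[OF le1(1) norm_ge_zero[of "w _"]] in \<open>auto simp: norm_mult\<close>)
  have id: "integrable M (\<lambda>x. w x * (2 * pi * \<i> * (h \<bullet> s x)) * chi \<eta> (s x))" for h \<eta>
  proof (rule integrable_moment_le[OF i2, where C="2 * pi * norm h"])
    fix x
    have "\<bar>h \<bullet> s x\<bar> \<le> norm h * (1 + norm (s x)) ^ 2"
      using Cauchy_Schwarz_ineq2[of h "s x"] mult_left_mono[OF le1(2), of "norm h" x] by simp
    then have "2 * pi * norm (w x) * \<bar>h \<bullet> s x\<bar> \<le> 2 * pi * norm (w x) * (norm h * (1 + norm (s x)) ^ 2)"
      by (intro mult_left_mono) auto
    then show "norm (w x * (2 * pi * \<i> * (h \<bullet> s x)) * chi \<eta> (s x)) \<le> 2 * pi * norm h * ((1 + norm (s x))\<^sup>2 * norm (w x))"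
      by (simp add: norm_mult mult_ac)
  qed measurable
  define K where "K = (LINT x|M. 2 * pi\<^sup>2 * ((1 + norm (s x)) ^ 2 * norm (w x)))"
  show ?thesis
  proof (rule has_derivativeI_sandwich[of 1])
    show "bounded_linear (\<lambda>h. LINT x|M. w x * (2 * pi * \<i> * (h \<bullet> s x)) * chi \<xi> (s x))"
    proof (rule bounded_linear_intro)
      fix h k :: 'a and r :: real
      show "(LINT x|M. w x * (2 * pi * \<i> * ((h + k) \<bullet> s x)) * chi \<xi> (s x)) =
        (LINT x|M. w x * (2 * pi * \<i> * (h \<bullet> s x)) * chi \<xi> (s x)) + (LINT x|M. w x * (2 * pi * \<i> * (k \<bullet> s x)) * chi \<xi> (s x))"
        by (subst Bochner_Integration.integral_add[symmetric, OF id id]) (simp add: inner_add_left algebra_simps)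
      have "(LINT x|M. w x * (2 * pi * \<i> * ((r *\<^sub>R h) \<bullet> s x)) * chi \<xi> (s x)) = (LINT x|M. r *\<^sub>R (w x * (2 * pi * \<i> * (h \<bullet> s x)) * chi \<xi> (s x)))"
        by (simp add: scaleR_conv_of_real mult_ac)
      then show "(LINT x|M. w x * (2 * pi * \<i> * ((r *\<^sub>R h) \<bullet> s x)) * chi \<xi> (s x)) = r *\<^sub>R (LINT x|M. w x * (2 * pi * \<i> * (h \<bullet> s x)) * chi \<xi> (s x))"
        by (simp only: integral_scaleR_right)
      have "norm (LINT x|M. w x * (2 * pi * \<i> * (h \<bullet> s x)) * chi \<xi> (s x)) \<le> (LINT x|M. norm h * (2 * pi * ((1 + norm (s x)) ^ 2 * norm (w x))))"
      proof (rule norm_integral_le[OF id])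
        show "integrable M (\<lambda>x. norm h * (2 * pi * ((1 + norm (s x))\<^sup>2 * norm (w x))))"
          by (intro integrable_mult_right i2)
        fix x
        have "\<bar>h \<bullet> s x\<bar> \<le> norm h * (1 + norm (s x)) ^ 2"
          using Cauchy_Schwarz_ineq2[of h "s x"] mult_left_mono[OF le1(2), of "norm h" x] by simp
        then have "2 * pi * norm (w x) * \<bar>h \<bullet> s x\<bar> \<le> 2 * pi * norm (w x) * (norm h * (1 + norm (s x)) ^ 2)"
          by (intro mult_left_mono) auto
        then show "norm (w x * (2 * pi * \<i> * (h \<bullet> s x)) * chi \<xi> (s x)) \<le> norm h * (2 * pi * ((1 + norm (s x))\<^sup>2 * norm (w x)))"
          by (simp add: norm_mult mult_ac)
      qed
      then show "norm (LINT x|M. w x * (2 * pi * \<i> * (h \<bullet> s x)) * chi \<xi> (s x)) \<le> norm h * (LINT x|M. 2 * pi * ((1 + norm (s x)) ^ 2 * norm (w x)))"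
        by (simp only: integral_mult_right_zero)
    qed
    show "((\<lambda>y. K * norm (y - \<xi>)) \<longlongrightarrow> 0) (at \<xi> within UNIV)"
      by (auto intro!: tendsto_eq_intros)
    fix y assume "y \<noteq> \<xi>"
    have "FTs M s w y - FTs M s w \<xi> - (LINT x|M. w x * (2 * pi * \<i> * ((y - \<xi>) \<bullet> s x)) * chi \<xi> (s x))
      = (LINT x|M. w x * chi \<xi> (s x) * (chi (y - \<xi>) (s x) - 1 - \<i> * of_real (2 * pi * ((y - \<xi>) \<bullet> s x))))"
    proof -
      have "w x * chi \<xi> (s x) * (chi (y - \<xi>) (s x) - 1 - \<i> * of_real (2 * pi * ((y - \<xi>) \<bullet> s x)))
        = (w x * chi y (s x) - w x * chi \<xi> (s x)) - w x * (2 * pi * \<i> * ((y - \<xi>) \<bullet> s x)) * chi \<xi> (s x)" for x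
      proof -
        have "chi y (s x) = chi \<xi> (s x) * chi (y - \<xi>) (s x)" by (simp flip: chi_add)
        then show ?thesis by (simp add: algebra_simps)
      qed
      then show ?thesis
        unfolding FTs_def
        by (simp only: Bochner_Integration.integral_diff[OF Bochner_Integration.integrable_diff[OF iw iw] id]
            Bochner_Integration.integral_diff[OF iw iw])
    qed
    also have "norm \<dots> \<le> (LINT x|M. (norm (y - \<xi>))\<^sup>2 * (2 * pi\<^sup>2 * ((1 + norm (s x)) ^ 2 * norm (w x))))"
    proof (rule norm_integral_le)
      show i: "integrable M (\<lambda>x. (norm (y - \<xi>))\<^sup>2 * (2 * pi\<^sup>2 * ((1 + norm (s x))\<^sup>2 * norm (w x))))"
        by (intro integrable_mult_right i2)
      have b: "norm (w x * chi \<xi> (s x) * (chi (y - \<xi>) (s x) - 1 - \<i> * of_real (2 * pi * ((y - \<xi>) \<bullet> s x))))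
        \<le> (norm (y - \<xi>))\<^sup>2 * (2 * pi\<^sup>2 * ((1 + norm (s x))\<^sup>2 * norm (w x)))" for x
      proof -
        let ?t = "2 * pi * ((y - \<xi>) \<bullet> s x)"
        have "norm (chi (y - \<xi>) (s x) - 1 - \<i> * of_real ?t) \<le> ?t\<^sup>2 / 2"
          unfolding chi_def by (rule cis_remainder)
        also have "\<dots> = 2 * pi\<^sup>2 * ((y - \<xi>) \<bullet> s x)\<^sup>2" by (simp add: power_mult_distrib)
        also have "((y - \<xi>) \<bullet> s x)\<^sup>2 \<le> (norm (y - \<xi>) * norm (s x))\<^sup>2"
          by (rule power2_le_iff_abs_le[THEN iffD2]) (auto intro: Cauchy_Schwarz_ineq2)
        also have "\<dots> \<le> (norm (y - \<xi>))\<^sup>2 * (1 + norm (s x))\<^sup>2"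
          unfolding power_mult_distrib by (intro mult_left_mono le1) auto
        finally have "norm (chi (y - \<xi>) (s x) - 1 - \<i> * of_real ?t) \<le> 2 * pi\<^sup>2 * ((norm (y - \<xi>))\<^sup>2 * (1 + norm (s x))\<^sup>2)" by simp
        then have "norm (w x) * norm (chi (y - \<xi>) (s x) - 1 - \<i> * of_real ?t) \<le> norm (w x) * (2 * pi\<^sup>2 * ((norm (y - \<xi>))\<^sup>2 * (1 + norm (s x))\<^sup>2))"
          by (rule mult_left_mono) simp
        then show ?thesis by (simp add: norm_mult mult_ac)
      qed
      show "integrable M (\<lambda>x. w x * chi \<xi> (s x) * (chi (y - \<xi>) (s x) - 1 - \<i> * of_real (2 * pi * ((y - \<xi>) \<bullet> s x))))"
        by (rule Bochner_Integration.integrable_bound[OF i]) (use b in \<open>auto intro: order_trans\<close>)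
      show "norm (w x * chi \<xi> (s x) * (chi (y - \<xi>) (s x) - 1 - \<i> * of_real (2 * pi * ((y - \<xi>) \<bullet> s x))))
        \<le> (norm (y - \<xi>))\<^sup>2 * (2 * pi\<^sup>2 * ((1 + norm (s x))\<^sup>2 * norm (w x)))" for x by (rule b)
    qed
    also have "\<dots> = (norm (y - \<xi>))\<^sup>2 * K" unfolding K_def by (simp only: integral_mult_right_zero)
    finally show "norm ((FTs M s w y - FTs M s w \<xi>) - (LINT x|M. w x * (2 * pi * \<i> * ((y - \<xi>) \<bullet> s x)) * chi \<xi> (s x))) / norm (y - \<xi>) \<le> K * norm (y - \<xi>)"
      using \<open>y \<noteq> \<xi>\<close> by (simp add: divide_simps power2_eq_square mult_ac)
  qed auto
qed

text \<open>Stable under multiplication by a coordinate, which is what a partial derivative of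
  \<open>FTs M s w\<close> does to \<open>w\<close>; hence such a transform is smooth.\<close>

definition all_moments :: "'b measure \<Rightarrow> ('b \<Rightarrow> 'a::real_normed_vector) \<Rightarrow> ('b \<Rightarrow> complex) \<Rightarrow> bool" where
  "all_moments M s w \<longleftrightarrow> w \<in> borel_measurable M \<and> (\<forall>m. integrable M (\<lambda>x. (1 + norm (s x)) ^ m * norm (w x)))"

lemma all_moments_integrable: "all_moments M s w \<Longrightarrow> integrable M w"
  unfolding all_moments_def
  by (elim conjE, drule spec[of _ 0]) (simp add: integrable_norm_iff)

lemma all_moments_coord:
  fixes s :: "'b \<Rightarrow> real^'n"
  assumes w: "all_moments M s w" and [measurable]: "s \<in> borel_measurable M"
  shows "all_moments M s (\<lambda>x. w x * (2 * pi * \<i> * (s x $ j)))"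
  unfolding all_moments_def
proof (intro conjI allI)
  have [measurable]: "w \<in> borel_measurable M" using w by (simp add: all_moments_def)
  have "(\<lambda>x. s x \<bullet> axis j 1) \<in> borel_measurable M" by measurable
  then have sj[measurable]: "(\<lambda>x. s x $ j) \<in> borel_measurable M" by (simp add: inner_axis)
  show "(\<lambda>x. w x * (2 * pi * \<i> * (s x $ j))) \<in> borel_measurable M" by measurable
  fix m
  show "integrable M (\<lambda>x. (1 + norm (s x)) ^ m * norm (w x * (2 * pi * \<i> * (s x $ j))))"
  proof (rule Bochner_Integration.integrable_bound)
    show "integrable M (\<lambda>x. 2 * pi * ((1 + norm (s x)) ^ Suc m * norm (w x)))"
      using w by (intro integrable_mult_right) (auto simp: all_moments_def simp del: power_Suc)
    show "AE x in M. norm ((1 + norm (s x)) ^ m * norm (w x * (2 * pi * \<i> * (s x $ j)))) \<le> norm (2 * pi * ((1 + norm (s x)) ^ Suc m * norm (w x)))"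
    proof (rule AE_I2)
      fix x
      have "\<bar>s x $ j\<bar> \<le> 1 + norm (s x)" using component_le_norm_cart[of "s x" j] by simp
      then have "2 * pi * (1 + norm (s x)) ^ m * norm (w x) * \<bar>s x $ j\<bar> \<le> 2 * pi * (1 + norm (s x)) ^ m * norm (w x) * (1 + norm (s x))"
        by (rule mult_left_mono) auto
      then show "norm ((1 + norm (s x)) ^ m * norm (w x * (2 * pi * \<i> * (s x $ j)))) \<le> norm (2 * pi * ((1 + norm (s x)) ^ Suc m * norm (w x)))"
        by (simp add: norm_mult mult_ac abs_mult)
    qed
  qed measurable
qed

lemma FTs_partial:
  fixes s :: "'b \<Rightarrow> real^'n"
  assumes w: "all_moments M s w" and s[measurable]: "s \<in> borel_measurable M"
  shows "((\<lambda>t. FTs M s w (\<xi> + t *\<^sub>R axis j 1)) has_vector_derivative FTs M s (\<lambda>x. w x * (2 * pi * \<i> * (s x $ j))) \<xi>) (at 0)"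
proof -
  have d: "(FTs M s w has_derivative (\<lambda>h. LINT x|M. w x * (2 * pi * \<i> * (h \<bullet> s x)) * chi \<xi> (s x))) (at (\<xi> + 0 *\<^sub>R axis j 1))"
    using FTs_has_derivative[OF s, of w \<xi>] w by (simp add: all_moments_def)
  have "((\<lambda>t. FTs M s w (\<xi> + t *\<^sub>R axis j 1)) has_derivative (\<lambda>t. LINT x|M. w x * (2 * pi * \<i> * ((t *\<^sub>R axis j 1) \<bullet> s x)) * chi \<xi> (s x))) (at 0)"
    by (rule has_derivative_compose[where f="\<lambda>t. \<xi> + t *\<^sub>R axis j 1" and f'="\<lambda>t. t *\<^sub>R axis j 1", OF _ d]) (auto intro!: derivative_eq_intros)
  moreover have "(\<lambda>t. LINT x|M. w x * (2 * pi * \<i> * ((t *\<^sub>R axis j 1) \<bullet> s x)) * chi \<xi> (s x))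
      = (\<lambda>t. t *\<^sub>R FTs M s (\<lambda>x. w x * (2 * pi * \<i> * (s x $ j))) \<xi>)"
  proof -
    have "(t *\<^sub>R axis j 1) \<bullet> s x = t * s x $ j" for t x
      by (simp add: inner_commute[of "axis j 1"] inner_axis)
    then show ?thesis
      unfolding FTs_def integral_scaleR_right[symmetric]
      by (simp add: scaleR_conv_of_real mult_ac)
  qed
  ultimately show ?thesis by (simp add: has_vector_derivative_def)
qed

text \<open>The moment condition is part of the induction, since the next derivative requires it for
  the weight that the previous ones have produced.\<close>

lemma FTs_iter_partial:
  fixes s :: "'b \<Rightarrow> real^'n"
  assumes w: "all_moments M s w" and s[measurable]: "s \<in> borel_measurable M"
  shows "iter_partial is (FTs M s w) = FTs M s (\<lambda>x. w x * prod_list (map (\<lambda>j. 2 * pi * \<i> * (s x $ j)) is)) \<and>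
     all_moments M s (\<lambda>x. w x * prod_list (map (\<lambda>j. 2 * pi * \<i> * (s x $ j)) is))"
proof (induction "is")
  case Nil
  show ?case using w by (simp add: iter_partial_def)
next
  case (Cons i "is")
  let ?v = "\<lambda>x. w x * prod_list (map (\<lambda>j. 2 * pi * \<i> * (s x $ j)) is)"
  have eq: "(\<lambda>x. w x * prod_list (map (\<lambda>j. 2 * pi * \<i> * (s x $ j)) (i # is))) = (\<lambda>x. ?v x * (2 * pi * \<i> * (s x $ i)))"
    by (auto simp: mult_ac)
  have "iter_partial (i # is) (FTs M s w) = partial_deriv i (iter_partial is (FTs M s w))"
    by (simp add: iter_partial_def)
  also have "\<dots> = partial_deriv i (FTs M s ?v)" using Cons.IH by simp
  also have "\<dots> = FTs M s (\<lambda>x. ?v x * (2 * pi * \<i> * (s x $ i)))"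
    unfolding partial_deriv_def using Cons.IH FTs_partial[of M s ?v] s
    by (intro ext vector_derivative_at) blast
  finally show ?case unfolding eq using all_moments_coord[of M s ?v i] Cons.IH s by simp
qed

lemma FTs_smooth:
  fixes s :: "'b \<Rightarrow> real^'n"
  assumes w: "all_moments M s w" and s[measurable]: "s \<in> borel_measurable M"
  shows "smooth_fun (FTs M s w)"
  unfolding smooth_fun_def
proof (intro allI)
  fix "is" x
  let ?v = "\<lambda>x. w x * prod_list (map (\<lambda>j. 2 * pi * \<i> * (s x $ j)) is)"
  have "iter_partial is (FTs M s w) = FTs M s ?v" "all_moments M s ?v"
    using FTs_iter_partial[OF w s, of "is"] by auto
  then show "iter_partial is (FTs M s w) differentiable (at x)"
    using FTs_has_derivative[OF s, of ?v x] unfolding all_moments_def differentiable_def by auto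
qed

lemma norm_integral_le_nn:
  fixes f :: "'b \<Rightarrow> 'c::{banach,second_countable_topology}"
  shows "ennreal (norm (integral\<^sup>L M f)) \<le> (\<integral>\<^sup>+x. ennreal (norm (f x)) \<partial>M)"
  by (cases "integrable M f") (auto simp: integral_norm_bound_ennreal not_integrable_integral_eq)

lemma integrable_bounded_mult:
  fixes g h :: "'b \<Rightarrow> complex"
  assumes g: "integrable M g" and [measurable]: "h \<in> borel_measurable M" and h: "\<And>x. norm (h x) \<le> K"
  shows "integrable M (\<lambda>x. h x * g x)"
proof (rule Bochner_Integration.integrable_bound)
  show "integrable M (\<lambda>x. K *\<^sub>R g x)" using g by (rule integrable_scaleR_right)
  have [measurable]: "g \<in> borel_measurable M" using g by auto
  show "(\<lambda>x. h x * g x) \<in> borel_measurable M" by measurable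
  show "AE x in M. norm (h x * g x) \<le> norm (K *\<^sub>R g x)"
  proof (rule AE_I2)
    fix x
    have "norm (h x) \<le> \<bar>K\<bar>" using h[of x] by simp
    then show "norm (h x * g x) \<le> norm (K *\<^sub>R g x)" by (simp add: norm_mult mult_right_mono)
  qed
qed

text \<open>Fubini for \<open>a x * b \<xi> * chi \<xi> (S x)\<close>. The symmetry assumption holds
  for \<open>S = uminus\<close> and for the identity, so that the formula serves the Fourier
  transform and its inverse alike.\<close>

lemma FTs_mult_formula:
  fixes a b :: "'a::euclidean_space \<Rightarrow> complex"
  assumes a: "integrable lborel a" and b: "integrable lborel b"
    and S[measurable]: "S \<in> borel_measurable borel" and sym: "\<And>x \<xi>. chi \<xi> (S x) = chi x (S \<xi>)"
  shows "(LINT \<xi>|lborel. FTs lborel S a \<xi> * b \<xi>) = (LINT x|lborel. a x * FTs lborel S b x)"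
proof -
  have [measurable]: "a \<in> borel_measurable borel" "b \<in> borel_measurable borel"
    using a b by (auto dest: borel_measurable_integrable)
  let ?f = "\<lambda>x \<xi>. a x * b \<xi> * chi \<xi> (S x)"
  have "integrable (lborel \<Otimes>\<^sub>M lborel) (case_prod ?f)"
  proof (rule lborel_pair.Fubini_integrable)
    show "case_prod ?f \<in> borel_measurable (lborel \<Otimes>\<^sub>M lborel)" by measurable
    show "integrable lborel (\<lambda>x. LINT y|lborel. norm (case (x, y) of (x, \<xi>) \<Rightarrow> ?f x \<xi>))"
      using a b by (simp add: norm_mult)
    show "AE x in lborel. integrable lborel (\<lambda>y. case (x, y) of (x, \<xi>) \<Rightarrow> ?f x \<xi>)"
    proof (intro AE_I2, simp)
      fix x
      show "integrable lborel (\<lambda>y. a x * b y * chi y (S x))"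
        using FTs_integrable[OF b, of S x] S
        by (simp add: mult.assoc sym)
    qed
  qed
  then have "(LINT \<xi>|lborel. LINT x|lborel. ?f x \<xi>) = (LINT x|lborel. LINT \<xi>|lborel. ?f x \<xi>)"
    by (rule lborel_pair.Fubini_integral)
  moreover have "(LINT x|lborel. ?f x \<xi>) = FTs lborel S a \<xi> * b \<xi>" for \<xi>
    unfolding FTs_def by (subst integral_mult_left_zero[symmetric]) (simp add: mult_ac)
  moreover have "(LINT \<xi>|lborel. ?f x \<xi>) = a x * FTs lborel S b x" for x
    unfolding FTs_def by (subst integral_mult_right_zero[symmetric]) (simp add: mult_ac sym)
  ultimately show ?thesis by simp
qed

section \<open>Gaussians composed with matrices\<close>

definition gaussian :: "real^'n^'n \<Rightarrow> real^'n \<Rightarrow> complex" where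
  "gaussian B x = complex_of_real (exp (- pi * (norm (B *v x))\<^sup>2))"

lemma continuous_gaussian [continuous_intros]: "continuous_on S f \<Longrightarrow> continuous_on S (\<lambda>x. gaussian B (f x))"
  unfolding gaussian_def by (intro continuous_intros continuous_on_compose2[OF matrix_vector_mult_linear_continuous_on[of UNIV B]]) auto

lemma gaussian_borel [measurable]: "gaussian B \<in> borel_measurable borel"
  by (intro borel_measurable_continuous_onI continuous_intros)

lemma norm_gaussian_le: "norm (gaussian B x) \<le> 1"
  by (simp add: gaussian_def mult_nonneg_nonneg)

lemma gaussian_nonzero [simp]: "gaussian B x \<noteq> 0" by (simp add: gaussian_def)

lemma matrix_vector_inv:
  fixes B C :: "real^'n^'n"
  assumes "B ** C = mat 1" shows "B *v (C *v x) = x"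
  using assms by (simp add: matrix_vector_mul_assoc)

lemma gaussian_chi:
  fixes B C :: "real^'n^'n"
  assumes BC: "B ** C = mat 1"
  shows "integrable lborel (\<lambda>x. gaussian B x * chi t x)"
    and "(LINT x|lborel. gaussian B x * chi t x) = \<bar>det C\<bar> * gaussian (transpose C) t"
proof -
  have CB: "C ** B = mat 1" using BC matrix_left_right_inverse by blast
  have inv: "invertible C" using BC CB by (auto simp: invertible_def)
  have eq: "gaussian B (C *v x) * chi t (C *v x) = complex_of_real (exp (- pi * (norm x)\<^sup>2)) * chi (transpose C *v t) x" for x
    by (simp add: gaussian_def chi_def matrix_vector_inv[OF BC] dot_lmul_matrix)
  show "integrable lborel (\<lambda>x. gaussian B x * chi t x)"
    by (subst integral_linear_subst(2)[OF inv], measurable, simp only: eq gauss_chi)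
  show "(LINT x|lborel. gaussian B x * chi t x) = \<bar>det C\<bar> * gaussian (transpose C) t"
    by (subst integral_linear_subst(1)[OF inv], measurable, simp only: eq gauss_chi, simp only: gaussian_def)
qed

lemma gaussian_integrable:
  fixes B C :: "real^'n^'n"
  assumes "B ** C = mat 1" shows "integrable lborel (gaussian B)"
  using gaussian_chi(1)[OF assms, of 0] by simp

lemma mat_vec: "(mat e :: real^'n^'n) *v x = e *\<^sub>R x"
  by (simp add: vec_eq_iff matrix_vector_mult_def mat_def mult_delta_left)

lemma mat_mult_inverse:
  fixes e :: real
  assumes "e \<noteq> 0" shows "(mat e :: real^'n^'n) ** mat (1 / e) = mat 1"
  using assms by (simp add: matrix_eq mat_vec flip: matrix_vector_mul_assoc)

lemma gaussian_mat1: "gaussian (mat 1) x = complex_of_real (exp (- pi * (norm x)\<^sup>2))" by (simp add: gaussian_def)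

lemma gaussian_mat1_integral: "(LINT x|lborel. gaussian (mat 1 :: real^'n^'n) x) = 1"
  using gauss_chi(2)[of "0::real^'n"] by (simp add: gaussian_mat1)

lemma gaussian_mat1_integrable: "integrable lborel (gaussian (mat 1 :: real^'n^'n))"
  using gauss_chi(1)[of "0::real^'n"] by (simp add: gaussian_mat1[abs_def])

text \<open>The inner integral is a Gaussian of mass one and width \<open>e\<close> centred at
  \<open>\<xi>\<close>. The substitution \<open>y = \<xi> + e *\<^sub>R z\<close> moves
  \<open>e\<close> from the kernel into the argument of \<open>u\<close>, where it can tend to zero;
  the two determinants cancel.\<close>

lemma smoothing_eq:
  fixes u :: "real^'n \<Rightarrow> complex"
  assumes e: "e > 0" and [measurable]: "u \<in> borel_measurable borel"
  shows "(LINT y|lborel. u y * (LINT x|lborel. gaussian (mat e) x * chi (y - \<xi>) x)) = (LINT z|lborel. u (\<xi> + e *\<^sub>R z) * gaussian (mat 1) z)"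
proof -
  let ?C = "mat (1 / e) :: real^'n^'n" and ?B = "mat e :: real^'n^'n"
  have BC: "?B ** ?C = mat 1" "?C ** ?B = mat 1"
    using mat_mult_inverse[of e] mat_mult_inverse[of "1/e"] e by auto
  have inv: "invertible ?B" using BC by (auto simp: invertible_def)
  have dd: "\<bar>det ?B\<bar> * \<bar>det ?C\<bar> = 1"
    using BC(1) by (metis abs_1 abs_mult det_I det_mul)
  have in1: "(LINT x|lborel. gaussian ?B x * chi t x) = \<bar>det ?C\<bar> * gaussian ?C t" for t
    using gaussian_chi(2)[OF BC(1), of t] by simp
  have "(LINT y|lborel. u y * (\<bar>det ?C\<bar> * gaussian ?C (y - \<xi>))) = (LINT y|lborel. u (\<xi> + y) * (\<bar>det ?C\<bar> * gaussian ?C y))"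
    using integral_translate(1)[of "\<lambda>y. u y * (\<bar>det ?C\<bar> * gaussian ?C (y - \<xi>))" \<xi>] by simp
  also have "\<dots> = \<bar>det ?B\<bar> * (LINT y|lborel. u (\<xi> + ?B *v y) * (\<bar>det ?C\<bar> * gaussian ?C (?B *v y)))"
    by (rule integral_linear_subst(1)[OF inv]) measurable
  also have "\<dots> = (LINT y|lborel. \<bar>det ?B\<bar> * (u (\<xi> + ?B *v y) * (\<bar>det ?C\<bar> * gaussian ?C (?B *v y))))"
    by (rule integral_mult_right_zero[symmetric])
  also have "\<dots> = (LINT y|lborel. u (\<xi> + e *\<^sub>R y) * gaussian (mat 1) y)"
  proof (rule Bochner_Integration.integral_cong[OF refl])
    fix y
    have "gaussian ?C (?B *v y) = gaussian (mat 1) y"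
      using e by (simp add: gaussian_def mat_vec)
    moreover have "complex_of_real \<bar>det ?B\<bar> * complex_of_real \<bar>det ?C\<bar> = 1"
      using dd by (metis of_real_1 of_real_mult)
    ultimately show "\<bar>det ?B\<bar> * (u (\<xi> + ?B *v y) * (\<bar>det ?C\<bar> * gaussian ?C (?B *v y))) = u (\<xi> + e *\<^sub>R y) * gaussian (mat 1) y"
      by (simp add: mat_vec algebra_simps)
  qed
  finally show ?thesis by (simp only: in1)
qed

section \<open>Gauss summability: inversion and Bessel's inequality\<close>

lemma eps_seq: "(\<lambda>m. 1 / real (Suc m)) \<longlonglongrightarrow> 0" using LIMSEQ_inverse_real_of_nat by (simp add: inverse_eq_divide)

lemma gaussian_eps_tendsto: "(\<lambda>m. gaussian (mat (1 / real (Suc m))) x) \<longlonglongrightarrow> 1"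
proof -
  have "(\<lambda>m. complex_of_real (exp (- pi * (norm ((1 / real (Suc m)) *\<^sub>R x))\<^sup>2))) \<longlonglongrightarrow> complex_of_real (exp (- pi * (norm (0 *\<^sub>R x))\<^sup>2))"
    by (intro tendsto_intros eps_seq)
  then show ?thesis by (simp add: gaussian_def mat_vec)
qed

text \<open>The transform is damped by \<open>gaussian (mat e)\<close> with \<open>e\<close> tending
  to zero. By the multiplication formula the damped inverse integral is an average of
  \<open>u\<close> around \<open>\<xi>\<close>, which tends to \<open>u \<xi>\<close> because
  \<open>u\<close> is continuous and bounded; the damping disappears by dominated
  convergence.\<close>

lemma fourier_inversion:
  fixes u :: "real^'n \<Rightarrow> complex"
  assumes cont: "continuous_on UNIV u" and bd: "\<And>x. norm (u x) \<le> K" and iu: "integrable lborel u"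
    and iF: "integrable lborel (FTs lborel uminus u)"
  shows "FTs lborel (\<lambda>x. x) (FTs lborel uminus u) \<xi> = u \<xi>"
proof -
  let ?e = "\<lambda>m. 1 / real (Suc m)"
  let ?U = "FTs lborel uminus u"
  have [measurable]: "u \<in> borel_measurable borel" "?U \<in> borel_measurable borel"
    using iu iF by (auto dest: borel_measurable_integrable)
  have "(\<lambda>m. LINT x|lborel. ?U x * (gaussian (mat (?e m)) x * chi \<xi> x)) \<longlonglongrightarrow> (LINT x|lborel. ?U x * chi \<xi> x)"
  proof (rule integral_dominated_convergence[where w="\<lambda>x. norm (?U x)"])
    show "AE x in lborel. (\<lambda>m. ?U x * (gaussian (mat (?e m)) x * chi \<xi> x)) \<longlonglongrightarrow> ?U x * chi \<xi> x"
    proof (rule AE_I2)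
      fix x
      show "(\<lambda>m. ?U x * (gaussian (mat (?e m)) x * chi \<xi> x)) \<longlonglongrightarrow> ?U x * chi \<xi> x"
        using tendsto_mult[OF tendsto_const[of "?U x"] tendsto_mult[OF gaussian_eps_tendsto tendsto_const[of "chi \<xi> x"]]] by simp
    qed
    show "AE x in lborel. norm (?U x * (gaussian (mat (?e m)) x * chi \<xi> x)) \<le> norm (?U x)" for m
      using mult_left_mono[OF norm_gaussian_le norm_ge_zero[of "?U _"]] by (auto simp: norm_mult)
  qed (use iF in auto)
  moreover have "(LINT x|lborel. ?U x * (gaussian (mat (?e m)) x * chi \<xi> x)) = (LINT z|lborel. u (\<xi> + ?e m *\<^sub>R z) * gaussian (mat 1 :: real^'n^'n) z)" for m
  proof -
    have BC: "(mat (?e m) :: real^'n^'n) ** mat (1 / ?e m) = mat 1" by (rule mat_mult_inverse) simp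
    have "(LINT x|lborel. ?U x * (gaussian (mat (?e m)) x * chi \<xi> x)) = (LINT x|lborel. u x * FTs lborel uminus (\<lambda>x. gaussian (mat (?e m)) x * chi \<xi> x) x)"
      by (rule FTs_mult_formula[OF iu gaussian_chi(1)[OF BC]]) (auto simp: chi_def inner_commute)
    also have "\<dots> = (LINT y|lborel. u y * (LINT x|lborel. gaussian (mat (?e m)) x * chi (\<xi> - y) x))"
      unfolding FTs_def by (simp add: mult.assoc chi_minus[symmetric] flip: chi_add)
    also have "\<dots> = (LINT y|lborel. u y * (LINT x|lborel. gaussian (mat (?e m)) x * chi (y - \<xi>) x))"
    proof -
      have "(LINT x|lborel. gaussian (mat (?e m)) x * chi (\<xi> - y) x) = (LINT x|lborel. gaussian (mat (?e m)) x * chi (y - \<xi>) x)" for y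
        unfolding gaussian_chi(2)[OF BC] by (simp add: gaussian_def mat_vec norm_minus_commute)
      then show ?thesis by simp
    qed
    also have "\<dots> = (LINT z|lborel. u (\<xi> + ?e m *\<^sub>R z) * gaussian (mat 1 :: real^'n^'n) z)"
      by (rule smoothing_eq) auto
    finally show ?thesis .
  qed
  moreover have "(\<lambda>m. LINT z|lborel. u (\<xi> + ?e m *\<^sub>R z) * gaussian (mat 1 :: real^'n^'n) z) \<longlonglongrightarrow> (LINT z|lborel. u \<xi> * gaussian (mat 1 :: real^'n^'n) z)"
  proof (rule integral_dominated_convergence[where w="\<lambda>x. K * norm (gaussian (mat 1 :: real^'n^'n) x)"])
    show "AE z in lborel. (\<lambda>m. u (\<xi> + ?e m *\<^sub>R z) * gaussian (mat 1 :: real^'n^'n) z) \<longlonglongrightarrow> u \<xi> * gaussian (mat 1 :: real^'n^'n) z"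
    proof (rule AE_I2, rule tendsto_mult_right)
      fix z
      have "(\<lambda>m. \<xi> + ?e m *\<^sub>R z) \<longlonglongrightarrow> \<xi> + 0 *\<^sub>R z" by (intro tendsto_intros eps_seq)
      moreover have "isCont u \<xi>" using cont by (simp add: continuous_on_eq_continuous_at)
      ultimately show "(\<lambda>m. u (\<xi> + ?e m *\<^sub>R z)) \<longlonglongrightarrow> u \<xi>"
        using isCont_tendsto_compose[of \<xi> u] by simp
    qed
    show "AE z in lborel. norm (u (\<xi> + ?e m *\<^sub>R z) * gaussian (mat 1 :: real^'n^'n) z) \<le> K * norm (gaussian (mat 1 :: real^'n^'n) z)" for m
      using bd by (auto simp: norm_mult intro: mult_right_mono)
  qed (use gaussian_mat1_integrable in auto)
  ultimately have "(LINT x|lborel. ?U x * chi \<xi> x) = (LINT z|lborel. u \<xi> * gaussian (mat 1 :: real^'n^'n) z)"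
    using LIMSEQ_unique by simp
  then show ?thesis by (simp add: FTs_def[of _ "\<lambda>x. x"] gaussian_mat1_integral)
qed

lemma nn_integral_shift_scale:
  fixes f :: "real^'n \<Rightarrow> ennreal"
  assumes [measurable]: "f \<in> borel_measurable borel"
  shows "(\<integral>\<^sup>+x. f (x + a) \<partial>lborel) = (\<integral>\<^sup>+x. f x \<partial>lborel)"
  using nn_integral_translate[of f a] by (simp add: add.commute)

text \<open>Integrability of \<open>u\<close> is enough, and the right-hand side may be infinite.
  The Gaussian-damped integral of the squared transform is, by the multiplication formula, an
  integral of \<open>u x * cnj (u (x + e *\<^sub>R z))\<close> against a Gaussian in
  \<open>z\<close> of mass one. The inequality between arithmetic and geometric mean and translation
  invariance bound it by the integral of the square of \<open>u\<close>, and Fatou's lemma removes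
  the damping.\<close>

lemma bessel_inequality:
  fixes u :: "real^'n \<Rightarrow> complex"
  assumes iu: "integrable lborel u"
  shows "(\<integral>\<^sup>+\<xi>. ennreal ((norm (FTs lborel uminus u \<xi>))\<^sup>2) \<partial>lborel) \<le> (\<integral>\<^sup>+x. ennreal ((norm (u x))\<^sup>2) \<partial>lborel)"
proof -
  let ?e = "\<lambda>m. 1 / real (Suc m)"
  let ?U = "FTs lborel uminus u"
  let ?G = "\<lambda>m \<xi>. (norm (?U \<xi>))\<^sup>2 * exp (- pi * (norm ((mat (?e m) :: real^'n^'n) *v \<xi>))\<^sup>2)"
  have um[measurable]: "u \<in> borel_measurable borel" using iu by (auto dest: borel_measurable_integrable)
  have "continuous_on UNIV ?U" by (rule FTs_continuous[OF iu]) simp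
  then have [measurable]: "?U \<in> borel_measurable borel" by (rule borel_measurable_continuous_onI)
  have Ub: "norm (?U \<xi>) \<le> (LINT x|lborel. norm (u x))" for \<xi> by (rule FTs_bound[OF iu]) simp
  have [measurable]: "cnj \<in> borel_measurable borel"
    by (intro borel_measurable_continuous_onI continuous_intros)
  have cUm[measurable]: "(\<lambda>x. cnj (?U x)) \<in> borel_measurable borel"
    by (intro borel_measurable_continuous_onI continuous_intros \<open>continuous_on UNIV ?U\<close>)
  have cum[measurable]: "(\<lambda>x. cnj (u x)) \<in> borel_measurable borel" by measurable
  have gm[measurable]: "(\<lambda>x. exp (- pi * (norm ((mat (?e m) :: real^'n^'n) *v x))\<^sup>2)) \<in> borel_measurable borel" for m
    by measurable
  have main: "(\<integral>\<^sup>+\<xi>. ennreal (?G m \<xi>) \<partial>lborel) \<le> (\<integral>\<^sup>+x. ennreal ((norm (u x))\<^sup>2) \<partial>lborel)" for m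
  proof -
    have BC: "(mat (?e m) :: real^'n^'n) ** mat (1 / ?e m) = mat 1" by (rule mat_mult_inverse) simp
    let ?g = "gaussian (mat (?e m)) :: real^'n \<Rightarrow> complex"
    let ?b = "\<lambda>\<xi>. cnj (?U \<xi>) * ?g \<xi>"
    have ig: "integrable lborel ?g" by (rule gaussian_integrable[OF BC])
    have ib: "integrable lborel ?b"
      by (rule integrable_bounded_mult[OF ig]) (measurable, use Ub in simp)
    have cU: "cnj (?U \<xi>) = FTs lborel (\<lambda>x. x) (\<lambda>x. cnj (u x)) \<xi>" for \<xi>
      unfolding FTs_def by (subst Bochner_Integration.integral_cnj[symmetric]) (simp add: cnj_chi chi_minus)
    have icu: "integrable lborel (\<lambda>x. cnj (u x))" using iu by simp
    have inner: "FTs lborel uminus ?b x = (LINT z|lborel. cnj (u (x + ?e m *\<^sub>R z)) * gaussian (mat 1) z)" for x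
    proof -
      have "FTs lborel uminus ?b x = (LINT \<xi>|lborel. FTs lborel (\<lambda>x. x) (\<lambda>x. cnj (u x)) \<xi> * (?g \<xi> * chi (- x) \<xi>))"
        unfolding FTs_def[of lborel uminus ?b] by (simp only: cU mult.assoc chi_minus)
      also have "\<dots> = (LINT y|lborel. cnj (u y) * FTs lborel (\<lambda>x. x) (\<lambda>\<xi>. ?g \<xi> * chi (- x) \<xi>) y)"
        by (rule FTs_mult_formula[OF icu gaussian_chi(1)[OF BC]]) (auto intro: chi_commute)
      also have "\<dots> = (LINT y|lborel. cnj (u y) * (LINT \<xi>|lborel. ?g \<xi> * chi (y - x) \<xi>))"
        unfolding FTs_def by (simp add: mult.assoc flip: chi_add)
      also have "\<dots> = (LINT z|lborel. cnj (u (x + ?e m *\<^sub>R z)) * gaussian (mat 1) z)"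
        by (rule smoothing_eq) auto
      finally show ?thesis .
    qed
    have eq: "complex_of_real (?G m \<xi>) = ?U \<xi> * ?b \<xi>" for \<xi>
    proof -
      have "?U \<xi> * ?b \<xi> = (?U \<xi> * cnj (?U \<xi>)) * ?g \<xi>" by (simp only: mult.assoc)
      also have "?U \<xi> * cnj (?U \<xi>) = complex_of_real ((norm (?U \<xi>))\<^sup>2)" by (rule complex_norm_square[symmetric])
      finally show ?thesis by (simp only: gaussian_def of_real_mult)
    qed
    have iG: "integrable lborel (\<lambda>\<xi>. ?U \<xi> * ?b \<xi>)"
      by (rule integrable_bounded_mult[OF ib _ Ub]) measurable
    then have iGr: "integrable lborel (?G m)"
      by (simp only: eq[symmetric] complex_of_real_integrable_eq)
    have "(\<integral>\<^sup>+\<xi>. ennreal (?G m \<xi>) \<partial>lborel) = ennreal (LINT \<xi>|lborel. ?G m \<xi>)"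
      by (rule nn_integral_eq_integral[OF iGr]) simp
    also have "\<dots> \<le> ennreal (norm (LINT \<xi>|lborel. complex_of_real (?G m \<xi>)))"
      by (rule ennreal_leI) (simp only: integral_complex_of_real norm_of_real abs_ge_self)
    also have "(LINT \<xi>|lborel. complex_of_real (?G m \<xi>)) = (LINT x|lborel. u x * FTs lborel uminus ?b x)"
      unfolding eq by (rule FTs_mult_formula[OF iu ib]) (auto simp: chi_def inner_commute)
    also have "ennreal (norm \<dots>) \<le> (\<integral>\<^sup>+x. ennreal (norm (u x * FTs lborel uminus ?b x)) \<partial>lborel)"
    proof (rule integral_norm_bound_ennreal)
      have "continuous_on UNIV (FTs lborel uminus ?b)" by (rule FTs_continuous[OF ib]) simp
      then have "FTs lborel uminus ?b \<in> borel_measurable borel" by (rule borel_measurable_continuous_onI)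
      then have "integrable lborel (\<lambda>x. FTs lborel uminus ?b x * u x)"
        by (intro integrable_bounded_mult[OF iu _ FTs_bound[OF ib]]) auto
      then show "integrable lborel (\<lambda>x. u x * FTs lborel uminus ?b x)" by (simp add: mult.commute)
    qed
    also have "\<dots> \<le> (\<integral>\<^sup>+x. (\<integral>\<^sup>+z. (ennreal ((norm (u x))\<^sup>2 / 2) + ennreal ((norm (u (x + ?e m *\<^sub>R z)))\<^sup>2 / 2)) * ennreal (norm (gaussian (mat 1) z)) \<partial>lborel) \<partial>lborel)"
    proof (rule nn_integral_mono)
      fix x
      have "ennreal (norm (u x * FTs lborel uminus ?b x)) = ennreal (norm (LINT z|lborel. u x * (cnj (u (x + ?e m *\<^sub>R z)) * gaussian (mat 1) z)))"
        unfolding inner by (simp only: integral_mult_right_zero)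
      also have "\<dots> \<le> (\<integral>\<^sup>+z. ennreal (norm (u x * (cnj (u (x + ?e m *\<^sub>R z)) * gaussian (mat 1) z))) \<partial>lborel)"
        by (rule norm_integral_le_nn)
      also have "\<dots> \<le> (\<integral>\<^sup>+z. (ennreal ((norm (u x))\<^sup>2 / 2) + ennreal ((norm (u (x + ?e m *\<^sub>R z)))\<^sup>2 / 2)) * ennreal (norm (gaussian (mat 1) z)) \<partial>lborel)"
      proof (rule nn_integral_mono)
        fix z
        have "norm (u x) * norm (u (x + ?e m *\<^sub>R z)) \<le> (norm (u x))\<^sup>2 / 2 + (norm (u (x + ?e m *\<^sub>R z)))\<^sup>2 / 2"
          using sum_squares_bound[of "norm (u x)" "norm (u (x + ?e m *\<^sub>R z))"] by simp
        from mult_right_mono[OF this norm_ge_zero[of "gaussian (mat 1) z"]]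
        show "ennreal (norm (u x * (cnj (u (x + ?e m *\<^sub>R z)) * gaussian (mat 1) z))) \<le> (ennreal ((norm (u x))\<^sup>2 / 2) + ennreal ((norm (u (x + ?e m *\<^sub>R z)))\<^sup>2 / 2)) * ennreal (norm (gaussian (mat 1) z))"
          by (subst ennreal_plus[symmetric], simp, simp, subst ennreal_mult[symmetric], simp, simp)
             (rule ennreal_leI, simp only: norm_mult complex_mod_cnj mult.assoc)
      qed
      finally show "ennreal (norm (u x * FTs lborel uminus ?b x)) \<le> (\<integral>\<^sup>+z. (ennreal ((norm (u x))\<^sup>2 / 2) + ennreal ((norm (u (x + ?e m *\<^sub>R z)))\<^sup>2 / 2)) * ennreal (norm (gaussian (mat 1) z)) \<partial>lborel)" .
    qed
    also have "\<dots> = (\<integral>\<^sup>+z. (\<integral>\<^sup>+x. (ennreal ((norm (u x))\<^sup>2 / 2) + ennreal ((norm (u (x + ?e m *\<^sub>R z)))\<^sup>2 / 2)) * ennreal (norm (gaussian (mat 1) z)) \<partial>lborel) \<partial>lborel)"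
      by (rule lborel_pair.Fubini') measurable
    also have "\<dots> = (\<integral>\<^sup>+z. (\<integral>\<^sup>+x. ennreal ((norm (u x))\<^sup>2) \<partial>lborel) * ennreal (norm (gaussian (mat 1 :: real^'n^'n) z)) \<partial>lborel)"
    proof (rule nn_integral_cong)
      fix z :: "real^'n"
      have "(\<integral>\<^sup>+x. (ennreal ((norm (u x))\<^sup>2 / 2) + ennreal ((norm (u (x + ?e m *\<^sub>R z)))\<^sup>2 / 2)) * ennreal (norm (gaussian (mat 1) z)) \<partial>lborel)
        = (\<integral>\<^sup>+x. (ennreal ((norm (u x))\<^sup>2 / 2) + ennreal ((norm (u (x + ?e m *\<^sub>R z)))\<^sup>2 / 2)) \<partial>lborel) * ennreal (norm (gaussian (mat 1) z))"
        by (rule nn_integral_multc) measurable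
      also have "(\<integral>\<^sup>+x. (ennreal ((norm (u x))\<^sup>2 / 2) + ennreal ((norm (u (x + ?e m *\<^sub>R z)))\<^sup>2 / 2)) \<partial>lborel)
         = (\<integral>\<^sup>+x. ennreal ((norm (u x))\<^sup>2 / 2) \<partial>lborel) + (\<integral>\<^sup>+x. ennreal ((norm (u (x + ?e m *\<^sub>R z)))\<^sup>2 / 2) \<partial>lborel)"
        by (rule nn_integral_add) measurable
      also have "(\<integral>\<^sup>+x. ennreal ((norm (u (x + ?e m *\<^sub>R z)))\<^sup>2 / 2) \<partial>lborel) = (\<integral>\<^sup>+x. ennreal ((norm (u x))\<^sup>2 / 2) \<partial>lborel)"
        by (rule nn_integral_shift_scale[of "\<lambda>x. ennreal ((norm (u x))\<^sup>2 / 2)"]) measurable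
      also have "(\<integral>\<^sup>+x. ennreal ((norm (u x))\<^sup>2 / 2) \<partial>lborel) + (\<integral>\<^sup>+x. ennreal ((norm (u x))\<^sup>2 / 2) \<partial>lborel) = (\<integral>\<^sup>+x. ennreal ((norm (u x))\<^sup>2) \<partial>lborel)"
        by (subst nn_integral_add[symmetric]) (simp_all flip: ennreal_plus)
      finally show "(\<integral>\<^sup>+x. (ennreal ((norm (u x))\<^sup>2 / 2) + ennreal ((norm (u (x + ?e m *\<^sub>R z)))\<^sup>2 / 2)) * ennreal (norm (gaussian (mat 1) z)) \<partial>lborel)
         = (\<integral>\<^sup>+x. ennreal ((norm (u x))\<^sup>2) \<partial>lborel) * ennreal (norm (gaussian (mat 1) z))" .
    qed
    also have "\<dots> = (\<integral>\<^sup>+x. ennreal ((norm (u x))\<^sup>2) \<partial>lborel) * (\<integral>\<^sup>+z. ennreal (norm (gaussian (mat 1 :: real^'n^'n) z)) \<partial>lborel)"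
      by (rule nn_integral_cmult) measurable
    also have "(\<integral>\<^sup>+z. ennreal (norm (gaussian (mat 1 :: real^'n^'n) z)) \<partial>lborel) = 1"
    proof -
      have "(\<integral>\<^sup>+z. ennreal (norm (gaussian (mat 1 :: real^'n^'n) z)) \<partial>lborel) = ennreal (LINT z|lborel. norm (gaussian (mat 1 :: real^'n^'n) z))"
        using gaussian_mat1_integrable by (intro nn_integral_eq_integral) auto
      moreover have "complex_of_real (LINT z|lborel. norm (gaussian (mat 1 :: real^'n^'n) z)) = 1"
        using gaussian_mat1_integral[where 'n='n] by (simp add: gaussian_def flip: integral_complex_of_real)
      ultimately show ?thesis by simp
    qed
    finally show ?thesis by (simp only: mult_1_right)
  qed
  have lim: "(\<lambda>m. ennreal (?G m \<xi>)) \<longlonglongrightarrow> ennreal ((norm (?U \<xi>))\<^sup>2)" for \<xi>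
  proof -
    have "(\<lambda>m. (norm (?U \<xi>))\<^sup>2 * norm (gaussian (mat (?e m)) \<xi>)) \<longlonglongrightarrow> (norm (?U \<xi>))\<^sup>2 * norm (1::complex)"
      by (intro tendsto_intros gaussian_eps_tendsto)
    moreover have "(norm (?U \<xi>))\<^sup>2 * norm (gaussian (mat (?e m)) \<xi>) = ?G m \<xi>" for m
      unfolding gaussian_def norm_of_real abs_exp_cancel ..
    ultimately show ?thesis by (intro tendsto_ennrealI) (simp only: norm_one mult_1_right)
  qed
  have "(\<integral>\<^sup>+\<xi>. ennreal ((norm (?U \<xi>))\<^sup>2) \<partial>lborel) = (\<integral>\<^sup>+\<xi>. liminf (\<lambda>m. ennreal (?G m \<xi>)) \<partial>lborel)"
    by (simp only: lim_imp_Liminf[OF _ lim] trivial_limit_sequentially not_False_eq_True)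
  also have "\<dots> \<le> liminf (\<lambda>m. \<integral>\<^sup>+\<xi>. ennreal (?G m \<xi>) \<partial>lborel)"
    by (rule nn_integral_liminf) measurable
  also have "\<dots> \<le> (\<integral>\<^sup>+x. ennreal ((norm (u x))\<^sup>2) \<partial>lborel)"
    by (rule Liminf_le[OF sequentially_bot], rule always_eventually, rule allI, rule main)
  finally show ?thesis .
qed

section \<open>Weighted bounds on derivatives\<close>

text \<open>A relation instead of an operator, so that a candidate for the derivative can be
  exhibited and combined by rules; nothing is asserted about other directions.\<close>

definition dirder :: "'n \<Rightarrow> (real^'n \<Rightarrow> complex) \<Rightarrow> (real^'n \<Rightarrow> complex) \<Rightarrow> bool" where
  "dirder j u u' \<longleftrightarrow> (\<forall>x. ((\<lambda>t. u (x + t *\<^sub>R axis j 1)) has_vector_derivative u' x) (at 0))"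

lemma dirder_at:
  assumes "dirder j u u'"
  shows "((\<lambda>t. u (x + t *\<^sub>R axis j 1)) has_vector_derivative u' (x + s *\<^sub>R axis j 1)) (at s)"
proof -
  have 1: "((\<lambda>t. t - s) has_vector_derivative 1) (at s)"
    by (auto intro!: derivative_eq_intros)
  have "((\<lambda>t. u ((x + s *\<^sub>R axis j 1) + t *\<^sub>R axis j 1)) has_vector_derivative u' (x + s *\<^sub>R axis j 1)) (at (s - s))"
    using assms by (simp add: dirder_def)
  from vector_diff_chain_at[OF 1 this]
  show ?thesis by (simp add: o_def algebra_simps)
qed

lemma dirder_add: "dirder j u u' \<Longrightarrow> dirder j v v' \<Longrightarrow> dirder j (\<lambda>x. u x + v x) (\<lambda>x. u' x + v' x)"
  unfolding dirder_def by (auto intro: has_vector_derivative_add)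

lemma dirder_diff: "dirder j u u' \<Longrightarrow> dirder j v v' \<Longrightarrow> dirder j (\<lambda>x. u x - v x) (\<lambda>x. u' x - v' x)"
  unfolding dirder_def by (auto intro: has_vector_derivative_diff)

lemma dirder_mult: "dirder j u u' \<Longrightarrow> dirder j v v' \<Longrightarrow> dirder j (\<lambda>x. u x * v x) (\<lambda>x. u x * v' x + u' x * v x)"
  unfolding dirder_def
proof safe
  fix x
  assume "\<forall>x. ((\<lambda>t. u (x + t *\<^sub>R axis j 1)) has_vector_derivative u' x) (at 0)"
    "\<forall>x. ((\<lambda>t. v (x + t *\<^sub>R axis j 1)) has_vector_derivative v' x) (at 0)"
  from has_vector_derivative_mult[OF this(1)[rule_format, of x] this(2)[rule_format, of x]]
  show "((\<lambda>t. u (x + t *\<^sub>R axis j 1) * v (x + t *\<^sub>R axis j 1)) has_vector_derivative u x * v' x + u' x * v x) (at 0)"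
    by simp
qed

lemma dirder_const: "dirder j (\<lambda>x. c) (\<lambda>x. 0)"
  unfolding dirder_def by auto

lemma dirder_mvt:
  assumes d: "dirder j u u'" and B: "\<And>t. t \<in> {0..h} \<Longrightarrow> norm (u' (x + t *\<^sub>R axis j 1)) \<le> B" and "0 \<le> h"
  shows "norm (u (x + h *\<^sub>R axis j 1) - u x) \<le> B * h"
proof -
  have "norm (u (x + h *\<^sub>R axis j 1) - u (x + 0 *\<^sub>R axis j 1)) \<le> B * norm (h - 0)"
  proof (rule differentiable_bound[where S="{0..h}" and f="\<lambda>t. u (x + t *\<^sub>R axis j 1)"])
    fix t assume t: "t \<in> {0..h}"
    show "((\<lambda>t. u (x + t *\<^sub>R axis j 1)) has_derivative (\<lambda>s. s *\<^sub>R u' (x + t *\<^sub>R axis j 1))) (at t within {0..h})"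
      using dirder_at[OF d, of x t] unfolding has_vector_derivative_def by (rule has_derivative_at_withinI)
    show "onorm (\<lambda>s. s *\<^sub>R u' (x + t *\<^sub>R axis j 1)) \<le> B"
    proof (rule onorm_bound)
      show "0 \<le> B" using B[OF t] norm_ge_zero order_trans by blast
      show "norm (s *\<^sub>R u' (x + t *\<^sub>R axis j 1)) \<le> B * norm s" for s
        using mult_right_mono[OF B[OF t] abs_ge_zero[of s]] by (simp add: mult.commute)
    qed
  qed (use assms in auto)
  then show ?thesis using assms by simp
qed

text \<open>Only pure derivatives in one direction are controlled. This suffices, since the seminorms of
  \<open>FT v\<close> are bounded by pure derivatives of \<open>v\<close>, and it avoids the order of mixed derivatives.\<close>

primrec deriv_bound :: "nat \<Rightarrow> 'n \<Rightarrow> real \<Rightarrow> real \<Rightarrow> (real^'n \<Rightarrow> complex) \<Rightarrow> bool" where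
  "deriv_bound 0 j M K u \<longleftrightarrow> continuous_on UNIV u \<and> (\<forall>x. norm (u x) \<le> K * (1 + norm x) powr M)"
| "deriv_bound (Suc m) j M K u \<longleftrightarrow> continuous_on UNIV u \<and> (\<forall>x. norm (u x) \<le> K * (1 + norm x) powr M)
     \<and> (\<exists>u'. dirder j u u' \<and> deriv_bound m j M K u')"

lemma deriv_bound_cont: "deriv_bound m j M K u \<Longrightarrow> continuous_on UNIV u" by (cases m) auto
lemma deriv_bound_bound: "deriv_bound m j M K u \<Longrightarrow> norm (u x) \<le> K * (1 + norm x) powr M" by (cases m) auto
lemma deriv_bound_borel: "deriv_bound m j M K u \<Longrightarrow> u \<in> borel_measurable borel"
  by (intro borel_measurable_continuous_onI deriv_bound_cont)

lemma one_plus_norm_pos [simp]: "0 < 1 + norm x" for x :: "'a::real_normed_vector"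
  by (simp add: add_pos_nonneg)

lemma one_plus_norm_nonzero [simp]: "1 + norm x \<noteq> 0" for x :: "'a::real_normed_vector"
  using one_plus_norm_pos[of x] by linarith

lemma deriv_bound_K_nonneg: assumes "deriv_bound m j M K u" shows "0 \<le> K"
proof -
  have "0 \<le> K * (1 + norm (0::real^'a)) powr M" using deriv_bound_bound[OF assms, of 0] norm_ge_zero order_trans by blast
  then show ?thesis by simp
qed

lemma deriv_bound_mono:
  assumes "deriv_bound m j M K u" "M \<le> M'" "K \<le> K'" "m' \<le> m"
  shows "deriv_bound m' j M' K' u"
proof -
  have le: "K * (1 + norm x) powr M \<le> K' * (1 + norm x) powr M'" if "0 \<le> K" for x :: "real^'a"
    using assms that by (intro mult_mono powr_mono) auto
  show ?thesis
    using assms(1,4)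
  proof (induction m arbitrary: u m')
    case 0
    then show ?case using le deriv_bound_K_nonneg[of 0 j M K u] order_trans by fastforce
  next
    case (Suc m)
    have K: "0 \<le> K" using deriv_bound_K_nonneg[OF Suc.prems(1)] .
    have b: "norm (u x) \<le> K' * (1 + norm x) powr M'" for x
      using deriv_bound_bound[OF Suc.prems(1), of x] le[OF K, of x] by linarith
    show ?case
    proof (cases m')
      case 0
      then show ?thesis using b deriv_bound_cont[OF Suc.prems(1)] by simp
    next
      case (Suc k)
      obtain u' where u': "dirder j u u'" "deriv_bound m j M K u'" using Suc.prems(1) by auto
      have "deriv_bound k j M' K' u'" using Suc.IH[OF u'(2)] Suc.prems(2) Suc by simp
      then show ?thesis using b deriv_bound_cont[OF Suc.prems(1)] u'(1) Suc by auto
    qed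
  qed
qed

lemma deriv_bound_add:
  "deriv_bound m j M K u \<Longrightarrow> deriv_bound m j M L v \<Longrightarrow> deriv_bound m j M (K + L) (\<lambda>x. u x + v x)"
proof (induction m arbitrary: u v)
  case 0
  then show ?case by (auto intro!: continuous_intros norm_triangle_mono simp: distrib_right)
next
  case (Suc m)
  obtain u' v' where uv: "dirder j u u'" "deriv_bound m j M K u'" "dirder j v v'" "deriv_bound m j M L v'" using Suc.prems by auto
  have "deriv_bound m j M (K + L) (\<lambda>x. u' x + v' x)" by (rule Suc.IH) fact+
  moreover have "dirder j (\<lambda>x. u x + v x) (\<lambda>x. u' x + v' x)" using uv by (intro dirder_add)
  ultimately show ?case using Suc.prems by (auto intro!: continuous_intros norm_triangle_mono simp: distrib_right)
qed

text \<open>Growth exponents add. By Leibniz' rule a derivative of the product is a sum of two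
  products with one order less to go, which doubles the constant at every order; this is the origin
  of \<open>2 ^ m\<close>.\<close>

lemma deriv_bound_mult:
  "deriv_bound m j M K u \<Longrightarrow> deriv_bound m j N L v \<Longrightarrow> deriv_bound m j (M + N) (2 ^ m * (K * L)) (\<lambda>x. u x * v x)"
proof (induction m arbitrary: u v)
  case 0
  have "norm (u x * v x) \<le> (K * (1 + norm x) powr M) * (L * (1 + norm x) powr N)" for x
    unfolding norm_mult using deriv_bound_bound[OF 0(1), of x] deriv_bound_bound[OF 0(2), of x] deriv_bound_K_nonneg[OF 0(1)]
    by (intro mult_mono) auto
  then show ?case using 0 by (auto intro!: continuous_intros simp: powr_add mult_ac)
next
  case (Suc m)
  obtain u' v' where uv: "dirder j u u'" "deriv_bound m j M K u'" "dirder j v v'" "deriv_bound m j N L v'" using Suc.prems by auto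
  have um: "deriv_bound m j M K u" "deriv_bound m j N L v" using deriv_bound_mono[OF Suc.prems(1) order_refl order_refl, of m] deriv_bound_mono[OF Suc.prems(2) order_refl order_refl, of m] by auto
  have "deriv_bound m j (M + N) (2 ^ m * (K * L) + 2 ^ m * (K * L)) (\<lambda>x. u x * v' x + u' x * v x)"
    by (intro deriv_bound_add Suc.IH um uv)
  then have d: "deriv_bound m j (M + N) (2 ^ Suc m * (K * L)) (\<lambda>x. u x * v' x + u' x * v x)" by (simp add: mult_ac)
  have K: "0 \<le> K" "0 \<le> L" using Suc.prems deriv_bound_K_nonneg by auto
  have "norm (u x * v x) \<le> (K * (1 + norm x) powr M) * (L * (1 + norm x) powr N)" for x
    unfolding norm_mult using deriv_bound_bound[OF Suc.prems(1), of x] deriv_bound_bound[OF Suc.prems(2), of x] K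
    by (intro mult_mono) auto
  also have "(K * (1 + norm x) powr M) * (L * (1 + norm x) powr N) = 1 * (K * L) * (1 + norm x) powr (M + N)" for x :: "real^'a"
    by (simp add: powr_add mult_ac)
  also have "1 * (K * L) * (1 + norm x) powr (M + N) \<le> 2 ^ Suc m * (K * L) * (1 + norm x) powr (M + N)" for x :: "real^'a"
    using K by (intro mult_right_mono one_le_power) auto
  finally have "norm (u x * v x) \<le> 2 ^ Suc m * (K * L) * (1 + norm x) powr (M + N)" for x .
  moreover have "continuous_on UNIV (\<lambda>x. u x * v x)" using deriv_bound_cont[OF Suc.prems(1)] deriv_bound_cont[OF Suc.prems(2)] by (intro continuous_intros)
  ultimately show ?case using d dirder_mult[OF uv(1,3)] unfolding deriv_bound.simps by blast
qed

lemma deriv_bound_const: "deriv_bound m j 0 (norm c) (\<lambda>x. c)"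
proof -
  have z: "deriv_bound m j 0 (norm c) (\<lambda>x. 0)" for m
    by (induction m) (auto intro: dirder_const exI[of _ "\<lambda>x. 0"])
  show ?thesis by (cases m) (auto intro!: dirder_const z exI[of _ "\<lambda>x. 0"])
qed

lemma deriv_bound_cmult: "deriv_bound m j M K u \<Longrightarrow> deriv_bound m j M (norm c * K) (\<lambda>x. c * u x)"
proof (induction m arbitrary: u)
  case 0
  then show ?case by (auto intro!: continuous_intros mult_left_mono simp: norm_mult mult.assoc)
next
  case (Suc m)
  obtain u' where uv: "dirder j u u'" "deriv_bound m j M K u'" using Suc.prems by auto
  have "dirder j (\<lambda>x. c * u x) (\<lambda>x. c * u' x)"
    using dirder_mult[OF dirder_const[of j c] uv(1)] by simp
  then show ?case using Suc.IH[OF uv(2)] Suc.prems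
    by (auto intro!: continuous_intros mult_left_mono simp: norm_mult mult.assoc)
qed

lemma deriv_bound_diff: "deriv_bound m j M K u \<Longrightarrow> deriv_bound m j M L v \<Longrightarrow> deriv_bound m j M (K + L) (\<lambda>x. u x - v x)"
  using deriv_bound_add[of m j M K u L "\<lambda>x. (-1) * v x"] deriv_bound_cmult[of m j M L v "-1"] by simp

lemma deriv_bound_linear:
  fixes a :: "real^'n"
  shows "deriv_bound m j 1 (norm c * norm a) (\<lambda>x. c * complex_of_real (a \<bullet> x))"
proof -
  have d: "dirder j (\<lambda>x. c * complex_of_real (a \<bullet> x)) (\<lambda>x. c * complex_of_real (a $ j))"
    unfolding dirder_def
  proof
    fix x :: "real^'n"
    have e: "a \<bullet> (x + t *\<^sub>R axis j 1) = a \<bullet> x + t * a $ j" for t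
      by (simp add: inner_add_right inner_axis)
    show "((\<lambda>t. c * complex_of_real (a \<bullet> (x + t *\<^sub>R axis j 1))) has_vector_derivative c * complex_of_real (a $ j)) (at 0)"
      unfolding has_vector_derivative_def e
      by (auto intro!: derivative_eq_intros simp: scaleR_conv_of_real mult_ac)
  qed
  have "norm (c * complex_of_real (a \<bullet> x)) \<le> norm c * norm a * (1 + norm x) powr 1" for x
  proof -
    have "\<bar>a \<bullet> x\<bar> \<le> norm a * (1 + norm x)"
      unfolding distrib_left mult_1_right using Cauchy_Schwarz_ineq2[of a x] norm_ge_zero[of a] by linarith
    then have "norm c * \<bar>a \<bullet> x\<bar> \<le> norm c * (norm a * (1 + norm x))" by (rule mult_left_mono) simp
    then show ?thesis by (simp add: norm_mult mult.assoc)
  qed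
  moreover have "continuous_on UNIV (\<lambda>x. c * complex_of_real (a \<bullet> x))" by (intro continuous_intros)
  moreover have "deriv_bound m j 1 (norm c * norm a) (\<lambda>x. c * complex_of_real (a $ j))" for m
  proof (rule deriv_bound_mono[OF deriv_bound_const[of m j "c * complex_of_real (a $ j)"]])
    show "norm (c * complex_of_real (a $ j)) \<le> norm c * norm a"
      by (auto simp: norm_mult intro: mult_left_mono component_le_norm_cart)
  qed auto
  ultimately show ?thesis using d by (cases m) auto
qed

text \<open>\<open>M\<close> ranges over all reals, so the pure derivatives decay faster than any
  power. This is the working form of the Schwartz property: \<open>schwartz_rapid\<close> and
  \<open>FT_in_schwartz\<close> connect it with \<open>schwartz_space\<close>.\<close>

definition rapid :: "(real^'n \<Rightarrow> complex) \<Rightarrow> bool" where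
  "rapid u \<longleftrightarrow> (\<forall>m j M. \<exists>K. deriv_bound m j M K u)"

lemma rapidD: "rapid u \<Longrightarrow> \<exists>K. \<forall>j. deriv_bound m j M K u"
proof -
  assume u: "rapid u"
  then have "\<forall>j. \<exists>K. deriv_bound m j M K u" unfolding rapid_def by blast
  then obtain K where K: "deriv_bound m j M (K j) u" for j by metis
  have "deriv_bound m j M (Max (range K)) u" for j
    by (rule deriv_bound_mono[OF K]) auto
  then show ?thesis by blast
qed

text \<open>The growth \<open>N\<close> of \<open>v\<close> may depend on the order and the
  direction; it is compensated by asking for the decay \<open>M - N\<close> of
  \<open>u\<close>.\<close>

lemma rapid_mult:
  assumes u: "rapid u" and v: "\<And>m j. \<exists>M K. deriv_bound m j M K v"
  shows "rapid (\<lambda>x. u x * v x)"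
  unfolding rapid_def
proof (intro allI)
  fix m j M
  obtain N L where v': "deriv_bound m j N L v" using v by blast
  obtain K where "deriv_bound m j (M - N) K u" using u unfolding rapid_def by blast
  from deriv_bound_mult[OF this v'] show "\<exists>K. deriv_bound m j M K (\<lambda>x. u x * v x)" by auto
qed

lemma rapid_cmult: "rapid u \<Longrightarrow> rapid (\<lambda>x. c * u x)"
  unfolding rapid_def using deriv_bound_cmult by blast
lemma rapid_add: "rapid u \<Longrightarrow> rapid v \<Longrightarrow> rapid (\<lambda>x. u x + v x)"
  unfolding rapid_def using deriv_bound_add by blast
lemma rapid_diff: "rapid u \<Longrightarrow> rapid v \<Longrightarrow> rapid (\<lambda>x. u x - v x)"
  unfolding rapid_def using deriv_bound_diff by blast
lemma rapid_zero: "rapid (\<lambda>x. 0)"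
  unfolding rapid_def
proof (intro allI exI)
  fix m j M
  show "deriv_bound m j M 0 (\<lambda>x. 0)" by (induction m) (auto intro: dirder_const exI[of _ "\<lambda>x. 0"])
qed
lemma rapid_sum: "finite I \<Longrightarrow> (\<And>i. i \<in> I \<Longrightarrow> rapid (u i)) \<Longrightarrow> rapid (\<lambda>x. \<Sum>i\<in>I. u i x)"
  by (induction I rule: finite_induct) (auto intro: rapid_zero rapid_add)
lemma rapid_cont: "rapid u \<Longrightarrow> continuous_on UNIV u"
  unfolding rapid_def using deriv_bound_cont by blast
lemma rapid_borel: "rapid u \<Longrightarrow> u \<in> borel_measurable borel"
  by (intro borel_measurable_continuous_onI rapid_cont)

section \<open>Integrability from weighted bounds\<close>

lemma integrable_inv_square: "integrable lborel (\<lambda>x::real. inverse (1 + x\<^sup>2))"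
proof -
  have "einterval (-\<infinity>) \<infinity> = UNIV" by (auto simp: einterval_def)
  then show ?thesis using integrable_inverse_1_plus_square by (simp add: set_integrable_def)
qed

text \<open>Each coordinate satisfies \<open>1 + (x $ i)^2 \<le> (1 + norm x)^2\<close>, so the
  weight lies below a product of integrable functions of one variable.\<close>

lemma wt_integrable: "integrable lborel (\<lambda>x::real^'n. (1 + norm x) powr (- 2 * real CARD('n)))"
proof (rule Bochner_Integration.integrable_bound)
  show "integrable lborel (\<lambda>x::real^'n. \<Prod>i\<in>UNIV. inverse (1 + (x $ i)\<^sup>2))"
    by (intro integrable_vec_prod integrable_inv_square)
  show "(\<lambda>x::real^'n. (1 + norm x) powr (- 2 * real CARD('n))) \<in> borel_measurable lborel" by measurable
  show "AE x::real^'n in lborel. norm ((1 + norm x) powr (- 2 * real CARD('n))) \<le> norm (\<Prod>i\<in>UNIV. inverse (1 + (x $ i)\<^sup>2))"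
  proof (rule AE_I2)
    fix x :: "real^'n"
    have p: "0 < 1 + norm x" by (simp add: add_pos_nonneg)
    have "(1 + norm x) powr (- 2 * real CARD('n)) = inverse ((1 + norm x) ^ (2 * CARD('n)))"
      using powr_realpow[OF p, of "2 * CARD('n)"] by (simp add: powr_minus)
    also have "\<dots> = (\<Prod>i\<in>(UNIV::'n set). inverse ((1 + norm x)\<^sup>2))"
      by (simp only: prod_constant power_mult power_inverse)
    also have "\<dots> \<le> (\<Prod>i\<in>UNIV. inverse (1 + (x $ i)\<^sup>2))"
    proof (rule prod_mono, safe)
      fix i
      have "(x $ i)\<^sup>2 \<le> (norm x)\<^sup>2" using component_le_norm_cart[of x i] by (metis abs_norm_cancel abs_le_square_iff)
      then have "1 + (x $ i)\<^sup>2 \<le> (1 + norm x)\<^sup>2" by (simp add: power2_sum add_increasing2)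
      then show "inverse ((1 + norm x)\<^sup>2) \<le> inverse (1 + (x $ i)\<^sup>2)"
        by (intro le_imp_inverse_le) (auto simp: add_pos_nonneg)
    qed auto
    finally show "norm ((1 + norm x) powr (- 2 * real CARD('n))) \<le> norm (\<Prod>i\<in>UNIV. inverse (1 + (x $ i)\<^sup>2))" by simp
  qed
qed

definition weight_integral :: "'n::finite itself \<Rightarrow> real" where
  "weight_integral _ = (LINT x|lborel. (1 + norm (x :: real^'n)) powr (- 2 * real CARD('n)))"

lemma weight_integral_nonneg: "0 \<le> weight_integral TYPE('n::finite)" unfolding weight_integral_def by (rule Bochner_Integration.integral_nonneg) auto

lemma deriv_bound_integrable:
  fixes u :: "real^'n \<Rightarrow> complex"
  assumes "deriv_bound m j (- 2 * real CARD('n)) K u" shows "integrable lborel u"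
    and "(LINT x|lborel. norm (u x)) \<le> K * weight_integral TYPE('n)"
proof -
  have i: "integrable lborel (\<lambda>x::real^'n. K * (1 + norm x) powr (- 2 * real CARD('n)))"
    using wt_integrable by (rule integrable_mult_right)
  show iu: "integrable lborel u"
    by (rule Bochner_Integration.integrable_bound[OF i])
       (use deriv_bound_bound[OF assms] deriv_bound_borel[OF assms] deriv_bound_K_nonneg[OF assms] in \<open>auto simp: abs_mult\<close>)
  have "(LINT x|lborel. norm (u x)) \<le> (LINT x::real^'n|lborel. K * (1 + norm x) powr (- 2 * real CARD('n)))"
    by (rule integral_mono) (use iu i deriv_bound_bound[OF assms] in auto)
  then show "(LINT x|lborel. norm (u x)) \<le> K * weight_integral TYPE('n)" by (simp add: weight_integral_def)
qed

lemma rapid_integrable: "rapid u \<Longrightarrow> integrable lborel u"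
  unfolding rapid_def using deriv_bound_integrable(1) by blast

lemma rapid_all_moments:
  fixes u :: "real^'n \<Rightarrow> complex"
  assumes "rapid u" and s: "\<And>x. norm (s x) = norm x"
  shows "all_moments lborel s u"
  unfolding all_moments_def
proof (intro conjI allI)
  show um[measurable]: "u \<in> borel_measurable lborel" using rapid_borel[OF assms(1)] by simp
  fix m
  obtain K where K: "deriv_bound 0 undefined (- 2 * real CARD('n) - real m) K u" using assms unfolding rapid_def by blast
  have "integrable lborel (\<lambda>x. (1 + norm x) ^ m * norm (u x))"
  proof (rule Bochner_Integration.integrable_bound)
    show "integrable lborel (\<lambda>x::real^'n. K * (1 + norm x) powr (- 2 * real CARD('n)))"
      using wt_integrable by (rule integrable_mult_right)
    show "AE x in lborel. norm ((1 + norm x) ^ m * norm (u x)) \<le> norm (K * (1 + norm x) powr (- 2 * real CARD('n)))"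
    proof (rule AE_I2)
      fix x :: "real^'n"
      have p: "0 < 1 + norm x" by (simp add: add_pos_nonneg)
      have "(1 + norm x) ^ m * norm (u x) \<le> (1 + norm x) ^ m * (K * (1 + norm x) powr (- 2 * real CARD('n) - real m))"
        using deriv_bound_bound[OF K, of x] p by (intro mult_left_mono) auto
      also have "\<dots> = K * (1 + norm x) powr (- 2 * real CARD('n))"
        using p by (simp add: powr_diff powr_realpow)
      finally show "norm ((1 + norm x) ^ m * norm (u x)) \<le> norm (K * (1 + norm x) powr (- 2 * real CARD('n)))"
        using deriv_bound_K_nonneg[OF K] p by (simp add: abs_mult)
    qed
  qed measurable
  then show "integrable lborel (\<lambda>x. (1 + norm (s x)) ^ m * norm (u x))" by (simp add: s)
qed

text \<open>Difference quotients of \<open>w\<close> have integral zero by translation invariance,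
  and they converge to \<open>w'\<close>. The mean value inequality gives them an integrable
  majorant, because \<open>w'\<close> is evaluated at distance at most one from
  \<open>x\<close>.\<close>

lemma integral_dirder_zero:
  fixes w :: "real^'n \<Rightarrow> complex"
  assumes d: "dirder j w w'" and w: "deriv_bound 0 j (- 2 * real CARD('n)) K w" and w': "deriv_bound 0 j (- 2 * real CARD('n)) K w'"
  shows "(LINT x|lborel. w' x) = 0"
proof -
  let ?N = "- 2 * real CARD('n)"
  let ?h = "\<lambda>m::nat. 1 / real (Suc m)"
  let ?q = "\<lambda>m x. (1 / ?h m) *\<^sub>R (w (x + ?h m *\<^sub>R axis j 1) - w x)"
  have [measurable]: "w \<in> borel_measurable borel" "w' \<in> borel_measurable borel" using deriv_bound_borel[OF w] deriv_bound_borel[OF w'] by auto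
  have K: "0 \<le> K" using deriv_bound_K_nonneg[OF w] .
  have iw: "integrable lborel w" using deriv_bound_integrable(1)[OF w] .
  have q0: "(LINT x|lborel. ?q m x) = 0" for m
  proof -
    have i: "integrable lborel (\<lambda>x. w (x + ?h m *\<^sub>R axis j 1))"
      using integral_translate(2)[of w "?h m *\<^sub>R axis j 1"] iw by (simp add: add.commute)
    have e: "(LINT x|lborel. w (x + ?h m *\<^sub>R axis j 1)) = (LINT x|lborel. w x)"
      using integral_translate(1)[of w "?h m *\<^sub>R axis j 1"] by (simp add: add.commute)
    show ?thesis
      unfolding integral_scaleR_right Bochner_Integration.integral_diff[OF i iw] e by simp
  qed
  have "(\<lambda>m. LINT x|lborel. ?q m x) \<longlonglongrightarrow> (LINT x|lborel. w' x)"
  proof (rule integral_dominated_convergence[where w="\<lambda>x. K * (2 powr (2 * real CARD('n)) * (1 + norm x) powr ?N)"])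
    show "w' \<in> borel_measurable lborel" "?q m \<in> borel_measurable lborel" for m by measurable
    show "integrable lborel (\<lambda>x::real^'n. K * (2 powr (2 * real CARD('n)) * (1 + norm x) powr ?N))"
      by (intro integrable_mult_right wt_integrable)
    show "AE x in lborel. (\<lambda>m. ?q m x) \<longlonglongrightarrow> w' x"
    proof (rule AE_I2)
      fix x
      have "((\<lambda>t. w (x + t *\<^sub>R axis j 1)) has_vector_derivative w' x) (at 0)" using d by (simp add: dirder_def)
      then have l: "((\<lambda>h. norm (w (x + (0 + h) *\<^sub>R axis j 1) - w (x + 0 *\<^sub>R axis j 1) - h *\<^sub>R w' x) / norm h) \<longlongrightarrow> 0) (at 0)"
        unfolding has_vector_derivative_def has_derivative_at by blast
      have "filterlim ?h (at 0) sequentially"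
        by (rule filterlim_atI[OF eps_seq]) auto
      from filterlim_compose[OF l this]
      have "(\<lambda>m. norm (w (x + (0 + ?h m) *\<^sub>R axis j 1) - w (x + 0 *\<^sub>R axis j 1) - ?h m *\<^sub>R w' x) / norm (?h m)) \<longlonglongrightarrow> 0" .
      moreover have "norm (w (x + (0 + ?h m) *\<^sub>R axis j 1) - w (x + 0 *\<^sub>R axis j 1) - ?h m *\<^sub>R w' x) / norm (?h m) = norm (?q m x - w' x)" for m
      proof -
        have "?q m x - w' x = (1 / ?h m) *\<^sub>R (w (x + (0 + ?h m) *\<^sub>R axis j 1) - w (x + 0 *\<^sub>R axis j 1) - ?h m *\<^sub>R w' x)"
          by (simp add: scaleR_diff_right)
        then show ?thesis by (simp only: norm_scaleR) simp
      qed
      ultimately have "(\<lambda>m. norm (?q m x - w' x)) \<longlonglongrightarrow> 0" by (simp only:)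
      then show "(\<lambda>m. ?q m x) \<longlonglongrightarrow> w' x" by (rule LIM_zero_cancel[OF tendsto_norm_zero_cancel])
    qed
    show "AE x in lborel. norm (?q m x) \<le> K * (2 powr (2 * real CARD('n)) * (1 + norm x) powr ?N)" for m
    proof (rule AE_I2)
      fix x :: "real^'n"
      have h: "0 < ?h m" "?h m \<le> 1" by auto
      have "norm (w (x + ?h m *\<^sub>R axis j 1) - w x) \<le> (K * (2 powr (2 * real CARD('n)) * (1 + norm x) powr ?N)) * ?h m"
      proof (rule dirder_mvt[OF d])
        fix t assume t: "t \<in> {0..?h m}"
        have "norm x \<le> norm (x + t *\<^sub>R axis j 1) + norm (t *\<^sub>R axis j (1::real) :: real^'n)"
          using norm_triangle_ineq4[of "x + t *\<^sub>R axis j 1" "t *\<^sub>R axis j 1"] by simp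
        moreover have "norm (t *\<^sub>R axis j (1::real) :: real^'n) \<le> 1"
          using t order_trans[OF _ h(2), of t] by (simp add: norm_axis_1)
        ultimately have le: "norm x \<le> norm (x + t *\<^sub>R axis j 1) + 1" by (rule order_trans[OF _ add_left_mono])
        \<comment> \<open>A shift by at most one changes \<open>1 + norm x\<close> at most by the
          factor two; this accounts for the power of two in the majorant.\<close>
        have "1 + norm x \<le> 2 * (1 + norm y)" if "norm x \<le> norm y + 1" for y :: "real^'n"
          using that norm_ge_zero[of y] by argo
        from this[OF le] have "1 + norm x \<le> 2 * (1 + norm (x + t *\<^sub>R axis j 1))" .
        then have "(2 * (1 + norm (x + t *\<^sub>R axis j 1))) powr ?N \<le> (1 + norm x) powr ?N"
          by (intro powr_mono2') (auto simp: add_pos_nonneg)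
        then have "2 powr ?N * (1 + norm (x + t *\<^sub>R axis j 1)) powr ?N \<le> (1 + norm x) powr ?N"
          by (subst (asm) powr_mult) auto
        then have "2 powr (2 * real CARD('n)) * (2 powr ?N * (1 + norm (x + t *\<^sub>R axis j 1)) powr ?N) \<le> 2 powr (2 * real CARD('n)) * (1 + norm x) powr ?N"
          by (rule mult_left_mono) simp
        then have "(1 + norm (x + t *\<^sub>R axis j 1)) powr ?N \<le> 2 powr (2 * real CARD('n)) * (1 + norm x) powr ?N"
          unfolding mult.assoc[symmetric] powr_add[symmetric] by simp
        then show "norm (w' (x + t *\<^sub>R axis j 1)) \<le> K * (2 powr (2 * real CARD('n)) * (1 + norm x) powr ?N)"
          using deriv_bound_bound[OF w', of "x + t *\<^sub>R axis j 1"] K by (meson mult_left_mono order_trans)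
      qed (use h in auto)
      then show "norm (?q m x) \<le> K * (2 powr (2 * real CARD('n)) * (1 + norm x) powr ?N)"
        using h by (simp add: divide_simps mult_ac)
    qed
  qed
  then show ?thesis unfolding q0 by (simp add: LIMSEQ_const_iff)
qed

section \<open>Weighted bounds for characters and Gaussians\<close>

lemma cis_minus_one: "cmod (cis t - 1) \<le> \<bar>t\<bar>"
  using iexp_approx1[of t 0] by (simp add: cis_conv_exp)

lemma dirder_chi: "dirder j (chi a) (\<lambda>x. (2 * pi * \<i> * (a $ j)) * chi a x)"
  unfolding dirder_def
proof
  fix x :: "real^'a"
  have e: "chi a (x + t *\<^sub>R axis j 1) = chi a x * cis (t * (2 * pi * a $ j))" for t
    by (simp add: chi_add_right chi_def[of a "t *\<^sub>R axis j 1"] inner_axis mult_ac)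
  have "((\<lambda>z. chi a x * exp (\<i> * (z * complex_of_real (2 * pi * a $ j)))) has_field_derivative (2 * pi * \<i> * (a $ j)) * chi a x) (at (of_real 0))"
    by (auto intro!: derivative_eq_intros simp: mult_ac)
  from has_vector_derivative_real_field[OF this]
  have "((\<lambda>t. chi a x * exp (\<i> * complex_of_real (t * (2 * pi * a $ j)))) has_vector_derivative (2 * pi * \<i> * (a $ j)) * chi a x) (at 0)"
    by simp
  then show "((\<lambda>t. chi a (x + t *\<^sub>R axis j 1)) has_vector_derivative (2 * pi * \<i> * (a $ j)) * chi a x) (at 0)"
    unfolding e cis_conv_exp .
qed

lemma norm_coord_factor: "norm (2 * pi * \<i> * complex_of_real (a $ j)) \<le> 2 * pi * norm a"
  using component_le_norm_cart[of a j] by (simp add: norm_mult)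

lemma deriv_bound_chi: "deriv_bound m j 0 ((1 + 2 * pi * norm a) ^ m) (chi a)"
proof (induction m)
  case 0
  show ?case by (auto intro!: continuous_intros)
next
  case (Suc m)
  have "deriv_bound m j 0 ((1 + 2 * pi * norm a) ^ Suc m) (\<lambda>x. (2 * pi * \<i> * (a $ j)) * chi a x)"
    by (rule deriv_bound_mono[OF deriv_bound_cmult[OF Suc]]) (use norm_coord_factor[of a j] in \<open>auto intro!: mult_right_mono\<close>)
  moreover have "(1::real) \<le> (1 + 2 * pi * norm a) ^ Suc m" by (rule one_le_power) simp
  moreover have "continuous_on UNIV (chi a)" by (intro continuous_intros)
  ultimately show ?case using dirder_chi[of j a] unfolding deriv_bound.simps by auto
qed

text \<open>Linear in \<open>norm (a - b)\<close> at the price of one power of growth in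
  \<open>x\<close>, and polynomial in \<open>norm a\<close> and \<open>norm b\<close>. This is what
  makes \<open>f\<close> applied to characters continuous in the frequency parameter.\<close>

lemma deriv_bound_chi_diff:
  "deriv_bound m j 1 ((1 + 2 * pi * (norm a + norm b)) ^ m * ((real m + 1) * (2 * pi * norm (a - b)))) (\<lambda>x. chi a x - chi b x)"
proof (induction m)
  case 0
  have "norm (chi a x - chi b x) \<le> 2 * pi * norm (a - b) * (1 + norm x)" for x
  proof -
    have "chi a x = chi b x * chi (a - b) x" by (simp flip: chi_add)
    then have "norm (chi a x - chi b x) = norm (chi b x * (chi (a - b) x - 1))" by (simp add: algebra_simps)
    also have "\<dots> \<le> \<bar>2 * pi * ((a - b) \<bullet> x)\<bar>" unfolding norm_mult norm_chi unfolding chi_def using cis_minus_one by simp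
    also have "\<dots> \<le> 2 * pi * (norm (a - b) * norm x)"
      using Cauchy_Schwarz_ineq2[of "a - b" x] by (simp add: abs_mult)
    also have "\<dots> \<le> 2 * pi * norm (a - b) * (1 + norm x)" by (simp add: algebra_simps)
    finally show ?thesis .
  qed
  then show ?case by (auto intro!: continuous_intros)
next
  case (Suc m)
  let ?R = "1 + 2 * pi * (norm a + norm b)" and ?d = "2 * pi * norm (a - b)"
  let ?c = "\<lambda>a. 2 * pi * \<i> * complex_of_real (a $ j)"
  have R: "1 \<le> ?R" by simp
  have ca: "norm (?c a) \<le> ?R" using norm_coord_factor[of a j] by (simp add: distrib_left add_increasing2 add_increasing)
  have cd: "norm (?c a - ?c b) \<le> ?d" using norm_coord_factor[of "a - b" j] by (simp add: algebra_simps)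
  \<comment> \<open>The difference of the two derivatives is regrouped so that each summand contains
    a small difference; the second summand raises the factor \<open>real m + 1\<close> by
    one.\<close>
  have d: "dirder j (\<lambda>x. chi a x - chi b x) (\<lambda>x. ?c a * (chi a x - chi b x) + (?c a - ?c b) * chi b x)"
    using dirder_diff[OF dirder_chi[of j a] dirder_chi[of j b]] by (simp add: algebra_simps)
  have 2: "deriv_bound m j 1 (norm (?c a - ?c b) * (1 + 2 * pi * norm b) ^ m) (\<lambda>x. (?c a - ?c b) * chi b x)"
    by (rule deriv_bound_mono[OF deriv_bound_cmult[OF deriv_bound_chi]]) auto
  note deriv_bound_add[OF deriv_bound_cmult[OF Suc, of "?c a"] 2]
  then have DBd: "deriv_bound m j 1 (?R ^ Suc m * ((real (Suc m) + 1) * ?d)) (\<lambda>x. ?c a * (chi a x - chi b x) + (?c a - ?c b) * chi b x)"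
  proof (rule deriv_bound_mono)
    have "norm (?c a) * (?R ^ m * ((real m + 1) * ?d)) \<le> ?R * (?R ^ m * ((real m + 1) * ?d))"
      by (rule mult_right_mono[OF ca]) (auto intro!: mult_nonneg_nonneg zero_le_power)
    moreover have "norm (?c a - ?c b) * (1 + 2 * pi * norm b) ^ m \<le> ?d * ?R ^ Suc m"
    proof (rule mult_mono[OF cd])
      have "(1 + 2 * pi * norm b) ^ m \<le> ?R ^ m" by (rule power_mono) auto
      also have "\<dots> \<le> ?R ^ Suc m" using R by (intro power_increasing) auto
      finally show "(1 + 2 * pi * norm b) ^ m \<le> ?R ^ Suc m" .
    qed auto
    ultimately have "norm (?c a) * (?R ^ m * ((real m + 1) * ?d)) + norm (?c a - ?c b) * (1 + 2 * pi * norm b) ^ m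
       \<le> ?R * (?R ^ m * ((real m + 1) * ?d)) + ?d * ?R ^ Suc m" by (rule add_mono)
    also have "\<dots> = ?R ^ Suc m * ((real (Suc m) + 1) * ?d)" by (simp add: algebra_simps)
    finally show "norm (?c a) * (?R ^ m * ((real m + 1) * ?d)) + norm (?c a - ?c b) * (1 + 2 * pi * norm b) ^ m
       \<le> ?R ^ Suc m * ((real (Suc m) + 1) * ?d)" .
  qed auto
  show ?case
  proof -
    have "norm (chi a x - chi b x) \<le> ?R ^ Suc m * ((real (Suc m) + 1) * ?d) * (1 + norm x) powr 1" for x
    proof (rule order_trans[OF deriv_bound_bound[OF Suc]])
      have "?R ^ m * ((real m + 1) * ?d) \<le> ?R ^ Suc m * ((real (Suc m) + 1) * ?d)"
        by (intro mult_mono power_increasing) (use R in auto)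
      then show "?R ^ m * ((real m + 1) * ?d) * (1 + norm x) powr 1 \<le> ?R ^ Suc m * ((real (Suc m) + 1) * ?d) * (1 + norm x) powr 1"
        by (rule mult_right_mono) simp
    qed
    then show ?thesis using d DBd Suc[THEN deriv_bound_cont] unfolding deriv_bound.simps by blast
  qed
qed

lemma dirder_gaussian:
  "dirder j (gaussian B) (\<lambda>x. (- 2 * pi) * complex_of_real ((transpose B *v (B *v axis j 1)) \<bullet> x) * gaussian B x)"
  unfolding dirder_def
proof
  fix x :: "real^'a"
  let ?b = "B *v axis j 1"
  have n: "(norm (B *v (x + t *\<^sub>R axis j 1)))\<^sup>2 = (norm (B *v x))\<^sup>2 + t * (2 * (?b \<bullet> (B *v x))) + t\<^sup>2 * (norm ?b)\<^sup>2" for t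
    unfolding matrix_vector_right_distrib matrix_vector_mult_scaleR power2_norm_eq_inner
    by (simp add: inner_add_left inner_add_right inner_commute power2_eq_square algebra_simps)
  have i: "(transpose B *v ?b) \<bullet> x = ?b \<bullet> (B *v x)"
    by (simp add: dot_lmul_matrix)
  have "((\<lambda>t. exp (- pi * ((norm (B *v x))\<^sup>2 + t * (2 * (?b \<bullet> (B *v x))) + t\<^sup>2 * (norm ?b)\<^sup>2))) has_real_derivative
     exp (- pi * (norm (B *v x))\<^sup>2) * (- pi * (2 * (?b \<bullet> (B *v x))))) (at 0)"
    by (auto intro!: derivative_eq_intros)
  then have "((\<lambda>t. exp (- pi * (norm (B *v (x + t *\<^sub>R axis j 1)))\<^sup>2)) has_real_derivative
     exp (- pi * (norm (B *v x))\<^sup>2) * (- pi * (2 * (?b \<bullet> (B *v x))))) (at 0)"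
    unfolding n .
  from has_vector_derivative_of_real[OF this]
  show "((\<lambda>t. gaussian B (x + t *\<^sub>R axis j 1)) has_vector_derivative (- 2 * pi) * complex_of_real ((transpose B *v (B *v axis j 1)) \<bullet> x) * gaussian B x) (at 0)"
    unfolding gaussian_def i by (simp add: mult_ac)
qed

text \<open>The squared norm of \<open>?a\<close> is the inner product of
  \<open>B *v axis j 1\<close> with \<open>B *v ?a\<close>, which is at most
  \<open>\<tau>^2 * norm ?a\<close>; so no bound for the transpose is needed beforehand.\<close>

lemma norm_BtB:
  fixes B :: "real^'n^'n"
  assumes "\<And>x. norm (B *v x) \<le> \<tau> * norm x"
  shows "norm (transpose B *v (B *v axis j 1)) \<le> \<tau>\<^sup>2"
proof -
  let ?a = "transpose B *v (B *v axis j 1)"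
  have t: "0 \<le> \<tau>" using order_trans[OF norm_ge_zero assms[of "axis j 1"]] by (simp add: norm_axis_1)
  have "(norm ?a)\<^sup>2 = (B *v axis j 1) \<bullet> (B *v ?a)"
    by (simp add: power2_norm_eq_inner dot_lmul_matrix inner_commute)
  also have "\<dots> \<le> norm (B *v axis j 1) * norm (B *v ?a)" by (rule norm_cauchy_schwarz)
  also have "\<dots> \<le> (\<tau> * 1) * (\<tau> * norm ?a)"
    using assms[of "axis j 1"] assms[of ?a] t by (intro mult_mono) (auto simp: norm_axis_1)
  finally have "norm ?a * norm ?a \<le> \<tau>\<^sup>2 * norm ?a" by (simp add: power2_eq_square)
  then show ?thesis by (cases "?a = 0") (use t in auto)
qed

text \<open>The recursion follows Leibniz' rule for the product of a linear factor with the
  Gaussian. The constants do not involve \<open>B\<close>, as they are applied to a sequence of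
  matrices tending to zero.\<close>

primrec gaussian_const :: "nat \<Rightarrow> real" where
  "gaussian_const 0 = 1" | "gaussian_const (Suc m) = 1 + 2 ^ m * (2 * pi * gaussian_const m)"

lemma gaussian_const_ge1: "1 \<le> gaussian_const m" by (induction m) auto

lemma deriv_bound_gaussian_lin:
  fixes B :: "real^'n^'n"
  assumes "\<And>x. norm (B *v x) \<le> \<tau> * norm x"
  shows "deriv_bound m j 1 (2 * pi * \<tau>\<^sup>2) (\<lambda>x. (- 2 * pi) * complex_of_real ((transpose B *v (B *v axis j 1)) \<bullet> x))"
  by (rule deriv_bound_mono[OF deriv_bound_linear]) (use norm_BtB[OF assms] in \<open>auto simp: norm_mult\<close>)

lemma deriv_bound_gaussian:
  fixes B :: "real^'n^'n"
  assumes B: "\<And>x. norm (B *v x) \<le> \<tau> * norm x" and t: "0 \<le> \<tau>" "\<tau> \<le> 1"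
  shows "deriv_bound m j (real m) (gaussian_const m) (gaussian B)"
proof (induction m)
  case 0
  show ?case using norm_gaussian_le by (auto intro!: continuous_intros)
next
  case (Suc m)
  have t2: "\<tau>\<^sup>2 \<le> 1" using t by (simp add: power_le_one)
  have d: "deriv_bound m j (real (Suc m)) (gaussian_const (Suc m)) (\<lambda>x. (- 2 * pi) * complex_of_real ((transpose B *v (B *v axis j 1)) \<bullet> x) * gaussian B x)"
  proof (rule deriv_bound_mono[OF deriv_bound_mult[OF deriv_bound_gaussian_lin[OF B] Suc]])
    have "2 * pi * \<tau>\<^sup>2 * gaussian_const m \<le> 2 * pi * 1 * gaussian_const m"
      using t2 gaussian_const_ge1[of m] by (intro mult_right_mono mult_left_mono) auto
    then have "2 ^ m * (2 * pi * \<tau>\<^sup>2 * gaussian_const m) \<le> 2 ^ m * (2 * pi * 1 * gaussian_const m)" by (rule mult_left_mono) simp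
    then show "2 ^ m * (2 * pi * \<tau>\<^sup>2 * gaussian_const m) \<le> gaussian_const (Suc m)"
      unfolding gaussian_const.simps mult_1_right by linarith
  qed auto
  have "norm (gaussian B x) \<le> gaussian_const (Suc m) * (1 + norm x) powr real (Suc m)" for x
  proof -
    have "1 * 1 \<le> gaussian_const (Suc m) * (1 + norm x) powr real (Suc m)"
      using order_trans[OF zero_le_one gaussian_const_ge1, of "Suc m"]
      by (intro mult_mono gaussian_const_ge1 ge_one_powr_ge_zero) (auto simp del: gaussian_const.simps)
    then show ?thesis using norm_gaussian_le[of B x] by linarith
  qed
  moreover have "continuous_on UNIV (gaussian B)" by (intro continuous_intros)
  ultimately show ?case using d dirder_gaussian[of j B] unfolding deriv_bound.simps by blast
qed

text \<open>The factor \<open>\<tau>^2\<close> measures how fast the Gaussians tend to one when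
  \<open>B\<close> tends to zero. For the function itself it comes from
  \<open>1 - exp (- s) \<le> s\<close>, for its derivatives from the linear factor that the first
  differentiation produces.\<close>

lemma deriv_bound_one_minus_gaussian:
  fixes B :: "real^'n^'n"
  assumes B: "\<And>x. norm (B *v x) \<le> \<tau> * norm x" and t: "0 \<le> \<tau>" "\<tau> \<le> 1"
  shows "deriv_bound m j (real m + 2) ((pi + gaussian_const (Suc m)) * \<tau>\<^sup>2) (\<lambda>x. 1 - gaussian B x)"
proof -
  have bd: "norm (1 - gaussian B x) \<le> (pi + gaussian_const m) * \<tau>\<^sup>2 * (1 + norm x) powr M" if "2 \<le> M" for x M m
  proof -
    have "norm (1 - gaussian B x) = 1 - exp (- pi * (norm (B *v x))\<^sup>2)"
    proof -
      have "1 - gaussian B x = complex_of_real (1 - exp (- pi * (norm (B *v x))\<^sup>2))" by (simp add: gaussian_def)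
      then have "norm (1 - gaussian B x) = \<bar>1 - exp (- pi * (norm (B *v x))\<^sup>2)\<bar>" by (simp only: norm_of_real)
      then show ?thesis by simp
    qed
    also have "\<dots> \<le> pi * (norm (B *v x))\<^sup>2"
      using exp_ge_add_one_self[of "- pi * (norm (B *v x))\<^sup>2"] by simp
    also have "\<dots> \<le> pi * (\<tau> * norm x)\<^sup>2" by (intro mult_left_mono power_mono B) auto
    also have "\<dots> = (pi * \<tau>\<^sup>2) * (norm x)\<^sup>2" by (simp add: power_mult_distrib)
    also have "\<dots> \<le> ((pi + gaussian_const m) * \<tau>\<^sup>2) * (1 + norm x) powr M"
    proof (rule mult_mono)
      have "(norm x)\<^sup>2 \<le> (1 + norm x) powr 2"
        by (subst powr_numeral) (auto intro: power_mono)
      also have "\<dots> \<le> (1 + norm x) powr M" using that by (intro powr_mono) auto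
      finally show "(norm x)\<^sup>2 \<le> (1 + norm x) powr M" .
      show "pi * \<tau>\<^sup>2 \<le> (pi + gaussian_const m) * \<tau>\<^sup>2" using gaussian_const_ge1[of m] by (intro mult_right_mono) auto
      show "0 \<le> (pi + gaussian_const m) * \<tau>\<^sup>2" using gaussian_const_ge1[of m] by auto
    qed auto
    finally show ?thesis .
  qed
  have c: "continuous_on UNIV (\<lambda>x. 1 - gaussian B x)" by (intro continuous_intros)
  show ?thesis
  proof (cases m)
    case 0
    show ?thesis using bd[of 2 _ "Suc 0"] c unfolding 0 by simp
  next
    case (Suc k)
    have d: "dirder j (\<lambda>x. 1 - gaussian B x) (\<lambda>x. (-1) * ((- 2 * pi) * complex_of_real ((transpose B *v (B *v axis j 1)) \<bullet> x) * gaussian B x))"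
      using dirder_diff[OF dirder_const[of j 1] dirder_gaussian[of j B]] by simp
    have "deriv_bound k j (real m + 2) ((pi + gaussian_const (Suc m)) * \<tau>\<^sup>2) (\<lambda>x. (-1) * ((- 2 * pi) * complex_of_real ((transpose B *v (B *v axis j 1)) \<bullet> x) * gaussian B x))"
    proof (rule deriv_bound_mono[OF deriv_bound_cmult[OF deriv_bound_mult[OF deriv_bound_gaussian_lin[OF B] deriv_bound_gaussian[OF B t]]]])
      have G: "2 ^ k * (2 * pi * gaussian_const k) \<le> gaussian_const m" unfolding Suc by simp
      have "1 * gaussian_const m \<le> 2 ^ m * (2 * pi * gaussian_const m)"
      proof -
        have "1 * 1 \<le> (2 ^ m :: real) * (2 * pi)" by (intro mult_mono) (use pi_gt3 in auto)
        then have "1 * gaussian_const m \<le> 2 ^ m * (2 * pi) * gaussian_const m" using gaussian_const_ge1[of m] by (intro mult_right_mono) auto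
        then show ?thesis by (simp add: mult.assoc)
      qed
      then have "gaussian_const m \<le> gaussian_const (Suc m)" by simp
      with G have "2 ^ k * (2 * pi * gaussian_const k) \<le> pi + gaussian_const (Suc m)" using pi_gt3 by linarith
      then have "2 ^ k * (2 * pi * gaussian_const k) * \<tau>\<^sup>2 \<le> (pi + gaussian_const (Suc m)) * \<tau>\<^sup>2" by (rule mult_right_mono) simp
      then show "norm (- 1 :: complex) * (2 ^ k * (2 * pi * \<tau>\<^sup>2 * gaussian_const k)) \<le> (pi + gaussian_const (Suc m)) * \<tau>\<^sup>2"
        by (simp add: mult_ac)
    qed (use Suc in auto)
    then show ?thesis using d c bd[of "real m + 2" _ "Suc m"] unfolding Suc deriv_bound.simps by auto
  qed
qed

text \<open>With \<open>y = a * (1 + r^2)\<close>, the inequality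
  \<open>(y / k) ^ k \<le> exp y\<close> bounds a power of \<open>1 + r\<close> by a multiple of
  \<open>exp (a * r^2)\<close>; \<open>k\<close> is chosen so that this power is at least
  \<open>- M\<close>.\<close>

lemma gauss_decay:
  fixes a :: real
  assumes "a > 0"
  shows "\<exists>K. \<forall>r\<ge>0. exp (- a * r\<^sup>2) \<le> K * (1 + r) powr M"
proof -
  obtain k :: nat where k: "1 \<le> k" "- M \<le> 2 * real k"
  proof -
    obtain k0 :: nat where "- M \<le> real k0" using real_arch_simple by blast
    then show ?thesis using that[of "Suc k0"] by simp
  qed
  have "exp (- a * r\<^sup>2) \<le> (exp a * (2 * k / a) ^ k) * (1 + r) powr M" if r: "0 \<le> r" for r
  proof -
    let ?y = "a * (1 + r\<^sup>2)"
    have y: "0 < ?y" using assms by (simp add: add_pos_nonneg)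
    have "(?y / k) ^ k \<le> (1 + ?y / k) ^ k" using y by (intro power_mono) auto
    also have "\<dots> \<le> exp ?y" using k y by (intro exp_ge_one_plus_x_over_n_power_n) auto
    finally have 1: "(?y / k) ^ k \<le> exp ?y" .
    have sq: "(1 + r)\<^sup>2 \<le> 2 * (1 + r\<^sup>2)" using sum_squares_bound[of 1 r] by (simp add: power2_sum)
    have "(1 + r) powr (- M) \<le> (1 + r) powr (2 * real k)" using r k by (intro powr_mono) auto
    also have "\<dots> = ((1 + r)\<^sup>2) ^ k" using r powr_realpow[of "1 + r" "2 * k"] by (simp add: power_mult)
    also have "\<dots> \<le> (2 * (1 + r\<^sup>2)) ^ k" using sq by (intro power_mono) auto
    also have "2 * (1 + r\<^sup>2) = (2 * k / a) * (?y / k)" using assms k by (simp add: field_simps)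
    also have "((2 * k / a) * (?y / k)) ^ k = (2 * k / a) ^ k * (?y / k) ^ k" by (rule power_mult_distrib)
    also have "\<dots> \<le> (2 * k / a) ^ k * exp ?y" using 1 assms by (intro mult_left_mono) auto
    finally have "(1 + r) powr (- M) * exp (- a * r\<^sup>2) \<le> (2 * k / a) ^ k * exp ?y * exp (- a * r\<^sup>2)"
      by (rule mult_right_mono) simp
    also have "(2 * k / a) ^ k * exp ?y * exp (- a * r\<^sup>2) = exp a * (2 * k / a) ^ k"
      by (simp add: exp_add[symmetric] algebra_simps)
    finally have "(1 + r) powr (- M) * exp (- a * r\<^sup>2) * (1 + r) powr M \<le> (exp a * (2 * k / a) ^ k) * (1 + r) powr M"
      by (rule mult_right_mono) simp
    moreover have "(1 + r) powr (- M) * exp (- a * r\<^sup>2) * (1 + r) powr M = exp (- a * r\<^sup>2)"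
    proof -
      have "(1 + r) powr (- M) * (1 + r) powr M = 1" using r by (simp add: powr_add[symmetric])
      moreover have "(1 + r) powr (- M) * exp (- a * r\<^sup>2) * (1 + r) powr M = exp (- a * r\<^sup>2) * ((1 + r) powr (- M) * (1 + r) powr M)"
        by (simp only: mult_ac)
      ultimately show ?thesis by (simp only: mult_1_right)
    qed
    ultimately show ?thesis by (simp only:)
  qed
  then show ?thesis by blast
qed

text \<open>The inverse matrix bounds \<open>norm (B *v x)\<close> from below by a multiple of
  \<open>norm x\<close>, hence the Gaussian decays. Each derivative multiplies it by a linear
  factor, which one further power of decay absorbs.\<close>

lemma rapid_gaussian:
  fixes B C :: "real^'n^'n"
  assumes CB: "C ** B = mat 1"
  shows "rapid (gaussian B)"
proof -
  obtain \<tau> where t: "\<And>x. norm (B *v x) \<le> \<tau> * norm x"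
    using linear_bounded[OF matrix_vector_mul_linear[of B]] by blast
  obtain s where s: "s > 0" "\<And>x. norm (C *v x) \<le> s * norm x"
    using linear_bounded_pos[OF matrix_vector_mul_linear[of C]] by blast
  have low: "norm x / s \<le> norm (B *v x)" for x
    using s(2)[of "B *v x"] s(1) by (simp add: matrix_vector_inv[OF CB] divide_le_eq mult.commute)
  have base: "\<exists>K. \<forall>x. norm (gaussian B x) \<le> K * (1 + norm x) powr M" for M
  proof -
    obtain K where K: "\<And>r. 0 \<le> r \<Longrightarrow> exp (- (pi / s\<^sup>2) * r\<^sup>2) \<le> K * (1 + r) powr M"
      using gauss_decay[of "pi / s\<^sup>2" M] s(1) by auto
    have "norm (gaussian B x) \<le> K * (1 + norm x) powr M" for x
    proof -
      have "(norm x / s)\<^sup>2 \<le> (norm (B *v x))\<^sup>2" using low s(1) by (intro power_mono) auto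
      then have "- pi * (norm (B *v x))\<^sup>2 \<le> - (pi / s\<^sup>2) * (norm x)\<^sup>2"
        using mult_left_mono[of "(norm x / s)\<^sup>2" "(norm (B *v x))\<^sup>2" pi] by (simp add: power_divide)
      then have "norm (gaussian B x) \<le> exp (- (pi / s\<^sup>2) * (norm x)\<^sup>2)" by (simp add: gaussian_def)
      also have "\<dots> \<le> K * (1 + norm x) powr M" by (rule K) simp
      finally show ?thesis .
    qed
    then show ?thesis by blast
  qed
  have c: "continuous_on UNIV (gaussian B)" by (intro continuous_intros)
  have "\<exists>K. deriv_bound m j M K (gaussian B)" for m j M
  proof (induction m arbitrary: M)
    case 0
    show ?case using base[of M] c by auto
  next
    case (Suc m)
    obtain K1 where K1: "\<And>x. norm (gaussian B x) \<le> K1 * (1 + norm x) powr M" using base by blast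
    obtain K2 where K2: "deriv_bound m j (M - 1) K2 (gaussian B)" using Suc by blast
    let ?K3 = "2 ^ m * (2 * pi * \<tau>\<^sup>2 * K2)"
    have d: "deriv_bound m j M ?K3 (\<lambda>x. (- 2 * pi) * complex_of_real ((transpose B *v (B *v axis j 1)) \<bullet> x) * gaussian B x)"
      using deriv_bound_mult[OF deriv_bound_gaussian_lin[OF t] K2] by simp
    have "deriv_bound m j M (max K1 ?K3) (\<lambda>x. (- 2 * pi) * complex_of_real ((transpose B *v (B *v axis j 1)) \<bullet> x) * gaussian B x)"
      by (rule deriv_bound_mono[OF d]) auto
    moreover have "norm (gaussian B x) \<le> max K1 ?K3 * (1 + norm x) powr M" for x
      using K1[of x] by (rule order_trans) (auto intro: mult_right_mono)
    ultimately have "deriv_bound (Suc m) j M (max K1 ?K3) (gaussian B)"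
      using c dirder_gaussian[of j B] unfolding deriv_bound.simps by blast
    then show ?case by blast
  qed
  then show ?thesis by (simp add: rapid_def)
qed

section \<open>Schwartz functions and tempered distributions\<close>

abbreviation FT :: "(real^'n \<Rightarrow> complex) \<Rightarrow> real^'n \<Rightarrow> complex" where
  "FT \<equiv> FTs lborel uminus"

text \<open>Integration by parts: the derivative of \<open>v\<close> times a character has integral
  zero, and one of its two terms is the character multiplied by the coordinate factor.\<close>

lemma FT_dirder:
  fixes v :: "real^'n \<Rightarrow> complex"
  assumes v: "deriv_bound (Suc m) j (- 2 * real CARD('n)) K v"
  obtains v' where "deriv_bound m j (- 2 * real CARD('n)) K v'" "\<And>x. FT v' x = (2 * pi * \<i> * (x $ j)) * FT v x"
proof -
  let ?N = "- 2 * real CARD('n)"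
  obtain v' where d: "dirder j v v'" and v': "deriv_bound m j ?N K v'" using v by auto
  have v0: "deriv_bound 0 j ?N K v" "deriv_bound 0 j ?N K v'" using deriv_bound_mono[OF v order_refl order_refl, of 0] deriv_bound_mono[OF v' order_refl order_refl, of 0] by auto
  have K: "0 \<le> K" using deriv_bound_K_nonneg[OF v] .
  have "FT v' x = (2 * pi * \<i> * (x $ j)) * FT v x" for x
  proof -
    let ?c = "2 * pi * \<i> * complex_of_real (x $ j)"
    have c0: "deriv_bound 0 j 0 1 (chi (- x))" using deriv_bound_chi[of 0 j "- x"] by simp
    have w: "deriv_bound 0 j ?N K (\<lambda>y. v y * chi (- x) y)" using deriv_bound_mult[OF v0(1) c0] by simp
    have v'c: "deriv_bound 0 j ?N K (\<lambda>y. v' y * chi (- x) y)" using deriv_bound_mult[OF v0(2) c0] by simp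
    have cw: "deriv_bound 0 j ?N (norm ?c * K) (\<lambda>y. ?c * (v y * chi (- x) y))" by (rule deriv_bound_cmult[OF w])
    have d2: "dirder j (\<lambda>y. v y * chi (- x) y) (\<lambda>y. v' y * chi (- x) y - ?c * (v y * chi (- x) y))"
      using dirder_mult[OF d dirder_chi[of j "- x"]] by (simp add: algebra_simps)
    have L: "deriv_bound 0 j ?N (K + norm ?c * K) (\<lambda>y. v' y * chi (- x) y - ?c * (v y * chi (- x) y))"
      by (rule deriv_bound_diff[OF v'c cw])
    have w2: "deriv_bound 0 j ?N (K + norm ?c * K) (\<lambda>y. v y * chi (- x) y)"
      by (rule deriv_bound_mono[OF w]) (use K in auto)
    have "(LINT y|lborel. v' y * chi (- x) y - ?c * (v y * chi (- x) y)) = 0"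
      by (rule integral_dirder_zero[OF d2 w2 L])
    then have "(LINT y|lborel. v' y * chi (- x) y) = ?c * (LINT y|lborel. v y * chi (- x) y)"
      by (simp only: Bochner_Integration.integral_diff[OF deriv_bound_integrable(1)[OF v'c] deriv_bound_integrable(1)[OF cw]]
          integral_mult_right_zero right_minus_eq)
    then show ?thesis unfolding FTs_def chi_minus .
  qed
  with v' show ?thesis by (rule that)
qed

text \<open>Each power of the coordinate is traded for a derivative of \<open>v\<close>. The factor
  \<open>2 * pi\<close> gained at every step exceeds one and is dropped.\<close>

lemma FT_coord_bound:
  fixes v :: "real^'n \<Rightarrow> complex"
  assumes v: "deriv_bound m j (- 2 * real CARD('n)) K v"
  shows "\<bar>x $ j\<bar> ^ m * norm (FT v x) \<le> K * weight_integral TYPE('n)"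
  using v
proof (induction m arbitrary: v)
  case 0
  then show ?case
    using order_trans[OF FTs_bound[OF deriv_bound_integrable(1)[OF 0], of uminus] deriv_bound_integrable(2)[OF 0]] by simp
next
  case (Suc m)
  obtain v' where v': "deriv_bound m j (- 2 * real CARD('n)) K v'" "\<And>x. FT v' x = (2 * pi * \<i> * (x $ j)) * FT v x"
    using FT_dirder[OF Suc.prems] by blast
  have "\<bar>x $ j\<bar> ^ Suc m * norm (FT v x) \<le> \<bar>x $ j\<bar> ^ m * (2 * pi * \<bar>x $ j\<bar> * norm (FT v x))"
  proof -
    have "1 * (\<bar>x $ j\<bar> ^ Suc m * norm (FT v x)) \<le> 2 * pi * (\<bar>x $ j\<bar> ^ Suc m * norm (FT v x))"
      using pi_gt3 by (intro mult_right_mono) auto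
    then show ?thesis by (simp add: mult_ac)
  qed
  also have "\<dots> = \<bar>x $ j\<bar> ^ m * norm (FT v' x)" by (simp add: v'(2) norm_mult)
  also have "\<dots> \<le> K * weight_integral TYPE('n)" by (rule Suc.IH[OF v'(1)])
  finally show ?case .
qed

text \<open>The factor that differentiating \<open>FT v\<close> along \<open>is\<close> produces
  under the integral; the sign comes from pairing with \<open>- y\<close>.\<close>

definition coordprod :: "'n list \<Rightarrow> real^'n \<Rightarrow> complex" where
  "coordprod is y = prod_list (map (\<lambda>j. 2 * pi * \<i> * ((- y) $ j)) is)"

lemma deriv_bound_coordprod: "\<exists>L. \<forall>j. deriv_bound m j (real (length is)) L (coordprod is)"
proof (induction "is")
  case Nil
  show ?case using deriv_bound_const[of m _ 1] by (auto simp: coordprod_def)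
next
  case (Cons i "is")
  then obtain L where L: "\<And>j. deriv_bound m j (real (length is)) L (coordprod is)" by blast
  have "coordprod (i # is) = (\<lambda>y. (- (2 * pi * \<i>)) * complex_of_real (axis i 1 \<bullet> y) * coordprod is y)"
    by (auto simp: coordprod_def inner_commute[of "axis i 1"] inner_axis)
  then have "deriv_bound m j (1 + real (length is)) (2 ^ m * (norm (- (2 * pi * \<i>)) * norm (axis i (1::real)) * L)) (coordprod (i # is))" for j
    using deriv_bound_mult[OF deriv_bound_linear[of m j "- (2 * pi * \<i>)" "axis i 1"] L[of j]] by simp
  then show ?case by (auto simp: add.commute)
qed

lemma iter_partial_FT:
  assumes "rapid v"
  shows "iter_partial is (FT v) = FT (\<lambda>y. v y * coordprod is y)"
  using FTs_iter_partial[OF rapid_all_moments[OF assms, of uminus], of "is"] by (simp add: coordprod_def)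

text \<open>\<open>j\<close> is a coordinate of maximal absolute value. It depends on
  \<open>x\<close>, but dominates every monomial by a pure power; therefore pure derivatives of
  \<open>v\<close>, bounded uniformly over the directions, control the Schwartz seminorms of
  \<open>FT v\<close>.\<close>

lemma mi_power_le:
  fixes x :: "real^'n"
  obtains j where "\<And>\<beta>. \<bar>mi_power x \<beta>\<bar> \<le> \<bar>x $ j\<bar> ^ mi_abs \<beta>"
proof -
  have "\<exists>j. \<forall>i. \<bar>x $ i\<bar> \<le> \<bar>x $ j\<bar>"
  proof -
    have "Max (range (\<lambda>i. \<bar>x $ i\<bar>)) \<in> range (\<lambda>i. \<bar>x $ i\<bar>)" by (rule Max_in) auto
    then obtain j where jm: "Max (range (\<lambda>i. \<bar>x $ i\<bar>)) = \<bar>x $ j\<bar>" by (rule rangeE)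
    have "\<bar>x $ i\<bar> \<le> \<bar>x $ j\<bar>" for i unfolding jm[symmetric] by (rule Max_ge) auto
    then show ?thesis by blast
  qed
  then obtain j where j: "\<And>i. \<bar>x $ i\<bar> \<le> \<bar>x $ j\<bar>" by blast
  have "\<bar>mi_power x \<beta>\<bar> \<le> \<bar>x $ j\<bar> ^ mi_abs \<beta>" for \<beta>
  proof -
    have "\<bar>mi_power x \<beta>\<bar> = (\<Prod>i\<in>UNIV. \<bar>x $ i\<bar> ^ \<beta> i)" by (simp add: mi_power_def abs_prod power_abs)
    also have "\<dots> \<le> (\<Prod>i\<in>UNIV. \<bar>x $ j\<bar> ^ \<beta> i)" using j by (intro prod_mono) (auto intro: power_mono)
    also have "\<dots> = \<bar>x $ j\<bar> ^ mi_abs \<beta>" by (simp add: mi_abs_def power_sum)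
    finally show ?thesis .
  qed
  then show ?thesis by (rule that)
qed

text \<open>\<open>C\<close> and \<open>M\<close> depend on the seminorm only and the bound is
  linear in \<open>K\<close>. It thus turns smallness of weighted derivatives of \<open>v\<close>
  into smallness of \<open>FT v\<close> in the Schwartz topology.\<close>

lemma FT_schwartz_bound:
  fixes \<beta> :: "'n::finite \<Rightarrow> nat"
  assumes m: "mi_abs \<beta> \<le> m"
  shows "\<exists>C M. 0 \<le> C \<and> (\<forall>v K. rapid v \<longrightarrow> (\<forall>j. deriv_bound m j (- M) K v) \<longrightarrow>
    (\<forall>x. norm (mi_power x \<beta> *\<^sub>R iter_partial is (FT v) x) \<le> C * K))"
proof -
  let ?N = "2 * real CARD('n)"
  obtain L where L: "\<And>j. deriv_bound m j (real (length is)) L (coordprod is :: real^'n \<Rightarrow> _)" using deriv_bound_coordprod by blast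
  have L0: "0 \<le> L" using deriv_bound_K_nonneg[OF L] .
  let ?C = "2 ^ m * L * weight_integral TYPE('n)"
  have "norm (mi_power x \<beta> *\<^sub>R iter_partial is (FT v) x) \<le> ?C * K"
    if v: "rapid v" and D: "\<forall>j. deriv_bound m j (- (?N + real (length is))) K v" for v K x
  proof -
    obtain j where j: "\<bar>mi_power x \<beta>\<bar> \<le> \<bar>x $ j\<bar> ^ mi_abs \<beta>" using mi_power_le by blast
    have "deriv_bound m j (- ?N) (2 ^ m * (K * L)) (\<lambda>y. v y * coordprod is y)"
      using deriv_bound_mult[OF D[rule_format, of j] L[of j]] by simp
    then have b: "deriv_bound (mi_abs \<beta>) j (- 2 * real CARD('n)) (2 ^ m * (K * L)) (\<lambda>y. v y * coordprod is y)"
      by (rule deriv_bound_mono) (use m in auto)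
    have "norm (mi_power x \<beta> *\<^sub>R iter_partial is (FT v) x) \<le> \<bar>x $ j\<bar> ^ mi_abs \<beta> * norm (FT (\<lambda>y. v y * coordprod is y) x)"
      unfolding iter_partial_FT[OF v] norm_scaleR by (rule mult_right_mono[OF j]) simp
    also have "\<dots> \<le> 2 ^ m * (K * L) * weight_integral TYPE('n)" by (rule FT_coord_bound[OF b])
    finally show ?thesis by (simp add: mult_ac)
  qed
  moreover have "0 \<le> ?C" using L0 weight_integral_nonneg by (intro mult_nonneg_nonneg) auto
  ultimately show ?thesis by blast
qed

lemma FT_bounded:
  assumes v: "rapid v"
  shows "\<exists>C. \<forall>x. norm (mi_power x \<beta> *\<^sub>R iter_partial is (FT v) x) \<le> C"
proof -
  obtain C M where CM: "\<forall>v K. rapid v \<longrightarrow> (\<forall>j. deriv_bound (mi_abs \<beta>) j (- M) K v) \<longrightarrow>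
    (\<forall>x. norm (mi_power x \<beta> *\<^sub>R iter_partial is (FT v) x) \<le> C * K)"
    using FT_schwartz_bound[OF order_refl, of \<beta> "is"] by blast
  obtain K where "\<forall>j. deriv_bound (mi_abs \<beta>) j (- M) K v" using rapidD[OF v] by blast
  with CM v show ?thesis by blast
qed

lemma FT_in_schwartz: "rapid v \<Longrightarrow> FT v \<in> schwartz_space"
  unfolding schwartz_space_def mi_deriv_def
  using FT_bounded[of v] FTs_smooth[OF rapid_all_moments[of v uminus]]
  by (auto simp: bounded_iff)

lemma list_count_replicate:
  assumes "\<forall>i. count_list xs i = (if i = j then m else 0)"
  shows "xs = replicate m j"
proof -
  have "x = j" if "x \<in> set xs" for x
    using assms that count_list_0_iff[of xs x] by (metis)
  then have xs: "xs = replicate (length xs) j" by (simp add: replicate_eqI)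
  have "count_list (replicate k j) j = k" for k by (induction k) auto
  with xs assms show ?thesis by metis
qed

text \<open>\<open>mi_deriv\<close> picks some list with the prescribed counts; if a single variable
  occurs, there is only one such list.\<close>

lemma mi_deriv_pure: "mi_deriv (\<lambda>i. if i = j then m else 0) \<phi> = iter_partial (replicate m j) \<phi>"
proof -
  let ?P = "\<lambda>is. \<forall>i. count_list is i = (if i = j then m else 0)"
  have "count_list (replicate k j) i = (if i = j then k else 0)" for k i by (induction k) auto
  then have "?P (replicate m j)" by simp
  then have "?P (SOME is. ?P is)" by (rule someI)
  then have "(SOME is. ?P is) = replicate m j" by (rule list_count_replicate)
  then show ?thesis by (simp only: mi_deriv_def)
qed

lemma one_plus_norm_power_le:
  fixes x :: "real^'n"
  shows "(1 + norm x) ^ k \<le> (1 + real CARD('n)) ^ k * (1 + (\<Sum>i\<in>UNIV. \<bar>x $ i\<bar> ^ k))"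
proof -
  have "Max (range (\<lambda>i. \<bar>x $ i\<bar>)) \<in> range (\<lambda>i. \<bar>x $ i\<bar>)" by (rule Max_in) auto
  then obtain j where jm: "Max (range (\<lambda>i. \<bar>x $ i\<bar>)) = \<bar>x $ j\<bar>" by (rule rangeE)
  have j: "\<bar>x $ i\<bar> \<le> \<bar>x $ j\<bar>" for i unfolding jm[symmetric] by (rule Max_ge) auto
  have "norm x \<le> (\<Sum>i\<in>UNIV. \<bar>x $ i\<bar>)" by (rule norm_le_l1_cart)
  also have "\<dots> \<le> real CARD('n) * \<bar>x $ j\<bar>" using sum_bounded_above[of UNIV "\<lambda>i. \<bar>x $ i\<bar>", OF j] by simp
  finally have n: "norm x \<le> real CARD('n) * \<bar>x $ j\<bar>" .
  let ?t = "max 1 \<bar>x $ j\<bar>"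
  have "1 + norm x \<le> (1 + real CARD('n)) * ?t"
  proof -
    have "norm x \<le> real CARD('n) * ?t"
      using n mult_left_mono[of "\<bar>x $ j\<bar>" ?t "real CARD('n)"] by linarith
    moreover have "1 \<le> ?t" by simp
    ultimately show ?thesis unfolding distrib_right by linarith
  qed
  then have "(1 + norm x) ^ k \<le> ((1 + real CARD('n)) * ?t) ^ k" by (intro power_mono) auto
  also have "\<dots> = (1 + real CARD('n)) ^ k * ?t ^ k" by (rule power_mult_distrib)
  also have "?t ^ k \<le> 1 + (\<Sum>i\<in>UNIV. \<bar>x $ i\<bar> ^ k)"
  proof -
    have s: "\<bar>x $ j\<bar> ^ k \<le> (\<Sum>i\<in>UNIV. \<bar>x $ i\<bar> ^ k)" by (rule member_le_sum) auto
    show ?thesis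
    proof (cases "\<bar>x $ j\<bar> \<le> 1")
      case True
      then show ?thesis by (simp add: max_absorb1 sum_nonneg)
    next
      case False
      then show ?thesis using s by (simp add: max_absorb2)
    qed
  qed
  finally show ?thesis by (simp add: mult_left_mono)
qed

lemma mi_power_pure: "mi_power x (\<lambda>i. if i = j then k else 0) = (x $ j) ^ k"
proof -
  have "mi_power x (\<lambda>i. if i = j then k else 0) = (\<Prod>i\<in>UNIV. if i = j then (x $ i) ^ k else 1)"
    unfolding mi_power_def by (rule prod.cong) auto
  then show ?thesis by simp
qed

text \<open>A power of \<open>1 + norm x\<close> is dominated by one plus the pure
  \<open>k\<close>-th powers of the coordinates, so finitely many monomials suffice.\<close>

lemma weighted_bound:
  fixes u :: "real^'n \<Rightarrow> complex"
  assumes "\<And>\<beta>. \<exists>C. \<forall>x. norm (mi_power x \<beta> *\<^sub>R u x) \<le> C"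
  shows "\<exists>K\<ge>0. \<forall>x. (1 + norm x) ^ k * norm (u x) \<le> K"
proof -
  obtain C0 where C0: "\<And>x. norm (mi_power x (\<lambda>_. 0) *\<^sub>R u x) \<le> C0" using assms by blast
  have "\<forall>i. \<exists>C. \<forall>x. norm (mi_power x (\<lambda>l. if l = i then k else 0) *\<^sub>R u x) \<le> C" using assms by blast
  then obtain C where C: "\<And>i x. norm (mi_power x (\<lambda>l. if l = i then k else 0) *\<^sub>R u x) \<le> C i" by metis
  let ?K = "(1 + real CARD('n)) ^ k * (C0 + (\<Sum>i\<in>UNIV. C i))"
  have b: "(1 + norm x) ^ k * norm (u x) \<le> ?K" for x
  proof -
    have "(1 + norm x) ^ k * norm (u x) \<le> ((1 + real CARD('n)) ^ k * (1 + (\<Sum>i\<in>UNIV. \<bar>x $ i\<bar> ^ k))) * norm (u x)"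
      by (rule mult_right_mono[OF one_plus_norm_power_le]) simp
    also have "\<dots> = (1 + real CARD('n)) ^ k * (norm (u x) + (\<Sum>i\<in>UNIV. \<bar>x $ i\<bar> ^ k * norm (u x)))"
      by (simp add: distrib_right sum_distrib_right mult.assoc)
    also have "\<dots> \<le> ?K"
    proof (intro mult_left_mono add_mono sum_mono)
      show "norm (u x) \<le> C0" using C0[of x] by (simp add: mi_power_def)
      show "\<bar>x $ i\<bar> ^ k * norm (u x) \<le> C i" for i using C[of x i] by (simp add: mi_power_pure power_abs)
    qed auto
    finally show ?thesis .
  qed
  then have "0 \<le> ?K" using b[of 0] order_trans[OF _ b[of 0]] by simp
  with b show ?thesis by blast
qed

text \<open>Among the bounds of the Schwartz space only those on the iterated derivatives in one
  direction are used; for these the list hidden in \<open>mi_deriv\<close> is known.\<close>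

lemma schwartz_rapid:
  fixes \<phi> :: "real^'n \<Rightarrow> complex"
  assumes "\<phi> \<in> schwartz_space"
  shows "rapid \<phi>"
proof -
  have sm: "smooth_fun \<phi>" and bd: "\<And>\<alpha> \<beta>. bounded (range (\<lambda>x. mi_power x \<beta> *\<^sub>R mi_deriv \<alpha> \<phi> x))"
    using assms by (auto simp: schwartz_space_def)
  define D where "D j m = iter_partial (replicate m j) \<phi>" for j m
  have diff: "D j m differentiable (at x)" for j m x using sm by (auto simp: smooth_fun_def D_def)
  have cont: "continuous_on UNIV (D j m)" for j m
    by (intro continuous_at_imp_continuous_on ballI differentiable_imp_continuous_within diff)
  have dd: "dirder j (D j m) (D j (Suc m))" for j m
    unfolding dirder_def
  proof
    fix x
    have "D j (Suc m) x = vector_derivative (\<lambda>t. D j m (x + t *\<^sub>R axis j 1)) (at 0)"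
      by (simp add: D_def iter_partial_def partial_deriv_def)
    moreover have "(\<lambda>t. D j m (x + t *\<^sub>R axis j 1)) differentiable (at 0)"
    proof -
      have "D j m differentiable (at (x + 0 *\<^sub>R axis j 1))" by (rule diff)
      moreover have "(\<lambda>t::real. x + t *\<^sub>R axis j 1) differentiable (at 0)" by simp
      ultimately have "(D j m \<circ> (\<lambda>t::real. x + t *\<^sub>R axis j 1)) differentiable (at 0)"
        by (intro differentiable_chain_at)
      then show ?thesis by (simp add: o_def)
    qed
    ultimately show "((\<lambda>t. D j m (x + t *\<^sub>R axis j 1)) has_vector_derivative D j (Suc m) x) (at 0)"
      by (simp add: vector_derivative_works)
  qed
  have bnd: "\<exists>K. \<forall>x. norm (D j m x) \<le> K * (1 + norm x) powr M" for j m M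
  proof -
    have "\<exists>C. \<forall>x. norm (mi_power x \<beta> *\<^sub>R D j m x) \<le> C" for \<beta>
      using bd[of \<beta> "\<lambda>i. if i = j then m else 0"] unfolding mi_deriv_pure D_def[symmetric] by (auto simp: bounded_iff)
    moreover obtain k :: nat where k: "- M \<le> real k" using real_arch_simple by blast
    ultimately obtain K where K: "0 \<le> K" "\<And>x. (1 + norm x) ^ k * norm (D j m x) \<le> K" using weighted_bound[of "D j m" k] by blast
    have "norm (D j m x) \<le> K * (1 + norm x) powr M" for x
    proof -
      have "(1 + norm x) powr (- M) \<le> (1 + norm x) ^ k"
        using k powr_mono[of "- M" "real k" "1 + norm x"] powr_realpow[of "1 + norm x" k] by simp
      then have "(1 + norm x) powr (- M) * norm (D j m x) \<le> K"
        using K(2)[of x] mult_right_mono[of "(1 + norm x) powr (- M)" "(1 + norm x) ^ k" "norm (D j m x)"] by simp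
      then have "(1 + norm x) powr (- M) * norm (D j m x) * (1 + norm x) powr M \<le> K * (1 + norm x) powr M"
        by (rule mult_right_mono) simp
      moreover have "(1 + norm x) powr (- M) * norm (D j m x) * (1 + norm x) powr M = norm (D j m x) * ((1 + norm x) powr (- M) * (1 + norm x) powr M)"
        by (simp only: mult_ac)
      moreover have "(1 + norm x) powr (- M) * (1 + norm x) powr M = 1" by (simp add: powr_add[symmetric])
      ultimately show ?thesis by (simp only: mult_1_right)
    qed
    then show ?thesis by blast
  qed
  have "\<exists>K. deriv_bound m j M K (D j i)" for m j M i
  proof (induction m arbitrary: i)
    case 0
    show ?case using bnd[of j i M] cont by auto
  next
    case (Suc m)
    obtain K1 where K1: "\<And>x. norm (D j i x) \<le> K1 * (1 + norm x) powr M" using bnd by blast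
    obtain K2 where K2: "deriv_bound m j M K2 (D j (Suc i))" using Suc by blast
    have "norm (D j i x) \<le> max K1 K2 * (1 + norm x) powr M" for x
      using K1[of x] by (rule order_trans) (auto intro: mult_right_mono)
    moreover have "deriv_bound m j M (max K1 K2) (D j (Suc i))" by (rule deriv_bound_mono[OF K2]) auto
    ultimately have "deriv_bound (Suc m) j M (max K1 K2) (D j i)" using dd cont unfolding deriv_bound.simps by blast
    then show ?case by blast
  qed
  from this[of _ _ _ 0] show ?thesis by (simp add: rapid_def D_def iter_partial_def)
qed

lemma fourier_eq_FT:
  fixes \<phi> :: "real^'n \<Rightarrow> complex"
  assumes "\<phi> \<in> borel_measurable borel"
  shows "fourier \<phi> = FT \<phi>"
proof
  fix x :: "real^'n"
  have [measurable]: "\<phi> \<in> borel_measurable borel" by fact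
  have e: "exp (- 2 * of_real pi * \<i> * of_real (x \<bullet> \<xi>)) = chi x (- \<xi>)" for \<xi>
    by (simp add: chi_def cis_conv_exp mult_ac)
  show "fourier \<phi> x = FT \<phi> x"
    unfolding fourier_def FTs_def e by (rule integral_completion) measurable
qed

lemma iter_partial_diff:
  assumes "smooth_fun \<phi>" "smooth_fun \<psi>"
  shows "iter_partial is (\<lambda>x. \<psi> x - \<phi> x) = (\<lambda>x. iter_partial is \<psi> x - iter_partial is \<phi> x)"
proof (induction "is")
  case Nil
  show ?case by (simp add: iter_partial_def)
next
  case (Cons i "is")
  have d: "((\<lambda>t. iter_partial is \<eta> (x + t *\<^sub>R axis i 1)) has_vector_derivative iter_partial (i # is) \<eta> x) (at 0)"
    if "smooth_fun \<eta>" for \<eta> x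
  proof -
    have "iter_partial is \<eta> differentiable (at (x + 0 *\<^sub>R axis i 1))" using that by (simp add: smooth_fun_def)
    then have "(iter_partial is \<eta> \<circ> (\<lambda>t::real. x + t *\<^sub>R axis i 1)) differentiable (at 0)"
      by (intro differentiable_chain_at) auto
    then show ?thesis by (simp add: o_def vector_derivative_works iter_partial_def partial_deriv_def)
  qed
  have "iter_partial (i # is) (\<lambda>x. \<psi> x - \<phi> x) = partial_deriv i (iter_partial is (\<lambda>x. \<psi> x - \<phi> x))"
    by (simp add: iter_partial_def)
  then show ?case
    unfolding Cons partial_deriv_def using vector_derivative_at[OF has_vector_derivative_diff[OF d[OF assms(2)] d[OF assms(1)]]] by auto
qed

section \<open>Seminorms and the continuity of tempered distributions\<close>

lemma schwartz_seminorm_bdd: "\<phi> \<in> schwartz_space \<Longrightarrow> bdd_above (range (\<lambda>x. norm (mi_power x \<beta> *\<^sub>R mi_deriv \<alpha> \<phi> x)))"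
  by (auto simp: schwartz_space_def bounded_iff bdd_above_def)

lemma schwartz_seminorm_le: "\<phi> \<in> schwartz_space \<Longrightarrow> norm (mi_power x \<beta> *\<^sub>R mi_deriv \<alpha> \<phi> x) \<le> schwartz_seminorm \<alpha> \<beta> \<phi>"
  unfolding schwartz_seminorm_def by (rule cSUP_upper[OF _ schwartz_seminorm_bdd]) auto

lemma schwartz_seminorm_leI: "(\<And>x. norm (mi_power x \<beta> *\<^sub>R mi_deriv \<alpha> \<phi> x) \<le> C) \<Longrightarrow> schwartz_seminorm \<alpha> \<beta> \<phi> \<le> C"
  unfolding schwartz_seminorm_def by (rule cSUP_least) auto

lemma schwartz_seminorm_diff:
  assumes "\<phi> \<in> schwartz_space" "\<psi> \<in> schwartz_space"
  shows "schwartz_seminorm \<alpha> \<beta> (\<lambda>x. \<psi> x - \<phi> x) \<le> schwartz_seminorm \<alpha> \<beta> \<psi> + schwartz_seminorm \<alpha> \<beta> \<phi>"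
proof (rule schwartz_seminorm_leI)
  fix x
  have "mi_deriv \<alpha> (\<lambda>x. \<psi> x - \<phi> x) x = mi_deriv \<alpha> \<psi> x - mi_deriv \<alpha> \<phi> x"
    using assms by (simp add: mi_deriv_def iter_partial_diff schwartz_space_def)
  then show "norm (mi_power x \<beta> *\<^sub>R mi_deriv \<alpha> (\<lambda>x. \<psi> x - \<phi> x) x) \<le> schwartz_seminorm \<alpha> \<beta> \<psi> + schwartz_seminorm \<alpha> \<beta> \<phi>"
    using norm_triangle_ineq4[of "mi_power x \<beta> *\<^sub>R mi_deriv \<alpha> \<psi> x" "mi_power x \<beta> *\<^sub>R mi_deriv \<alpha> \<phi> x"]
      schwartz_seminorm_le[OF assms(1), of x \<beta> \<alpha>] schwartz_seminorm_le[OF assms(2), of x \<beta> \<alpha>]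
    by (simp add: scaleR_diff_right)
qed

lemma FT_zero: "FT (\<lambda>x. 0) = (\<lambda>x. 0)" by (simp add: FTs_def fun_eq_iff)

lemma zero_schwartz: "(\<lambda>x. 0) \<in> schwartz_space"
  using FT_in_schwartz[OF rapid_zero] by (simp add: FT_zero)

text \<open>Induction over the generation of the topology. A subbasic set may be centred at a
  nonzero \<open>\<phi>\<close>; if it contains zero, the seminorm of \<open>\<phi>\<close> is below
  \<open>e\<close>, and the triangle inequality leaves the difference as a radius around
  zero.\<close>

lemma schwartz_nbhd:
  fixes U :: "(real^'n \<Rightarrow> complex) set"
  assumes "generate_topology_on {{\<psi> \<in> schwartz_space. schwartz_seminorm \<alpha> \<beta> (\<lambda>x. \<psi> x - \<phi> x) < e} | \<alpha> \<beta> \<phi> e.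
        \<phi> \<in> schwartz_space \<and> 0 < e} U"
    and "(\<lambda>x. 0) \<in> U"
  shows "\<exists>I e. finite I \<and> 0 < e \<and> (\<forall>\<psi>\<in>schwartz_space. (\<forall>(\<alpha>, \<beta>)\<in>I. schwartz_seminorm \<alpha> \<beta> \<psi> < e) \<longrightarrow> \<psi> \<in> U)"
  using assms
proof (induction rule: generate_topology_on.induct)
  case Empty
  then show ?case by simp
next
  case (Int a b)
  then obtain I e J e' where "finite I" "0 < e" "\<forall>\<psi>\<in>schwartz_space. (\<forall>(\<alpha>, \<beta>)\<in>I. schwartz_seminorm \<alpha> \<beta> \<psi> < e) \<longrightarrow> \<psi> \<in> a"
    "finite J" "0 < e'" "\<forall>\<psi>\<in>schwartz_space. (\<forall>(\<alpha>, \<beta>)\<in>J. schwartz_seminorm \<alpha> \<beta> \<psi> < e') \<longrightarrow> \<psi> \<in> b" by blast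
  then show ?case by (intro exI[of _ "I \<union> J"] exI[of _ "min e e'"]) (auto simp: case_prod_unfold)
next
  case (UN K)
  then show ?case by (meson UnionE UnionI)
next
  case (Basis s)
  then obtain \<alpha> \<beta> \<phi> e where s: "s = {\<psi> \<in> schwartz_space. schwartz_seminorm \<alpha> \<beta> (\<lambda>x. \<psi> x - \<phi> x) < e}" "\<phi> \<in> schwartz_space" by blast
  then have "schwartz_seminorm \<alpha> \<beta> (\<lambda>x. 0 - \<phi> x) < e" using Basis by simp
  moreover have "schwartz_seminorm \<alpha> \<beta> (\<lambda>x. 0 - \<phi> x) = schwartz_seminorm \<alpha> \<beta> \<phi>"
  proof -
    have z: "smooth_fun (\<lambda>x::real^'n. 0::complex)" using zero_schwartz unfolding schwartz_space_def by blast
    have "smooth_fun \<phi>" using s by (simp add: schwartz_space_def)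
    then have "mi_deriv \<alpha> (\<lambda>x. 0 - \<phi> x) = (\<lambda>x. mi_deriv \<alpha> (\<lambda>x. 0) x - mi_deriv \<alpha> \<phi> x)"
      unfolding mi_deriv_def by (rule iter_partial_diff[OF _ z])
    moreover have "mi_deriv \<alpha> (\<lambda>x::real^'n. 0) = (\<lambda>x. 0)"
      using iter_partial_FT[OF rapid_zero] by (simp add: mi_deriv_def FT_zero)
    ultimately show ?thesis by (simp add: schwartz_seminorm_def)
  qed
  ultimately have e: "0 < e - schwartz_seminorm \<alpha> \<beta> \<phi>" by simp
  have "\<psi> \<in> s" if "\<psi> \<in> schwartz_space" "schwartz_seminorm \<alpha> \<beta> \<psi> < e - schwartz_seminorm \<alpha> \<beta> \<phi>" for \<psi>
    using schwartz_seminorm_diff[OF s(2) that(1), of \<alpha> \<beta>] that by (simp add: s)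
  with e show ?case by (intro exI[of _ "{(\<alpha>, \<beta>)}"] exI[of _ "e - schwartz_seminorm \<alpha> \<beta> \<phi>"]) auto
qed

lemma FT_seminorm_bound:
  assumes "finite I"
  shows "\<exists>C m M. 0 \<le> C \<and> (\<forall>v K. rapid v \<longrightarrow> (\<forall>j. deriv_bound m j (- M) K v) \<longrightarrow> (\<forall>(\<alpha>, \<beta>)\<in>I. schwartz_seminorm \<alpha> \<beta> (FT v) \<le> C * K))"
  using assms
proof (induction I rule: finite_induct)
  case empty
  then show ?case by auto
next
  case (insert p I)
  obtain \<alpha> \<beta> where p: "p = (\<alpha>, \<beta>)" by force
  obtain C m M where C: "0 \<le> C" and IH: "\<And>v K. rapid v \<Longrightarrow> (\<forall>j. deriv_bound m j (- M) K v) \<Longrightarrow> (\<forall>(\<alpha>, \<beta>)\<in>I. schwartz_seminorm \<alpha> \<beta> (FT v) \<le> C * K)"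
    using insert.IH by blast
  obtain C' M' where C': "0 \<le> C'" and new: "\<And>v K. rapid v \<Longrightarrow> (\<forall>j. deriv_bound (mi_abs \<beta>) j (- M') K v) \<Longrightarrow>
    (\<forall>x. norm (mi_power x \<beta> *\<^sub>R mi_deriv \<alpha> (FT v) x) \<le> C' * K)"
    using FT_schwartz_bound[OF order_refl, of \<beta>] unfolding mi_deriv_def by blast
  have "\<forall>(\<alpha>, \<beta>)\<in>insert p I. schwartz_seminorm \<alpha> \<beta> (FT v) \<le> max C C' * K"
    if v: "rapid v" and D: "\<forall>j. deriv_bound (max m (mi_abs \<beta>)) j (- (max M M')) K v" for v K
  proof -
    have K: "0 \<le> K" using D deriv_bound_K_nonneg by blast
    have "\<forall>j. deriv_bound m j (- M) K v" "\<forall>j. deriv_bound (mi_abs \<beta>) j (- M') K v"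
      using D by (auto intro: deriv_bound_mono)
    then have "\<forall>(\<alpha>, \<beta>)\<in>I. schwartz_seminorm \<alpha> \<beta> (FT v) \<le> C * K" "schwartz_seminorm \<alpha> \<beta> (FT v) \<le> C' * K"
      using IH[OF v] new[OF v] by (auto intro: schwartz_seminorm_leI)
    moreover have "C * K \<le> max C C' * K" "C' * K \<le> max C C' * K" using K by (auto intro: mult_right_mono)
    ultimately show ?thesis unfolding p by fastforce
  qed
  then show ?case using C by (intro exI[of _ "max C C'"] exI[of _ "max m (mi_abs \<beta>)"] exI[of _ "max M M'"]) auto
qed

lemma FT_cmult: "FT (\<lambda>x. c * v x) = (\<lambda>x. c * FT v x)"
  by (simp add: FTs_def fun_eq_iff mult.assoc)

text \<open>The preimage of the unit disc contains a neighbourhood of zero given by finitely many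
  seminorms, and homogeneity extends the bound to all \<open>v\<close>. It is phrased for
  \<open>FT v\<close>, because the distribution is applied to such functions only and the
  multipliers act on \<open>v\<close>.\<close>

lemma tempered_bound:
  fixes f :: "(real^'n \<Rightarrow> complex) \<Rightarrow> complex"
  assumes f: "f \<in> tempered_distributions"
  shows "\<exists>C m M. 0 \<le> C \<and> (\<forall>v K. 0 < K \<longrightarrow> rapid v \<longrightarrow> (\<forall>j. deriv_bound m j (- M) K v) \<longrightarrow> norm (f (FT v)) \<le> C * K)"
proof -
  have sc: "f (\<lambda>x. c * \<phi> x) = c * f \<phi>" if "\<phi> \<in> schwartz_space" for c \<phi>
    using f that by (simp add: tempered_distributions_def)
  have f0: "f (\<lambda>x. 0) = 0" using sc[OF zero_schwartz, of 0] by simp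
  let ?S = "{{\<psi> \<in> schwartz_space. schwartz_seminorm \<alpha> \<beta> (\<lambda>x. \<psi> x - \<phi> x) < e} | \<alpha> \<beta> \<phi> e.
        \<phi> \<in> schwartz_space \<and> 0 < e} :: (real^'n \<Rightarrow> complex) set set"
  let ?U = "{\<phi> \<in> topspace schwartz_topology. f \<phi> \<in> ball 0 1}"
  have "continuous_map schwartz_topology euclidean f" using f by (simp add: tempered_distributions_def)
  then have "\<forall>U. open U \<longrightarrow> openin schwartz_topology {\<phi> \<in> topspace schwartz_topology. f \<phi> \<in> U}"
    by (simp add: continuous_map_def)
  then have "openin schwartz_topology ?U" using open_ball by blast
  then have g: "generate_topology_on ?S ?U"
    unfolding schwartz_topology_def by (rule openin_topology_generated_by)
  have "(\<lambda>x. 0) \<in> topspace (schwartz_topology :: (real^'n \<Rightarrow> complex) topology)"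
  proof -
    have "schwartz_seminorm (\<lambda>_. 0) (\<lambda>_. 0) (\<lambda>x::real^'n. 0 - 0) = 0"
    proof -
      have "mi_deriv (\<lambda>_. 0) (\<lambda>x::real^'n. 0) = (\<lambda>x. 0)"
        using iter_partial_FT[OF rapid_zero] by (simp add: mi_deriv_def FT_zero)
      then show ?thesis by (simp add: schwartz_seminorm_def)
    qed
    then have "(\<lambda>x. 0) \<in> {\<psi> \<in> schwartz_space. schwartz_seminorm (\<lambda>_. 0) (\<lambda>_. 0) (\<lambda>x::real^'n. \<psi> x - 0) < 1}"
      using zero_schwartz by simp
    moreover have "{\<psi> \<in> schwartz_space. schwartz_seminorm (\<lambda>_. 0) (\<lambda>_. 0) (\<lambda>x::real^'n. \<psi> x - 0) < 1} \<in> ?S"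
      by (intro CollectI exI[of _ "\<lambda>_. 0"] exI[of _ 1] conjI refl zero_schwartz zero_less_one)
    ultimately show ?thesis unfolding schwartz_topology_def topology_generated_by_topspace by blast
  qed
  then have "(\<lambda>x. 0) \<in> ?U" using f0 by simp
  from schwartz_nbhd[OF g this] obtain I e where I: "finite I" "0 < e"
    "\<And>\<psi>. \<psi> \<in> schwartz_space \<Longrightarrow> (\<forall>(\<alpha>, \<beta>)\<in>I. schwartz_seminorm \<alpha> \<beta> \<psi> < e) \<Longrightarrow> \<psi> \<in> ?U" by blast
  obtain C m M where C: "0 \<le> C" and b: "\<And>v K. rapid v \<Longrightarrow> (\<forall>j. deriv_bound m j (- M) K v) \<Longrightarrow> (\<forall>(\<alpha>, \<beta>)\<in>I. schwartz_seminorm \<alpha> \<beta> (FT v) \<le> C * K)"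
    using FT_seminorm_bound[OF I(1)] by blast
  have "norm (f (FT v)) \<le> (2 * (C + 1) / e) * K" if K: "0 < K" and v: "rapid v" and D: "\<forall>j. deriv_bound m j (- M) K v" for v K
  proof -
    \<comment> \<open>The scaling brings the seminorms of \<open>FT v\<close> below
      \<open>e\<close>; \<open>C + 1\<close> keeps the denominator positive if
      \<open>C = 0\<close>.\<close>
    let ?c = "complex_of_real (e / (2 * (C + 1) * K))"
    have c0: "0 < e / (2 * (C + 1) * K)" using K I(2) C by simp
    have D': "\<forall>j. deriv_bound m j (- M) (norm ?c * K) (\<lambda>x. ?c * v x)" using D deriv_bound_cmult by blast
    have "\<forall>(\<alpha>, \<beta>)\<in>I. schwartz_seminorm \<alpha> \<beta> (FT (\<lambda>x. ?c * v x)) \<le> C * (norm ?c * K)"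
      by (rule b[OF rapid_cmult[OF v] D'])
    moreover have "C * (norm ?c * K) < e"
    proof -
      have nc: "norm ?c = e / (2 * (C + 1) * K)" using c0 by (simp only: norm_of_real abs_of_pos)
      have "C * (norm ?c * K) = e * (C / (2 * (C + 1)))" unfolding nc using K by simp
      also have "\<dots> < e * 1" using I(2) C by (intro mult_strict_left_mono) (auto simp: divide_simps)
      finally show ?thesis by simp
    qed
    ultimately have "FT (\<lambda>x. ?c * v x) \<in> ?U"
      by (intro I(3) FT_in_schwartz rapid_cmult v) fastforce
    then have "f (FT (\<lambda>x. ?c * v x)) \<in> ball 0 1" by blast
    then have "norm (?c * f (FT v)) < 1"
      unfolding FT_cmult sc[OF FT_in_schwartz[OF v]] by (simp only: mem_ball dist_0_norm)
    then have "(e / (2 * (C + 1) * K)) * norm (f (FT v)) < 1"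
      using c0 by (simp only: norm_mult norm_of_real abs_of_pos)
    moreover have d: "0 < 2 * (C + 1) * K" using K C by simp
    ultimately have "norm (f (FT v)) * e < 2 * (C + 1) * K"
      by (simp only: times_divide_eq_left pos_divide_less_eq[OF d] mult_1_left mult.commute[of e])
    then have "norm (f (FT v)) \<le> 2 * (C + 1) * K / e" using I(2) by (simp add: pos_le_divide_eq)
    then show ?thesis by simp
  qed
  then show ?thesis using C I(2) by (intro exI[of _ "2 * (C + 1) / e"] exI[of _ m] exI[of _ M]) auto
qed

section \<open>A tempered distribution and its smoothings\<close>

lemma FTs_add:
  assumes "integrable M u" "integrable M v" "s \<in> borel_measurable M"
  shows "FTs M s (\<lambda>x. u x + v x) = (\<lambda>\<xi>. FTs M s u \<xi> + FTs M s v \<xi>)"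
  using FTs_integrable[OF assms(1,3)] FTs_integrable[OF assms(2,3)]
  by (simp add: FTs_def distrib_right fun_eq_iff)

context
  fixes f :: "(real^'n \<Rightarrow> complex) \<Rightarrow> complex"
  assumes f: "f \<in> tempered_distributions"
begin

lemma f_FT_cmult: "rapid v \<Longrightarrow> f (FT (\<lambda>x. c * v x)) = c * f (FT v)"
  unfolding FT_cmult using f FT_in_schwartz[of v] by (simp add: tempered_distributions_def)

lemma f_FT_add: "rapid u \<Longrightarrow> rapid v \<Longrightarrow> f (FT (\<lambda>x. u x + v x)) = f (FT u) + f (FT v)"
  using f FT_in_schwartz[of v] FT_in_schwartz[of u]
  by (simp add: FTs_add rapid_integrable tempered_distributions_def)

lemma f_FT_diff: "rapid u \<Longrightarrow> rapid v \<Longrightarrow> f (FT (\<lambda>x. u x - v x)) = f (FT u) - f (FT v)"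
  using f_FT_add[of u "\<lambda>x. (-1) * v x"] f_FT_cmult[of v "-1"] rapid_cmult[of v "-1"] by simp

lemma f_FT_zero: "f (FT (\<lambda>x. 0)) = 0"
  using f_FT_cmult[OF rapid_zero, of 0] by simp

lemma f_FT_sum:
  "finite I \<Longrightarrow> (\<And>i. i \<in> I \<Longrightarrow> rapid (u i)) \<Longrightarrow> f (FT (\<lambda>x. \<Sum>i\<in>I. u i x)) = (\<Sum>i\<in>I. f (FT (u i)))"
  by (induction I rule: finite_induct) (auto simp: f_FT_zero f_FT_add rapid_sum)

text \<open>The convolution of \<open>f\<close> with the kernel whose Fourier transform is the Gaussian
  \<open>gaussian B\<close>.\<close>

definition smoothed :: "real^'n^'n \<Rightarrow> real^'n \<Rightarrow> complex" where
  "smoothed B x = f (FT (\<lambda>\<xi>. gaussian B \<xi> * chi x \<xi>))"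

lemma rapid_gaussian_chi: "rapid (gaussian B) \<Longrightarrow> rapid (\<lambda>\<xi>. gaussian B \<xi> * chi x \<xi>)"
  by (erule rapid_mult) (use deriv_bound_chi in blast)

text \<open>The difference is \<open>f\<close> at the transform of a Gaussian times a difference of
  characters. The linear growth of the latter is absorbed by one more power of decay of the
  Gaussian, and its derivatives cause the polynomial factor in \<open>x\<close> and
  \<open>y\<close>.\<close>

lemma smoothed_diff_bound:
  assumes g: "rapid (gaussian B)"
  shows "\<exists>C m. 0 \<le> C \<and> (\<forall>x y. norm (smoothed B x - smoothed B y) \<le> C * (1 + norm x + norm y) ^ m * norm (x - y))"
proof -
  obtain C m M where C: "0 \<le> C" and b: "\<And>v K. 0 < K \<Longrightarrow> rapid v \<Longrightarrow> (\<forall>j. deriv_bound m j (- M) K v) \<Longrightarrow> norm (f (FT v)) \<le> C * K"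
    using tempered_bound[OF f] by blast
  obtain K0 where K0: "\<forall>j. deriv_bound m j (- M - 1) K0 (gaussian B)" using rapidD[OF g] by blast
  \<comment> \<open>The bound for \<open>f\<close> asks for a strictly positive constant.\<close>
  define K where "K = max 1 K0"
  have K: "deriv_bound m j (- M - 1) K (gaussian B)" for j by (rule deriv_bound_mono[OF K0[rule_format, of j]]) (auto simp: K_def)
  have K1: "1 \<le> K" by (simp add: K_def)
  define C2 where "C2 = C * (2 ^ m * (K * ((2 * pi) ^ m * ((real m + 1) * (2 * pi)))))"
  have C2: "0 \<le> C2" unfolding C2_def using C K1 by (intro mult_nonneg_nonneg) auto
  have "norm (smoothed B x - smoothed B y) \<le> C2 * (1 + norm x + norm y) ^ m * norm (x - y)" for x y
  proof (cases "x = y")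
    case False
    let ?D = "(1 + 2 * pi * (norm x + norm y)) ^ m * ((real m + 1) * (2 * pi * norm (x - y)))"
    let ?D' = "(2 * pi * (1 + norm x + norm y)) ^ m * ((real m + 1) * (2 * pi * norm (x - y)))"
    have pos: "0 < ?D'" using False norm_ge_zero[of x] norm_ge_zero[of y]
      by (intro mult_pos_pos zero_less_power) (auto intro: add_pos_nonneg)
    have le: "?D \<le> ?D'"
    proof (intro mult_right_mono power_mono)
      show "1 + 2 * pi * (norm x + norm y) \<le> 2 * pi * (1 + norm x + norm y)"
        using pi_gt3 by (simp add: distrib_left)
    qed (auto intro: add_nonneg_nonneg)
    have D: "deriv_bound m j 1 ?D' (\<lambda>\<xi>. chi x \<xi> - chi y \<xi>)" for j
      by (rule deriv_bound_mono[OF deriv_bound_chi_diff _ le]) auto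
    have "deriv_bound m j (- M) (2 ^ m * (K * ?D')) (\<lambda>\<xi>. gaussian B \<xi> * (chi x \<xi> - chi y \<xi>))" for j
      using deriv_bound_mult[OF K D] by simp
    moreover have "rapid (\<lambda>\<xi>. gaussian B \<xi> * (chi x \<xi> - chi y \<xi>))"
      using rapid_diff[OF rapid_gaussian_chi[OF g, of x] rapid_gaussian_chi[OF g, of y]] by (simp add: right_diff_distrib)
    moreover have "0 < 2 ^ m * (K * ?D')"
      by (rule mult_pos_pos[OF _ mult_pos_pos[OF _ pos]]) (use K1 in auto)
    ultimately have "norm (f (FT (\<lambda>\<xi>. gaussian B \<xi> * (chi x \<xi> - chi y \<xi>)))) \<le> C * (2 ^ m * (K * ?D'))" using b by blast
    moreover have "f (FT (\<lambda>\<xi>. gaussian B \<xi> * (chi x \<xi> - chi y \<xi>))) = smoothed B x - smoothed B y"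
      unfolding smoothed_def by (subst f_FT_diff[symmetric, OF rapid_gaussian_chi[OF g] rapid_gaussian_chi[OF g]]) (simp add: right_diff_distrib)
    moreover have "C * (2 ^ m * (K * ?D')) = C2 * (1 + norm x + norm y) ^ m * norm (x - y)"
      unfolding C2_def power_mult_distrib by (simp only: mult_ac)
    ultimately show ?thesis by simp
  qed simp
  with C2 show ?thesis by blast
qed

lemma smoothed_continuous:
  assumes g: "rapid (gaussian B)"
  shows "continuous_on UNIV (smoothed B)"
proof (rule continuous_at_imp_continuous_on, safe)
  fix x :: "real^'n"
  obtain C m where C: "\<And>x y. norm (smoothed B x - smoothed B y) \<le> C * (1 + norm x + norm y) ^ m * norm (x - y)"
    using smoothed_diff_bound[OF g] by blast
  have "((\<lambda>y. C * (1 + norm y + norm x) ^ m * norm (y - x)) \<longlongrightarrow> C * (1 + norm x + norm x) ^ m * norm (x - x)) (at x)"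
    by (intro tendsto_intros)
  then have l: "((\<lambda>y. C * (1 + norm y + norm x) ^ m * norm (y - x)) \<longlongrightarrow> 0) (at x)" by simp
  have "((\<lambda>y. smoothed B y - smoothed B x) \<longlongrightarrow> 0) (at x)"
    by (rule Lim_null_comparison[OF _ l]) (use C in \<open>auto intro!: always_eventually\<close>)
  then show "isCont (smoothed B) x" unfolding isCont_def by (rule LIM_zero_cancel)
qed

lemma smoothed_growth:
  assumes g: "rapid (gaussian B)"
  shows "\<exists>C m. 0 \<le> C \<and> (\<forall>x. norm (smoothed B x) \<le> C * (1 + norm x) ^ m)"
proof -
  obtain C m where C0: "0 \<le> C" and C: "\<And>x y. norm (smoothed B x - smoothed B y) \<le> C * (1 + norm x + norm y) ^ m * norm (x - y)"
    using smoothed_diff_bound[OF g] by blast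
  have "norm (smoothed B x) \<le> (norm (smoothed B 0) + C) * (1 + norm x) ^ Suc m" for x
  proof -
    have "norm (smoothed B x) \<le> norm (smoothed B 0) + norm (smoothed B x - smoothed B 0)" by (rule norm_triangle_sub)
    also have "\<dots> \<le> norm (smoothed B 0) * 1 + C * ((1 + norm x) ^ m * norm x)" using C[of x 0] by (simp add: mult.assoc)
    also have "\<dots> \<le> norm (smoothed B 0) * (1 + norm x) ^ Suc m + C * ((1 + norm x) ^ m * (1 + norm x))"
      using C0 by (intro add_mono mult_left_mono one_le_power) auto
    also have "\<dots> = (norm (smoothed B 0) + C) * (1 + norm x) ^ Suc m" by (simp add: distrib_right mult_ac)
    finally show ?thesis .
  qed
  then show ?thesis using C0 by (intro exI[of _ "norm (smoothed B 0) + C"] exI[of _ "Suc m"]) auto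
qed

lemma smoothed_borel: "rapid (gaussian B) \<Longrightarrow> smoothed B \<in> borel_measurable borel"
  by (intro borel_measurable_continuous_onI smoothed_continuous)

text \<open>All derivatives of such a transform are bounded, so that its product with a Gaussian is
  rapid and \<open>f\<close> may be applied to the transform of this product.\<close>

lemma deriv_bound_FTs:
  fixes s :: "'b \<Rightarrow> real^'m"
  assumes w: "all_moments M s w" and s: "s \<in> borel_measurable M"
  shows "\<exists>K. deriv_bound m j 0 K (FTs M s w)"
  using w
proof (induction m arbitrary: w)
  case 0
  then show ?case using FTs_continuous[OF all_moments_integrable[OF 0] s] FTs_bound[OF all_moments_integrable[OF 0] s] by auto
next
  case (Suc m)
  let ?w' = "\<lambda>x. w x * (2 * pi * \<i> * (s x $ j))"
  obtain K where K: "deriv_bound m j 0 K (FTs M s ?w')" using Suc.IH[OF all_moments_coord[OF Suc.prems s]] by blast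
  let ?K = "max K (LINT x|M. norm (w x))"
  have "deriv_bound m j 0 ?K (FTs M s ?w')" by (rule deriv_bound_mono[OF K]) auto
  moreover have "dirder j (FTs M s w) (FTs M s ?w')" unfolding dirder_def using FTs_partial[OF Suc.prems s] by blast
  moreover have "norm (FTs M s w x) \<le> ?K * (1 + norm x) powr 0" for x
    using FTs_bound[OF all_moments_integrable[OF Suc.prems] s, of x] by simp
  ultimately have "deriv_bound (Suc m) j 0 ?K (FTs M s w)"
    using FTs_continuous[OF all_moments_integrable[OF Suc.prems] s] unfolding deriv_bound.simps by blast
  then show ?case by blast
qed

lemma rapid_gaussian_FTs:
  fixes s :: "'b \<Rightarrow> real^'n"
  assumes "rapid (gaussian B)" "all_moments M s w" "s \<in> borel_measurable M"
  shows "rapid (\<lambda>\<xi>. gaussian B \<xi> * FTs M s w \<xi>)"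
  by (rule rapid_mult[OF assms(1)]) (use deriv_bound_FTs[OF assms(2,3)] in blast)

lemma simple_function_integral_sum:
  fixes h :: "'b \<Rightarrow> complex"
  assumes s: "simple_function M s" and w: "integrable M w"
  shows "(LINT x|M. w x * h (s x)) = (\<Sum>v\<in>s ` space M. (LINT x|M. w x * indicator (s -` {v} \<inter> space M) x) * h v)"
proof -
  have fin: "finite (s ` space M)" using s by (simp add: simple_function_def)
  have ms: "s -` {v} \<inter> space M \<in> sets M" if "v \<in> s ` space M" for v using s that by (auto simp: simple_function_def)
  have "(LINT x|M. w x * h (s x)) = (LINT x|M. (\<Sum>v\<in>s ` space M. (w x * indicator (s -` {v} \<inter> space M) x) * h v))"
  proof (rule Bochner_Integration.integral_cong[OF refl])
    fix x assume x: "x \<in> space M"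
    have "(\<Sum>v\<in>s ` space M. (w x * indicator (s -` {v} \<inter> space M) x) * h v) = (\<Sum>v\<in>s ` space M. if v = s x then w x * h v else 0)"
      using x by (intro sum.cong) (auto simp: indicator_def)
    then show "w x * h (s x) = (\<Sum>v\<in>s ` space M. (w x * indicator (s -` {v} \<inter> space M) x) * h v)"
      using fin x by simp
  qed
  also have "\<dots> = (\<Sum>v\<in>s ` space M. (LINT x|M. (w x * indicator (s -` {v} \<inter> space M) x) * h v))"
  proof (rule Bochner_Integration.integral_sum)
    fix v assume "v \<in> s ` space M"
    from ms[OF this] have "integrable M (\<lambda>x. indicator (s -` {v} \<inter> space M) x * w x)"
      by (intro integrable_bounded_mult[OF w, where K=1] borel_measurable_indicator) (auto simp: indicator_def)
    then show "integrable M (\<lambda>x. (w x * indicator (s -` {v} \<inter> space M) x) * h v)"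
      by (simp add: mult.commute)
  qed
  finally show ?thesis by simp
qed

text \<open>For a simple \<open>s\<close> the transform \<open>FTs M s w\<close> is a finite linear
  combination of characters.\<close>

lemma f_FT_gaussian_FTs_simple:
  fixes s :: "'b \<Rightarrow> real^'n"
  assumes g: "rapid (gaussian B)" and s: "simple_function M s" and w: "integrable M w"
  shows "f (FT (\<lambda>\<xi>. gaussian B \<xi> * FTs M s w \<xi>)) = (LINT x|M. w x * smoothed B (s x))"
proof -
  let ?c = "\<lambda>v. LINT x|M. w x * indicator (s -` {v} \<inter> space M) x"
  have fin: "finite (s ` space M)" using s by (simp add: simple_function_def)
  have "gaussian B \<xi> * FTs M s w \<xi> = (\<Sum>v\<in>s ` space M. ?c v * (gaussian B \<xi> * chi v \<xi>))" for \<xi>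
    unfolding FTs_def simple_function_integral_sum[OF s w, of "chi \<xi>"]
    by (simp add: sum_distrib_left mult_ac chi_commute)
  then have "f (FT (\<lambda>\<xi>. gaussian B \<xi> * FTs M s w \<xi>)) = f (FT (\<lambda>\<xi>. \<Sum>v\<in>s ` space M. ?c v * (gaussian B \<xi> * chi v \<xi>)))" by simp
  also have "\<dots> = (\<Sum>v\<in>s ` space M. f (FT (\<lambda>\<xi>. ?c v * (gaussian B \<xi> * chi v \<xi>))))"
    by (rule f_FT_sum[OF fin]) (intro rapid_cmult rapid_gaussian_chi g)
  also have "\<dots> = (\<Sum>v\<in>s ` space M. ?c v * smoothed B v)"
    unfolding smoothed_def by (simp add: f_FT_cmult rapid_gaussian_chi g)
  also have "\<dots> = (LINT x|M. w x * smoothed B (s x))" by (rule simple_function_integral_sum[OF s w, symmetric])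
  finally show ?thesis .
qed

text \<open>The factor two is the one by which the simple functions that approximate the identity
  are dominated by it.\<close>

lemma all_moments_compare:
  fixes w :: "'b \<Rightarrow> complex"
  assumes w: "all_moments M s w" and [measurable]: "s' \<in> borel_measurable M" "s \<in> borel_measurable M"
    and le: "\<And>x. norm (s' x) \<le> 2 * norm (s x)"
  shows "all_moments M (s' :: 'b \<Rightarrow> real^'n) w"
  unfolding all_moments_def
proof (intro conjI allI)
  show wm[measurable]: "w \<in> borel_measurable M" using w by (simp add: all_moments_def)
  fix m
  show "integrable M (\<lambda>x. (1 + norm (s' x)) ^ m * norm (w x))"
  proof (rule Bochner_Integration.integrable_bound)
    show "integrable M (\<lambda>x. 2 ^ m * ((1 + norm (s x)) ^ m * norm (w x)))"
      using w by (intro integrable_mult_right) (simp add: all_moments_def)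
    show "AE x in M. norm ((1 + norm (s' x)) ^ m * norm (w x)) \<le> norm (2 ^ m * ((1 + norm (s x)) ^ m * norm (w x)))"
    proof (rule AE_I2)
      fix x
      have "(1 + norm (s' x)) ^ m \<le> (2 * (1 + norm (s x))) ^ m" using le[of x] by (intro power_mono) (auto simp: distrib_left)
      then have "(1 + norm (s' x)) ^ m * norm (w x) \<le> (2 * (1 + norm (s x))) ^ m * norm (w x)" by (rule mult_right_mono) simp
      then have "(1 + norm (s' x)) ^ m * norm (w x) \<le> 2 ^ m * ((1 + norm (s x)) ^ m * norm (w x))"
        unfolding power_mult_distrib mult.assoc .
      then show "norm ((1 + norm (s' x)) ^ m * norm (w x)) \<le> norm (2 ^ m * ((1 + norm (s x)) ^ m * norm (w x)))"
        by (simp add: abs_mult)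
    qed
  qed measurable
qed

text \<open>The \<open>k\<close>-th derivative in direction \<open>j\<close> multiplies
  \<open>w\<close> and \<open>w'\<close> by the \<open>k\<close>-th power of their own coordinate
  factors, so a bound on all these differences up to order \<open>m\<close> is what has to be
  supplied.\<close>

lemma deriv_bound_FTs_diff:
  fixes s s' :: "'b \<Rightarrow> real^'m"
  assumes w: "all_moments M s w" and w': "all_moments M s' w'" and s: "s \<in> borel_measurable M" "s' \<in> borel_measurable M"
    and b: "\<And>k \<xi>. k \<le> m \<Longrightarrow> norm (FTs M s (\<lambda>x. w x * (2 * pi * \<i> * (s x $ j)) ^ k) \<xi> - FTs M s' (\<lambda>x. w' x * (2 * pi * \<i> * (s' x $ j)) ^ k) \<xi>) \<le> d * (1 + norm \<xi>)"
  shows "deriv_bound m j 1 d (\<lambda>\<xi>. FTs M s w \<xi> - FTs M s' w' \<xi>)"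
  using w w' b
proof (induction m arbitrary: w w')
  case 0
  have "continuous_on UNIV (\<lambda>\<xi>. FTs M s w \<xi> - FTs M s' w' \<xi>)"
    by (intro continuous_on_diff FTs_continuous all_moments_integrable[OF 0(1)] all_moments_integrable[OF 0(2)] s)
  then show ?case using 0(3)[of 0] by simp
next
  case (Suc m)
  let ?v = "\<lambda>x. w x * (2 * pi * \<i> * (s x $ j))" and ?v' = "\<lambda>x. w' x * (2 * pi * \<i> * (s' x $ j))"
  have "deriv_bound m j 1 d (\<lambda>\<xi>. FTs M s ?v \<xi> - FTs M s' ?v' \<xi>)"
    by (rule Suc.IH[OF all_moments_coord[OF Suc.prems(1) s(1)] all_moments_coord[OF Suc.prems(2) s(2)]])
       (use Suc.prems(3)[of "Suc _"] in \<open>simp add: mult_ac\<close>)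
  moreover have "dirder j (\<lambda>\<xi>. FTs M s w \<xi> - FTs M s' w' \<xi>) (\<lambda>\<xi>. FTs M s ?v \<xi> - FTs M s' ?v' \<xi>)"
    using FTs_partial[OF Suc.prems(1) s(1)] FTs_partial[OF Suc.prems(2) s(2)]
    by (intro dirder_diff) (auto simp: dirder_def)
  moreover have "continuous_on UNIV (\<lambda>\<xi>. FTs M s w \<xi> - FTs M s' w' \<xi>)"
    by (intro continuous_on_diff FTs_continuous all_moments_integrable[OF Suc.prems(1)] all_moments_integrable[OF Suc.prems(2)] s)
  moreover have "norm (FTs M s w \<xi> - FTs M s' w' \<xi>) \<le> d * (1 + norm \<xi>) powr 1" for \<xi>
    using Suc.prems(3)[of 0 \<xi>] by simp
  ultimately show ?case unfolding deriv_bound.simps by blast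
qed

lemma all_moments_power:
  fixes s :: "'b \<Rightarrow> real^'m"
  assumes "all_moments M s w" "s \<in> borel_measurable M"
  shows "all_moments M s (\<lambda>x. w x * (2 * pi * \<i> * (s x $ j)) ^ k)"
proof (induction k)
  case (Suc k)
  show ?case using all_moments_coord[OF Suc assms(2), of j] by (simp add: mult_ac)
qed (use assms in simp)

text \<open>The identity map in the inner integral is approximated by simple functions, for which the claim
  is linearity of \<open>f\<close>.\<close>

lemma f_FT_gaussian_FTs:
  fixes w :: "real^'n \<Rightarrow> complex"
  assumes g: "rapid (gaussian B)" and w: "all_moments lborel (\<lambda>x. x) w"
  shows "f (FT (\<lambda>\<xi>. gaussian B \<xi> * FTs lborel (\<lambda>x. x) w \<xi>)) = (LINT x|lborel. w x * smoothed B x)"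
proof -
  have iw: "integrable lborel w" by (rule all_moments_integrable[OF w])
  have wm[measurable]: "w \<in> borel_measurable borel" using iw by (auto dest: borel_measurable_integrable)
  have idm: "(\<lambda>x::real^'n. x) \<in> borel_measurable lborel" by simp
  obtain s :: "nat \<Rightarrow> real^'n \<Rightarrow> real^'n" where s: "\<And>i. simple_function lborel (s i)" "\<And>x. (\<lambda>i. s i x) \<longlonglongrightarrow> x" "\<And>i x. norm (s i x) \<le> 2 * norm x"
    using borel_measurable_implies_sequence_metric[OF idm, of 0] by (auto simp: space_borel)
  have sm[measurable]: "s i \<in> borel_measurable borel" for i
    using borel_measurable_simple_function[OF s(1)[of i]] by simp
  have ws: "all_moments lborel (s i) w" for i
    by (rule all_moments_compare[OF w]) (use s in auto)
  obtain Cg mg where Cg: "0 \<le> Cg" "\<And>x. norm (smoothed B x) \<le> Cg * (1 + norm x) ^ mg" using smoothed_growth[OF g] by blast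
  have ucm[measurable]: "smoothed B \<in> borel_measurable borel" by (rule smoothed_borel[OF g])
  have R: "(\<lambda>i. LINT x|lborel. w x * smoothed B (s i x)) \<longlonglongrightarrow> (LINT x|lborel. w x * smoothed B x)"
  proof (rule integral_dominated_convergence[where w="\<lambda>x. (Cg * 2 ^ mg) * ((1 + norm x) ^ mg * norm (w x))"])
    show "integrable lborel (\<lambda>x. (Cg * 2 ^ mg) * ((1 + norm x) ^ mg * norm (w x)))"
      using w by (intro integrable_mult_right) (simp add: all_moments_def)
    show "AE x in lborel. (\<lambda>i. w x * smoothed B (s i x)) \<longlonglongrightarrow> w x * smoothed B x"
    proof (rule AE_I2, rule tendsto_mult_left)
      fix x
      have "isCont (smoothed B) x" using smoothed_continuous[OF g] by (simp add: continuous_on_eq_continuous_at)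
      then show "(\<lambda>i. smoothed B (s i x)) \<longlonglongrightarrow> smoothed B x" using s(2) by (rule isCont_tendsto_compose)
    qed
    show "AE x in lborel. norm (w x * smoothed B (s i x)) \<le> (Cg * 2 ^ mg) * ((1 + norm x) ^ mg * norm (w x))" for i
    proof (rule AE_I2)
      fix x
      have "norm (smoothed B (s i x)) \<le> Cg * (2 * (1 + norm x)) ^ mg"
        by (rule order_trans[OF Cg(2)], intro mult_left_mono power_mono Cg) (use s(3)[of i x] in \<open>auto simp: distrib_left\<close>)
      then have "norm (w x) * norm (smoothed B (s i x)) \<le> norm (w x) * (Cg * (2 * (1 + norm x)) ^ mg)" by (rule mult_left_mono) simp
      then show "norm (w x * smoothed B (s i x)) \<le> (Cg * 2 ^ mg) * ((1 + norm x) ^ mg * norm (w x))"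
        unfolding norm_mult power_mult_distrib by (simp only: mult_ac)
    qed
  qed measurable
  obtain C m M where C: "0 \<le> C" and bd: "\<And>v K. 0 < K \<Longrightarrow> rapid v \<Longrightarrow> (\<forall>j. deriv_bound m j (- M) K v) \<Longrightarrow> norm (f (FT v)) \<le> C * K"
    using tempered_bound[OF f] by blast
  obtain K0 where K0: "\<forall>j. deriv_bound m j (- M - 1) K0 (gaussian B)" using rapidD[OF g] by blast
  have K00: "0 \<le> K0" using K0 deriv_bound_K_nonneg by blast
  let ?c = "\<lambda>j (y::real^'n). 2 * pi * \<i> * complex_of_real (y $ j)"
  \<comment> \<open>Up to the factor \<open>1 + norm \<xi>\<close>, a majorant for the difference of
    the integrands of the \<open>k\<close>-th derivatives: the first summand compares the coordinate
    factors, the second one the characters.\<close>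
  let ?a = "\<lambda>i j k x. norm (w x) * (norm (?c j (s i x) ^ k - ?c j x ^ k) + norm (?c j x) ^ k * (2 * pi * norm (s i x - x)))"
  define d where "d i j k = (LINT x|lborel. ?a i j k x)" for i j k
  have cm[measurable]: "?c j \<in> borel_measurable borel" for j
    by (intro borel_measurable_continuous_onI continuous_intros)
  have ndc: "norm (?c j y) \<le> 2 * pi * (1 + norm y)" for j y
    using norm_coord_factor[of y j] by (rule order_trans) simp
  have dom: "?a i j k x \<le> (2 * (4 * pi) ^ k + (2 * pi) ^ k * (6 * pi)) * ((1 + norm x) ^ Suc k * norm (w x))" for i j k x
  proof -
    let ?t = "1 + norm x"
    have t1: "1 \<le> ?t" by simp
    have sx: "1 + norm (s i x) \<le> 2 * ?t" using s(3)[of i x] by (simp add: distrib_left)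
    have 1: "norm (?c j (s i x) ^ k) \<le> (4 * pi) ^ k * ?t ^ Suc k"
    proof -
      have "norm (?c j (s i x)) \<le> 2 * pi * (2 * ?t)" by (rule order_trans[OF ndc], intro mult_left_mono sx) simp
      then have "norm (?c j (s i x) ^ k) \<le> (2 * pi * (2 * ?t)) ^ k" unfolding norm_power by (intro power_mono) auto
      also have "2 * pi * (2 * ?t) = (4 * pi) * ?t" by simp
      also have "\<dots> ^ k = (4 * pi) ^ k * ?t ^ k" by (rule power_mult_distrib)
      also have "\<dots> \<le> (4 * pi) ^ k * ?t ^ Suc k" using t1 by (intro mult_left_mono power_increasing) auto
      finally show ?thesis .
    qed
    have 2: "norm (?c j x) ^ k \<le> (2 * pi) ^ k * ?t ^ k"
      unfolding power_mult_distrib[symmetric] by (intro power_mono ndc) simp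
    also have "\<dots> \<le> (4 * pi) ^ k * ?t ^ Suc k" using t1 by (intro mult_mono power_mono power_increasing) auto
    finally have 3: "norm (?c j x ^ k) \<le> (4 * pi) ^ k * ?t ^ Suc k" by (simp only: norm_power)
    have 4: "2 * pi * norm (s i x - x) \<le> 6 * pi * ?t"
    proof -
      have "norm (s i x - x) \<le> 3 * ?t" using norm_triangle_ineq4[of "s i x" x] s(3)[of i x] by (simp add: distrib_left)
      then show ?thesis using mult_left_mono[of "norm (s i x - x)" "3 * ?t" "2 * pi"] by simp
    qed
    have "norm (?c j x) ^ k * (2 * pi * norm (s i x - x)) \<le> ((2 * pi) ^ k * ?t ^ k) * (6 * pi * ?t)"
      by (rule mult_mono[OF 2 4]) auto
    also have "\<dots> = (2 * pi) ^ k * (6 * pi) * ?t ^ Suc k" by (simp add: mult_ac)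
    finally have 5: "norm (?c j x) ^ k * (2 * pi * norm (s i x - x)) \<le> (2 * pi) ^ k * (6 * pi) * ?t ^ Suc k" .
    have "norm (?c j (s i x) ^ k - ?c j x ^ k) \<le> (4 * pi) ^ k * ?t ^ Suc k + (4 * pi) ^ k * ?t ^ Suc k"
      by (rule order_trans[OF norm_triangle_ineq4 add_mono[OF 1 3]])
    from add_mono[OF this 5] have "norm (?c j (s i x) ^ k - ?c j x ^ k) + norm (?c j x) ^ k * (2 * pi * norm (s i x - x))
       \<le> (2 * (4 * pi) ^ k + (2 * pi) ^ k * (6 * pi)) * ?t ^ Suc k" by (simp only: distrib_right mult_2)
    from mult_left_mono[OF this norm_ge_zero[of "w x"]] show ?thesis by (simp only: mult_ac)
  qed
  have a0: "0 \<le> ?a i j k x" for i j k x by (intro mult_nonneg_nonneg add_nonneg_nonneg) auto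
  have domi: "integrable lborel (\<lambda>x. (2 * (4 * pi) ^ k + (2 * pi) ^ k * (6 * pi)) * ((1 + norm x) ^ Suc k * norm (w x)))" for k
    using w unfolding all_moments_def by (intro integrable_mult_right) blast
  have am[measurable]: "?a i j k \<in> borel_measurable lborel" for i j k by measurable
  have ia: "integrable lborel (?a i j k)" for i j k
    by (rule Bochner_Integration.integrable_bound[OF domi[of k] am]) (use dom a0 in \<open>auto intro!: AE_I2 order_trans[OF _ abs_ge_self] simp only: real_norm_def abs_of_nonneg\<close>)
  have dlim: "(\<lambda>i. d i j k) \<longlonglongrightarrow> 0" for j k
  proof -
    have "(\<lambda>i. d i j k) \<longlonglongrightarrow> (LINT x::real^'n|lborel. 0)"
      unfolding d_def
    proof (rule integral_dominated_convergence[OF _ am domi[of k]])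
      show "AE x in lborel. (\<lambda>i. ?a i j k x) \<longlonglongrightarrow> 0"
      proof (rule AE_I2)
        fix x
        have "(\<lambda>i. ?a i j k x) \<longlonglongrightarrow> norm (w x) * (norm (?c j x ^ k - ?c j x ^ k) + norm (?c j x) ^ k * (2 * pi * norm (x - x)))"
          by (intro tendsto_intros s(2))
        then show "(\<lambda>i. ?a i j k x) \<longlonglongrightarrow> 0" by simp
      qed
      show "AE x in lborel. norm (?a i j k x) \<le> (2 * (4 * pi) ^ k + (2 * pi) ^ k * (6 * pi)) * ((1 + norm x) ^ Suc k * norm (w x))" for i
        using dom a0 by (intro AE_I2) (simp only: real_norm_def abs_of_nonneg)
    qed simp
    then show ?thesis by simp
  qed
  \<comment> \<open>A single null sequence for all directions and all orders up to \<open>m\<close>,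
    the form in which the continuity of \<open>f\<close> is available.\<close>
  define D where "D i = (\<Sum>j\<in>UNIV. \<Sum>k\<le>m. d i j k)" for i
  have Dlim: "D \<longlonglongrightarrow> 0"
  proof -
    have "D \<longlonglongrightarrow> (\<Sum>j\<in>(UNIV::'n set). \<Sum>k\<le>m. 0)" unfolding D_def by (intro tendsto_sum dlim)
    then show ?thesis by simp
  qed
  have d0: "0 \<le> d i j k" for i j k unfolding d_def using a0 by (intro Bochner_Integration.integral_nonneg) auto
  have dD: "d i j k \<le> D i" if "k \<le> m" for i j k
  proof -
    have "d i j k \<le> (\<Sum>k\<le>m. d i j k)" using that d0 by (intro member_le_sum) auto
    also have "\<dots> \<le> D i" unfolding D_def using d0 by (intro member_le_sum) (auto intro: sum_nonneg)
    finally show ?thesis .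
  qed
  let ?W = "FTs lborel (\<lambda>x. x) w" and ?Wi = "\<lambda>i. FTs lborel (s i) w"
  have diffb: "norm (FTs lborel (s i) (\<lambda>x. w x * ?c j (s i x) ^ k) \<xi> - FTs lborel (\<lambda>x. x) (\<lambda>x. w x * ?c j x ^ k) \<xi>) \<le> d i j k * (1 + norm \<xi>)" for i j k \<xi>
  proof -
    have i1: "integrable lborel (\<lambda>x. w x * ?c j (s i x) ^ k * chi \<xi> (s i x))"
      by (rule FTs_integrable[OF all_moments_integrable[OF all_moments_power[OF ws]]]) measurable
    have i2: "integrable lborel (\<lambda>x. w x * ?c j x ^ k * chi \<xi> x)"
      by (rule FTs_integrable[OF all_moments_integrable[OF all_moments_power[OF w]]]) measurable
    have e1: "FTs lborel (s i) (\<lambda>x. w x * ?c j (s i x) ^ k) \<xi> - FTs lborel (\<lambda>x. x) (\<lambda>x. w x * ?c j x ^ k) \<xi>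
      = (LINT x|lborel. w x * ?c j (s i x) ^ k * chi \<xi> (s i x) - w x * ?c j x ^ k * chi \<xi> x)"
      unfolding FTs_def by (rule Bochner_Integration.integral_diff[OF i1 i2, symmetric])
    have "norm (LINT x|lborel. w x * ?c j (s i x) ^ k * chi \<xi> (s i x) - w x * ?c j x ^ k * chi \<xi> x) \<le> (LINT x|lborel. ?a i j k x * (1 + norm \<xi>))"
    proof (rule norm_integral_le)
      show "integrable lborel (\<lambda>x. ?a i j k x * (1 + norm \<xi>))" by (intro integrable_mult_left ia)
      fix x
      have e: "w x * ?c j (s i x) ^ k * chi \<xi> (s i x) - w x * ?c j x ^ k * chi \<xi> x
        = w x * ((?c j (s i x) ^ k - ?c j x ^ k) * chi \<xi> (s i x) + ?c j x ^ k * (chi \<xi> (s i x) - chi \<xi> x))"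
        by (simp add: algebra_simps)
      have alg: "w0 * (p * t + q * (r * t)) = w0 * (p + q * r) * t" for w0 p q r t :: real
        by (simp add: algebra_simps)
      have "norm (w x * ((?c j (s i x) ^ k - ?c j x ^ k) * chi \<xi> (s i x) + ?c j x ^ k * (chi \<xi> (s i x) - chi \<xi> x)))
         \<le> norm (w x) * (norm (?c j (s i x) ^ k - ?c j x ^ k) * 1 + norm (?c j x) ^ k * norm (chi \<xi> (s i x) - chi \<xi> x))"
        unfolding norm_mult[of "w x"] by (intro mult_left_mono order_trans[OF norm_triangle_ineq]) (auto simp only: norm_mult norm_chi norm_power norm_ge_zero order_refl)
      also have "\<dots> \<le> norm (w x) * (norm (?c j (s i x) ^ k - ?c j x ^ k) * (1 + norm \<xi>) + norm (?c j x) ^ k * (2 * pi * norm (s i x - x) * (1 + norm \<xi>)))"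
      proof (intro mult_left_mono add_mono)
        show "norm (chi \<xi> (s i x) - chi \<xi> x) \<le> 2 * pi * norm (s i x - x) * (1 + norm \<xi>)"
          using deriv_bound_bound[OF deriv_bound_chi_diff[of 0 undefined "s i x" x], of \<xi>] by (simp add: chi_commute[of \<xi>])
      qed auto
      also have "\<dots> = ?a i j k x * (1 + norm \<xi>)" by (rule alg)
      finally show "norm (w x * ?c j (s i x) ^ k * chi \<xi> (s i x) - w x * ?c j x ^ k * chi \<xi> x) \<le> ?a i j k x * (1 + norm \<xi>)"
        unfolding e .
    qed (intro Bochner_Integration.integrable_diff i1 i2)
    then show ?thesis unfolding e1 d_def integral_mult_left_zero .
  qed
  have DBd: "deriv_bound m j 1 (D i) (\<lambda>\<xi>. ?Wi i \<xi> - ?W \<xi>)" for i j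
  proof (rule deriv_bound_FTs_diff[OF ws w])
    fix k and \<xi> :: "real^'n" assume "k \<le> m"
    have "d i j k * (1 + norm \<xi>) \<le> D i * (1 + norm \<xi>)" by (rule mult_right_mono[OF dD[OF \<open>k \<le> m\<close>]]) simp
    with diffb[of i j k \<xi>] show "norm (FTs lborel (s i) (\<lambda>x. w x * ?c j (s i x) ^ k) \<xi> - FTs lborel (\<lambda>x. x) (\<lambda>x. w x * ?c j x ^ k) \<xi>) \<le> D i * (1 + norm \<xi>)"
      by (rule order_trans)
  qed auto
  have D0: "0 \<le> D i" for i using deriv_bound_K_nonneg[OF DBd] .
  \<comment> \<open>The added null sequence keeps the constant positive.\<close>
  let ?K = "\<lambda>i. 2 ^ m * (K0 * D i) + 1 / real (Suc i)"
  have L: "norm (f (FT (\<lambda>\<xi>. gaussian B \<xi> * ?Wi i \<xi>)) - f (FT (\<lambda>\<xi>. gaussian B \<xi> * ?W \<xi>))) \<le> C * ?K i" for i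
  proof -
    have r1: "rapid (\<lambda>\<xi>. gaussian B \<xi> * ?Wi i \<xi>)" by (rule rapid_gaussian_FTs[OF g ws]) simp
    have r2: "rapid (\<lambda>\<xi>. gaussian B \<xi> * ?W \<xi>)" by (rule rapid_gaussian_FTs[OF g w]) simp
    have r: "rapid (\<lambda>\<xi>. gaussian B \<xi> * (?Wi i \<xi> - ?W \<xi>))"
      using rapid_diff[OF r1 r2] by (simp add: right_diff_distrib)
    have "deriv_bound m j (- M) (?K i) (\<lambda>\<xi>. gaussian B \<xi> * (?Wi i \<xi> - ?W \<xi>))" for j
      using deriv_bound_mult[OF K0[rule_format, of j] DBd[of j i]] by (rule deriv_bound_mono) auto
    moreover have "0 < ?K i" using K00 D0[of i] by (intro add_nonneg_pos) auto
    ultimately have "norm (f (FT (\<lambda>\<xi>. gaussian B \<xi> * (?Wi i \<xi> - ?W \<xi>)))) \<le> C * ?K i" using bd r by blast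
    then show ?thesis using f_FT_diff[OF r1 r2] by (simp add: right_diff_distrib)
  qed
  have "(\<lambda>i. C * ?K i) \<longlonglongrightarrow> C * (2 ^ m * (K0 * 0) + 0)"
    by (intro tendsto_intros Dlim eps_seq)
  then have "(\<lambda>i. C * ?K i) \<longlonglongrightarrow> 0" by simp
  then have "(\<lambda>i. f (FT (\<lambda>\<xi>. gaussian B \<xi> * ?Wi i \<xi>)) - f (FT (\<lambda>\<xi>. gaussian B \<xi> * ?W \<xi>))) \<longlonglongrightarrow> 0"
    by (rule Lim_null_comparison[rotated]) (intro always_eventually allI L)
  then have "(\<lambda>i. f (FT (\<lambda>\<xi>. gaussian B \<xi> * ?Wi i \<xi>))) \<longlonglongrightarrow> f (FT (\<lambda>\<xi>. gaussian B \<xi> * ?W \<xi>))" by (rule LIM_zero_cancel)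
  then show ?thesis
    using R unfolding f_FT_gaussian_FTs_simple[OF g s(1) iw] by (rule LIMSEQ_unique)
qed

section \<open>Identifying the Fourier transform of the distribution\<close>

lemma FT_rapid: "rapid \<phi> \<Longrightarrow> rapid (FT \<phi>)"
  by (rule schwartz_rapid[OF FT_in_schwartz])

lemma FT_inverse_rapid:
  assumes "rapid \<phi>"
  shows "FTs lborel (\<lambda>x. x) (FT \<phi>) = \<phi>"
proof
  fix \<xi>
  obtain K where "deriv_bound 0 undefined 0 K \<phi>" using assms unfolding rapid_def by blast
  then have "\<And>x. norm (\<phi> x) \<le> K" by simp
  then show "FTs lborel (\<lambda>x. x) (FT \<phi>) \<xi> = \<phi> \<xi>"
    by (rule fourier_inversion[OF rapid_cont[OF assms] _ rapid_integrable[OF assms] rapid_integrable[OF FT_rapid[OF assms]]])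
qed

text \<open>By inversion \<open>\<phi>\<close> is a superposition of characters with weight
  \<open>FT \<phi>\<close>, and on Gaussians times characters \<open>f\<close> is given by
  \<open>smoothed B\<close>. The multiplication formula moves the transform from
  \<open>\<phi>\<close> to \<open>smoothed B\<close>.\<close>

lemma f_FT_gaussian_mult:
  assumes g: "rapid (gaussian B)" and p: "rapid \<phi>" and u: "integrable lborel (smoothed B)"
  shows "f (FT (\<lambda>\<xi>. gaussian B \<xi> * \<phi> \<xi>)) = (LINT \<xi>|lborel. FT (smoothed B) \<xi> * \<phi> \<xi>)"
proof -
  have "all_moments lborel (\<lambda>x. x) (FT \<phi>)" by (rule rapid_all_moments[OF FT_rapid[OF p]]) simp
  from f_FT_gaussian_FTs[OF g this]
  have "f (FT (\<lambda>\<xi>. gaussian B \<xi> * \<phi> \<xi>)) = (LINT x|lborel. smoothed B x * FT \<phi> x)"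
    unfolding FT_inverse_rapid[OF p] by (simp add: mult.commute)
  also have "\<dots> = (LINT \<xi>|lborel. FT (smoothed B) \<xi> * \<phi> \<xi>)"
    by (rule FTs_mult_formula[OF u rapid_integrable[OF p], symmetric]) (auto simp: chi_def inner_commute)
  finally show ?thesis .
qed

text \<open>Integrated against characters, both products give \<open>f\<close> at the transform of
  the product of the two Gaussians and the character. Their difference is continuous, bounded and
  integrable with vanishing transform, so it is zero at every point by inversion.\<close>

lemma FT_smoothed_consistent:
  assumes g: "rapid (gaussian B)" "rapid (gaussian B')" and u: "integrable lborel (smoothed B)" "integrable lborel (smoothed B')"
  shows "FT (smoothed B) \<xi> * gaussian B' \<xi> = FT (smoothed B') \<xi> * gaussian B \<xi>"
proof -
  have c: "continuous_on UNIV (FT (smoothed B))" "continuous_on UNIV (FT (smoothed B'))"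
    by (intro FTs_continuous u; simp)+
  then have [measurable]: "FT (smoothed B) \<in> borel_measurable borel" "FT (smoothed B') \<in> borel_measurable borel"
    by (auto intro: borel_measurable_continuous_onI)
  have bd: "norm (FT (smoothed B) \<xi>) \<le> (LINT x|lborel. norm (smoothed B x))" "norm (FT (smoothed B') \<xi>) \<le> (LINT x|lborel. norm (smoothed B' x))" for \<xi>
    by (intro FTs_bound u; simp)+
  let ?h1 = "\<lambda>\<xi>. FT (smoothed B) \<xi> * gaussian B' \<xi>" and ?h2 = "\<lambda>\<xi>. FT (smoothed B') \<xi> * gaussian B \<xi>"
  let ?h = "\<lambda>\<xi>. ?h1 \<xi> - ?h2 \<xi>"
  have i1: "integrable lborel ?h1" by (rule integrable_bounded_mult[OF rapid_integrable[OF g(2)] _ bd(1)]) simp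
  have i2: "integrable lborel ?h2" by (rule integrable_bounded_mult[OF rapid_integrable[OF g(1)] _ bd(2)]) simp
  have ih: "integrable lborel ?h" by (rule Bochner_Integration.integrable_diff[OF i1 i2])
  have ch: "continuous_on UNIV ?h" by (intro continuous_intros c)
  have hb: "norm (?h \<xi>) \<le> (LINT x|lborel. norm (smoothed B x)) + (LINT x|lborel. norm (smoothed B' x))" for \<xi>
  proof -
    have "norm (?h1 \<xi>) \<le> (LINT x|lborel. norm (smoothed B x)) * 1" "norm (?h2 \<xi>) \<le> (LINT x|lborel. norm (smoothed B' x)) * 1"
      unfolding norm_mult by (intro mult_mono bd norm_gaussian_le Bochner_Integration.integral_nonneg; simp)+
    then show ?thesis using norm_triangle_ineq4[of "?h1 \<xi>" "?h2 \<xi>"] by simp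
  qed
  have z: "FT ?h x = 0" for x
  proof -
    have e: "FT ?h x = (LINT \<xi>|lborel. FT (smoothed B) \<xi> * (gaussian B' \<xi> * chi (- x) \<xi>)) - (LINT \<xi>|lborel. FT (smoothed B') \<xi> * (gaussian B \<xi> * chi (- x) \<xi>))"
    proof -
      have "FT ?h x = (LINT \<xi>|lborel. ?h1 \<xi> * chi x (- \<xi>) - ?h2 \<xi> * chi x (- \<xi>))"
        unfolding FTs_def[of lborel uminus ?h] by (simp only: left_diff_distrib)
      also have "\<dots> = (LINT \<xi>|lborel. ?h1 \<xi> * chi x (- \<xi>)) - (LINT \<xi>|lborel. ?h2 \<xi> * chi x (- \<xi>))"
        by (intro Bochner_Integration.integral_diff FTs_integrable i1 i2) auto
      finally show ?thesis by (simp only: mult.assoc chi_minus)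
    qed
    also have "\<dots> = f (FT (\<lambda>\<xi>. gaussian B \<xi> * (gaussian B' \<xi> * chi (- x) \<xi>))) - f (FT (\<lambda>\<xi>. gaussian B' \<xi> * (gaussian B \<xi> * chi (- x) \<xi>)))"
      by (simp only: f_FT_gaussian_mult[OF g(1) rapid_gaussian_chi[OF g(2)] u(1)] f_FT_gaussian_mult[OF g(2) rapid_gaussian_chi[OF g(1)] u(2)])
    also have "\<dots> = 0" by (simp add: mult.left_commute)
    finally show ?thesis .
  qed
  then have z': "FT ?h = (\<lambda>x. 0)" by (rule ext)
  have "FTs lborel (\<lambda>x. x) (FT ?h) \<xi> = ?h \<xi>"
    by (rule fourier_inversion[OF ch hb ih]) (simp only: z' integrable_zero)
  moreover have "FTs lborel (\<lambda>x. x) (\<lambda>x. 0) \<xi> = 0" by (simp add: FTs_def)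
  ultimately show ?thesis by (simp only: z' right_minus_eq eq_commute[of 0])
qed

text \<open>With \<open>gaussian (Bk k) * \<phi>\<close> in place of \<open>\<phi>\<close> the
  identity is \<open>f_FT_gaussian_mult\<close>, and the Gaussians tend to one. The growth bound on
  \<open>F\<close> permits dominated convergence in the integral; inside \<open>f\<close> the error
  is of the order of \<open>(\<tau> k)^2\<close>, up to a null sequence.\<close>

lemma f_FT_eq_integral:
  fixes Bk :: "nat \<Rightarrow> real^'n^'n" and F :: "real^'n \<Rightarrow> complex"
  assumes g: "\<And>k. rapid (gaussian (Bk k))" and u: "\<And>k. integrable lborel (smoothed (Bk k))"
    and t: "\<And>k x. norm (Bk k *v x) \<le> \<tau> k * norm x" "\<And>k. 0 \<le> \<tau> k" "\<tau> \<longlonglongrightarrow> 0"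
    and F: "\<And>k \<xi>. F \<xi> * gaussian (Bk k) \<xi> = FT (smoothed (Bk k)) \<xi>" and cF: "continuous_on UNIV F"
    and gr: "\<And>\<xi>. norm (F \<xi>) \<le> CF * (1 + norm \<xi>) powr MF"
    and p: "rapid \<phi>"
  shows "integrable lborel (\<lambda>\<xi>. F \<xi> * \<phi> \<xi>)" "f (FT \<phi>) = (LINT \<xi>|lborel. F \<xi> * \<phi> \<xi>)"
proof -
  have [measurable]: "F \<in> borel_measurable borel" using cF by (rule borel_measurable_continuous_onI)
  have [measurable]: "\<phi> \<in> borel_measurable borel" using rapid_borel[OF p] .
  obtain K where K: "deriv_bound 0 undefined (- 2 * real CARD('n) - MF) K \<phi>" using p unfolding rapid_def by blast
  have "deriv_bound 0 undefined MF CF F" using cF gr by simp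
  from deriv_bound_mult[OF this K] have "deriv_bound 0 undefined (- 2 * real CARD('n)) (CF * K) (\<lambda>\<xi>. F \<xi> * \<phi> \<xi>)" by simp
  then show i: "integrable lborel (\<lambda>\<xi>. F \<xi> * \<phi> \<xi>)" by (rule deriv_bound_integrable)
  have eq: "f (FT (\<lambda>\<xi>. gaussian (Bk k) \<xi> * \<phi> \<xi>)) = (LINT \<xi>|lborel. gaussian (Bk k) \<xi> * (F \<xi> * \<phi> \<xi>))" for k
    unfolding f_FT_gaussian_mult[OF g p u] F[symmetric] by (simp add: mult_ac)
  have R: "(\<lambda>k. LINT \<xi>|lborel. gaussian (Bk k) \<xi> * (F \<xi> * \<phi> \<xi>)) \<longlonglongrightarrow> (LINT \<xi>|lborel. F \<xi> * \<phi> \<xi>)"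
  proof (rule integral_dominated_convergence[where w="\<lambda>\<xi>. norm (F \<xi> * \<phi> \<xi>)"])
    show "AE \<xi> in lborel. (\<lambda>k. gaussian (Bk k) \<xi> * (F \<xi> * \<phi> \<xi>)) \<longlonglongrightarrow> F \<xi> * \<phi> \<xi>"
    proof (rule AE_I2)
      fix \<xi> :: "real^'n"
      have "(\<lambda>k. \<tau> k * norm \<xi>) \<longlonglongrightarrow> 0 * norm \<xi>" by (intro tendsto_intros t)
      then have "(\<lambda>k. \<tau> k * norm \<xi>) \<longlonglongrightarrow> 0" by simp
      then have "(\<lambda>k. norm (Bk k *v \<xi>)) \<longlonglongrightarrow> 0"
        by (rule Lim_null_comparison[rotated]) (use t(1) in simp)
      then have "(\<lambda>k. complex_of_real (exp (- pi * (norm (Bk k *v \<xi>))\<^sup>2))) \<longlonglongrightarrow> complex_of_real (exp (- pi * 0\<^sup>2))"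
        by (intro tendsto_intros)
      then have "(\<lambda>k. gaussian (Bk k) \<xi>) \<longlonglongrightarrow> 1" by (simp add: gaussian_def)
      from tendsto_mult_right[OF this, of "F \<xi> * \<phi> \<xi>"]
      show "(\<lambda>k. gaussian (Bk k) \<xi> * (F \<xi> * \<phi> \<xi>)) \<longlonglongrightarrow> F \<xi> * \<phi> \<xi>" by simp
    qed
    show "AE \<xi> in lborel. norm (gaussian (Bk k) \<xi> * (F \<xi> * \<phi> \<xi>)) \<le> norm (F \<xi> * \<phi> \<xi>)" for k
      using mult_right_mono[OF norm_gaussian_le norm_ge_zero] unfolding norm_mult[of "gaussian _ _"] by (intro AE_I2) simp
  qed (use i in auto)
  obtain C m M where C: "0 \<le> C" and bd: "\<And>v K. 0 < K \<Longrightarrow> rapid v \<Longrightarrow> (\<forall>j. deriv_bound m j (- M) K v) \<Longrightarrow> norm (f (FT v)) \<le> C * K"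
    using tempered_bound[OF f] by blast
  obtain K0 where K0: "\<forall>j. deriv_bound m j (- M - (real m + 2)) K0 \<phi>" using rapidD[OF p] by blast
  have K00: "0 \<le> K0" using K0 deriv_bound_K_nonneg by blast
  let ?G = "pi + gaussian_const (Suc m)"
  have G0: "0 \<le> ?G" using gaussian_const_ge1[of "Suc m"] pi_gt3 by linarith
  let ?K = "\<lambda>k. 2 ^ m * (?G * (\<tau> k)\<^sup>2 * K0) + 1 / real (Suc k)"
  have L: "norm (f (FT \<phi>) - f (FT (\<lambda>\<xi>. gaussian (Bk k) \<xi> * \<phi> \<xi>))) \<le> C * ?K k" if t1: "\<tau> k \<le> 1" for k
  proof -
    have r1: "rapid (\<lambda>\<xi>. gaussian (Bk k) \<xi> * \<phi> \<xi>)"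
      by (rule rapid_mult[OF g]) (use p in \<open>auto simp: rapid_def\<close>)
    have e: "(1 - gaussian (Bk k) \<xi>) * \<phi> \<xi> = \<phi> \<xi> - gaussian (Bk k) \<xi> * \<phi> \<xi>" for \<xi> by (simp add: left_diff_distrib)
    have r: "rapid (\<lambda>\<xi>. (1 - gaussian (Bk k) \<xi>) * \<phi> \<xi>)" unfolding e by (rule rapid_diff[OF p r1])
    have "deriv_bound m j (- M) (?K k) (\<lambda>\<xi>. (1 - gaussian (Bk k) \<xi>) * \<phi> \<xi>)" for j
      using deriv_bound_mult[OF deriv_bound_one_minus_gaussian[OF t(1) t(2) t1] K0[rule_format, of j]] by (rule deriv_bound_mono) auto
    moreover have "0 < ?K k" using K00 G0 by (intro add_nonneg_pos mult_nonneg_nonneg) auto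
    ultimately have "norm (f (FT (\<lambda>\<xi>. (1 - gaussian (Bk k) \<xi>) * \<phi> \<xi>))) \<le> C * ?K k" using bd r by blast
    then show ?thesis unfolding e f_FT_diff[OF p r1] .
  qed
  \<comment> \<open>The derivative bounds for the Gaussians require \<open>\<tau> k \<le> 1\<close>,
    which holds eventually.\<close>
  have ev: "\<forall>\<^sub>F k in sequentially. \<tau> k \<le> 1"
    using order_tendstoD(2)[OF t(3), of 1] by (auto elim: eventually_mono)
  have "(\<lambda>k. C * ?K k) \<longlonglongrightarrow> C * (2 ^ m * (?G * 0\<^sup>2 * K0) + 0)"
    by (intro tendsto_intros t(3) eps_seq)
  then have "(\<lambda>k. C * ?K k) \<longlonglongrightarrow> 0" by simp
  then have "(\<lambda>k. f (FT \<phi>) - f (FT (\<lambda>\<xi>. gaussian (Bk k) \<xi> * \<phi> \<xi>))) \<longlonglongrightarrow> 0"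
    by (rule Lim_null_comparison[rotated]) (use ev L in \<open>auto elim: eventually_mono\<close>)
  from tendsto_diff[OF tendsto_const[of "f (FT \<phi>)"] this]
  have "(\<lambda>k. f (FT (\<lambda>\<xi>. gaussian (Bk k) \<xi> * \<phi> \<xi>))) \<longlonglongrightarrow> f (FT \<phi>)" by simp
  then show "f (FT \<phi>) = (LINT \<xi>|lborel. F \<xi> * \<phi> \<xi>)"
    using R unfolding eq by (rule LIMSEQ_unique)
qed

end

section \<open>Sums over shells\<close>

text \<open>Sums over all integers as integrals for the counting measure: they need no convergence
  conditions and can be interchanged with each other and with integrals.\<close>

abbreviation isum :: "(int \<Rightarrow> ennreal) \<Rightarrow> ennreal" where
  "isum f \<equiv> integral\<^sup>N (count_space UNIV) f"

lemma powr_uminus_less_one: "1 < x \<Longrightarrow> 0 < y \<Longrightarrow> x powr (- y) < 1" for x y :: real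
  using powr_less_mono[of "- y" 0 x] by simp

lemma isum_reflect: "isum (\<lambda>j. f (- j)) = isum f"
  by (rule nn_integral_bij_count_space) (auto simp: bij_def inj_def surj_def intro: exI[of _ "- _"])

lemma geometric_growth:
  fixes a :: "int \<Rightarrow> real"
  assumes g: "\<And>j. \<sigma> * a j \<le> a (j + 1)" and s: "1 < \<sigma>"
  shows "\<sigma> ^ n * a j \<le> a (j + int n)"
proof (induction n)
  case (Suc n)
  have "\<sigma> ^ Suc n * a j = \<sigma> * (\<sigma> ^ n * a j)" by simp
  also have "\<dots> \<le> \<sigma> * a (j + int n)" using Suc s by (intro mult_left_mono) auto
  also have "\<dots> \<le> a (j + int n + 1)" by (rule g)
  finally show ?case by (simp add: algebra_simps)
qed simp

text \<open>Growth makes the indices with \<open>a j \<le> x\<close> a half-line with a last element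
  \<open>J\<close>, if there are any, and going down from \<open>J\<close> by \<open>k\<close> steps
  divides the value at least by \<open>\<sigma> ^ k\<close>. The sum is dominated by a geometric
  series.\<close>

lemma geom_sum_below:
  fixes a :: "int \<Rightarrow> real"
  assumes pos: "\<And>j. 0 < a j" and g: "\<And>j. \<sigma> * a j \<le> a (j + 1)" and s: "1 < \<sigma>" and x: "0 < x"
  shows "isum (\<lambda>j. ennreal (if a j \<le> x then a j else 0)) \<le> ennreal (x / (1 - 1 / \<sigma>))"
proof (cases "\<exists>j. a j \<le> x")
  case False
  then have "(\<lambda>j. ennreal (if a j \<le> x then a j else 0)) = (\<lambda>j. 0)" by auto
  then show ?thesis by simp
next
  case True
  then obtain j0 where j0: "a j0 \<le> x" by blast
  have gr: "\<sigma> ^ n * a j \<le> a (j + int n)" for n j by (rule geometric_growth[where a=a and \<sigma>=\<sigma>, OF g s])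
  obtain n0 where n0: "x / a j0 < \<sigma> ^ n0" using s real_arch_pow by blast
  then have "x < a (j0 + int n0)" using gr[of n0 j0] pos[of j0] by (simp add: divide_less_eq)
  then have ex: "\<exists>n. x < a (j0 + int n)" by blast
  define n where "n = (LEAST n. x < a (j0 + int n))"
  have n1: "x < a (j0 + int n)" unfolding n_def using ex by (rule LeastI_ex)
  have n0: "n \<noteq> 0" using n1 j0 by (cases n) auto
  then have n2: "a (j0 + int (n - 1)) \<le> x"
    using not_less_Least[of "n - 1" "\<lambda>n. x < a (j0 + int n)"] unfolding n_def[symmetric] by simp
  define J where "J = j0 + int (n - 1)"
  have J: "a J \<le> x" "x < a (J + 1)" using n1 n2 n0 by (auto simp: J_def of_nat_diff algebra_simps)
  have up: "x < a j" if "J < j" for j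
  proof -
    have "1 * a (J + 1) \<le> \<sigma> ^ nat (j - (J + 1)) * a (J + 1)"
      using pos[of "J + 1"] s by (intro mult_right_mono one_le_power) auto
    also have "\<dots> \<le> a (J + 1 + int (nat (j - (J + 1))))" by (rule gr)
    also have "J + 1 + int (nat (j - (J + 1))) = j" using that by simp
    finally show ?thesis using J by simp
  qed
  have dn: "a (J - int k) \<le> x * (1 / \<sigma>) ^ k" for k
    using gr[of k "J - int k"] J(1) s by (simp add: field_simps power_divide)
  let ?f = "\<lambda>j. ennreal (if a j \<le> x then a j else 0)"
  have "isum ?f = isum (\<lambda>j. ?f j * indicator {..J} j)"
  proof (rule nn_integral_cong)
    fix j
    show "?f j = ?f j * indicator {..J} j" using up[of j] by (cases "j \<le> J") auto
  qed
  also have "\<dots> = (\<integral>\<^sup>+j. ?f j \<partial>count_space {..J})"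
    by (rule nn_integral_count_space_indicator[symmetric]) simp
  also have "\<dots> = (\<integral>\<^sup>+k. ?f (J - int k) \<partial>count_space UNIV)"
  proof (rule nn_integral_bij_count_space[symmetric])
    show "bij_betw (\<lambda>k. J - int k) UNIV {..J}"
      by (rule bij_betwI[where g="\<lambda>j. nat (J - j)"]) auto
  qed
  also have "\<dots> = (\<Sum>k. ?f (J - int k))" by (rule nn_integral_count_space_nat)
  also have "\<dots> \<le> (\<Sum>k. ennreal (x * (1 / \<sigma>) ^ k))"
  proof (rule suminf_le)
    fix k
    have "0 \<le> x * (1 / \<sigma>) ^ k" using x s by simp
    then show "?f (J - int k) \<le> ennreal (x * (1 / \<sigma>) ^ k)" using dn[of k] by (auto intro: ennreal_leI)
  qed auto
  also have "\<dots> = ennreal (x * (1 / (1 - 1 / \<sigma>)))"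
  proof (rule suminf_ennreal_eq)
    show "(\<lambda>k. x * (1 / \<sigma>) ^ k) sums (x * (1 / (1 - 1 / \<sigma>)))"
      using s by (intro sums_mult geometric_sums) auto
  qed (use x s in auto)
  finally show ?thesis by simp
qed

text \<open>The reflection of \<open>j\<close> to \<open>- j\<close> turns the negative powers into
  a sequence growing by the factor \<open>\<sigma> powr \<alpha>\<close>, to which
  \<open>geom_sum_below\<close> applies.\<close>

lemma geom_sum_above:
  fixes a :: "int \<Rightarrow> real"
  assumes pos: "\<And>j. 0 < a j" and g: "\<And>j. \<sigma> * a j \<le> a (j + 1)" and s: "1 < \<sigma>" and x: "0 < x" and al: "0 < \<alpha>"
  shows "isum (\<lambda>j. ennreal (if x \<le> a j then a j powr (- \<alpha>) else 0)) \<le> ennreal (x powr (- \<alpha>) / (1 - \<sigma> powr (- \<alpha>)))"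
proof -
  let ?a = "\<lambda>j. a (- j) powr (- \<alpha>)"
  have "isum (\<lambda>j. ennreal (if x \<le> a j then a j powr (- \<alpha>) else 0)) = isum (\<lambda>j. ennreal (if x \<le> a (- j) then ?a j else 0))"
    by (rule isum_reflect[symmetric])
  also have "\<dots> \<le> isum (\<lambda>j. ennreal (if ?a j \<le> x powr (- \<alpha>) then ?a j else 0))"
  proof (intro nn_integral_mono ennreal_leI)
    fix j
    have "?a j \<le> x powr (- \<alpha>)" if "x \<le> a (- j)" using that x al by (intro powr_mono2') auto
    then show "(if x \<le> a (- j) then ?a j else 0) \<le> (if ?a j \<le> x powr (- \<alpha>) then ?a j else 0)" by auto
  qed
  also have "\<dots> \<le> ennreal (x powr (- \<alpha>) / (1 - 1 / (\<sigma> powr \<alpha>)))"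
  proof (rule geom_sum_below)
    show "0 < ?a j" for j using pos[of "- j"] by simp
    show "1 < \<sigma> powr \<alpha>" using s al by (intro gr_one_powr)
    show "0 < x powr (- \<alpha>)" using x by simp
    fix j
    have "\<sigma> * a (- (j + 1)) \<le> a (- j)" using g[of "- (j + 1)"] by simp
    then have "(a (- j)) powr (- \<alpha>) \<le> (\<sigma> * a (- (j + 1))) powr (- \<alpha>)"
      using pos[of "- (j + 1)"] s al by (intro powr_mono2') auto
    also have "\<dots> = \<sigma> powr (- \<alpha>) * ?a (j + 1)" using s pos[of "- (j + 1)"] by (simp add: powr_mult)
    finally have "\<sigma> powr \<alpha> * ?a j \<le> \<sigma> powr \<alpha> * (\<sigma> powr (- \<alpha>) * ?a (j + 1))" by (rule mult_left_mono) simp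
    then show "\<sigma> powr \<alpha> * ?a j \<le> ?a (j + 1)"
      using s unfolding mult.assoc[symmetric] powr_add[symmetric] by simp
  qed
  finally show ?thesis by (simp add: powr_minus_divide)
qed

text \<open>Terms with \<open>\<tau> j \<le> x\<close> equal \<open>\<tau> j powr p\<close> and are
  summed up to the threshold; the others equal \<open>x^2 * \<tau> j powr (p - 2)\<close> and
  decrease geometrically because \<open>p < 2\<close>. Both sums are of the size of
  \<open>x powr p\<close>.\<close>

lemma min_square_sum:
  fixes \<tau> :: "int \<Rightarrow> real"
  assumes pos: "\<And>j. 0 < \<tau> j" and g: "\<And>j. \<sigma> * \<tau> j \<le> \<tau> (j + 1)" and s: "1 < \<sigma>" and p: "0 < p" "p < 2" and x: "0 \<le> x"
  shows "isum (\<lambda>j. ennreal (\<tau> j powr (p - 2) * (min x (\<tau> j))\<^sup>2))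
    \<le> ennreal ((1 / (1 - \<sigma> powr (- p)) + 1 / (1 - \<sigma> powr (- (2 - p)))) * x powr p)"
proof (cases "x = 0")
  case True
  then have "min x (\<tau> j) = 0" for j using pos[of j] by simp
  then show ?thesis by simp
next
  case False
  then have x: "0 < x" using x by simp
  let ?c1 = "1 / (1 - \<sigma> powr (- p))" and ?c2 = "1 / (1 - \<sigma> powr (- (2 - p)))"
  have lt1: "\<sigma> powr (- p) < 1" "\<sigma> powr (- (2 - p)) < 1" using powr_uminus_less_one[OF s, of p] powr_uminus_less_one[OF s, of "2 - p"] p by auto
  have c: "0 \<le> ?c1" "0 \<le> ?c2" using lt1 by auto
  have "isum (\<lambda>j. ennreal (\<tau> j powr (p - 2) * (min x (\<tau> j))\<^sup>2))
    \<le> isum (\<lambda>j. ennreal (if \<tau> j powr p \<le> x powr p then \<tau> j powr p else 0) + ennreal (x\<^sup>2) * ennreal (if x \<le> \<tau> j then \<tau> j powr (- (2 - p)) else 0))"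
  proof (rule nn_integral_mono)
    fix j
    show "ennreal (\<tau> j powr (p - 2) * (min x (\<tau> j))\<^sup>2) \<le> ennreal (if \<tau> j powr p \<le> x powr p then \<tau> j powr p else 0) + ennreal (x\<^sup>2) * ennreal (if x \<le> \<tau> j then \<tau> j powr (- (2 - p)) else 0)"
    proof (cases "\<tau> j \<le> x")
      case True
      then have "\<tau> j powr p \<le> x powr p" using pos[of j] p by (intro powr_mono2) auto
      moreover have "\<tau> j powr (p - 2) * (min x (\<tau> j))\<^sup>2 = \<tau> j powr p"
      proof -
        have "\<tau> j powr p = \<tau> j powr (p - 2) * \<tau> j powr 2" using powr_add[of "\<tau> j" "p - 2" 2] by simp
        then show ?thesis using True pos[of j] by (simp add: min_absorb2)
      qed
      ultimately show ?thesis by simp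
    next
      case False
      then have "ennreal (\<tau> j powr (p - 2) * (min x (\<tau> j))\<^sup>2) = ennreal (x\<^sup>2) * ennreal (\<tau> j powr (- (2 - p)))"
        by (simp add: min_absorb1 ennreal_mult'[symmetric] mult.commute)
      with False show ?thesis by simp
    qed
  qed
  also have "\<dots> = isum (\<lambda>j. ennreal (if \<tau> j powr p \<le> x powr p then \<tau> j powr p else 0)) + ennreal (x\<^sup>2) * isum (\<lambda>j. ennreal (if x \<le> \<tau> j then \<tau> j powr (- (2 - p)) else 0))"
    by (simp add: nn_integral_add nn_integral_cmult)
  also have "\<dots> \<le> ennreal (x powr p / (1 - 1 / \<sigma> powr p)) + ennreal (x\<^sup>2) * ennreal (x powr (- (2 - p)) / (1 - \<sigma> powr (- (2 - p))))"
  proof (intro add_mono mult_left_mono)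
    show "isum (\<lambda>j. ennreal (if \<tau> j powr p \<le> x powr p then \<tau> j powr p else 0)) \<le> ennreal (x powr p / (1 - 1 / \<sigma> powr p))"
    proof (rule geom_sum_below)
      fix j
      show "0 < \<tau> j powr p" using pos[of j] by simp
      have "(\<sigma> * \<tau> j) powr p \<le> \<tau> (j + 1) powr p" using g[of j] s pos[of j] p by (intro powr_mono2) auto
      then show "\<sigma> powr p * \<tau> j powr p \<le> \<tau> (j + 1) powr p" using s pos[of j] by (simp add: powr_mult)
    qed (use s p x in \<open>auto intro: gr_one_powr\<close>)
    show "isum (\<lambda>j. ennreal (if x \<le> \<tau> j then \<tau> j powr (- (2 - p)) else 0)) \<le> ennreal (x powr (- (2 - p)) / (1 - \<sigma> powr (- (2 - p))))"
      by (rule geom_sum_above[where a=\<tau> and \<sigma>=\<sigma>, OF pos g s x]) (use p in simp)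
  qed auto
  also have "\<dots> = ennreal ((?c1 + ?c2) * x powr p)"
  proof -
    have "x\<^sup>2 * x powr (- (2 - p)) = x powr p"
    proof -
      have "x\<^sup>2 = x powr 2" using x by (simp add: powr_numeral)
      then show ?thesis by (simp add: powr_add[symmetric])
    qed
    then have "x\<^sup>2 * (x powr (- (2 - p)) / (1 - \<sigma> powr (- (2 - p)))) = ?c2 * x powr p" by (simp only: times_divide_eq_right) simp
    moreover have "x powr p / (1 - 1 / \<sigma> powr p) = ?c1 * x powr p" by (simp add: powr_minus_divide)
    moreover have "ennreal (x\<^sup>2) * ennreal (x powr (- (2 - p)) / (1 - \<sigma> powr (- (2 - p)))) = ennreal (x\<^sup>2 * (x powr (- (2 - p)) / (1 - \<sigma> powr (- (2 - p)))))"
      by (rule ennreal_mult'[symmetric]) simp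
    ultimately have "ennreal (x powr p / (1 - 1 / \<sigma> powr p)) + ennreal (x\<^sup>2) * ennreal (x powr (- (2 - p)) / (1 - \<sigma> powr (- (2 - p)))) = ennreal (?c1 * x powr p) + ennreal (?c2 * x powr p)"
      by (simp only:)
    also have "\<dots> = ennreal (?c1 * x powr p + ?c2 * x powr p)" using c by (intro ennreal_plus[symmetric] mult_nonneg_nonneg) auto
    finally show ?thesis by (simp only: distrib_right)
  qed
  finally show ?thesis .
qed

text \<open>The numbers \<open>\<tau> j\<close> dominate the decreasing rearrangement of \<open>h\<close> at \<open>b powr - j\<close>. The last
  clause, which makes a Franke--Jawerth type summation possible, is obtained by enlarging them so
  that they grow at least geometrically.\<close>

definition rearrangement_seq :: "'a measure \<Rightarrow> real \<Rightarrow> real \<Rightarrow> real \<Rightarrow> ('a \<Rightarrow> real) \<Rightarrow> (int \<Rightarrow> real) \<Rightarrow> bool" where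
  "rearrangement_seq M b p C h \<tau> \<longleftrightarrow> (\<forall>j. 0 < \<tau> j) \<and> (\<forall>j\<ge>0. 1 \<le> \<tau> j)
    \<and> (\<forall>j s. 0 < s \<longrightarrow> ennreal (b powr (- real_of_int j)) \<le> emeasure M {x \<in> space M. s \<le> h x} \<longrightarrow> s \<le> \<tau> j)
    \<and> isum (\<lambda>j. ennreal (b powr (- real_of_int j) * \<tau> j powr p)) \<le> ennreal C
    \<and> (\<forall>x\<ge>0. isum (\<lambda>j. ennreal (\<tau> j powr (p - 2) * (min x (\<tau> j))\<^sup>2)) \<le> ennreal (C * x powr p))"

text \<open>\<open>\<tau> j\<close> is the \<open>p\<close>-th root of a sum \<open>S j\<close> over
  those dyadic heights \<open>2 powr m\<close> whose superlevel sets have measure at least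
  \<open>b powr (- j)\<close>. The square root in the summand \<open>t m j\<close> forces growth by
  the factor \<open>b powr (1/2)\<close> from one scale to the next, yet is weak enough for the sum
  against \<open>b powr (- j)\<close> to converge.\<close>

lemma rearrangement_seq_exists:
  fixes b p :: real
  assumes b: "1 < b" and p: "0 < p" "p < 2"
  shows "\<exists>C>0. \<forall>h. h \<in> borel_measurable M \<longrightarrow> (\<forall>x. 0 \<le> h x) \<longrightarrow> (\<integral>\<^sup>+x. ennreal (h x powr p) \<partial>M) \<le> 1
    \<longrightarrow> Ex (rearrangement_seq M b p C h)"
proof -
  \<comment> \<open>\<open>S\<close> grows by the factor \<open>b powr (1/2)\<close> per scale,
    hence its \<open>p\<close>-th root by \<open>?\<sigma>\<close>.\<close>
  let ?\<sigma> = "b powr (1 / (2 * p))"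
  have s1: "1 < ?\<sigma>" using b p by (intro gr_one_powr) auto
  define C1 where "C1 = 1 / (1 - ?\<sigma> powr (- p)) + 1 / (1 - ?\<sigma> powr (- (2 - p)))"
  have C1: "0 \<le> C1" unfolding C1_def
  proof (intro add_nonneg_nonneg)
    have "?\<sigma> powr (- p) < 1" "?\<sigma> powr (- (2 - p)) < 1" using powr_uminus_less_one[OF s1, of p] powr_uminus_less_one[OF s1, of "2 - p"] p by auto
    then show "0 \<le> 1 / (1 - ?\<sigma> powr (- p))" "0 \<le> 1 / (1 - ?\<sigma> powr (- (2 - p)))" by auto
  qed
  let ?g = "1 / (1 - b powr (- (1/2)))"
  have g0: "0 \<le> ?g" using powr_uminus_less_one[OF b, of "1/2"] by auto
  let ?g1 = "1 / (1 - 1 / b)"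
  have g1: "0 \<le> ?g1" using b by simp
  let ?h2 = "1 / (1 - 1 / 2 powr p)"
  have "1 < (2::real) powr p" using p by (intro gr_one_powr) auto
  then have h20: "0 \<le> ?h2" by simp
  define C2 where "C2 = (?g1 + ?g) + ?g * 2 powr p * ?h2"
  have C2: "0 \<le> C2" unfolding C2_def using g0 g1 h20 by (intro add_nonneg_nonneg mult_nonneg_nonneg) auto
  \<comment> \<open>A floor for \<open>S\<close>: it makes all values positive, even for
    \<open>h = 0\<close>, and at least one for \<open>0 \<le> j\<close>. It grows at least by
    \<open>b powr (1/2)\<close> per step, while \<open>b powr (- j) * e j\<close> is
    \<open>b powr (- j / 2)\<close> on the nonnegative and \<open>b powr j\<close> on the negative
    side, so it is summable.\<close>
  define e where "e j = (if 0 \<le> j then b powr (j / 2) else b powr (2 * j))" for j :: int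
  have epos: "0 < e j" for j using b by (simp add: e_def)
  have egr: "b powr (1/2) * e j \<le> e (j + 1)" for j
  proof -
    consider "0 \<le> j" | "j = -1" | "j < -1" by linarith
    then show ?thesis
      by cases (use b powr_uminus_less_one[OF b, of "3/2"] in \<open>auto simp: e_def powr_add[symmetric] add_divide_distrib intro!: powr_mono\<close>)
  qed
  have esum: "isum (\<lambda>j. ennreal (b powr (- real_of_int j) * e j)) \<le> ennreal (?g1 + ?g)"
  proof -
    have "isum (\<lambda>j. ennreal (b powr (- real_of_int j) * e j)) \<le> isum (\<lambda>j. ennreal (if b powr j \<le> 1 then b powr j else 0) + ennreal (if 1 \<le> b powr j then (b powr j) powr (- (1/2)) else 0))"
    proof (rule nn_integral_mono)
      fix j :: int
      show "ennreal (b powr (- real_of_int j) * e j) \<le> ennreal (if b powr j \<le> 1 then b powr j else 0) + ennreal (if 1 \<le> b powr j then (b powr j) powr (- (1/2)) else 0)"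
      proof (cases "0 \<le> j")
        case True
        then have "1 \<le> b powr j" using b by (intro ge_one_powr_ge_zero) auto
        moreover have "b powr (- real_of_int j) * e j = (b powr j) powr (- (1/2))"
          using True by (simp add: e_def powr_powr powr_add[symmetric])
        ultimately show ?thesis by (simp add: ennreal_plus[symmetric] del: ennreal_plus)
      next
        case False
        then have "b powr j \<le> b powr 0" using b by (intro powr_mono) auto
        then have "b powr j \<le> 1" using b by simp
        moreover have "b powr (- real_of_int j) * e j = b powr j"
          using False by (simp add: e_def powr_add[symmetric])
        ultimately show ?thesis by simp
      qed
    qed
    also have "\<dots> = isum (\<lambda>j. ennreal (if b powr j \<le> 1 then b powr j else 0)) + isum (\<lambda>j. ennreal (if 1 \<le> b powr j then (b powr j) powr (- (1/2)) else 0))"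
      by (simp add: nn_integral_add)
    also have "\<dots> \<le> ennreal (1 / (1 - 1 / b)) + ennreal (1 powr (- (1/2)) / (1 - b powr (- (1/2))))"
    proof (rule add_mono)
      show "isum (\<lambda>j. ennreal (if b powr j \<le> 1 then b powr j else 0)) \<le> ennreal (1 / (1 - 1 / b))"
        by (rule geom_sum_below) (use b in \<open>auto simp: powr_add mult.commute\<close>)
      show "isum (\<lambda>j. ennreal (if 1 \<le> b powr j then (b powr j) powr (- (1/2)) else 0)) \<le> ennreal (1 powr (- (1/2)) / (1 - b powr (- (1/2))))"
        by (rule geom_sum_above[where a="\<lambda>j::int. b powr j"]) (use b in \<open>auto simp: powr_add mult.commute\<close>)
    qed
    also have "\<dots> = ennreal (?g1 + ?g)" using g0 g1 by (simp add: ennreal_plus[symmetric] del: ennreal_plus)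
    finally show ?thesis .
  qed
  define C where "C = max 1 (max C1 C2)"
  have C: "0 < C" "C1 \<le> C" "C2 \<le> C" by (auto simp: C_def)
  have main: "Ex (rearrangement_seq M b p C h)"
    if hm[measurable]: "h \<in> borel_measurable M" and h0: "\<And>x. 0 \<le> h x" and hi: "(\<integral>\<^sup>+x. ennreal (h x powr p) \<partial>M) \<le> 1" for h
  proof -
    define A where "A m = {x \<in> space M. 2 powr m \<le> h x}" for m :: int
    have Am[measurable]: "A m \<in> sets M" for m unfolding A_def by measurable
    define \<mu> where "\<mu> m = measure M (A m)" for m
    have Afin: "emeasure M (A m) < \<infinity>" for m
    proof -
      have "ennreal (2 powr (p * m)) * emeasure M (A m) = (\<integral>\<^sup>+x. ennreal (2 powr (p * m)) * indicator (A m) x \<partial>M)"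
        by (simp add: nn_integral_cmult)
      also have "\<dots> \<le> (\<integral>\<^sup>+x. ennreal (h x powr p) \<partial>M)"
      proof (rule nn_integral_mono)
        fix x
        show "ennreal (2 powr (p * m)) * indicator (A m) x \<le> ennreal (h x powr p)"
        proof (cases "x \<in> A m")
          case True
          then have "(2 powr m) powr p \<le> h x powr p" using p by (intro powr_mono2) (auto simp: A_def)
          with True show ?thesis by (simp add: powr_powr mult.commute)
        qed simp
      qed
      finally have "ennreal (2 powr (p * m)) * emeasure M (A m) \<le> 1" using hi by simp
      then show ?thesis by (auto simp: ennreal_mult_eq_top_iff top.not_eq_extremum[symmetric] top_unique)
    qed
    have \<mu>e: "emeasure M (A m) = ennreal (\<mu> m)" for m
      unfolding \<mu>_def using Afin[of m] by (intro emeasure_eq_ennreal_measure) auto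
    have \<mu>0: "0 \<le> \<mu> m" for m by (simp add: \<mu>_def)
    \<comment> \<open>The condition says that \<open>A m\<close> has measure at least
      \<open>b powr (- j)\<close>. The exponent uses \<open>m + 1\<close> because a height between
      two consecutive powers of two has to be dominated by the upper one.\<close>
    define t where "t m j = (if 1 \<le> b powr j * \<mu> m then 2 powr (p * (m + 1)) * sqrt (b powr j * \<mu> m) else 0)" for m j :: int
    have t0: "0 \<le> t m j" for m j using \<mu>0 b by (simp add: t_def)
    have tgr: "b powr (1/2) * t m j \<le> t m (j + 1)" for m j
    proof (cases "1 \<le> b powr j * \<mu> m")
      case True
      have e1: "b powr real_of_int (j + 1) * \<mu> m = b * (b powr j * \<mu> m)" using b by (simp add: powr_add mult_ac)
      have "1 * 1 \<le> b * (b powr j * \<mu> m)" using True b by (intro mult_mono) auto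
      then have "1 \<le> b powr real_of_int (j + 1) * \<mu> m" unfolding e1 by simp
      then have "t m (j + 1) = 2 powr (p * (m + 1)) * sqrt (b * (b powr j * \<mu> m))" by (simp only: t_def if_True e1)
      moreover have "sqrt (b * (b powr j * \<mu> m)) = b powr (1/2) * sqrt (b powr j * \<mu> m)"
        using b by (simp add: real_sqrt_mult powr_half_sqrt)
      ultimately show ?thesis using True by (simp add: t_def)
    qed (simp add: t_def t0[unfolded t_def])
    define S where "S j = ennreal (e j) + isum (\<lambda>m. ennreal (t m j))" for j
    have Ssum: "isum (\<lambda>j. ennreal (b powr (- real_of_int j)) * S j) \<le> ennreal C2"
    proof -
      \<comment> \<open>For fixed \<open>m\<close> this is a geometric series that starts where
        \<open>b powr j * \<mu> m\<close> reaches one; what remains is a multiple of the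
        \<open>m\<close>-th layer \<open>2 powr (p * m) * \<mu> m\<close>.\<close>
      have inner: "isum (\<lambda>j. ennreal (b powr (- real_of_int j)) * ennreal (t m j)) \<le> ennreal (?g * 2 powr p * (2 powr (p * m) * \<mu> m))" for m
      proof (cases "\<mu> m = 0")
        case True
        then show ?thesis by (simp add: t_def)
      next
        case False
        then have mp: "0 < \<mu> m" using \<mu>0[of m] by simp
        have "isum (\<lambda>j. ennreal (b powr (- real_of_int j)) * ennreal (t m j))
          = isum (\<lambda>j. ennreal (2 powr (p * (m + 1)) * \<mu> m) * ennreal (if 1 \<le> b powr j * \<mu> m then (b powr j * \<mu> m) powr (- (1/2)) else 0))"
        proof (rule nn_integral_cong)
          fix j :: int
          show "ennreal (b powr (- real_of_int j)) * ennreal (t m j) = ennreal (2 powr (p * (m + 1)) * \<mu> m) * ennreal (if 1 \<le> b powr j * \<mu> m then (b powr j * \<mu> m) powr (- (1/2)) else 0)"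
          proof (cases "1 \<le> b powr j * \<mu> m")
            case True
            let ?y = "b powr j * \<mu> m"
            have y: "0 < ?y" using True by linarith
            have "sqrt ?y = ?y * ?y powr (- (1/2))"
              using y by (simp add: powr_minus powr_half_sqrt real_div_sqrt flip: divide_inverse)
            then have "b powr (- real_of_int j) * t m j = b powr (- real_of_int j) * (2 powr (p * (m + 1)) * (?y * ?y powr (- (1/2))))" using True by (simp only: t_def if_True)
            also have "\<dots> = (b powr (- real_of_int j) * b powr j) * (2 powr (p * (m + 1)) * \<mu> m * ?y powr (- (1/2)))" by (simp only: mult_ac)
            also have "b powr (- real_of_int j) * b powr j = 1" using b by (simp add: powr_add[symmetric])
            finally have "b powr (- real_of_int j) * t m j = 2 powr (p * (m + 1)) * \<mu> m * ?y powr (- (1/2))" by simp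
            with True show ?thesis using mp by (simp add: ennreal_mult'[symmetric])
          next
            case False
            then show ?thesis by (simp only: t_def if_False ennreal_0 mult_zero_right)
          qed
        qed
        also have "\<dots> = ennreal (2 powr (p * (m + 1)) * \<mu> m) * isum (\<lambda>j. ennreal (if 1 \<le> b powr j * \<mu> m then (b powr j * \<mu> m) powr (- (1/2)) else 0))"
          by (rule nn_integral_cmult) simp
        also have "\<dots> \<le> ennreal (2 powr (p * (m + 1)) * \<mu> m) * ennreal (1 powr (- (1/2)) / (1 - b powr (- (1/2))))"
          by (intro mult_left_mono geom_sum_above[where a="\<lambda>j::int. b powr j * \<mu> m"]) (use b mp in \<open>auto simp: powr_add\<close>)
        also have "\<dots> = ennreal (?g * 2 powr p * (2 powr (p * m) * \<mu> m))"
        proof -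
          have "2 powr (p * (m + 1)) * \<mu> m * (1 powr (- (1/2)) / (1 - b powr (- (1/2)))) = ?g * 2 powr p * (2 powr (p * m) * \<mu> m)"
            by (simp add: distrib_left powr_add)
          moreover have "0 \<le> 2 powr (p * (m + 1)) * \<mu> m" "0 \<le> 1 powr (- (1/2)) / (1 - b powr (- (1/2)))" using mp g0 by simp_all
          ultimately show ?thesis by (simp only: ennreal_mult[symmetric])
        qed
        finally show ?thesis .
      qed
      \<comment> \<open>Dyadic layer cake: at a point \<open>x\<close> the \<open>p\<close>-th
        powers of the dyadic heights below \<open>h x\<close> form a geometric series, bounded by a
        multiple of \<open>h x powr p\<close>.\<close>
      have layer: "isum (\<lambda>m. ennreal (2 powr (p * m) * \<mu> m)) \<le> ennreal ?h2"
      proof -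
        have "isum (\<lambda>m. ennreal (2 powr (p * m) * \<mu> m)) = isum (\<lambda>m. \<integral>\<^sup>+x. ennreal (2 powr (p * m)) * indicator (A m) x \<partial>M)"
          by (simp add: nn_integral_cmult \<mu>e ennreal_mult')
        also have "\<dots> = (\<integral>\<^sup>+x. isum (\<lambda>m. ennreal (2 powr (p * m)) * indicator (A m) x) \<partial>M)"
          by (rule nn_integral_count_space_nn_integral[symmetric]) auto
        also have "\<dots> \<le> (\<integral>\<^sup>+x. ennreal ?h2 * ennreal (h x powr p) \<partial>M)"
        proof (rule nn_integral_mono)
          fix x
          show "isum (\<lambda>m. ennreal (2 powr (p * m)) * indicator (A m) x) \<le> ennreal ?h2 * ennreal (h x powr p)"
          proof (cases "0 < h x")
            case False
            then have "h x = 0" using h0[of x] by simp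
            then have "indicator (A m) x = (0::ennreal)" for m by (simp add: A_def indicator_def)
            then show ?thesis by simp
          next
            case True
            have "isum (\<lambda>m. ennreal (2 powr (p * m)) * indicator (A m) x) \<le> isum (\<lambda>m. ennreal (if 2 powr (p * m) \<le> h x powr p then 2 powr (p * m) else 0))"
            proof (rule nn_integral_mono)
              fix m :: int
              have "2 powr (p * m) \<le> h x powr p" if "2 powr m \<le> h x"
                using powr_mono2[of p "2 powr m" "h x"] that p by (simp add: powr_powr mult.commute)
              then show "ennreal (2 powr (p * m)) * indicator (A m) x \<le> ennreal (if 2 powr (p * m) \<le> h x powr p then 2 powr (p * m) else 0)"
                by (auto simp: A_def indicator_def)
            qed
            also have "\<dots> \<le> ennreal (h x powr p / (1 - 1 / 2 powr p))"
              by (rule geom_sum_below) (use True \<open>1 < 2 powr p\<close> in \<open>auto simp: distrib_left powr_add\<close>)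
            also have "\<dots> = ennreal ?h2 * ennreal (h x powr p)" using h20 by (subst ennreal_mult[symmetric]) auto
            finally show ?thesis .
          qed
        qed
        also have "\<dots> = ennreal ?h2 * (\<integral>\<^sup>+x. ennreal (h x powr p) \<partial>M)" by (rule nn_integral_cmult) measurable
        also have "\<dots> \<le> ennreal ?h2 * 1" by (intro mult_left_mono hi) simp
        finally show ?thesis by simp
      qed
      have "isum (\<lambda>j. ennreal (b powr (- real_of_int j)) * S j) = isum (\<lambda>j. ennreal (b powr (- real_of_int j) * e j) + isum (\<lambda>m. ennreal (b powr (- real_of_int j)) * ennreal (t m j)))"
      proof (rule nn_integral_cong)
        fix j :: int
        have "ennreal (b powr (- real_of_int j) * e j) = ennreal (b powr (- real_of_int j)) * ennreal (e j)" by (rule ennreal_mult') simp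
        moreover have "isum (\<lambda>m. ennreal (b powr (- real_of_int j)) * ennreal (t m j)) = ennreal (b powr (- real_of_int j)) * isum (\<lambda>m. ennreal (t m j))"
          by (rule nn_integral_cmult) simp
        ultimately show "ennreal (b powr (- real_of_int j)) * S j = ennreal (b powr (- real_of_int j) * e j) + isum (\<lambda>m. ennreal (b powr (- real_of_int j)) * ennreal (t m j))"
          unfolding S_def distrib_left by (simp only:)
      qed
      also have "\<dots> = isum (\<lambda>j. ennreal (b powr (- real_of_int j) * e j)) + isum (\<lambda>j. isum (\<lambda>m. ennreal (b powr (- real_of_int j)) * ennreal (t m j)))"
        by (rule nn_integral_add) auto
      also have "isum (\<lambda>j. isum (\<lambda>m. ennreal (b powr (- real_of_int j)) * ennreal (t m j))) = isum (\<lambda>m. isum (\<lambda>j. ennreal (b powr (- real_of_int j)) * ennreal (t m j)))"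
        by (rule nn_integral_count_space_nn_integral) auto
      also have "isum (\<lambda>m. isum (\<lambda>j. ennreal (b powr (- real_of_int j)) * ennreal (t m j))) \<le> isum (\<lambda>m. ennreal (?g * 2 powr p) * ennreal (2 powr (p * m) * \<mu> m))"
        using inner g0 \<mu>0 by (intro nn_integral_mono) (simp add: ennreal_mult[symmetric])
      also have "\<dots> = ennreal (?g * 2 powr p) * isum (\<lambda>m. ennreal (2 powr (p * m) * \<mu> m))"
        by (rule nn_integral_cmult) simp
      also have "\<dots> \<le> ennreal (?g * 2 powr p) * ennreal ?h2" by (intro mult_left_mono layer) simp
      also have "\<dots> = ennreal (?g * 2 powr p * ?h2)" using g0 h20 by (intro ennreal_mult[symmetric]) auto
      also note esum
      also have "ennreal (?g1 + ?g) + ennreal (?g * 2 powr p * ?h2) = ennreal C2"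
        unfolding C2_def using g0 g1 h20 by (intro ennreal_plus[symmetric]) auto
      finally show ?thesis by (simp add: add_mono)
    qed
    have Sj: "ennreal (b powr (- real_of_int j)) * S j \<le> ennreal C2" for j
      using order_trans[OF nn_integral_ge_point[of j UNIV "\<lambda>j. ennreal (b powr (- real_of_int j)) * S j"] Ssum] by simp
    have Sfin: "S j < \<infinity>" for j
    proof -
      have "ennreal (b powr (- real_of_int j)) * S j < \<infinity>" using Sj[of j] by (simp add: le_less_trans)
      then show ?thesis using b by (auto simp: ennreal_mult_less_top)
    qed
    define \<tau> where "\<tau> j = enn2real (S j) powr (1 / p)" for j
    have Sge: "ennreal (e j) \<le> S j" for j by (simp add: S_def)
    have Sreal: "ennreal (enn2real (S j)) = S j" for j using Sfin[of j] by simp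
    have ele: "e j \<le> enn2real (S j)" for j
      using Sge[of j] Sreal[of j] epos[of j] by (metis ennreal_le_iff enn2real_nonneg)
    have Spos: "0 < enn2real (S j)" for j using ele[of j] epos[of j] by linarith
    have \<tau>p: "\<tau> j powr p = enn2real (S j)" for j using Spos[of j] p by (simp add: \<tau>_def powr_powr)
    have \<tau>pos: "0 < \<tau> j" for j using Spos[of j] by (simp add: \<tau>_def)
    have \<tau>1: "1 \<le> \<tau> j" if "0 \<le> j" for j
    proof -
      have "1 \<le> e j" using that b by (simp add: e_def ge_one_powr_ge_zero)
      then show ?thesis unfolding \<tau>_def using ele[of j] p by (intro ge_one_powr_ge_zero) auto
    qed
    have \<tau>gr: "?\<sigma> * \<tau> j \<le> \<tau> (j + 1)" for j
    proof -
      have "ennreal (b powr (1/2)) * S j = ennreal (b powr (1/2) * e j) + isum (\<lambda>m. ennreal (b powr (1/2) * t m j))"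
        unfolding S_def distrib_left using epos[of j] t0
        by (simp add: ennreal_mult nn_integral_cmult less_imp_le)
      also have "\<dots> \<le> S (j + 1)"
        unfolding S_def by (intro add_mono nn_integral_mono ennreal_leI egr tgr)
      finally have "ennreal (b powr (1/2)) * S j \<le> S (j + 1)" .
      then have "b powr (1/2) * enn2real (S j) \<le> enn2real (S (j + 1))"
        using Sreal by (metis ennreal_le_iff enn2real_nonneg ennreal_mult powr_ge_zero)
      then have "(b powr (1/2) * enn2real (S j)) powr (1 / p) \<le> \<tau> (j + 1)"
        unfolding \<tau>_def using p b by (intro powr_mono2) auto
      then show ?thesis using b by (simp add: powr_mult powr_powr \<tau>_def)
    qed
    have \<tau>sup: "s \<le> \<tau> j" if s: "0 < s" and m: "ennreal (b powr (- real_of_int j)) \<le> emeasure M {x \<in> space M. s \<le> h x}" for j s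
    proof -
      \<comment> \<open>\<open>2 powr m\<close> is the dyadic height just below \<open>s\<close>, so
        the superlevel set at height \<open>s\<close> is contained in \<open>A m\<close>, and the
        single summand \<open>t m j\<close> already exceeds \<open>s powr p\<close>.\<close>
      define m where "m = \<lfloor>log 2 s\<rfloor>"
      have m1: "2 powr m \<le> s" "s < 2 powr (m + 1)"
        using s by (auto simp: m_def powr_le_iff less_powr_iff) 
      have "emeasure M {x \<in> space M. s \<le> h x} \<le> emeasure M (A m)"
        by (rule emeasure_mono) (use m1 in \<open>auto simp: A_def\<close>)
      from order_trans[OF m this] have "ennreal (b powr (- real_of_int j)) \<le> ennreal (\<mu> m)" unfolding \<mu>e .
      then have "b powr (- real_of_int j) \<le> \<mu> m" unfolding ennreal_le_iff[OF \<mu>0] .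
      then have "b powr j * b powr (- real_of_int j) \<le> b powr j * \<mu> m" by (rule mult_left_mono) simp
      then have 1: "1 \<le> b powr j * \<mu> m" using b by (simp add: powr_add[symmetric])
      have "s powr p \<le> (2 powr (m + 1)) powr p" using s m1 p by (intro powr_mono2) auto
      also have "\<dots> = 2 powr (p * (m + 1)) * 1" by (simp add: powr_powr mult.commute)
      also have "\<dots> \<le> t m j" unfolding t_def using 1 by (auto intro!: mult_left_mono)
      finally have "ennreal (s powr p) \<le> ennreal (t m j)" by (rule ennreal_leI)
      also have "\<dots> \<le> isum (\<lambda>m. ennreal (t m j))" by (rule nn_integral_ge_point) simp
      also have "\<dots> \<le> S j" by (simp add: S_def)
      finally have "s powr p \<le> enn2real (S j)" using Sreal[of j] by (metis ennreal_le_iff enn2real_nonneg)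
      then have "(s powr p) powr (1 / p) \<le> \<tau> j" unfolding \<tau>_def using p by (intro powr_mono2) auto
      then show ?thesis using s p by (simp add: powr_powr)
    qed
    have "isum (\<lambda>j. ennreal (b powr (- real_of_int j) * \<tau> j powr p)) \<le> ennreal C2"
      using Ssum unfolding \<tau>p by (simp add: ennreal_mult Sreal)
    then have "isum (\<lambda>j. ennreal (b powr (- real_of_int j) * \<tau> j powr p)) \<le> ennreal C"
      by (rule order_trans[OF _ ennreal_leI[OF C(3)]])
    moreover have "isum (\<lambda>j. ennreal (\<tau> j powr (p - 2) * (min x (\<tau> j))\<^sup>2)) \<le> ennreal (C * x powr p)" if "0 \<le> x" for x
    proof (rule order_trans)
      show "isum (\<lambda>j. ennreal (\<tau> j powr (p - 2) * (min x (\<tau> j))\<^sup>2)) \<le> ennreal (C1 * x powr p)"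
        unfolding C1_def by (rule min_square_sum[where \<tau>=\<tau> and \<sigma>="?\<sigma>", OF \<tau>pos \<tau>gr s1 p that])
    qed (use C(2) in \<open>intro ennreal_leI mult_right_mono, auto\<close>)
    ultimately have "rearrangement_seq M b p C h \<tau>"
      unfolding rearrangement_seq_def using \<tau>pos \<tau>1 \<tau>sup by blast
    then show ?thesis by blast
  qed
  then show ?thesis using C(1) by blast
qed

text \<open>The threshold \<open>t\<close> is left free: where \<open>V\<close> stays below it, the
  measure of \<open>S\<close> pays, and where \<open>V\<close> is larger, the square integral does,
  as \<open>P \<le> 2\<close>.\<close>

lemma nn_integral_power_split:
  fixes V :: "'a \<Rightarrow> real"
  assumes V: "\<And>x. 0 \<le> V x" and [measurable]: "V \<in> borel_measurable M" "S \<in> sets M" and t: "0 < t" and P: "0 < P" "P \<le> 2"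
  shows "(\<integral>\<^sup>+x. ennreal (V x powr P) * indicator S x \<partial>M) \<le> ennreal (t powr P) * emeasure M S + ennreal (t powr (P - 2)) * (\<integral>\<^sup>+x. ennreal ((V x)\<^sup>2) \<partial>M)"
proof -
  have "(\<integral>\<^sup>+x. ennreal (V x powr P) * indicator S x \<partial>M) \<le> (\<integral>\<^sup>+x. ennreal (t powr P) * indicator S x + ennreal (t powr (P - 2)) * ennreal ((V x)\<^sup>2) \<partial>M)"
  proof (rule nn_integral_mono)
    fix x
    have "V x powr P \<le> t powr P + t powr (P - 2) * (V x)\<^sup>2"
    proof (cases "V x \<le> t")
      case True
      then have "V x powr P \<le> t powr P" using V[of x] P by (intro powr_mono2) auto
      moreover have "0 \<le> t powr (P - 2) * (V x)\<^sup>2" by simp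
      ultimately show ?thesis by linarith
    next
      case False
      then have v: "t \<le> V x" "0 < V x" using t by auto
      have "V x powr P = V x powr (P - 2) * (V x)\<^sup>2" using powr_add[of "V x" "P - 2" 2] v by simp
      also have "\<dots> \<le> t powr (P - 2) * (V x)\<^sup>2" using v t P by (intro mult_right_mono powr_mono2') auto
      finally show ?thesis using powr_ge_zero[of t P] by linarith
    qed
    then have "ennreal (V x powr P) \<le> ennreal (t powr P) + ennreal (t powr (P - 2)) * ennreal ((V x)\<^sup>2)"
      by (simp add: ennreal_plus[symmetric] ennreal_mult'[symmetric] del: ennreal_plus)
    then show "ennreal (V x powr P) * indicator S x \<le> ennreal (t powr P) * indicator S x + ennreal (t powr (P - 2)) * ennreal ((V x)\<^sup>2)"
      by (simp add: indicator_def)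
  qed
  also have "\<dots> = ennreal (t powr P) * emeasure M S + ennreal (t powr (P - 2)) * (\<integral>\<^sup>+x. ennreal ((V x)\<^sup>2) \<partial>M)"
    by (simp add: nn_integral_add nn_integral_cmult)
  finally show ?thesis .
qed

section \<open>Modulars with variable exponent\<close>

lemma enn_powr_mono: "x \<le> y \<Longrightarrow> 0 \<le> a \<Longrightarrow> enn_powr x a \<le> enn_powr y a"
  unfolding enn_powr_def
  by (auto simp: top_unique intro!: ennreal_leI powr_mono2 enn2real_mono simp: top.not_eq_extremum)

lemma enn_powr_one [simp]: "enn_powr 1 a = 1" by (simp add: enn_powr_def)

lemma enn_powr_measurable [measurable]:
  assumes [measurable]: "h \<in> borel_measurable M" "p \<in> borel_measurable M"
  shows "(\<lambda>x. enn_powr (h x) (p x)) \<in> borel_measurable M"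
  unfolding enn_powr_def by measurable

text \<open>Chebyshev's inequality at height one, where the value of the exponent does not
  matter.\<close>

lemma modular_superlevel:
  assumes [measurable]: "h \<in> borel_measurable M" and p0: "\<And>x. 0 < p x"
    and i: "(\<integral>\<^sup>+x. enn_powr (h x) (p x) \<partial>M) \<le> 1"
  shows "emeasure M {x \<in> space M. 1 \<le> h x} \<le> 1"
proof -
  have "emeasure M {x \<in> space M. 1 \<le> h x} = (\<integral>\<^sup>+x. indicator {x \<in> space M. 1 \<le> h x} x \<partial>M)" by simp
  also have "\<dots> \<le> (\<integral>\<^sup>+x. enn_powr (h x) (p x) \<partial>M)"
  proof (rule nn_integral_mono)
    fix x
    show "indicator {x \<in> space M. 1 \<le> h x} x \<le> enn_powr (h x) (p x)"
      using enn_powr_mono[of 1 "h x" "p x"] p0[of x] by (auto simp: indicator_def)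
  qed
  also note i
  finally show ?thesis .
qed

text \<open>Sum and integral are interchanged, so that the summation over scales takes place at a
  single point, where the assumption on \<open>\<tau>\<close> bounds it by a power of
  \<open>h x\<close>.\<close>

lemma min_trunc_integral_sum:
  fixes \<tau> :: "int \<Rightarrow> real" and h :: "'a \<Rightarrow> real"
  assumes [measurable]: "h \<in> borel_measurable M" and h0: "\<And>x. 0 \<le> h x" and hi: "(\<integral>\<^sup>+x. ennreal (h x powr r) \<partial>M) \<le> 1"
    and C: "0 \<le> C" and s: "\<And>x. 0 \<le> x \<Longrightarrow> isum (\<lambda>j. ennreal (\<tau> j powr (r - 2) * (min x (\<tau> j))\<^sup>2)) \<le> ennreal (C * x powr r)"
  shows "isum (\<lambda>j. ennreal (\<tau> j powr (r - 2)) * (\<integral>\<^sup>+x. ennreal ((min (h x) (\<tau> j))\<^sup>2) \<partial>M)) \<le> ennreal C"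
proof -
  have "isum (\<lambda>j. ennreal (\<tau> j powr (r - 2)) * (\<integral>\<^sup>+x. ennreal ((min (h x) (\<tau> j))\<^sup>2) \<partial>M))
     = isum (\<lambda>j. \<integral>\<^sup>+x. ennreal (\<tau> j powr (r - 2) * (min (h x) (\<tau> j))\<^sup>2) \<partial>M)"
    by (simp add: nn_integral_cmult ennreal_mult')
  also have "\<dots> = (\<integral>\<^sup>+x. isum (\<lambda>j. ennreal (\<tau> j powr (r - 2) * (min (h x) (\<tau> j))\<^sup>2)) \<partial>M)"
    by (rule nn_integral_count_space_nn_integral[symmetric]) auto
  also have "\<dots> \<le> (\<integral>\<^sup>+x. ennreal C * ennreal (h x powr r) \<partial>M)"
    using s[OF h0] C by (intro nn_integral_mono) (simp add: ennreal_mult)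
  also have "\<dots> = ennreal C * (\<integral>\<^sup>+x. ennreal (h x powr r) \<partial>M)" by (rule nn_integral_cmult) measurable
  also have "\<dots> \<le> ennreal C * 1" by (intro mult_left_mono hi) simp
  finally show ?thesis by simp
qed

lemma ennreal_mult_affine:
  "0 \<le> w \<Longrightarrow> ennreal w * (ennreal a + ennreal c * X) = ennreal (w * a) + ennreal (w * c) * X"
  by (simp add: distrib_left ennreal_mult' mult.assoc)

text \<open>In the application \<open>h\<close> is the normalized grand maximal function, \<open>U j\<close> and \<open>V j\<close> are the
  moduli of the smoothed distribution at scale \<open>j\<close> and of its Fourier transform, and \<open>S j\<close> is a
  shell of the dual dilation.\<close>

definition shell_sum_const :: "'a measure \<Rightarrow> real \<Rightarrow> real \<Rightarrow> real \<Rightarrow> real \<Rightarrow> bool" where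
  "shell_sum_const M b q P C \<longleftrightarrow> 0 < C \<and> (\<forall>p h U V S. h \<in> borel_measurable M \<longrightarrow> p \<in> borel_measurable M \<longrightarrow> (\<forall>x. 0 < p x)
    \<longrightarrow> (AE x in M. q \<le> p x \<and> p x \<le> P) \<longrightarrow> (\<integral>\<^sup>+x. enn_powr (h x) (p x) \<partial>M) \<le> 1
    \<longrightarrow> (\<forall>j x. 0 \<le> U j x \<and> ennreal (U j x) \<le> h x)
    \<longrightarrow> (\<forall>j y. ennreal (b powr (- real_of_int j)) \<le> emeasure M {x \<in> space M. ennreal (U j y) \<le> h x})
    \<longrightarrow> (\<forall>j x. 0 \<le> V j x) \<longrightarrow> (\<forall>j. V j \<in> borel_measurable M)
    \<longrightarrow> (\<forall>j. (\<integral>\<^sup>+x. ennreal ((V j x)\<^sup>2) \<partial>M) \<le> (\<integral>\<^sup>+x. ennreal ((U j x)\<^sup>2) \<partial>M))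
    \<longrightarrow> (\<forall>j. S j \<in> sets M \<and> emeasure M (S j) \<le> ennreal (b powr (real_of_int j + 1)))
    \<longrightarrow> isum (\<lambda>j. ennreal (if j < 0 then b powr (real_of_int j * (P - 2)) else b powr (real_of_int j * (P - 1 - P / q)))
          * (\<integral>\<^sup>+x. ennreal (V j x powr P) * indicator (S j) x \<partial>M)) \<le> ennreal C)"

lemma shell_sum_constD:
  assumes "shell_sum_const M b q P C" "h \<in> borel_measurable M" "p \<in> borel_measurable M" "\<And>x. 0 < p x"
    "AE x in M. q \<le> p x \<and> p x \<le> P" "(\<integral>\<^sup>+x. enn_powr (h x) (p x) \<partial>M) \<le> 1"
    "\<And>j x. 0 \<le> U j x" "\<And>j x. ennreal (U j x) \<le> h x"
    "\<And>j y. ennreal (b powr (- real_of_int j)) \<le> emeasure M {x \<in> space M. ennreal (U j y) \<le> h x}"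
    "\<And>j x. 0 \<le> V j x" "\<And>j. V j \<in> borel_measurable M"
    "\<And>j. (\<integral>\<^sup>+x. ennreal ((V j x)\<^sup>2) \<partial>M) \<le> (\<integral>\<^sup>+x. ennreal ((U j x)\<^sup>2) \<partial>M)"
    "\<And>j. S j \<in> sets M" "\<And>j. emeasure M (S j) \<le> ennreal (b powr (real_of_int j + 1))"
  shows "isum (\<lambda>j. ennreal (if j < 0 then b powr (real_of_int j * (P - 2)) else b powr (real_of_int j * (P - 1 - P / q)))
          * (\<integral>\<^sup>+x. ennreal (V j x powr P) * indicator (S j) x \<partial>M)) \<le> ennreal C"
  by (rule assms(1)[unfolded shell_sum_const_def, THEN conjunct2, rule_format, of h p U V S]) (use assms(2-) in auto)

text \<open>The part of \<open>h\<close> below one is measured with the exponent \<open>P\<close>,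
  the part above one with \<open>q\<close>, and each has its own rearrangement sequence. Negative
  scales see the former only; nonnegative scales are estimated by the latter, with an additional
  bounded term from the former. The weight exponents are those for which all powers of
  \<open>b\<close> match these sequences.\<close>

lemma shell_sum_bound:
  fixes b q P :: real and M :: "'a measure"
  assumes b: "1 < b" and q: "0 < q" "q \<le> P" "P \<le> 1"
  shows "\<exists>C. shell_sum_const M b q P C"
proof -
  have P: "0 < P" "P < 2" "P \<le> 2" and q2: "q < 2" using q by auto
  obtain C1 where C1: "0 < C1" and J1: "\<And>h. h \<in> borel_measurable M \<Longrightarrow> (\<forall>x. 0 \<le> h x)
      \<Longrightarrow> (\<integral>\<^sup>+x. ennreal (h x powr P) \<partial>M) \<le> 1 \<Longrightarrow> Ex (rearrangement_seq M b P C1 h)"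
    using rearrangement_seq_exists[OF b P(1,2), of M] by blast
  obtain C2 where C2: "0 < C2" and J2: "\<And>h. h \<in> borel_measurable M \<Longrightarrow> (\<forall>x. 0 \<le> h x)
      \<Longrightarrow> (\<integral>\<^sup>+x. ennreal (h x powr q) \<partial>M) \<le> 1 \<Longrightarrow> Ex (rearrangement_seq M b q C2 h)"
    using rearrangement_seq_exists[OF b q(1) q2, of M] by blast
  \<comment> \<open>Each term \<open>z\<close> of the sum controlled by \<open>C2\<close> is itself
    at most \<open>C2\<close>, so that \<open>z powr (P / q) \<le> ?L * z\<close>. In this way the
    integral with exponent \<open>P\<close> is reduced to a sum for the exponent
    \<open>q\<close>.\<close>
  let ?L = "C2 powr (P / q - 1)"
  define C where "C = (b * C1 + C1) + ?L * (b * C2 + (C2 + C2))"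
  have C: "0 < C" unfolding C_def using b C1 C2 by (intro add_pos_pos mult_pos_pos) auto
  have "isum (\<lambda>j. ennreal (if j < 0 then b powr (real_of_int j * (P - 2)) else b powr (real_of_int j * (P - 1 - P / q)))
          * (\<integral>\<^sup>+x. ennreal (V j x powr P) * indicator (S j) x \<partial>M)) \<le> ennreal C"
    if hm[measurable]: "h \<in> borel_measurable M" and pm[measurable]: "p \<in> borel_measurable M" and p0: "\<forall>x. 0 < p x"
      and pb: "AE x in M. q \<le> p x \<and> p x \<le> P" and mod: "(\<integral>\<^sup>+x. enn_powr (h x) (p x) \<partial>M) \<le> 1"
      and U: "\<forall>j x. 0 \<le> U j x \<and> ennreal (U j x) \<le> h x"
      and Ub: "\<forall>j y. ennreal (b powr (- real_of_int j)) \<le> emeasure M {x \<in> space M. ennreal (U j y) \<le> h x}"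
      and V0: "\<forall>j x. 0 \<le> V j x" and Vm: "\<forall>j. V j \<in> borel_measurable M"
      and VU: "\<forall>j. (\<integral>\<^sup>+x. ennreal ((V j x)\<^sup>2) \<partial>M) \<le> (\<integral>\<^sup>+x. ennreal ((U j x)\<^sup>2) \<partial>M)"
      and S: "\<forall>j. S j \<in> sets M \<and> emeasure M (S j) \<le> ennreal (b powr (real_of_int j + 1))"
    for p :: "'a \<Rightarrow> real" and h U V and S :: "int \<Rightarrow> 'a set"
  proof -
    have fin: "AE x in M. h x \<noteq> \<top>"
    proof -
      have "(\<integral>\<^sup>+x. enn_powr (h x) (p x) \<partial>M) \<noteq> \<infinity>" using mod by (auto simp: top_unique)
      then have "AE x in M. enn_powr (h x) (p x) \<noteq> \<infinity>" by (intro nn_integral_PInf_AE) measurable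
      then show ?thesis by (rule AE_mp) (auto intro!: AE_I2 simp: enn_powr_def)
    qed
    \<comment> \<open>\<open>h\<close> is finite almost everywhere by \<open>fin\<close>, so the
      value zero that \<open>enn2real\<close> assigns to infinity is harmless.\<close>
    define g where "g x = enn2real (h x)" for x
    have gm[measurable]: "g \<in> borel_measurable M" unfolding g_def by measurable
    have g0: "0 \<le> g x" for x by (simp add: g_def)
    \<comment> \<open>Powers of numbers below one decrease with the exponent and powers of numbers
      above one increase; hence the modular dominates the \<open>P\<close>-th power of
      \<open>h1\<close> and the \<open>q\<close>-th power of \<open>h2\<close>.\<close>
    define h1 where "h1 x = min (g x) 1" for x
    define h2 where "h2 x = (if 1 < g x then g x else 0)" for x
    have m12[measurable]: "h1 \<in> borel_measurable M" "h2 \<in> borel_measurable M" unfolding h1_def h2_def by measurable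
    have n12: "\<forall>x. 0 \<le> h1 x" "\<forall>x. 0 \<le> h2 x" using g0 by (auto simp: h1_def h2_def)
    have AEg: "AE x in M. enn_powr (h x) (p x) = ennreal (g x powr p x) \<and> h x = ennreal (g x) \<and> q \<le> p x \<and> p x \<le> P"
      using fin pb by eventually_elim (auto simp: enn_powr_def g_def top.not_eq_extremum)
    have i1: "(\<integral>\<^sup>+x. ennreal (h1 x powr P) \<partial>M) \<le> 1"
    proof -
      have "(\<integral>\<^sup>+x. ennreal (h1 x powr P) \<partial>M) \<le> (\<integral>\<^sup>+x. enn_powr (h x) (p x) \<partial>M)"
      proof (rule nn_integral_mono_AE, use AEg in eventually_elim)
        case (elim x)
        have "h1 x powr P \<le> g x powr p x"
        proof (cases "g x \<le> 1")
          case True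
          then show ?thesis using g0[of x] elim P by (cases "g x = 0") (auto simp: h1_def intro: powr_mono')
        next
          case False
          then show ?thesis using p0[rule_format, of x] by (simp add: h1_def ge_one_powr_ge_zero)
        qed
        then show ?case by (subst conjunct1[OF elim]) (rule ennreal_leI)
      qed
      with mod show ?thesis by simp
    qed
    have i2: "(\<integral>\<^sup>+x. ennreal (h2 x powr q) \<partial>M) \<le> 1"
    proof -
      have "(\<integral>\<^sup>+x. ennreal (h2 x powr q) \<partial>M) \<le> (\<integral>\<^sup>+x. enn_powr (h x) (p x) \<partial>M)"
      proof (rule nn_integral_mono_AE, use AEg in eventually_elim)
        case (elim x)
        have "h2 x powr q \<le> g x powr p x" using elim by (auto simp: h2_def intro: powr_mono)
        then show ?case by (subst conjunct1[OF elim]) (rule ennreal_leI)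
      qed
      with mod show ?thesis by simp
    qed
    have h12: "(\<integral>\<^sup>+x. ennreal ((h1 x)\<^sup>2) \<partial>M) \<le> 1"
    proof -
      have "(\<integral>\<^sup>+x. ennreal ((h1 x)\<^sup>2) \<partial>M) \<le> (\<integral>\<^sup>+x. ennreal (h1 x powr P) \<partial>M)"
      proof (intro nn_integral_mono ennreal_leI)
        fix x
        show "(h1 x)\<^sup>2 \<le> h1 x powr P"
        proof (cases "h1 x = 0")
          case False
          then have "0 < h1 x" "h1 x \<le> 1" using n12(1)[rule_format, of x] by (auto simp: h1_def)
          then have "h1 x powr 2 \<le> h1 x powr P" using P by (intro powr_mono') auto
          then show ?thesis using \<open>0 < h1 x\<close> by simp
        qed simp
      qed
      with i1 show ?thesis by simp
    qed
    have Ug: "AE x in M. U j x \<le> g x" for j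
      using AEg
    proof eventually_elim
      case (elim x)
      then have "ennreal (U j x) \<le> ennreal (g x)" using U by metis
      then show ?case using g0[of x] by simp
    qed
    obtain \<tau> :: "int \<Rightarrow> real" where \<tau>: "\<And>j. 0 < \<tau> j"
      "\<And>j s. 0 < s \<Longrightarrow> ennreal (b powr (- real_of_int j)) \<le> emeasure M {x \<in> space M. s \<le> h1 x} \<Longrightarrow> s \<le> \<tau> j"
      "isum (\<lambda>j. ennreal (b powr (- real_of_int j) * \<tau> j powr P)) \<le> ennreal C1"
      "\<And>x. 0 \<le> x \<Longrightarrow> isum (\<lambda>j. ennreal (\<tau> j powr (P - 2) * (min x (\<tau> j))\<^sup>2)) \<le> ennreal (C1 * x powr P)"
      using J1[OF m12(1) n12(1) i1] unfolding rearrangement_seq_def by blast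
    obtain \<rho> :: "int \<Rightarrow> real" where \<rho>: "\<And>j. 0 < \<rho> j" "\<And>j. 0 \<le> j \<Longrightarrow> 1 \<le> \<rho> j"
      "\<And>j s. 0 < s \<Longrightarrow> ennreal (b powr (- real_of_int j)) \<le> emeasure M {x \<in> space M. s \<le> h2 x} \<Longrightarrow> s \<le> \<rho> j"
      "isum (\<lambda>j. ennreal (b powr (- real_of_int j) * \<rho> j powr q)) \<le> ennreal C2"
      "\<And>x. 0 \<le> x \<Longrightarrow> isum (\<lambda>j. ennreal (\<rho> j powr (q - 2) * (min x (\<rho> j))\<^sup>2)) \<le> ennreal (C2 * x powr q)"
      using J2[OF m12(2) n12(2) i2] unfolding rearrangement_seq_def by blast
    define X where "X j = (\<integral>\<^sup>+x. ennreal ((min (h1 x) (\<tau> j))\<^sup>2) \<partial>M)" for j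
    define Y where "Y j = (\<integral>\<^sup>+x. ennreal ((min (h2 x) (\<rho> j))\<^sup>2) \<partial>M)" for j
    have Xs: "isum (\<lambda>j. ennreal (\<tau> j powr (P - 2)) * X j) \<le> ennreal C1"
      unfolding X_def by (rule min_trunc_integral_sum[OF m12(1) n12(1)[rule_format] i1 _ \<tau>(4)]) (use C1 in auto)
    have Ys: "isum (\<lambda>j. ennreal (\<rho> j powr (q - 2)) * Y j) \<le> ennreal C2"
      unfolding Y_def by (rule min_trunc_integral_sum[OF m12(2) n12(2)[rule_format] i2 _ \<rho>(5)]) (use C2 in auto)
    \<comment> \<open>A value of \<open>U j\<close> above one would make \<open>h\<close> exceed one
      on a set of measure greater than one, since \<open>b powr (- j) > 1\<close> for negative
      \<open>j\<close>; this contradicts \<open>modular_superlevel\<close>. Below height one,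
      \<open>h\<close> may be replaced by \<open>h1\<close>.\<close>
    have sup1: "U j y \<le> \<tau> j" "U j y \<le> 1" if j: "j < 0" for j y
    proof -
      have Uy0: "0 \<le> U j y" using U by blast
      have le: "ennreal (b powr (- real_of_int j)) \<le> emeasure M {x \<in> space M. ennreal (U j y) \<le> h x}" using Ub by blast
      show 1: "U j y \<le> 1"
      proof (rule ccontr)
        assume "\<not> U j y \<le> 1"
        then have "emeasure M {x \<in> space M. ennreal (U j y) \<le> h x} \<le> emeasure M {x \<in> space M. 1 \<le> h x}"
          by (intro emeasure_mono) (auto intro: order_trans[rotated])
        also have "\<dots> \<le> 1" by (rule modular_superlevel[OF hm p0[rule_format] mod])
        finally have "emeasure M {x \<in> space M. ennreal (U j y) \<le> h x} \<le> 1" .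
        from order_trans[OF le this] have "b powr (- real_of_int j) \<le> 1" by simp
        moreover have "1 < b powr (- real_of_int j)" using b j by (intro gr_one_powr) auto
        ultimately show False by simp
      qed
      show "U j y \<le> \<tau> j"
      proof (cases "U j y = 0")
        case True
        then show ?thesis using \<tau>(1)[of j] by simp
      next
        case False
        have "emeasure M {x \<in> space M. ennreal (U j y) \<le> h x} \<le> emeasure M {x \<in> space M. U j y \<le> h1 x}"
        proof (rule emeasure_mono_AE)
          show "AE x in M. x \<in> {x \<in> space M. ennreal (U j y) \<le> h x} \<longrightarrow> x \<in> {x \<in> space M. U j y \<le> h1 x}"
            using AEg by eventually_elim (use 1 g0 in \<open>auto simp: h1_def\<close>)
        qed measurable
        with le have "ennreal (b powr (- real_of_int j)) \<le> emeasure M {x \<in> space M. U j y \<le> h1 x}" by (rule order_trans)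
        then show ?thesis using False Uy0 by (intro \<tau>(2)) auto
      qed
    qed
    \<comment> \<open>Values up to one are covered by \<open>1 \<le> \<rho> j\<close>, a property of
      the sequence for \<open>0 \<le> j\<close>; for larger values, \<open>h\<close> may be replaced
      by \<open>h2\<close> up to a null set.\<close>
    have sup2: "U j y \<le> \<rho> j" if j: "0 \<le> j" for j y
    proof (cases "U j y \<le> 1")
      case True
      then show ?thesis using \<rho>(2)[OF j] by simp
    next
      case False
      have le: "ennreal (b powr (- real_of_int j)) \<le> emeasure M {x \<in> space M. ennreal (U j y) \<le> h x}" using Ub by blast
      have "emeasure M {x \<in> space M. ennreal (U j y) \<le> h x} \<le> emeasure M {x \<in> space M. U j y \<le> h2 x}"
      proof (rule emeasure_mono_AE)
        show "AE x in M. x \<in> {x \<in> space M. ennreal (U j y) \<le> h x} \<longrightarrow> x \<in> {x \<in> space M. U j y \<le> h2 x}"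
          using AEg by eventually_elim (use False g0 in \<open>auto simp: h2_def\<close>)
      qed measurable
      with le have "ennreal (b powr (- real_of_int j)) \<le> emeasure M {x \<in> space M. U j y \<le> h2 x}" by (rule order_trans)
      then show ?thesis using False by (intro \<rho>(3)) auto
    qed
    have VX: "(\<integral>\<^sup>+x. ennreal ((V j x)\<^sup>2) \<partial>M) \<le> X j" if j: "j < 0" for j
    proof -
      have "(\<integral>\<^sup>+x. ennreal ((U j x)\<^sup>2) \<partial>M) \<le> X j"
        unfolding X_def
      proof (rule nn_integral_mono_AE, use Ug[of j] in eventually_elim)
        case (elim x)
        have "0 \<le> U j x" using U by blast
        moreover have "U j x \<le> min (h1 x) (\<tau> j)" using elim sup1[OF j, of x] by (simp add: h1_def)
        ultimately show ?case by (intro ennreal_leI power_mono) auto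
      qed
      with VU[rule_format, of j] show ?thesis by (rule order_trans)
    qed
    \<comment> \<open>Where \<open>g\<close> is at most one, \<open>U j\<close> is compared with
      \<open>h1\<close>, whose square has integral at most one; this is the summand one.\<close>
    have VY: "(\<integral>\<^sup>+x. ennreal ((V j x)\<^sup>2) \<partial>M) \<le> 1 + Y j" if j: "0 \<le> j" for j
    proof -
      have "(\<integral>\<^sup>+x. ennreal ((U j x)\<^sup>2) \<partial>M) \<le> (\<integral>\<^sup>+x. ennreal ((h1 x)\<^sup>2) + ennreal ((min (h2 x) (\<rho> j))\<^sup>2) \<partial>M)"
      proof (rule nn_integral_mono_AE, use Ug[of j] in eventually_elim)
        case (elim x)
        have U0: "0 \<le> U j x" using U by blast
        show ?case
        proof (cases "g x \<le> 1")
          case True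
          then have "(U j x)\<^sup>2 \<le> (h1 x)\<^sup>2" using elim U0 by (intro power_mono) (auto simp: h1_def)
          from ennreal_leI[OF this] show ?thesis by (rule order_trans[OF _ add_increasing2[OF zero_le order_refl]])
        next
          case False
          then have "(U j x)\<^sup>2 \<le> (min (h2 x) (\<rho> j))\<^sup>2" using elim U0 sup2[OF j, of x] by (intro power_mono) (auto simp: h2_def)
          from ennreal_leI[OF this] show ?thesis by (rule order_trans[OF _ add_increasing[OF zero_le order_refl]])
        qed
      qed
      also have "\<dots> = (\<integral>\<^sup>+x. ennreal ((h1 x)\<^sup>2) \<partial>M) + Y j" unfolding Y_def by (rule nn_integral_add) measurable
      also have "\<dots> \<le> 1 + Y j" by (intro add_mono h12 order_refl)
      finally show ?thesis using VU[rule_format, of j] by (rule order_trans[rotated])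
    qed
    let ?I = "\<lambda>j. \<integral>\<^sup>+x. ennreal (V j x powr P) * indicator (S j) x \<partial>M"
    let ?A = "\<lambda>j. ennreal b * ennreal (b powr (- real_of_int j) * \<tau> j powr P) + ennreal (\<tau> j powr (P - 2)) * X j"
    let ?B = "\<lambda>j. ennreal ?L * (ennreal b * ennreal (b powr (- real_of_int j) * \<rho> j powr q) + (ennreal (\<rho> j powr (q - 2) * (min 1 (\<rho> j))\<^sup>2) + ennreal (\<rho> j powr (q - 2)) * Y j))"
    have Ile: "?I j \<le> ennreal (t powr P * b powr (real_of_int j + 1)) + ennreal (t powr (P - 2)) * (\<integral>\<^sup>+x. ennreal ((V j x)\<^sup>2) \<partial>M)" if t: "0 < t" for t j
    proof -
      have "?I j \<le> ennreal (t powr P) * emeasure M (S j) + ennreal (t powr (P - 2)) * (\<integral>\<^sup>+x. ennreal ((V j x)\<^sup>2) \<partial>M)"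
        using V0 Vm S t P by (intro nn_integral_power_split) auto
      also have "\<dots> \<le> ennreal (t powr P) * ennreal (b powr (real_of_int j + 1)) + ennreal (t powr (P - 2)) * (\<integral>\<^sup>+x. ennreal ((V j x)\<^sup>2) \<partial>M)"
        using S by (intro add_mono mult_left_mono) auto
      finally show ?thesis by (simp add: ennreal_mult')
    qed
    have low: "ennreal (b powr (real_of_int j * (P - 2))) * ?I j \<le> ?A j" if j: "j < 0" for j
    proof -
      \<comment> \<open>For this threshold all powers of \<open>b\<close> cancel in the second term
        of the split, and \<open>b powr (- j)\<close> with one constant factor \<open>b\<close> is
        left in the first; these are the two sums that \<open>\<tau>\<close> controls.\<close>
      let ?t = "b powr (- real_of_int j) * \<tau> j" and ?w = "b powr (real_of_int j * (P - 2))"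
      have t: "0 < ?t" using b \<tau>(1)[of j] by simp
      have e1: "?w * (?t powr P * b powr (real_of_int j + 1)) = b * (b powr (- real_of_int j) * \<tau> j powr P)"
      proof -
        have "?t powr P = b powr (- real_of_int j * P) * \<tau> j powr P" using b \<tau>(1)[of j] by (simp add: powr_mult powr_powr)
        moreover have "b powr (real_of_int j * (P - 2)) * b powr (- real_of_int j * P) * b powr (real_of_int j + 1) = b powr (- real_of_int j + 1)"
          unfolding powr_add[symmetric] by (simp add: algebra_simps)
        moreover have "b powr (- real_of_int j + 1) = b powr (- real_of_int j) * b" using b by (simp only: powr_add powr_one less_imp_le zero_less_one order_less_trans[OF zero_less_one b])
        ultimately show ?thesis by (simp add: mult_ac)
      qed
      have e2: "?w * ?t powr (P - 2) = \<tau> j powr (P - 2)"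
      proof -
        have "?t powr (P - 2) = b powr (- real_of_int j * (P - 2)) * \<tau> j powr (P - 2)" using b \<tau>(1)[of j] by (simp add: powr_mult powr_powr)
        moreover have "?w * b powr (- real_of_int j * (P - 2)) = 1" using b by (simp add: powr_add[symmetric])
        ultimately show ?thesis by (simp add: mult.assoc[symmetric])
      qed
      have "ennreal ?w * ?I j \<le> ennreal ?w * (ennreal (?t powr P * b powr (real_of_int j + 1)) + ennreal (?t powr (P - 2)) * X j)"
        by (intro mult_left_mono order_trans[OF Ile[OF t]] add_mono VX j) auto
      also have "\<dots> = ennreal (?w * (?t powr P * b powr (real_of_int j + 1))) + ennreal (?w * ?t powr (P - 2)) * X j"
        by (rule ennreal_mult_affine) simp
      also have "\<dots> = ?A j" unfolding e1 e2 using b by (simp add: ennreal_mult')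
      finally show ?thesis .
    qed
    have \<rho>C: "b powr (- real_of_int j) * \<rho> j powr q \<le> C2" for j
    proof -
      have "ennreal (b powr (- real_of_int j) * \<rho> j powr q) \<le> ennreal C2"
        using order_trans[OF nn_integral_ge_point[of j UNIV "\<lambda>j. ennreal (b powr (- real_of_int j) * \<rho> j powr q)"] \<rho>(4)] by simp
      then show ?thesis using C1 C2 by simp
    qed
    have high: "ennreal (b powr (real_of_int j * (P - 1 - P / q))) * ?I j \<le> ?B j" if j: "0 \<le> j" for j
    proof -
      let ?t = "b powr (- real_of_int j) * \<rho> j" and ?w = "b powr (real_of_int j * (P - 1 - P / q))"
      \<comment> \<open>The weight turns the first term into \<open>b * ?z powr (P / q)\<close>.
        Splitting off \<open>?z powr (P / q - 1)\<close>, which also appears in the second term,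
        leaves the sums for the exponent \<open>q\<close>.\<close>
      let ?z = "b powr (- real_of_int j) * \<rho> j powr q"
      have r0: "0 < \<rho> j" by (rule \<rho>(1))
      have t: "0 < ?t" using b r0 by simp
      have z0: "0 < ?z" using b r0 by simp
      have zL: "?z powr (P / q - 1) \<le> ?L" using z0 \<rho>C[of j] q by (intro powr_mono2) auto
      have zp: "?z powr (P / q - 1) = b powr (- real_of_int j * (P / q - 1)) * \<rho> j powr (P - q)"
      proof -
        have "q * (P / q - 1) = P - q" using q by (simp add: right_diff_distrib)
        then show ?thesis using b r0 by (simp only: powr_mult powr_powr powr_ge_zero less_imp_le)
      qed
      have e1: "?w * (?t powr P * b powr (real_of_int j + 1)) = b * (?z * ?z powr (P / q - 1))"
      proof -
        have "?t powr P = b powr (- real_of_int j * P) * \<rho> j powr P" using b r0 by (simp add: powr_mult powr_powr)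
        moreover have "\<rho> j powr P = \<rho> j powr q * \<rho> j powr (P - q)" by (simp add: powr_add[symmetric])
        moreover have "?w * b powr (- real_of_int j * P) * b powr (real_of_int j + 1) = b powr (1 + (- real_of_int j + (- real_of_int j * (P / q - 1))))"
          unfolding powr_add[symmetric] by (simp add: algebra_simps)
        moreover have "b powr (1 + (- real_of_int j + (- real_of_int j * (P / q - 1)))) = b * (b powr (- real_of_int j) * b powr (- real_of_int j * (P / q - 1)))"
          using b by (simp only: powr_add powr_one less_imp_le order_less_trans[OF zero_less_one b])
        ultimately show ?thesis unfolding zp by (simp add: mult_ac)
      qed
      have e2: "?w * ?t powr (P - 2) = ?z powr (P / q - 1) * \<rho> j powr (q - 2)"
      proof -
        have "?t powr (P - 2) = b powr (- real_of_int j * (P - 2)) * \<rho> j powr (P - 2)" using b r0 by (simp add: powr_mult powr_powr)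
        moreover have "\<rho> j powr (P - 2) = \<rho> j powr (P - q) * \<rho> j powr (q - 2)" by (simp add: powr_add[symmetric])
        moreover have "?w * b powr (- real_of_int j * (P - 2)) = b powr (- real_of_int j * (P / q - 1))"
          unfolding powr_add[symmetric] by (simp add: algebra_simps)
        ultimately show ?thesis unfolding zp by (simp add: mult_ac)
      qed
      have "ennreal ?w * ?I j \<le> ennreal ?w * (ennreal (?t powr P * b powr (real_of_int j + 1)) + ennreal (?t powr (P - 2)) * (1 + Y j))"
        by (intro mult_left_mono order_trans[OF Ile[OF t]] add_mono VY j) auto
      also have "\<dots> = ennreal (?w * (?t powr P * b powr (real_of_int j + 1))) + ennreal (?w * ?t powr (P - 2)) * (1 + Y j)"
        by (rule ennreal_mult_affine) simp
      also have "\<dots> = ennreal (b * (?z * ?z powr (P / q - 1))) + ennreal (?z powr (P / q - 1) * \<rho> j powr (q - 2)) * (1 + Y j)"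
        unfolding e1 e2 ..
      also have "\<dots> \<le> ennreal (?L * (b * ?z)) + ennreal (?L * \<rho> j powr (q - 2)) * (1 + Y j)"
      proof (intro add_mono mult_right_mono ennreal_leI)
        have "(b * ?z) * ?z powr (P / q - 1) \<le> (b * ?z) * ?L" by (rule mult_left_mono[OF zL]) (use b z0 in auto)
        then show "b * (?z * ?z powr (P / q - 1)) \<le> ?L * (b * ?z)" by (simp only: mult_ac)
      qed (use zL in auto)
      also have "\<dots> = ?B j"
      proof -
        \<comment> \<open>Since \<open>\<rho> j\<close> is at least one, the summand one contributed
          by \<open>h1\<close> has the form of a truncation at \<open>x = 1\<close>, and its sum
          over the scales is bounded by the last property of \<open>\<rho>\<close>.\<close>
        have "(min 1 (\<rho> j))\<^sup>2 = 1" using \<rho>(2)[OF j] by (simp add: min_absorb1)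
        moreover have "ennreal (?L * (b * ?z)) = ennreal ?L * (ennreal b * ennreal ?z)" using b z0 by (simp add: ennreal_mult)
        moreover have "ennreal (?L * \<rho> j powr (q - 2)) = ennreal ?L * ennreal (\<rho> j powr (q - 2))" by (simp add: ennreal_mult)
        ultimately show ?thesis by (simp only: distrib_left mult_1_right mult.assoc)
      qed
      finally show ?thesis .
    qed
    have "isum (\<lambda>j. ennreal (if j < 0 then b powr (real_of_int j * (P - 2)) else b powr (real_of_int j * (P - 1 - P / q))) * ?I j) \<le> isum (\<lambda>j. ?A j + ?B j)"
    proof (rule nn_integral_mono)
      fix j :: int
      show "ennreal (if j < 0 then b powr (real_of_int j * (P - 2)) else b powr (real_of_int j * (P - 1 - P / q))) * ?I j \<le> ?A j + ?B j"
      proof (cases "j < 0")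
        case True
        show ?thesis using order_trans[OF low[OF True], of "?A j + ?B j"] True by simp
      next
        case False
        then have "0 \<le> j" by simp
        show ?thesis using order_trans[OF high[OF \<open>0 \<le> j\<close>], of "?A j + ?B j"] False by simp
      qed
    qed
    also have "\<dots> = isum ?A + isum ?B" by (rule nn_integral_add) auto
    also have "isum ?A \<le> ennreal b * ennreal C1 + ennreal C1"
    proof -
      have "isum ?A = ennreal b * isum (\<lambda>j. ennreal (b powr (- real_of_int j) * \<tau> j powr P)) + isum (\<lambda>j. ennreal (\<tau> j powr (P - 2)) * X j)"
        by (subst nn_integral_add) (simp_all add: nn_integral_cmult)
      also have "\<dots> \<le> ennreal b * ennreal C1 + ennreal C1" by (intro add_mono mult_left_mono \<tau>(3) Xs) simp
      finally show ?thesis .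
    qed
    also have "isum ?B \<le> ennreal ?L * (ennreal b * ennreal C2 + (ennreal C2 + ennreal C2))"
    proof -
      have "isum ?B = ennreal ?L * isum (\<lambda>j. ennreal b * ennreal (b powr (- real_of_int j) * \<rho> j powr q) + (ennreal (\<rho> j powr (q - 2) * (min 1 (\<rho> j))\<^sup>2) + ennreal (\<rho> j powr (q - 2)) * Y j))"
        by (rule nn_integral_cmult) simp
      also have "isum (\<lambda>j. ennreal b * ennreal (b powr (- real_of_int j) * \<rho> j powr q) + (ennreal (\<rho> j powr (q - 2) * (min 1 (\<rho> j))\<^sup>2) + ennreal (\<rho> j powr (q - 2)) * Y j))
        = isum (\<lambda>j. ennreal b * ennreal (b powr (- real_of_int j) * \<rho> j powr q)) + isum (\<lambda>j. ennreal (\<rho> j powr (q - 2) * (min 1 (\<rho> j))\<^sup>2) + ennreal (\<rho> j powr (q - 2)) * Y j)"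
        by (rule nn_integral_add) auto
      also have "isum (\<lambda>j. ennreal b * ennreal (b powr (- real_of_int j) * \<rho> j powr q)) = ennreal b * isum (\<lambda>j. ennreal (b powr (- real_of_int j) * \<rho> j powr q))"
        by (rule nn_integral_cmult) simp
      also have "isum (\<lambda>j. ennreal (\<rho> j powr (q - 2) * (min 1 (\<rho> j))\<^sup>2) + ennreal (\<rho> j powr (q - 2)) * Y j)
        = isum (\<lambda>j. ennreal (\<rho> j powr (q - 2) * (min 1 (\<rho> j))\<^sup>2)) + isum (\<lambda>j. ennreal (\<rho> j powr (q - 2)) * Y j)"
        by (rule nn_integral_add) auto
      also have "ennreal ?L * (ennreal b * isum (\<lambda>j. ennreal (b powr (- real_of_int j) * \<rho> j powr q)) + \<dots>) \<le> ennreal ?L * (ennreal b * ennreal C2 + (ennreal C2 + ennreal C2))"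
        using \<rho>(5)[of 1] by (intro mult_left_mono add_mono \<rho>(4) Ys) auto
      finally show ?thesis .
    qed
    also have "ennreal b * ennreal C1 + ennreal C1 + ennreal ?L * (ennreal b * ennreal C2 + (ennreal C2 + ennreal C2)) = ennreal C"
      unfolding C_def using b C1 C2 by (simp add: ennreal_plus[symmetric] ennreal_mult[symmetric] del: ennreal_plus)
    finally show ?thesis by (simp add: add_mono)
  qed
  with C show ?thesis unfolding shell_sum_const_def by blast
qed

section \<open>Dilations and step quasi-norms\<close>

text \<open>The equivalence between neighbours works in both directions, so identities for negative
  powers need no separate argument.\<close>

lemma int_iff_induct:
  fixes k :: int
  assumes "P 0" and "\<And>k. P k \<longleftrightarrow> P (k + 1)"
  shows "P k"
proof (induction k rule: int_induct[where k=0])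
  case (step2 i)
  then show ?case using assms(2)[of "i - 1"] by simp
qed (use assms in auto)

context
  fixes A :: "real^'n^'n"
  assumes A: "invertible A"
begin

lemma matrix_inv_mult: "A ** matrix_inv A = mat 1" "matrix_inv A ** A = mat 1"
  using someI_ex[OF A[unfolded invertible_def]] unfolding matrix_inv_def by auto

lemma matrix_powi_0: "matrix_powi A 0 = mat 1" by (simp add: matrix_powi_def)

lemma matrix_powi_succ: "matrix_powi A (k + 1) = A ** matrix_powi A k"
proof (cases "0 \<le> k")
  case True
  then have "nat (k + 1) = Suc (nat k)" by simp
  then show ?thesis using True by (simp add: matrix_powi_def)
next
  case False
  define n where "n = nat (- k) - 1"
  have k: "nat (- k) = Suc n" "nat (- (k + 1)) = n" using False by (auto simp: n_def)
  have "matrix_powi A k = matrix_inv A ** (((**) (matrix_inv A)) ^^ n) (mat 1)"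
    using False k by (simp add: matrix_powi_def)
  moreover have "matrix_powi A (k + 1) = (((**) (matrix_inv A)) ^^ n) (mat 1)"
  \<comment> \<open>At \<open>k = -1\<close> the successor falls into the other branch of the
    definition of \<open>matrix_powi\<close>.\<close>
  proof (cases "k = -1")
    case True
    then have "n = 0" using k by simp
    with True show ?thesis by (simp add: matrix_powi_def)
  next
    case F: False
    then have "\<not> 0 \<le> k + 1" using False by simp
    then show ?thesis using k by (simp add: matrix_powi_def)
  qed
  ultimately show ?thesis by (simp add: matrix_mul_assoc matrix_inv_mult)
qed

lemma matrix_left_cancel: "A ** X = A ** Y \<longleftrightarrow> X = Y"
proof
  assume "A ** X = A ** Y"
  then have "matrix_inv A ** (A ** X) = matrix_inv A ** (A ** Y)" by simp
  then show "X = Y" by (simp add: matrix_mul_assoc matrix_inv_mult)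
qed simp

lemma matrix_powi_comm: "matrix_powi A k ** A = A ** matrix_powi A k"
proof (induction k rule: int_iff_induct)
  case (2 k)
  then show ?case by (simp add: matrix_powi_succ matrix_mul_assoc[symmetric] matrix_left_cancel)
qed (simp add: matrix_powi_0)

lemma matrix_powi_uminus_mult: "matrix_powi A (- k) ** matrix_powi A k = mat 1"
proof (induction k rule: int_iff_induct)
  case (2 k)
  have "matrix_powi A (- k) = A ** matrix_powi A (- (k + 1))" using matrix_powi_succ[of "- (k + 1)"] by simp
  then have "matrix_powi A (- k) = matrix_powi A (- (k + 1)) ** A" by (simp only: matrix_powi_comm)
  then have "matrix_powi A (- k) ** matrix_powi A k = matrix_powi A (- (k + 1)) ** matrix_powi A (k + 1)"
    by (simp only: matrix_powi_succ matrix_mul_assoc)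
  then show ?case by (simp only:)
qed (simp add: matrix_powi_0)

lemma matrix_powi_mult_uminus: "matrix_powi A k ** matrix_powi A (- k) = mat 1"
  using matrix_powi_uminus_mult[of "- k"] by simp

lemma det_A_nonzero: "det A \<noteq> 0" using A by (simp add: invertible_det_nz)

lemma det_matrix_powi: "det (matrix_powi A k) = det A powi k"
proof (induction k rule: int_iff_induct)
  case (2 k)
  show ?case using det_A_nonzero by (simp add: matrix_powi_succ det_mul power_int_add)
qed (simp add: matrix_powi_0)

lemma invertible_matrix_powi: "invertible (matrix_powi A k)"
  using det_A_nonzero by (simp add: invertible_det_nz det_matrix_powi)

end

lemma invertible_transpose_iff: "invertible (transpose A) \<longleftrightarrow> invertible A" for A :: "real^'n^'n"
  by (simp add: invertible_det_nz)

lemma matrix_powi_transpose: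
  fixes A :: "real^'n^'n"
  assumes A: "invertible A"
  shows "matrix_powi (transpose A) k = transpose (matrix_powi A k)"
proof -
  have At: "invertible (transpose A)" using A by (simp add: invertible_transpose_iff)
  show ?thesis
  proof (induction k rule: int_iff_induct)
    case 1
    show ?case by (simp add: matrix_powi_0[OF A] matrix_powi_0[OF At] transpose_mat)
  next
    case (2 k)
    show ?case
      by (simp add: matrix_powi_succ[OF A] matrix_powi_succ[OF At] matrix_transpose_mul matrix_powi_comm[OF A, symmetric]
          matrix_left_cancel[OF At])
  qed
qed

section \<open>Ellipsoids, their dilates and their volumes\<close>

lemma det_mat: "det (mat r :: real^'n^'n) = r ^ CARD('n)"
  by (subst det_diagonal) (auto simp: mat_def)

lemma emeasure_linear_image:
  fixes T :: "real^'n^'n"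
  assumes T: "invertible T" and X: "X \<in> sets borel"
  shows "emeasure lborel ((*v) T ` X) = ennreal \<bar>det T\<bar> * emeasure lborel X" "(*v) T ` X \<in> sets borel"
proof -
  obtain S where S: "S ** T = mat 1" "T ** S = mat 1" using T by (auto simp: invertible_def)
  have im: "(*v) T ` X = (*v) S -` X \<inter> space borel"
    using matrix_vector_inv[OF S(1)] matrix_vector_inv[OF S(2)] by (auto simp: image_iff intro!: bexI[of _ "S *v _"])
  show s[measurable]: "(*v) T ` X \<in> sets borel" unfolding im using X by measurable
  have "inj ((*v) T)" using matrix_vector_inv[OF S(1)] by (metis injI)
  then have i: "indicator ((*v) T ` X) (T *v x) = (indicator X x :: ennreal)" for x by (auto simp: indicator_def dest: injD)
  have "emeasure lborel ((*v) T ` X) = (\<integral>\<^sup>+x. indicator ((*v) T ` X) x \<partial>lborel)" by simp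
  also have "\<dots> = ennreal \<bar>det T\<bar> * (\<integral>\<^sup>+x. indicator X x \<partial>lborel)"
    by (subst nn_integral_linear_subst[OF T]) (simp_all add: i)
  finally show "emeasure lborel ((*v) T ` X) = ennreal \<bar>det T\<bar> * emeasure lborel X" using X by simp
qed

text \<open>Turns the existential witnesses \<open>P\<close> and \<open>r\<close> into parameters;
  the locale is used twice, for \<open>A\<close> and for its transpose.\<close>

locale ellipsoid =
  fixes A :: "real^'n^'n" and \<Delta> :: "(real^'n) set" and P :: "real^'n^'n" and r :: real
  assumes P: "invertible P" and r: "1 < r" and \<Delta>: "\<Delta> = {x. norm (P *v x) < 1}"
    and mass: "emeasure lebesgue \<Delta> = 1"
    and expand: "(\<lambda>x. r *\<^sub>R x) ` \<Delta> \<subseteq> (\<lambda>x. A *v x) ` \<Delta>"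

lemma dilation_ellipsoid_locale:
  assumes "dilation_ellipsoid A \<Delta>" obtains P r where "ellipsoid A \<Delta> P r"
  using assms unfolding dilation_ellipsoid_def ellipsoid_def by blast

context ellipsoid
begin

text \<open>\<open>\<Delta>\<close> absorbs every vector, and a multiple of \<open>\<Delta>\<close>
  lies in its own image under \<open>A\<close>; hence \<open>A\<close> is surjective.\<close>

lemma invA: "invertible A"
proof -
  have "\<exists>x. A *v x = y" for y
  proof -
    let ?t = "norm (P *v y) + 1"
    have t: "0 < ?t" by (simp add: add_nonneg_pos)
    have "(1 / ?t) *\<^sub>R y \<in> \<Delta>"
      using t by (simp add: \<Delta> matrix_vector_mult_scaleR)
    then have "r *\<^sub>R ((1 / ?t) *\<^sub>R y) \<in> (\<lambda>x. A *v x) ` \<Delta>" using expand by blast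
    then obtain x where x: "A *v x = (r / ?t) *\<^sub>R y" by auto
    have "A *v ((?t / r) *\<^sub>R x) = y" using r t by (simp add: matrix_vector_mult_scaleR x)
    then show ?thesis by blast
  qed
  then have "surj ((*v) A)" by (metis surjI surj_def)
  then show ?thesis by (simp add: invertible_right_inverse matrix_right_invertible_surjective)
qed

abbreviation pw :: "int \<Rightarrow> real^'n^'n" where "pw k \<equiv> matrix_powi A k"

text \<open>The gauge of the dilated ball: \<open>ball_iff\<close> describes the ball as its open
  unit ball. Nesting of balls and existence of shells follow from its geometric decay in
  \<open>k\<close>.\<close>

definition nrm :: "int \<Rightarrow> real^'n \<Rightarrow> real" where "nrm k x = norm (P *v (pw (- k) *v x))"

lemma pw_inv: "pw (- k) *v (pw k *v x) = x" "pw k *v (pw (- k) *v x) = x"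
  using matrix_vector_inv[OF matrix_powi_uminus_mult[OF invA]] matrix_vector_inv[OF matrix_powi_mult_uminus[OF invA]] by auto

lemma nrm_pos: "x \<noteq> 0 \<Longrightarrow> 0 < nrm k x"
proof -
  assume x: "x \<noteq> 0"
  obtain Q where Q: "Q ** P = mat 1" using P by (auto simp: invertible_def)
  have "P *v (pw (- k) *v x) \<noteq> 0"
  proof
    assume "P *v (pw (- k) *v x) = 0"
    then have "pw (- k) *v x = 0" using matrix_vector_inv[OF Q, of "pw (- k) *v x"] by simp
    then have "x = 0" using pw_inv(2)[of k x] by simp
    with x show False by simp
  qed
  then show ?thesis by (simp add: nrm_def)
qed

lemma ball_iff: "x \<in> dilated_ball A \<Delta> k \<longleftrightarrow> nrm k x < 1"
proof
  assume "x \<in> dilated_ball A \<Delta> k"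
  then show "nrm k x < 1" by (auto simp: dilated_ball_def nrm_def \<Delta> pw_inv)
next
  assume "nrm k x < 1"
  then have "pw (- k) *v x \<in> \<Delta>" by (simp add: nrm_def \<Delta>)
  then show "x \<in> dilated_ball A \<Delta> k" unfolding dilated_ball_def using pw_inv(2)[of k x] by (metis imageI)
qed

text \<open>The inclusion \<open>expand\<close> as an inequality between gauges. Division by
  \<open>?t\<close>, which is slightly larger than the gauge of \<open>x\<close>, brings
  \<open>x\<close> into the open set \<open>\<Delta>\<close>; the excess is arbitrarily
  small.\<close>

lemma P_contract: "norm (P *v (pw (- 1) *v x)) \<le> norm (P *v x) / r"
proof (rule field_le_epsilon)
  fix e :: real assume e: "0 < e"
  let ?t = "norm (P *v x) + e * r"
  have t: "0 < ?t" using e r by (simp add: add_nonneg_pos)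
  have "(1 / ?t) *\<^sub>R x \<in> \<Delta>" using t e r by (simp add: \<Delta> matrix_vector_mult_scaleR)
  then have "r *\<^sub>R ((1 / ?t) *\<^sub>R x) \<in> (\<lambda>x. A *v x) ` \<Delta>" using expand by blast
  then obtain y where y: "y \<in> \<Delta>" "(r / ?t) *\<^sub>R x = A *v y" by auto
  have A1: "pw 1 = A" using matrix_powi_succ[OF invA, of 0] by (simp add: matrix_powi_0[OF invA])
  have "(r / ?t) *\<^sub>R (pw (- 1) *v x) = y"
    using pw_inv(1)[of 1 y] y(2) unfolding A1 by (metis matrix_vector_mult_scaleR)
  then have "norm (P *v ((r / ?t) *\<^sub>R (pw (- 1) *v x))) < 1" using y(1) by (simp add: \<Delta>)
  then have "(r / ?t) * norm (P *v (pw (- 1) *v x)) < 1" using r t by (simp add: matrix_vector_mult_scaleR)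
  then have "norm (P *v (pw (- 1) *v x)) < ?t / r" using r t by (simp add: field_simps)
  also have "?t / r = norm (P *v x) / r + e" using r by (simp add: field_simps)
  finally show "norm (P *v (pw (- 1) *v x)) \<le> norm (P *v x) / r + e" by simp
qed

lemma nrm_succ: "nrm (k + 1) x \<le> nrm k x / r"
proof -
  have "pw (- k) = A ** pw (- (k + 1))" using matrix_powi_succ[OF invA, of "- (k + 1)"] by simp
  moreover have "pw (- 1) ** A = mat 1"
    using matrix_powi_uminus_mult[OF invA, of 1] matrix_powi_succ[OF invA, of 0] by (simp add: matrix_powi_0[OF invA])
  ultimately have "pw (- 1) ** pw (- k) = pw (- (k + 1))" by (simp add: matrix_mul_assoc)
  then have "pw (- (k + 1)) *v x = pw (- 1) *v (pw (- k) *v x)" by (simp add: matrix_vector_mul_assoc)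
  then show ?thesis unfolding nrm_def using P_contract[of "pw (- k) *v x"] by simp
qed

lemma nrm_add: "r ^ n * nrm (k + int n) x \<le> nrm k x"
proof (induction n)
  case (Suc n)
  have "r * nrm (k + int n + 1) x \<le> nrm (k + int n) x" using nrm_succ[of "k + int n" x] r by (simp add: field_simps)
  then have "r ^ n * (r * nrm (k + int n + 1) x) \<le> r ^ n * nrm (k + int n) x" using r by (intro mult_left_mono) auto
  with Suc show ?case by (simp add: algebra_simps)
qed simp

lemma nrm_antimono: "k \<le> l \<Longrightarrow> nrm l x \<le> nrm k x"
proof -
  assume "k \<le> l"
  then have l: "l = k + int (nat (l - k))" by simp
  have "1 * nrm l x \<le> r ^ nat (l - k) * nrm l x" using r by (intro mult_right_mono one_le_power) (auto simp: nrm_def)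
  also have "\<dots> \<le> nrm k x" using nrm_add[of "nat (l - k)" k x] l by simp
  finally show ?thesis by simp
qed

definition shell :: "int \<Rightarrow> (real^'n) set" where
  "shell k = dilated_ball A \<Delta> (k + 1) - dilated_ball A \<Delta> k"

lemma shell_iff: "x \<in> shell k \<longleftrightarrow> nrm (k + 1) x < 1 \<and> 1 \<le> nrm k x"
  by (auto simp: shell_def ball_iff)

lemma shell_unique: "x \<in> shell k \<Longrightarrow> x \<in> shell l \<Longrightarrow> k = l"
  using nrm_antimono[of "k + 1" l x] nrm_antimono[of "l + 1" k x] by (force simp: shell_iff)

text \<open>By geometric decay the gauge of a nonzero vector is at least one for some negative index
  and below one for some large index; the shell is where it passes below one for the first
  time.\<close>

lemma shell_exists:
  assumes x: "x \<noteq> 0" shows "\<exists>k. x \<in> shell k"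
proof -
  have up: "\<exists>n. nrm (int n) x < 1"
  proof -
    obtain n where n: "nrm 0 x < r ^ n" using r real_arch_pow by blast
    have "r ^ n * nrm (int n) x < r ^ n * 1" using nrm_add[of n 0 x] n by simp
    then have "nrm (int n) x < 1" using r by (simp only: mult_less_cancel_left_pos zero_less_power)
    then show ?thesis by blast
  qed
  have dn: "\<exists>n. 1 \<le> nrm (- int n) x"
  proof -
    obtain n where n: "1 / nrm 0 x < r ^ n" using r real_arch_pow by blast
    then have "1 < r ^ n * nrm 0 x" using nrm_pos[OF x, of 0] by (simp add: field_simps)
    also have "\<dots> \<le> nrm (- int n) x" using nrm_add[of n "- int n" x] by simp
    finally show ?thesis by (intro exI[of _ n]) simp
  qed
  obtain a where a: "1 \<le> nrm (- int a) x" using dn by blast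
  define n where "n = (LEAST n. nrm (- int a + int n) x < 1)"
  have ex: "\<exists>n. nrm (- int a + int n) x < 1"
  proof -
    obtain m where "nrm (int m) x < 1" using up by blast
    then have "nrm (- int a + int (a + m)) x < 1" by simp
    then show ?thesis by blast
  qed
  have n1: "nrm (- int a + int n) x < 1" unfolding n_def using ex by (rule LeastI_ex)
  have n0: "n \<noteq> 0" using n1 a by (cases n) auto
  have n2: "1 \<le> nrm (- int a + int (n - 1)) x"
    using not_less_Least[of "n - 1" "\<lambda>n. nrm (- int a + int n) x < 1"] n0 unfolding n_def[symmetric] by simp
  have "- int a + int (n - 1) + 1 = - int a + int n" using n0 by (simp add: of_nat_diff)
  then show ?thesis using n1 n2 by (intro exI[of _ "- int a + int (n - 1)"]) (simp add: shell_iff)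
qed

abbreviation b :: real where "b \<equiv> \<bar>det A\<bar>"

lemma rho_shell: "x \<in> shell k \<Longrightarrow> step_quasi_norm A \<Delta> x = b powi k"
proof -
  assume x: "x \<in> shell k"
  have "x \<noteq> 0" using x by (auto simp: shell_iff nrm_def)
  moreover have "(THE k. x \<in> dilated_ball A \<Delta> (k + 1) - dilated_ball A \<Delta> k) = k"
    using x shell_unique unfolding shell_def by blast
  ultimately show ?thesis by (simp add: step_quasi_norm_def)
qed

lemma open_Delta: "open \<Delta>"
proof -
  have "continuous_on UNIV (\<lambda>x. norm (P *v x))" by (intro continuous_intros)
  from open_vimage[OF open_lessThan[of 1] this] show ?thesis
    by (simp add: \<Delta> vimage_def)
qed

lemma Delta_borel [measurable]: "\<Delta> \<in> sets borel" using open_Delta by simp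

lemma emeasure_Delta: "emeasure lborel \<Delta> = 1"
  using mass by simp

lemma b_pos: "0 < b" using det_A_nonzero[OF invA] by simp

lemma emeasure_ball: "emeasure lborel (dilated_ball A \<Delta> k) = ennreal (b powi k)" "dilated_ball A \<Delta> k \<in> sets borel"
  using emeasure_linear_image[OF invertible_matrix_powi[OF invA, of k] Delta_borel]
  by (simp_all add: dilated_ball_def emeasure_Delta det_matrix_powi[OF invA] power_int_abs)

lemma shell_borel [measurable]: "shell k \<in> sets borel"
  unfolding shell_def using emeasure_ball(2) by auto

lemma emeasure_shell: "emeasure lborel (shell k) \<le> ennreal (b powi (k + 1))"
  unfolding emeasure_ball(1)[symmetric] shell_def by (rule emeasure_mono) (use emeasure_ball(2) in auto)

text \<open>Comparing volumes in the inclusion \<open>expand\<close> gives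
  \<open>r ^ CARD('n) \<le> b\<close>.\<close>

lemma b_gt1: "1 < b"
proof -
  have rm: "invertible (mat r :: real^'n^'n)" using r by (simp add: invertible_det_nz det_mat)
  have "(\<lambda>x. r *\<^sub>R x) ` \<Delta> = (*v) (mat r) ` \<Delta>" by (simp add: mat_vec)
  then have "emeasure lborel ((\<lambda>x. r *\<^sub>R x) ` \<Delta>) = ennreal (r ^ CARD('n))"
    using emeasure_linear_image(1)[OF rm Delta_borel] r by (simp add: emeasure_Delta det_mat)
  moreover have "emeasure lborel ((\<lambda>x. A *v x) ` \<Delta>) = ennreal b"
    using emeasure_linear_image(1)[OF invA Delta_borel] by (simp add: emeasure_Delta)
  moreover have "emeasure lborel ((\<lambda>x. r *\<^sub>R x) ` \<Delta>) \<le> emeasure lborel ((\<lambda>x. A *v x) ` \<Delta>)"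
    using emeasure_linear_image(2)[OF invA Delta_borel] by (intro emeasure_mono expand) simp
  ultimately have "r ^ CARD('n) \<le> b" by simp
  moreover have "1 < r ^ CARD('n)" using r by (intro one_less_power) auto
  ultimately show ?thesis by linarith
qed

lemma ball_symmetric: "- x \<in> dilated_ball A \<Delta> k \<longleftrightarrow> x \<in> dilated_ball A \<Delta> k"
proof -
  have "M *v (- x) = - (M *v x)" for M :: "real^'n^'n" and x
    using matrix_vector_mult_scaleR[of M "- 1" x] by simp
  then show ?thesis by (simp add: ball_iff nrm_def)
qed

lemma P_bounds: "\<exists>c>0. (\<forall>x. norm x \<le> c * norm (P *v x)) \<and> (\<forall>x. norm (P *v x) \<le> c * norm x)"
proof -
  obtain Q where Q: "Q ** P = mat 1" using P by (auto simp: invertible_def)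
  obtain c1 where c1: "0 < c1" "\<And>x. norm (Q *v x) \<le> c1 * norm x"
    using linear_bounded_pos[OF matrix_vector_mul_linear[of Q]] by blast
  obtain c2 where c2: "0 < c2" "\<And>x. norm (P *v x) \<le> c2 * norm x"
    using linear_bounded_pos[OF matrix_vector_mul_linear[of P]] by blast
  have "norm x \<le> max c1 c2 * norm (P *v x)" for x
    using c1(2)[of "P *v x"] mult_right_mono[of c1 "max c1 c2" "norm (P *v x)"] by (simp add: matrix_vector_inv[OF Q])
  moreover have "norm (P *v x) \<le> max c1 c2 * norm x" for x
    using c2(2)[of x] mult_right_mono[of c2 "max c1 c2" "norm x"] by simp
  ultimately show ?thesis using c1(1) by (intro exI[of _ "max c1 c2"]) auto
qed

text \<open>Outside the unit ball of the gauge, \<open>r ^ k\<close> is at most a multiple of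
  \<open>norm x\<close> on the \<open>k\<close>-th shell. With \<open>M\<close> chosen such that
  \<open>b < r ^ M\<close>, the step quasi-norm \<open>b powi k\<close> is at most a multiple of the
  \<open>M\<close>-th power; for negative \<open>k\<close> it is at most one.\<close>

lemma rho_growth: "\<exists>K M. 0 \<le> K \<and> (\<forall>x k. x \<in> shell k \<longrightarrow> b powi k \<le> K * (1 + norm x) ^ M)"
proof -
  obtain c where c: "0 < c" "\<And>x. norm x \<le> c * norm (P *v x)" "\<And>x. norm (P *v x) \<le> c * norm x" using P_bounds by auto
  obtain M where M: "b < r ^ M" using r real_arch_pow by blast
  have "b powi k \<le> (1 + c) ^ M * (1 + norm x) ^ M" if x: "x \<in> shell k" for x k
  proof (cases "0 \<le> k")
    case True
    define n where "n = nat k"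
    have k: "k = int n" using True by (simp add: n_def)
    have "r ^ n * 1 \<le> r ^ n * nrm k x" using x r by (intro mult_left_mono) (auto simp: shell_iff)
    also have "\<dots> \<le> nrm 0 x" using nrm_add[of n 0 x] k by simp
    also have "\<dots> \<le> c * norm x" using c(3)[of x] by (simp add: nrm_def matrix_powi_0[OF invA])
    also have "\<dots> \<le> (1 + c) * (1 + norm x)" using c(1) by (intro mult_mono) auto
    finally have rn: "r ^ n \<le> (1 + c) * (1 + norm x)" by simp
    have "b powi k = b ^ n" by (simp add: k)
    also have "\<dots> \<le> (r ^ M) ^ n" using M b_pos by (intro power_mono) auto
    also have "\<dots> = (r ^ n) ^ M" by (simp add: power_mult[symmetric] mult.commute)
    also have "\<dots> \<le> ((1 + c) * (1 + norm x)) ^ M" using rn r by (intro power_mono) auto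
    finally show ?thesis by (simp only: power_mult_distrib)
  next
    case False
    have "b powi k \<le> b powi 0" using False b_gt1 by (intro power_int_increasing) auto
    also have "\<dots> \<le> (1 + c) ^ M * (1 + norm x) ^ M" unfolding power_mult_distrib[symmetric]
    proof -
      have "1 * 1 \<le> (1 + c) * (1 + norm x)" using c(1) by (intro mult_mono) auto
      then show "b powi 0 \<le> ((1 + c) * (1 + norm x)) ^ M" by simp
    qed
    finally show ?thesis .
  qed
  then show ?thesis using c(1) by (intro exI[of _ "(1 + c) ^ M"] exI[of _ M]) auto
qed

text \<open>Membership imposes finitely many bounds, indexed by \<open>I\<close>, and a small
  multiple of the Gaussian satisfies them all. The Gaussian is its own Fourier transform, so the
  bounds for transforms of rapid functions apply; powers of the step quasi-norm are dominated by
  powers of \<open>1 + norm x\<close>.\<close>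

lemma gauss_schwartz_N:
  "\<exists>c>0. (\<lambda>x. complex_of_real c * gaussian (mat 1) x) \<in> schwartz_N A \<Delta> N"
proof -
  let ?G = "gaussian (mat 1) :: real^'n \<Rightarrow> complex"
  have rG: "rapid ?G" by (rule rapid_gaussian[of "mat 1"]) simp
  have FG: "FT (\<lambda>x. c * ?G x) = (\<lambda>x. c * ?G x)" for c
  proof
    fix x
    have "FT (\<lambda>x. c * ?G x) x = c * (LINT y|lborel. ?G y * chi (- x) y)"
      by (simp add: FTs_def chi_minus mult.assoc)
    also have "(LINT y|lborel. ?G y * chi (- x) y) = ?G x"
      using gaussian_chi(2)[of "mat 1 :: real^'n^'n" "mat 1" "- x"] by (simp add: gaussian_def transpose_mat)
    finally show "FT (\<lambda>x. c * ?G x) x = c * ?G x" .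
  qed
  obtain K M where K: "0 \<le> K" "\<And>x k. x \<in> shell k \<Longrightarrow> b powi k \<le> K * (1 + norm x) ^ M" using rho_growth by blast
  have rho0: "0 \<le> step_quasi_norm A \<Delta> x" for x
    using b_pos by (auto simp: step_quasi_norm_def)
  have rho: "step_quasi_norm A \<Delta> x \<le> K * (1 + norm x) ^ M" for x
  proof (cases "x = 0")
    case True
    then show ?thesis using K(1) by (simp add: step_quasi_norm_def)
  next
    case False
    then obtain k where "x \<in> shell k" using shell_exists by blast
    then show ?thesis using K(2) rho_shell by metis
  qed
  have one: "\<exists>C. \<forall>x. step_quasi_norm A \<Delta> x ^ l * norm (mi_deriv \<alpha> ?G x) \<le> C" for \<alpha> l
  proof -
    have "\<exists>C. \<forall>x. norm (mi_power x \<beta> *\<^sub>R mi_deriv \<alpha> ?G x) \<le> C" for \<beta>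
      using FT_bounded[OF rG] FG[of 1] unfolding mi_deriv_def by simp
    from weighted_bound[OF this, of "M * l"] obtain C where C: "\<And>x. (1 + norm x) ^ (M * l) * norm (mi_deriv \<alpha> ?G x) \<le> C" by blast
    have "step_quasi_norm A \<Delta> x ^ l * norm (mi_deriv \<alpha> ?G x) \<le> K ^ l * C" for x
    proof -
      have "step_quasi_norm A \<Delta> x ^ l \<le> (K * (1 + norm x) ^ M) ^ l" by (intro power_mono rho rho0)
      also have "\<dots> = K ^ l * (1 + norm x) ^ (M * l)" by (simp add: power_mult_distrib power_mult)
      finally have "step_quasi_norm A \<Delta> x ^ l * norm (mi_deriv \<alpha> ?G x) \<le> K ^ l * (1 + norm x) ^ (M * l) * norm (mi_deriv \<alpha> ?G x)"
        by (rule mult_right_mono) simp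
      also have "\<dots> \<le> K ^ l * C" unfolding mult.assoc using C K(1) by (intro mult_left_mono) auto
      finally show ?thesis .
    qed
    then show ?thesis by blast
  qed
  define I where "I = {\<alpha> :: 'n \<Rightarrow> nat. mi_abs \<alpha> \<le> N} \<times> {..N}"
  have finI: "finite I"
  proof -
    have "{\<alpha> :: 'n \<Rightarrow> nat. mi_abs \<alpha> \<le> N} \<subseteq> PiE UNIV (\<lambda>_. {..N})"
    proof
      fix \<alpha> :: "'n \<Rightarrow> nat" assume "\<alpha> \<in> {\<alpha>. mi_abs \<alpha> \<le> N}"
      then have "\<alpha> i \<le> N" for i using member_le_sum[of i UNIV \<alpha>] by (simp add: mi_abs_def)
      then show "\<alpha> \<in> PiE UNIV (\<lambda>_. {..N})" by auto
    qed
    then have "finite {\<alpha> :: 'n \<Rightarrow> nat. mi_abs \<alpha> \<le> N}" by (rule finite_subset) (intro finite_PiE; simp)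
    then show ?thesis by (simp add: I_def)
  qed
  define C where "C \<alpha> l = (SOME C. \<forall>x. step_quasi_norm A \<Delta> x ^ l * norm (mi_deriv \<alpha> ?G x) \<le> C)" for \<alpha> l
  have C: "step_quasi_norm A \<Delta> x ^ l * norm (mi_deriv \<alpha> ?G x) \<le> C \<alpha> l" for \<alpha> l x
    using someI_ex[OF one, of l \<alpha>] unfolding C_def by blast
  \<comment> \<open>The reciprocal of a number that exceeds each of the finitely many
    bounds.\<close>
  define c where "c = 1 / (1 + (\<Sum>(\<alpha>, l)\<in>I. \<bar>C \<alpha> l\<bar>))"
  have s0: "0 \<le> (\<Sum>(\<alpha>, l)\<in>I. \<bar>C \<alpha> l\<bar>)" by (intro sum_nonneg) auto
  have c: "0 < c" using s0 by (simp add: c_def)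
  have "(\<lambda>x. complex_of_real c * ?G x) \<in> schwartz_space"
    using FT_in_schwartz[OF rapid_cmult[OF rG, of "complex_of_real c"]] FG by simp
  moreover have "(SUP x. ennreal (step_quasi_norm A \<Delta> x ^ l * norm (mi_deriv \<alpha> (\<lambda>x. complex_of_real c * ?G x) x))) \<le> 1"
    if al: "mi_abs \<alpha> \<le> N" "l \<le> N" for \<alpha> l
  proof (rule SUP_least)
    fix x
    have "mi_deriv \<alpha> (\<lambda>x. complex_of_real c * ?G x) x = complex_of_real c * mi_deriv \<alpha> ?G x"
    proof -
      let ?is = "SOME is. \<forall>i. count_list is i = \<alpha> i"
      have "mi_deriv \<alpha> (\<lambda>x. complex_of_real c * ?G x) = iter_partial ?is (FT (\<lambda>x. complex_of_real c * ?G x))"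
        unfolding FG mi_deriv_def ..
      also have "\<dots> = FT (\<lambda>y. complex_of_real c * (?G y * coordprod ?is y))"
        by (simp add: iter_partial_FT[OF rapid_cmult[OF rG]] mult.assoc)
      also have "\<dots> = (\<lambda>x. complex_of_real c * FT (\<lambda>y. ?G y * coordprod ?is y) x)" by (rule FT_cmult)
      also have "FT (\<lambda>y. ?G y * coordprod ?is y) = mi_deriv \<alpha> ?G"
        using iter_partial_FT[OF rG, of ?is] FG[of 1] by (simp add: mi_deriv_def)
      finally show ?thesis by simp
    qed
    then have "step_quasi_norm A \<Delta> x ^ l * norm (mi_deriv \<alpha> (\<lambda>x. complex_of_real c * ?G x) x) = c * (step_quasi_norm A \<Delta> x ^ l * norm (mi_deriv \<alpha> ?G x))"
      using c by (simp add: norm_mult mult_ac)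
    also have "\<dots> \<le> c * C \<alpha> l" using c C by (intro mult_left_mono) auto
    also have "\<dots> \<le> c * (1 + (\<Sum>(\<alpha>, l)\<in>I. \<bar>C \<alpha> l\<bar>))"
    proof -
      have "(\<alpha>, l) \<in> I" using al by (simp add: I_def)
      then have "\<bar>C \<alpha> l\<bar> \<le> (\<Sum>(\<alpha>, l)\<in>I. \<bar>C \<alpha> l\<bar>)"
        using member_le_sum[of "(\<alpha>, l)" I "\<lambda>(\<alpha>, l). \<bar>C \<alpha> l\<bar>"] finI by auto
      then show ?thesis using c by (intro mult_left_mono) auto
    qed
    also have "\<dots> = 1" using s0 by (simp add: c_def)
    finally show "ennreal (step_quasi_norm A \<Delta> x ^ l * norm (mi_deriv \<alpha> (\<lambda>x. complex_of_real c * ?G x) x)) \<le> 1" by simp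
  qed
  ultimately show ?thesis using c by (intro exI[of _ c]) (auto simp: schwartz_N_def)
qed

end

section \<open>The Hardy space estimate\<close>

text \<open>Chebyshev's inequality at a height \<open>s\<close> of at least one, where
  \<open>s powr p x\<close> is smallest for the smallest exponent \<open>q\<close>.\<close>

lemma modular_bound:
  fixes q :: real
  assumes [measurable]: "h \<in> borel_measurable M" "p \<in> borel_measurable M"
    and pq: "AE x in M. q \<le> p x" and q: "0 < q"
    and i: "(\<integral>\<^sup>+x. enn_powr (h x) (p x) \<partial>M) \<le> 1"
    and s: "1 \<le> s" and t: "0 < t" "ennreal t \<le> emeasure M {x \<in> space M. ennreal s \<le> h x}"
  shows "t * s powr q \<le> 1"
proof -
  let ?E = "{x \<in> space M. ennreal s \<le> h x}"
  have "ennreal (s powr q) * ennreal t \<le> ennreal (s powr q) * emeasure M ?E" by (intro mult_left_mono t) simp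
  also have "\<dots> = (\<integral>\<^sup>+x. ennreal (s powr q) * indicator ?E x \<partial>M)" by (simp add: nn_integral_cmult)
  also have "\<dots> \<le> (\<integral>\<^sup>+x. enn_powr (h x) (p x) \<partial>M)"
  proof (rule nn_integral_mono_AE, use pq in eventually_elim)
    case (elim x)
    show ?case
    proof (cases "x \<in> ?E")
      case True
      have "ennreal (s powr q) \<le> ennreal (s powr p x)" using elim s by (intro ennreal_leI powr_mono) auto
      also have "\<dots> = enn_powr (ennreal s) (p x)" using s by (simp add: enn_powr_def)
      also have "\<dots> \<le> enn_powr (h x) (p x)" using True elim q by (intro enn_powr_mono) auto
      finally show ?thesis using True by simp
    qed simp
  qed
  also note i
  finally have "ennreal (s powr q * t) \<le> 1" by (simp add: ennreal_mult')
  then show ?thesis by (simp add: mult.commute)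
qed

text \<open>Where \<open>h\<close> is below one, the exponent being at most one gives
  \<open>U x \<le> U x powr p x\<close>, which the modular dominates; where \<open>h\<close> is at
  least one, \<open>U\<close> is at most \<open>K\<close> on a set of measure at most one.\<close>

lemma modular_L1:
  assumes [measurable]: "h \<in> borel_measurable M" "p \<in> borel_measurable M"
    and p0: "\<And>x. 0 < p x" and p1: "AE x in M. p x \<le> 1"
    and i: "(\<integral>\<^sup>+x. enn_powr (h x) (p x) \<partial>M) \<le> 1"
    and U: "\<And>x. 0 \<le> U x" "\<And>x. ennreal (U x) \<le> h x" "\<And>x. U x \<le> K" and K: "0 \<le> K"
  shows "(\<integral>\<^sup>+x. ennreal (U x) \<partial>M) \<le> ennreal (1 + K)"
proof -
  let ?E = "{x \<in> space M. 1 \<le> h x}"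
  have "(\<integral>\<^sup>+x. ennreal (U x) \<partial>M) \<le> (\<integral>\<^sup>+x. enn_powr (h x) (p x) + ennreal K * indicator ?E x \<partial>M)"
  proof (rule nn_integral_mono_AE, use p1 AE_space in eventually_elim)
    case (elim x)
    show ?case
    proof (cases "1 \<le> h x")
      case True
      then have "ennreal (U x) \<le> ennreal K * indicator ?E x" using U(3) elim by (simp add: ennreal_leI)
      then show ?thesis by (rule order_trans[OF _ add_increasing[OF zero_le order_refl]])
    next
      case False
      then have h: "h x < 1" by simp
      have "ennreal (U x) \<le> enn_powr (h x) (p x)"
      proof (cases "U x = 0")
        case False
        then have u: "0 < U x" using U(1)[of x] by simp
        have "U x < 1" using le_less_trans[OF U(2) h] by simp
        then have "U x powr 1 \<le> U x powr p x" using u elim by (intro powr_mono') auto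
        then have "ennreal (U x) \<le> ennreal (U x powr p x)" using u by (intro ennreal_leI) simp
        also have "\<dots> = enn_powr (ennreal (U x)) (p x)" using u by (simp add: enn_powr_def)
        also have "\<dots> \<le> enn_powr (h x) (p x)" using U(2) p0 by (intro enn_powr_mono) (auto simp: less_imp_le)
        finally show ?thesis .
      qed simp
      then show ?thesis by (rule order_trans[OF _ add_increasing2[OF zero_le order_refl]])
    qed
  qed
  also have "\<dots> = (\<integral>\<^sup>+x. enn_powr (h x) (p x) \<partial>M) + ennreal K * emeasure M ?E"
    by (simp add: nn_integral_add nn_integral_cmult)
  also have "\<dots> \<le> 1 + ennreal K * 1"
    by (intro add_mono mult_left_mono i modular_superlevel[OF _ p0 i]) auto
  also have "\<dots> = ennreal (1 + K)" using K by simp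
  finally show ?thesis .
qed

text \<open>Ensures that the infimum in the norm is taken over a nonempty set. For
  \<open>l \<ge> 1\<close> division by \<open>l\<close> multiplies the integrand at most by
  \<open>l powr (- q)\<close>, and \<open>l\<close> is chosen such that \<open>l powr q\<close>
  exceeds the modular by one.\<close>

lemma modular_scaling:
  assumes [measurable]: "g \<in> borel_measurable M" "p \<in> borel_measurable M"
    and pq: "AE x in M. q \<le> p x" and q: "0 < q"
    and fin: "(\<integral>\<^sup>+x. enn_powr (g x) (p x) \<partial>M) < \<infinity>"
  shows "\<exists>l>0. (\<integral>\<^sup>+x. enn_powr (g x / ennreal l) (p x) \<partial>M) \<le> 1"
proof -
  let ?I = "\<integral>\<^sup>+x. enn_powr (g x) (p x) \<partial>M"
  obtain i where i: "0 \<le> i" "?I = ennreal i" using fin by (cases ?I) auto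
  define l where "l = (1 + i) powr (1 / q)"
  have l1: "1 \<le> l" unfolding l_def using i q by (intro ge_one_powr_ge_zero) auto
  have lq: "l powr q = 1 + i" using i q by (simp add: l_def powr_powr)
  have "(\<integral>\<^sup>+x. enn_powr (g x / ennreal l) (p x) \<partial>M) \<le> (\<integral>\<^sup>+x. ennreal (l powr (- q)) * enn_powr (g x) (p x) \<partial>M)"
  proof (rule nn_integral_mono_AE, use pq in eventually_elim)
    case (elim x)
    show ?case
    proof (cases "g x")
      case (real y)
      have "enn_powr (g x / ennreal l) (p x) = ennreal ((y / l) powr p x)"
        using real l1 by (simp add: enn_powr_def divide_ennreal)
      also have "(y / l) powr p x = l powr (- p x) * y powr p x" using real l1 by (simp add: powr_divide powr_minus_divide)
      also have "ennreal \<dots> \<le> ennreal (l powr (- q) * y powr p x)"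
        using elim l1 by (intro ennreal_leI mult_right_mono powr_mono) auto
      also have "\<dots> = ennreal (l powr (- q)) * enn_powr (g x) (p x)"
        using real by (simp add: enn_powr_def ennreal_mult')
      finally show ?thesis .
    next
      case top
      then show ?thesis using l1 by (simp add: enn_powr_def ennreal_mult_top)
    qed
  qed
  also have "\<dots> = ennreal (l powr (- q)) * ?I" by (rule nn_integral_cmult) measurable
  also have "\<dots> \<le> 1"
  proof -
    have "l powr (- q) * i \<le> 1" unfolding powr_minus lq using i by (simp add: divide_simps)
    then show ?thesis using i by (simp add: ennreal_mult'[symmetric])
  qed
  finally show ?thesis using l1 by (intro exI[of _ l]) auto
qed

text \<open>Multiplication by a positive finite constant is invertible on extended nonnegative
  numbers, so it can be moved to the other side, where the infimum is the greatest lower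
  bound.\<close>

lemma ennreal_scaled_inf:
  assumes C: "0 < C" and S: "\<And>l. l \<in> S \<Longrightarrow> X \<le> ennreal C * l"
  shows "X \<le> ennreal C * Inf S"
proof -
  have inv: "ennreal C * (ennreal (1 / C) * y) = y" "ennreal (1 / C) * (ennreal C * y) = y" for y
    using C by (simp_all add: mult.assoc[symmetric] ennreal_mult'[symmetric])
  have "ennreal (1 / C) * X \<le> Inf S"
  proof (rule Inf_greatest)
    fix l assume "l \<in> S"
    from mult_left_mono[OF S[OF this], of "ennreal (1 / C)"] show "ennreal (1 / C) * X \<le> l" by (simp only: inv zero_le)
  qed
  then have "ennreal C * (ennreal (1 / C) * X) \<le> ennreal C * Inf S" by (rule mult_left_mono) simp
  then show ?thesis by (simp only: inv)
qed

lemma p_bounds: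
  fixes p :: "real^'n \<Rightarrow> real"
  assumes "p \<in> variable_exponents"
  shows "AE x in lebesgue. p_minus p \<le> p x \<and> p x \<le> p_plus p"
proof -
  have m: "0 < ess_minus p" "ess_minus p \<le> ess_plus p" "ess_plus p < \<infinity>"
    using assms by (auto simp: variable_exponents_def)
  have e1: "ereal (p_plus p) = ess_plus p" unfolding p_plus_def using m by (intro ereal_real') auto
  have e2: "ereal (p_minus p) = ess_minus p" unfolding p_minus_def using m by (intro ereal_real') auto
  have "AE x in lebesgue. ereal (p x) \<le> ess_plus p" unfolding ess_plus_def by (rule esssup_AE)
  moreover have "AE x in lebesgue. - ereal (p x) \<le> esssup lebesgue (\<lambda>x. - ereal (p x))" by (rule esssup_AE)
  ultimately show ?thesis
  proof eventually_elim
    case (elim x)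
    have "ess_minus p \<le> ereal (p x)" unfolding ess_minus_def using elim(2) by (simp add: ereal_uminus_le_reorder)
    with elim(1) show ?case unfolding e1[symmetric] e2[symmetric] by simp
  qed
qed

section \<open>The dilation together with its transpose\<close>

locale dual_ellipsoids = E: ellipsoid A \<Delta> P r + E': ellipsoid "transpose A" \<Delta>' P' r'
  for A :: "real^'n^'n" and \<Delta> P r \<Delta>' P' r'
begin

text \<open>\<open>G j\<close> maps the \<open>j\<close>-th ball of the transposed dilation onto its
  ellipsoid, so \<open>gaussian (G j)\<close> is a smooth substitute for the indicator function of
  that ball.\<close>

definition G :: "int \<Rightarrow> real^'n^'n" where "G j = matrix_powi (transpose A) (- j)"

lemma G_inv: "G j ** matrix_powi (transpose A) j = mat 1" "matrix_powi (transpose A) j ** G j = mat 1"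
  unfolding G_def using matrix_powi_uminus_mult[OF E'.invA] matrix_powi_mult_uminus[OF E'.invA] by auto

lemma rapid_G: "rapid (gaussian (G j))" by (rule rapid_gaussian[OF G_inv(2)])

lemma abs_det_transpose: "\<bar>det (transpose A)\<bar> = \<bar>det A\<bar>" by simp

text \<open>The transform of a Gaussian involves the transposed inverse matrix; this is why the
  transpose of \<open>A\<close> on the frequency side gives powers of \<open>A\<close> itself in
  space.\<close>

lemma FT_gaussian_G:
  "FT (\<lambda>\<xi>. gaussian (G j) \<xi> * chi y \<xi>) z = complex_of_real (E.b powi j) * gaussian (mat 1) (matrix_powi A j *v (y - z))"
proof -
  have "FT (\<lambda>\<xi>. gaussian (G j) \<xi> * chi y \<xi>) z = (LINT \<xi>|lborel. gaussian (G j) \<xi> * chi (y - z) \<xi>)"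
    unfolding FTs_def chi_minus[symmetric] by (simp add: mult.assoc flip: chi_add)
  also have "\<dots> = \<bar>det (matrix_powi (transpose A) j)\<bar> * gaussian (transpose (matrix_powi (transpose A) j)) (y - z)"
    by (rule gaussian_chi(2)[OF G_inv(1)])
  also have "\<bar>det (matrix_powi (transpose A) j)\<bar> = E.b powi j"
    by (simp add: det_matrix_powi[OF E'.invA] power_int_abs)
  also have "transpose (matrix_powi (transpose A) j) = matrix_powi A j"
    by (simp add: matrix_powi_transpose[OF E.invA])
  finally show ?thesis by (simp add: gaussian_def)
qed

lemma convolution_smoothed:
  assumes f: "f \<in> tempered_distributions"
  shows "Defs.convolution f (dilate_fun A (- j) (\<lambda>x. complex_of_real c * gaussian (mat 1) x)) y = c * smoothed f (G j) y"
proof -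
  have "(\<lambda>z. dilate_fun A (- j) (\<lambda>x. complex_of_real c * gaussian (mat 1) x) (y - z)) = FT (\<lambda>\<xi>. complex_of_real c * (gaussian (G j) \<xi> * chi y \<xi>))"
    unfolding FT_cmult FT_gaussian_G by (simp add: dilate_fun_def fun_eq_iff mult_ac)
  then show ?thesis
    unfolding Defs.convolution_def smoothed_def[OF f] using f_FT_cmult[OF f rapid_gaussian_chi[OF f rapid_G]] by simp
qed

text \<open>The kernel belonging to scale \<open>j\<close> is a dilate with index \<open>- j\<close>
  of a function in \<open>schwartz_N\<close>, so \<open>y\<close> may range over the ball of the
  same index around \<open>x\<close>.\<close>

lemma nontangential:
  assumes f: "f \<in> tempered_distributions" and c: "0 < c"
    and cN: "(\<lambda>x. complex_of_real c * gaussian (mat 1) x) \<in> schwartz_N A \<Delta> N"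
    and xy: "y - x \<in> dilated_ball A \<Delta> (- j)"
  shows "ennreal (c * norm (smoothed f (G j) y)) \<le> grand_maximal A \<Delta> N f x"
proof -
  let ?\<phi> = "\<lambda>x. complex_of_real c * gaussian (mat 1) x"
  have "ennreal (c * norm (smoothed f (G j) y)) = ennreal (norm (Defs.convolution f (dilate_fun A (- j) ?\<phi>) y))"
    using c by (simp add: convolution_smoothed[OF f] norm_mult)
  also have "\<dots> \<le> (SUP y \<in> (\<lambda>z. x + z) ` dilated_ball A \<Delta> (- j). ennreal (norm (Defs.convolution f (dilate_fun A (- j) ?\<phi>) y)))"
    by (rule SUP_upper) (use xy in \<open>auto intro!: image_eqI[of _ _ "y - x"]\<close>)
  also have "\<dots> \<le> (SUP k. SUP y \<in> (\<lambda>z. x + z) ` dilated_ball A \<Delta> k. ennreal (norm (Defs.convolution f (dilate_fun A k ?\<phi>) y)))"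
    by (rule SUP_upper) simp
  also have "\<dots> \<le> grand_maximal A \<Delta> N f x"
    unfolding grand_maximal_def by (rule SUP_upper[OF cN])
  finally show ?thesis .
qed

text \<open>The set of \<open>x\<close> is the ball reflected and translated; the ball is symmetric
  about the origin.\<close>

lemma emeasure_reflected_ball:
  "{x. y - x \<in> dilated_ball A \<Delta> k} \<in> sets borel" "emeasure lborel {x. y - x \<in> dilated_ball A \<Delta> k} = ennreal (E.b powi k)"
proof -
  let ?B = "dilated_ball A \<Delta> k"
  have [measurable]: "?B \<in> sets borel" by (rule E.emeasure_ball(2))
  have eq: "{x. y - x \<in> ?B} = {x. - y + x \<in> ?B}"
    using E.ball_symmetric[of "y - _" k] by auto
  show s[measurable]: "{x. y - x \<in> ?B} \<in> sets borel"
  proof -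
    have "(\<lambda>x. y - x) -` ?B \<inter> space borel \<in> sets borel" by (rule measurable_sets) measurable
    then show ?thesis by (simp add: vimage_def)
  qed
  have "emeasure lborel {x. y - x \<in> ?B} = (\<integral>\<^sup>+x. indicator {x. y - x \<in> ?B} x \<partial>lborel)" by simp
  also have "\<dots> = (\<integral>\<^sup>+x. indicator ?B (- y + x) \<partial>lborel)" unfolding eq by (simp add: indicator_def)
  also have "\<dots> = (\<integral>\<^sup>+x. indicator ?B x \<partial>lborel)" by (rule nn_integral_translate) measurable
  also have "\<dots> = ennreal (E.b powi k)" by (simp add: E.emeasure_ball)
  finally show "emeasure lborel {x. y - x \<in> ?B} = ennreal (E.b powi k)" .
qed

text \<open>A point of the \<open>j\<close>-th shell lies in the ball of index \<open>j + 1\<close>.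
  So the power of index \<open>- (j + 1)\<close> maps it into a fixed bounded set, and one further
  application of the transpose of \<open>A\<close> keeps \<open>G j *v \<xi>\<close> bounded,
  uniformly in \<open>j\<close>.\<close>

lemma gaussian_lower_shell: "\<exists>\<kappa>>0. \<forall>j \<xi>. \<xi> \<in> E'.shell j \<longrightarrow> \<kappa> \<le> norm (gaussian (G j) \<xi>)"
proof -
  obtain c where c: "0 < c" "\<And>x. norm x \<le> c * norm (P' *v x)" using E'.P_bounds by blast
  obtain a where a: "0 < a" "\<And>x. norm (transpose A *v x) \<le> a * norm x"
    using linear_bounded_pos[OF matrix_vector_mul_linear[of "transpose A"]] by blast
  have "exp (- pi * (a * c)\<^sup>2) \<le> norm (gaussian (G j) \<xi>)" if x: "\<xi> \<in> E'.shell j" for j \<xi>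
  proof -
    have "G j = transpose A ** matrix_powi (transpose A) (- (j + 1))"
      using matrix_powi_succ[OF E'.invA, of "- (j + 1)"] by (simp add: G_def)
    then have "G j *v \<xi> = transpose A *v (matrix_powi (transpose A) (- (j + 1)) *v \<xi>)"
      by (simp only: matrix_vector_mul_assoc)
    then have "norm (G j *v \<xi>) \<le> a * norm (matrix_powi (transpose A) (- (j + 1)) *v \<xi>)" using a(2) by simp
    also have "\<dots> \<le> a * (c * norm (P' *v (matrix_powi (transpose A) (- (j + 1)) *v \<xi>)))" using a c by (intro mult_left_mono) auto
    also have "\<dots> \<le> a * (c * 1)" using x a c unfolding E'.shell_iff E'.nrm_def by (intro mult_left_mono) auto
    finally have "norm (G j *v \<xi>) \<le> a * c" by simp
    then have "(norm (G j *v \<xi>))\<^sup>2 \<le> (a * c)\<^sup>2" by (intro power_mono) auto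
    then show ?thesis by (simp add: gaussian_def)
  qed
  then show ?thesis by (intro exI[of _ "exp (- pi * (a * c)\<^sup>2)"]) auto
qed

text \<open>The gauge of \<open>P'\<close> contracts by \<open>1 / r'\<close> per step;
  \<open>C\<close> is the price for passing to the Euclidean norm and back. Hence the Gaussians
  \<open>gaussian (G (int k))\<close> tend to one.\<close>

lemma G_contract: "\<exists>C\<ge>0. \<forall>k x. norm (G (int k) *v x) \<le> C * (1 / r') ^ k * norm x"
proof -
  obtain c where c: "0 < c" "\<And>x. norm x \<le> c * norm (P' *v x)" "\<And>x. norm (P' *v x) \<le> c * norm x" using E'.P_bounds by auto
  have "norm (G (int k) *v x) \<le> (c * c) * (1 / r') ^ k * norm x" for k x
  proof -
    have "r' ^ k * E'.nrm (int k) x \<le> E'.nrm 0 x" using E'.nrm_add[of k 0 x] by simp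
    then have "E'.nrm (int k) x \<le> E'.nrm 0 x * (1 / r') ^ k" using E'.r by (simp add: field_simps)
    also have "\<dots> \<le> (c * norm x) * (1 / r') ^ k"
      using c(3)[of x] E'.r by (intro mult_right_mono) (auto simp: E'.nrm_def matrix_powi_0[OF E'.invA])
    finally have n: "norm (P' *v (G (int k) *v x)) \<le> (c * norm x) * (1 / r') ^ k" by (simp add: E'.nrm_def G_def)
    have "norm (G (int k) *v x) \<le> c * norm (P' *v (G (int k) *v x))" by (rule c(2))
    also have "\<dots> \<le> c * ((c * norm x) * (1 / r') ^ k)" using n c(1) by (intro mult_left_mono) auto
    finally show ?thesis by (simp add: mult_ac)
  qed
  then show ?thesis using c(1) by (intro exI[of _ "c * c"]) auto
qed

section \<open>Estimates for a single distribution\<close>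

context
  fixes f :: "(real^'n \<Rightarrow> complex) \<Rightarrow> complex" and p :: "real^'n \<Rightarrow> real" and N :: nat and c q s :: real
  assumes f: "f \<in> tempered_distributions"
    and pm [measurable]: "p \<in> borel_measurable lebesgue" and p0: "\<And>x. 0 < p x"
    and pb: "AE x in lebesgue. q \<le> p x \<and> p x \<le> s"
    and q: "0 < q" "q \<le> s" and s1: "s \<le> 1"
    and gm [measurable]: "grand_maximal A \<Delta> N f \<in> borel_measurable lebesgue"
    and c: "0 < c" and cN: "(\<lambda>x. complex_of_real c * gaussian (mat 1) x) \<in> schwartz_N A \<Delta> N"
begin

text \<open>The numbers over which the infimum in the Hardy norm is taken.\<close>

definition admissible :: "real \<Rightarrow> bool" where
  "admissible l \<longleftrightarrow> 0 < l \<and> (\<integral>\<^sup>+x. enn_powr (grand_maximal A \<Delta> N f x / ennreal l) (p x) \<partial>lebesgue) \<le> 1"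

definition U :: "real \<Rightarrow> int \<Rightarrow> real^'n \<Rightarrow> real" where
  "U l j y = c * norm (smoothed f (G j) y) / l"

lemma b_powi: "E.b powi j = E.b powr real_of_int j"
  using powr_real_of_int'[of E.b j] E.b_pos by simp

lemma U_le: "0 < l \<Longrightarrow> y - x \<in> dilated_ball A \<Delta> (- j) \<Longrightarrow> ennreal (U l j y) \<le> grand_maximal A \<Delta> N f x / ennreal l"
proof -
  assume l: "0 < l" and xy: "y - x \<in> dilated_ball A \<Delta> (- j)"
  have "ennreal (U l j y) = ennreal (c * norm (smoothed f (G j) y)) / ennreal l"
    using l c by (simp add: U_def divide_ennreal)
  also have "\<dots> \<le> grand_maximal A \<Delta> N f x / ennreal l"
    by (intro divide_right_mono_ennreal nontangential[OF f c cN xy])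
  finally show ?thesis .
qed

lemma U_nonneg: "0 < l \<Longrightarrow> 0 \<le> U l j y" using c by (simp add: U_def)

lemma U_self: "0 < l \<Longrightarrow> ennreal (U l j x) \<le> grand_maximal A \<Delta> N f x / ennreal l"
  by (rule U_le) (auto simp: E.ball_iff E.nrm_def)

lemma U_level:
  assumes l: "0 < l"
  shows "ennreal (E.b powr (- real_of_int j)) \<le> emeasure lebesgue {x \<in> space lebesgue. ennreal (U l j y) \<le> grand_maximal A \<Delta> N f x / ennreal l}"
proof -
  have "ennreal (E.b powr (- real_of_int j)) = emeasure lebesgue {x. y - x \<in> dilated_ball A \<Delta> (- j)}"
    using emeasure_reflected_ball[of y "- j"] b_powi[of "- j"] by simp
  also have "\<dots> \<le> emeasure lebesgue {x \<in> space lebesgue. ennreal (U l j y) \<le> grand_maximal A \<Delta> N f x / ennreal l}"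
  proof (rule emeasure_mono)
    show "{x. y - x \<in> dilated_ball A \<Delta> (- j)} \<subseteq> {x \<in> space lebesgue. ennreal (U l j y) \<le> grand_maximal A \<Delta> N f x / ennreal l}"
      using U_le[OF l] by auto
  qed measurable
  finally show ?thesis .
qed

text \<open>A value above one is attained or exceeded by the normalised maximal function on a set of
  measure at least \<open>b powr (- j)\<close>, which the modular permits only up to height
  \<open>b powr (j / q)\<close>.\<close>

lemma U_bound:
  assumes l: "admissible l"
  shows "U l j y \<le> max 1 (E.b powr (real_of_int j / q))"
proof (cases "U l j y \<le> 1")
  case False
  have l0: "0 < l" and mod: "(\<integral>\<^sup>+x. enn_powr (grand_maximal A \<Delta> N f x / ennreal l) (p x) \<partial>lebesgue) \<le> 1" using l by (auto simp: admissible_def)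
  have pq: "AE x in lebesgue. q \<le> p x" using pb by eventually_elim simp
  have "E.b powr (- real_of_int j) * U l j y powr q \<le> 1"
    by (rule modular_bound[OF _ pm pq q(1) mod _ _ U_level[OF l0]]) (use False E.b_pos in auto)
  then have "E.b powr real_of_int j * (E.b powr (- real_of_int j) * U l j y powr q) \<le> E.b powr real_of_int j * 1"
    by (rule mult_left_mono) simp
  then have "U l j y powr q \<le> E.b powr real_of_int j"
    using E.b_pos by (simp add: mult.assoc[symmetric] powr_add[symmetric])
  then have "(U l j y powr q) powr (1 / q) \<le> (E.b powr real_of_int j) powr (1 / q)"
    using q by (intro powr_mono2) auto
  then have "U l j y \<le> E.b powr (real_of_int j / q)" using False q by (simp add: powr_powr)
  then show ?thesis by simp
qed simp

lemma smoothed_measurable [measurable]: "smoothed f (G j) \<in> borel_measurable borel"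
  by (rule smoothed_borel[OF f rapid_G])

text \<open>The explicit bound matters as well as the integrability: its growth in \<open>j\<close>
  becomes the polynomial growth of \<open>fourier_fun\<close>.\<close>

lemma smoothed_integrable:
  assumes l: "admissible l"
  shows "integrable lborel (smoothed f (G j))"
    and "(LINT x|lborel. norm (smoothed f (G j) x)) \<le> (l / c) * (1 + max 1 (E.b powr (real_of_int j / q)))"
proof -
  let ?K = "max 1 (E.b powr (real_of_int j / q))"
  have l0: "0 < l" and mod: "(\<integral>\<^sup>+x. enn_powr (grand_maximal A \<Delta> N f x / ennreal l) (p x) \<partial>lebesgue) \<le> 1" using l by (auto simp: admissible_def)
  have p1: "AE x in lebesgue. p x \<le> 1" using pb by eventually_elim (use s1 in simp)
  have "(\<integral>\<^sup>+x. ennreal (U l j x) \<partial>lebesgue) \<le> ennreal (1 + ?K)"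
    by (rule modular_L1[OF _ pm p0 p1 mod U_nonneg[OF l0] U_self[OF l0] U_bound[OF l]]) auto
  then have "(\<integral>\<^sup>+x. ennreal (U l j x) \<partial>lborel) \<le> ennreal (1 + ?K)" by (simp only: nn_integral_completion)
  moreover have "(\<integral>\<^sup>+x. ennreal (norm (smoothed f (G j) x)) \<partial>lborel) = ennreal (l / c) * (\<integral>\<^sup>+x. ennreal (U l j x) \<partial>lborel)"
  proof -
    have e: "ennreal (norm (smoothed f (G j) x)) = ennreal (l / c) * ennreal (U l j x)" for x
      using l0 c by (simp add: U_def ennreal_mult'[symmetric])
    have [measurable]: "U l j \<in> borel_measurable borel" unfolding U_def[abs_def] by measurable
    show ?thesis by (simp only: e) (rule nn_integral_cmult, measurable)
  qed
  ultimately have n: "(\<integral>\<^sup>+x. ennreal (norm (smoothed f (G j) x)) \<partial>lborel) \<le> ennreal (l / c) * ennreal (1 + ?K)"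
    by (simp add: mult_left_mono)
  also have "\<dots> = ennreal ((l / c) * (1 + ?K))" using l0 c by (intro ennreal_mult[symmetric]) auto
  finally have n: "(\<integral>\<^sup>+x. ennreal (norm (smoothed f (G j) x)) \<partial>lborel) \<le> ennreal ((l / c) * (1 + ?K))" .
  show i: "integrable lborel (smoothed f (G j))"
    unfolding integrable_iff_bounded using n by (auto simp: le_less_trans)
  have "ennreal (LINT x|lborel. norm (smoothed f (G j) x)) = (\<integral>\<^sup>+x. ennreal (norm (smoothed f (G j) x)) \<partial>lborel)"
    by (rule nn_integral_eq_integral[symmetric]) (use i in auto)
  with n have "ennreal (LINT x|lborel. norm (smoothed f (G j) x)) \<le> ennreal ((l / c) * (1 + ?K))" by simp
  moreover have "0 \<le> (l / c) * (1 + ?K)" using l0 c by (intro mult_nonneg_nonneg) auto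
  ultimately show "(LINT x|lborel. norm (smoothed f (G j) x)) \<le> (l / c) * (1 + ?K)" by simp
qed

text \<open>The scale zero is an arbitrary choice, by \<open>FT_smoothed_consistent\<close>. No
  admissible number enters, so that estimates for all of them concern the same function.\<close>

definition fourier_fun :: "real^'n \<Rightarrow> complex" where
  "fourier_fun \<xi> = FT (smoothed f (G 0)) \<xi> / gaussian (G 0) \<xi>"

lemma fourier_fun_gaussian: "admissible l \<Longrightarrow> fourier_fun \<xi> * gaussian (G j) \<xi> = FT (smoothed f (G j)) \<xi>"
  using FT_smoothed_consistent[OF f rapid_G[of 0] rapid_G[of j] smoothed_integrable(1) smoothed_integrable(1), of l l \<xi>]
  by (simp add: fourier_fun_def field_simps)

lemma fourier_fun_continuous: "admissible l \<Longrightarrow> continuous_on UNIV fourier_fun"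
  unfolding fourier_fun_def[abs_def]
  by (intro continuous_intros FTs_continuous smoothed_integrable) auto

lemma fourier_fun_shell_bound:
  assumes \<kappa>: "0 < \<kappa>" "\<And>j \<xi>. \<xi> \<in> E'.shell j \<Longrightarrow> \<kappa> \<le> norm (gaussian (G j) \<xi>)" and l: "admissible l" and x: "\<xi> \<in> E'.shell j"
  shows "norm (fourier_fun \<xi>) \<le> norm (FT (smoothed f (G j)) \<xi>) / \<kappa>"
proof -
  have "norm (fourier_fun \<xi>) * \<kappa> \<le> norm (fourier_fun \<xi>) * norm (gaussian (G j) \<xi>)" using \<kappa>(2)[OF x] by (rule mult_left_mono) simp
  also have "\<dots> = norm (FT (smoothed f (G j)) \<xi>)" by (simp add: fourier_fun_gaussian[OF l, symmetric] norm_mult)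
  finally show ?thesis using \<kappa>(1) by (simp add: pos_le_divide_eq)
qed

text \<open>On the \<open>j\<close>-th shell the function is at most a multiple of the integral of
  \<open>norm (smoothed f (G j) x)\<close>, thus of \<open>1 + b powr (j / q)\<close>, and
  \<open>b powr j\<close> grows polynomially there. This makes products with Schwartz functions
  integrable.\<close>

lemma fourier_fun_growth:
  assumes l: "admissible l"
  shows "\<exists>C M. \<forall>\<xi>. norm (fourier_fun \<xi>) \<le> C * (1 + norm \<xi>) powr M"
proof -
  obtain \<kappa> where \<kappa>: "0 < \<kappa>" "\<And>j \<xi>. \<xi> \<in> E'.shell j \<Longrightarrow> \<kappa> \<le> norm (gaussian (G j) \<xi>)" using gaussian_lower_shell by blast
  obtain K M where K: "0 \<le> K" "\<And>x k. x \<in> E'.shell k \<Longrightarrow> E.b powi k \<le> K * (1 + norm x) ^ M"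
    using E'.rho_growth unfolding abs_det_transpose by blast
  have l0: "0 < l" using l by (simp add: admissible_def)
  \<comment> \<open>The origin lies in no shell, so its value is added to the constant.\<close>
  let ?C = "norm (fourier_fun 0) + (l / c) * (2 + K powr (1 / q)) / \<kappa>" and ?M = "real M / q"
  have C0: "0 \<le> (l / c) * (2 + K powr (1 / q)) / \<kappa>" using l0 c \<kappa>(1) by (intro divide_nonneg_pos mult_nonneg_nonneg add_nonneg_nonneg) auto
  have w1: "1 \<le> (1 + norm \<xi>) powr ?M" for \<xi> :: "real^'n" using q by (intro ge_one_powr_ge_zero) auto
  have "norm (fourier_fun \<xi>) \<le> ?C * (1 + norm \<xi>) powr ?M" for \<xi>
  proof (cases "\<xi> = 0")
    case True
    then show ?thesis using C0 by simp
  next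
    case False
    then obtain j where j: "\<xi> \<in> E'.shell j" using E'.shell_exists by blast
    have "E.b powr (real_of_int j / q) = (E.b powi j) powr (1 / q)" using E.b_pos by (simp add: b_powi powr_powr)
    also have "\<dots> \<le> (K * (1 + norm \<xi>) ^ M) powr (1 / q)" using K(2)[OF j] E.b_pos q by (intro powr_mono2) auto
    also have "\<dots> = K powr (1 / q) * (1 + norm \<xi>) powr ?M"
      using K(1) powr_realpow[of "1 + norm \<xi>" M, symmetric] by (simp add: powr_mult powr_powr)
    finally have "1 + max 1 (E.b powr (real_of_int j / q)) \<le> 1 + (1 + K powr (1 / q) * (1 + norm \<xi>) powr ?M)"
      by (simp add: max_def)
    also have "\<dots> \<le> (2 + K powr (1 / q)) * (1 + norm \<xi>) powr ?M" using w1[of \<xi>] by (simp add: distrib_right)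
    finally have m: "1 + max 1 (E.b powr (real_of_int j / q)) \<le> (2 + K powr (1 / q)) * (1 + norm \<xi>) powr ?M" .
    have "norm (fourier_fun \<xi>) \<le> norm (FT (smoothed f (G j)) \<xi>) / \<kappa>" by (rule fourier_fun_shell_bound[OF \<kappa> l j])
    also have "\<dots> \<le> (LINT x|lborel. norm (smoothed f (G j) x)) / \<kappa>"
      using \<kappa>(1) by (intro divide_right_mono FTs_bound smoothed_integrable(1)[OF l]) auto
    also have "\<dots> \<le> ((l / c) * (1 + max 1 (E.b powr (real_of_int j / q)))) / \<kappa>"
      using \<kappa>(1) by (intro divide_right_mono smoothed_integrable(2)[OF l]) auto
    also have "\<dots> \<le> ((l / c) * ((2 + K powr (1 / q)) * (1 + norm \<xi>) powr ?M)) / \<kappa>"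
      using \<kappa>(1) l0 c m by (intro divide_right_mono mult_left_mono) auto
    also have "\<dots> \<le> ?C * (1 + norm \<xi>) powr ?M" by (simp add: distrib_right mult.assoc)
    finally show ?thesis .
  qed
  then show ?thesis by blast
qed

lemma fourier_fun_dist:
  assumes l: "admissible l"
  shows "dist_eq_fun (fourier_dist f) fourier_fun"
  unfolding dist_eq_fun_def fourier_dist_def
proof (intro ballI)
  fix \<phi> :: "real^'n \<Rightarrow> complex" assume "\<phi> \<in> schwartz_space"
  then have r: "rapid \<phi>" by (rule schwartz_rapid)
  obtain C M where CM: "\<And>\<xi>. norm (fourier_fun \<xi>) \<le> C * (1 + norm \<xi>) powr M" using fourier_fun_growth[OF l] by blast
  obtain D where D: "0 \<le> D" "\<And>k x. norm (G (int k) *v x) \<le> D * (1 / r') ^ k * norm x" using G_contract by blast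
  have lim: "(\<lambda>k. D * (1 / r') ^ k) \<longlonglongrightarrow> 0"
    using E'.r by (intro tendsto_mult_right_zero LIMSEQ_power_zero) auto
  have D0: "0 \<le> D * (1 / r') ^ k" for k using D(1) E'.r by simp
  note main = f_FT_eq_integral[where Bk="\<lambda>k. G (int k)" and F=fourier_fun, OF f rapid_G smoothed_integrable(1)[OF l] D(2) D0 lim fourier_fun_gaussian[OF l] fourier_fun_continuous[OF l] CM r]
  have [measurable]: "fourier_fun \<in> borel_measurable borel" "\<phi> \<in> borel_measurable borel"
    using fourier_fun_continuous[OF l] rapid_borel[OF r] by (auto intro: borel_measurable_continuous_onI)
  have "integrable lebesgue (\<lambda>x. fourier_fun x * \<phi> x)" using main(1) by (subst integrable_completion) auto
  moreover have "f (fourier \<phi>) = (LINT x|lebesgue. fourier_fun x * \<phi> x)"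
    using main(2) by (subst integral_completion) (auto simp: fourier_eq_FT[OF rapid_borel[OF r]])
  ultimately show "integrable lebesgue (\<lambda>x. fourier_fun x * \<phi> x) \<and> f (fourier \<phi>) = (LINT x|lebesgue. fourier_fun x * \<phi> x)" by blast
qed

text \<open>The shells cover everything but the origin, and on each of them the function is replaced
  by the normalised transform \<open>?V j\<close>. Undoing the normalisation \<open>c / l\<close>
  and the lower bound \<open>\<kappa>\<close> of the Gaussian produces the factor
  \<open>?d\<close>.\<close>

lemma fourier_fun_weighted:
  assumes \<kappa>: "0 < \<kappa>" "\<And>j \<xi>. \<xi> \<in> E'.shell j \<Longrightarrow> \<kappa> \<le> norm (gaussian (G j) \<xi>)"
    and C0: "shell_sum_const (lebesgue :: (real^'n) measure) E.b q s C"
    and l: "admissible l"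
  shows "(\<integral>\<^sup>+ x. ennreal (norm (fourier_fun x) powr s *
              min (step_quasi_norm (transpose A) \<Delta>' x powr (s - 1 - s / q))
                  (step_quasi_norm (transpose A) \<Delta>' x powr (s - 2))) \<partial>lebesgue)
     \<le> ennreal ((l / (c * \<kappa>)) powr s) * ennreal C"
proof -
  let ?h = "\<lambda>x. grand_maximal A \<Delta> N f x / ennreal l"
  let ?V = "\<lambda>j x. (c / l) * norm (FT (smoothed f (G j)) x)"
  let ?w = "\<lambda>j::int. if j < 0 then E.b powr (real_of_int j * (s - 2)) else E.b powr (real_of_int j * (s - 1 - s / q))"
  let ?d = "(l / (c * \<kappa>)) powr s"
  have l0: "0 < l" and mod: "(\<integral>\<^sup>+x. enn_powr (?h x) (p x) \<partial>lebesgue) \<le> 1" using l by (auto simp: admissible_def)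
  have s0: "0 < s" using q by simp
  have FTm[measurable]: "FT (smoothed f (G j)) \<in> borel_measurable borel" for j
    by (rule borel_measurable_continuous_onI[OF FTs_continuous[OF smoothed_integrable(1)[OF l]]]) simp
  have Vb: "?V j \<in> borel_measurable borel" for j by measurable
  have Vm: "?V j \<in> borel_measurable lebesgue" for j
    using measurable_completion[of "?V j" lborel borel] Vb[of j] by simp
  have sb: "isum (\<lambda>j. ennreal (?w j) * (\<integral>\<^sup>+x. ennreal (?V j x powr s) * indicator (E'.shell j) x \<partial>lebesgue)) \<le> ennreal C"
  proof (rule shell_sum_constD[OF C0, where h="?h" and p=p and U="U l" and V="?V"])
    show "?h \<in> borel_measurable lebesgue" by measurable
    show "p \<in> borel_measurable lebesgue" by (rule pm)
    show "0 < p x" for x by (rule p0)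
    show "AE x in lebesgue. q \<le> p x \<and> p x \<le> s" by (rule pb)
    show "(\<integral>\<^sup>+x. enn_powr (?h x) (p x) \<partial>lebesgue) \<le> 1" by (rule mod)
    show "0 \<le> U l j x" "ennreal (U l j x) \<le> ?h x" for j x by (rule U_nonneg[OF l0], rule U_self[OF l0])
    show "ennreal (E.b powr (- real_of_int j)) \<le> emeasure lebesgue {x \<in> space lebesgue. ennreal (U l j y) \<le> ?h x}" for j y
      by (rule U_level[OF l0])
    show "0 \<le> ?V j x" for j x using l0 c by simp
    show "?V j \<in> borel_measurable lebesgue" for j by (rule Vm)
    show "(\<integral>\<^sup>+x. ennreal ((?V j x)\<^sup>2) \<partial>lebesgue) \<le> (\<integral>\<^sup>+x. ennreal ((U l j x)\<^sup>2) \<partial>lebesgue)" for j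
    proof -
      have "(\<integral>\<^sup>+x. ennreal ((?V j x)\<^sup>2) \<partial>lborel) = ennreal ((c / l)\<^sup>2) * (\<integral>\<^sup>+x. ennreal ((norm (FT (smoothed f (G j)) x))\<^sup>2) \<partial>lborel)"
        by (subst nn_integral_cmult[symmetric]) (simp_all only: power_mult_distrib ennreal_mult'[OF zero_le_power2], measurable)
      also have "\<dots> \<le> ennreal ((c / l)\<^sup>2) * (\<integral>\<^sup>+x. ennreal ((norm (smoothed f (G j) x))\<^sup>2) \<partial>lborel)"
        by (intro mult_left_mono bessel_inequality smoothed_integrable(1)[OF l]) simp
      also have "\<dots> = (\<integral>\<^sup>+x. ennreal (((c / l) * norm (smoothed f (G j) x))\<^sup>2) \<partial>lborel)"
        by (subst nn_integral_cmult[symmetric]) (simp_all only: power_mult_distrib ennreal_mult'[OF zero_le_power2], measurable)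
      finally show "(\<integral>\<^sup>+x. ennreal ((?V j x)\<^sup>2) \<partial>lebesgue) \<le> (\<integral>\<^sup>+x. ennreal ((U l j x)\<^sup>2) \<partial>lebesgue)"
        by (simp add: nn_integral_completion U_def)
    qed
    show "E'.shell j \<in> sets lebesgue" for j using E'.shell_borel[of j] by simp
    show "emeasure lebesgue (E'.shell j) \<le> ennreal (E.b powr (real_of_int j + 1))" for j
    proof -
      have "emeasure lebesgue (E'.shell j) = emeasure lborel (E'.shell j)" using E'.shell_borel[of j] by simp
      then show ?thesis using E'.emeasure_shell[of j] b_powi[of "j + 1"] unfolding abs_det_transpose by simp
    qed
  qed
  have "(\<integral>\<^sup>+ x. ennreal (norm (fourier_fun x) powr s *
              min (step_quasi_norm (transpose A) \<Delta>' x powr (s - 1 - s / q))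
                  (step_quasi_norm (transpose A) \<Delta>' x powr (s - 2))) \<partial>lebesgue)
     \<le> (\<integral>\<^sup>+ x. ennreal ?d * isum (\<lambda>j. ennreal (?w j) * (ennreal (?V j x powr s) * indicator (E'.shell j) x)) \<partial>lebesgue)"
  proof (rule nn_integral_mono)
    fix x :: "real^'n"
    show "ennreal (norm (fourier_fun x) powr s *
              min (step_quasi_norm (transpose A) \<Delta>' x powr (s - 1 - s / q))
                  (step_quasi_norm (transpose A) \<Delta>' x powr (s - 2)))
      \<le> ennreal ?d * isum (\<lambda>j. ennreal (?w j) * (ennreal (?V j x powr s) * indicator (E'.shell j) x))"
    proof (cases "x = 0")
      \<comment> \<open>At the origin the step quasi-norm is zero and \<open>0 powr a = 0\<close>,
        so the weight vanishes.\<close>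
      case True
      then show ?thesis by (simp add: step_quasi_norm_def)
    next
      case False
      then obtain j where j: "x \<in> E'.shell j" using E'.shell_exists by blast
      have rho: "step_quasi_norm (transpose A) \<Delta>' x = E.b powr real_of_int j"
        using E'.rho_shell[OF j] unfolding abs_det_transpose b_powi .
      \<comment> \<open>Whichever of the two powers \<open>?w j\<close> selects according to the
        sign of \<open>j\<close>, it is an upper bound for their minimum.\<close>
      have "min (step_quasi_norm (transpose A) \<Delta>' x powr (s - 1 - s / q)) (step_quasi_norm (transpose A) \<Delta>' x powr (s - 2)) \<le> ?w j"
        unfolding rho by (simp add: powr_powr)
      moreover have "norm (fourier_fun x) powr s \<le> ?d * ?V j x powr s"
      proof -
        have "norm (fourier_fun x) \<le> norm (FT (smoothed f (G j)) x) / \<kappa>" by (rule fourier_fun_shell_bound[OF \<kappa> l j])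
        also have "\<dots> = (l / (c * \<kappa>)) * ?V j x" using l0 c by simp
        finally have "norm (fourier_fun x) powr s \<le> ((l / (c * \<kappa>)) * ?V j x) powr s" using s0 by (intro powr_mono2) auto
        also have "\<dots> = ?d * ?V j x powr s" by (rule powr_mult)
        finally show ?thesis .
      qed
      ultimately have "norm (fourier_fun x) powr s * min (step_quasi_norm (transpose A) \<Delta>' x powr (s - 1 - s / q)) (step_quasi_norm (transpose A) \<Delta>' x powr (s - 2))
        \<le> (?d * ?V j x powr s) * ?w j" by (intro mult_mono) auto
      also have "\<dots> = ?d * (?w j * ?V j x powr s)" by (simp only: mult_ac)
      finally have "ennreal (norm (fourier_fun x) powr s * min (step_quasi_norm (transpose A) \<Delta>' x powr (s - 1 - s / q)) (step_quasi_norm (transpose A) \<Delta>' x powr (s - 2)))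
        \<le> ennreal (?d * (?w j * ?V j x powr s))" by (rule ennreal_leI)
      also have "\<dots> = ennreal ?d * (ennreal (?w j) * ennreal (?V j x powr s))"
      proof -
        have "0 \<le> ?w j" by simp
        then show ?thesis by (simp only: ennreal_mult'[OF powr_ge_zero] ennreal_mult'[of "?w j"])
      qed
      also have "\<dots> \<le> ennreal ?d * isum (\<lambda>j. ennreal (?w j) * (ennreal (?V j x powr s) * indicator (E'.shell j) x))"
      proof (rule mult_left_mono)
        show "ennreal (?w j) * ennreal (?V j x powr s) \<le> isum (\<lambda>j. ennreal (?w j) * (ennreal (?V j x powr s) * indicator (E'.shell j) x))"
          using nn_integral_ge_point[of j UNIV "\<lambda>j. ennreal (?w j) * (ennreal (?V j x powr s) * indicator (E'.shell j) x)"] j by simp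
      qed simp
      finally show ?thesis .
    qed
  qed
  also have "\<dots> = (\<integral>\<^sup>+ x. isum (\<lambda>j. ennreal ?d * (ennreal (?w j) * (ennreal (?V j x powr s) * indicator (E'.shell j) x))) \<partial>lborel)"
    unfolding nn_integral_completion by (intro nn_integral_cong nn_integral_cmult[symmetric]) simp
  also have "\<dots> = isum (\<lambda>j. \<integral>\<^sup>+ x. ennreal ?d * (ennreal (?w j) * (ennreal (?V j x powr s) * indicator (E'.shell j) x)) \<partial>lborel)"
    by (rule nn_integral_count_space_nn_integral) (auto, measurable)
  also have "\<dots> = isum (\<lambda>j. ennreal ?d * (ennreal (?w j) * (\<integral>\<^sup>+x. ennreal (?V j x powr s) * indicator (E'.shell j) x \<partial>lebesgue)))"
    unfolding nn_integral_completion
  proof (rule nn_integral_cong)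
    fix j :: int
    have m[measurable]: "(\<lambda>x. ennreal (?V j x powr s) * indicator (E'.shell j) x) \<in> borel_measurable lborel" by measurable
    show "(\<integral>\<^sup>+ x. ennreal ?d * (ennreal (?w j) * (ennreal (?V j x powr s) * indicator (E'.shell j) x)) \<partial>lborel)
      = ennreal ?d * (ennreal (?w j) * (\<integral>\<^sup>+x. ennreal (?V j x powr s) * indicator (E'.shell j) x \<partial>lborel))"
      by (subst nn_integral_cmult, measurable) (subst nn_integral_cmult[OF m], simp)
  qed
  also have "\<dots> = ennreal ?d * isum (\<lambda>j. ennreal (?w j) * (\<integral>\<^sup>+x. ennreal (?V j x powr s) * indicator (E'.shell j) x \<partial>lebesgue))"
    by (rule nn_integral_cmult) simp
  also have "\<dots> \<le> ennreal ?d * ennreal C" by (intro mult_left_mono sb) simp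
  finally show ?thesis .
qed

end

end

theorem theorem4p2:
  fixes A :: "real^'n^'n" and \<Delta> \<Delta>' :: "(real^'n) set"
    and lm :: real and p :: "real^'n \<Rightarrow> real" and N :: nat
  assumes "expansive_dilation A"
    and "lower_eigen_bound A lm"
    and "dilation_ellipsoid A \<Delta>"
    and "dilation_ellipsoid (transpose A) \<Delta>'"
    and "p \<in> log_holder A \<Delta>"
    and "0 < p_minus p" and "p_minus p \<le> p_plus p" and "p_plus p \<le> 1"
    and "int N \<ge> \<lfloor>(1 / p_underline p - 1) * ln \<bar>det A\<bar> / ln lm\<rfloor> + 2"
  shows "\<exists>C::real. C > 0 \<and>
    (\<forall>f \<in> hardy_space A \<Delta> N p. \<exists>F :: real^'n \<Rightarrow> complex.
       continuous_on UNIV F \<and> dist_eq_fun (fourier_dist f) F \<and>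
       enn_powr
         (\<integral>\<^sup>+ x. ennreal (norm (F x) powr p_plus p *
              min (step_quasi_norm (transpose A) \<Delta>' x powr (p_plus p - 1 - p_plus p / p_minus p))
                  (step_quasi_norm (transpose A) \<Delta>' x powr (p_plus p - 2))) \<partial>lebesgue)
         (1 / p_plus p)
       \<le> ennreal C * hardy_norm A \<Delta> N p f)"
proof -
  obtain P r where E: "ellipsoid A \<Delta> P r" using assms(3) by (rule dilation_ellipsoid_locale)
  obtain P' r' where E': "ellipsoid (transpose A) \<Delta>' P' r'" using assms(4) by (rule dilation_ellipsoid_locale)
  interpret dual_ellipsoids A \<Delta> P r \<Delta>' P' r' using E E' by (simp add: dual_ellipsoids_def)
  let ?q = "p_minus p" and ?s = "p_plus p"
  have pv: "p \<in> variable_exponents" using assms(5) by (simp add: log_holder_def)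
  then have pm: "p \<in> borel_measurable lebesgue" and p0: "\<And>x. 0 < p x" by (auto simp: variable_exponents_def)
  have pb: "AE x in lebesgue. ?q \<le> p x \<and> p x \<le> ?s" by (rule p_bounds[OF pv])
  have s0: "0 < ?s" using assms(6,7) by simp
  obtain c where c: "0 < c" "(\<lambda>x. complex_of_real c * gaussian (mat 1) x) \<in> schwartz_N A \<Delta> N"
    using E.gauss_schwartz_N by blast
  obtain \<kappa> where \<kappa>: "0 < \<kappa>" "\<And>j \<xi>. \<xi> \<in> E'.shell j \<Longrightarrow> \<kappa> \<le> norm (gaussian (G j) \<xi>)" using gaussian_lower_shell by blast
  obtain C0 where sh: "shell_sum_const (lebesgue :: (real^'n) measure) E.b ?q ?s C0"
    using shell_sum_bound[OF E.b_gt1 assms(6,7,8)] by blast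
  then have C0: "0 < C0" by (simp add: shell_sum_const_def)
  \<comment> \<open>The root of order \<open>p_plus p\<close> of the bound for the shell sum,
    divided by the factor that normalises the Gaussian and by its lower bound on the shells.\<close>
  define C where "C = C0 powr (1 / ?s) / (c * \<kappa>)"
  have C: "0 < C" using C0 c \<kappa>(1) by (simp add: C_def)
  have "\<exists>F :: real^'n \<Rightarrow> complex.
       continuous_on UNIV F \<and> dist_eq_fun (fourier_dist f) F \<and>
       enn_powr
         (\<integral>\<^sup>+ x. ennreal (norm (F x) powr ?s *
              min (step_quasi_norm (transpose A) \<Delta>' x powr (?s - 1 - ?s / ?q))
                  (step_quasi_norm (transpose A) \<Delta>' x powr (?s - 2))) \<partial>lebesgue)
         (1 / ?s)
       \<le> ennreal C * hardy_norm A \<Delta> N p f" if fH: "f \<in> hardy_space A \<Delta> N p" for f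
  proof -
    have f: "f \<in> tempered_distributions" and gm: "grand_maximal A \<Delta> N f \<in> borel_measurable lebesgue"
      and fin: "(\<integral>\<^sup>+ x. enn_powr (grand_maximal A \<Delta> N f x) (p x) \<partial>lebesgue) < \<infinity>"
      using fH by (auto simp: hardy_space_def Lvar_def)
    note hyps = f pm p0 pb assms(6,7,8) gm c
    have "AE x in lebesgue. ?q \<le> p x" using pb by eventually_elim simp
    \<comment> \<open>A single admissible number suffices for the continuity of
      \<open>fourier_fun f\<close> and its equality with the transformed distribution.\<close>
    from modular_scaling[OF gm pm this assms(6) fin] obtain l0 where l0: "admissible f p N l0"
      unfolding admissible_def[OF hyps] by blast
    let ?F = "fourier_fun f"
    let ?X = "\<integral>\<^sup>+ x. ennreal (norm (?F x) powr ?s *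
              min (step_quasi_norm (transpose A) \<Delta>' x powr (?s - 1 - ?s / ?q))
                  (step_quasi_norm (transpose A) \<Delta>' x powr (?s - 2))) \<partial>lebesgue"
    have X: "enn_powr ?X (1 / ?s) \<le> ennreal C * ennreal l" if l: "admissible f p N l" for l
    proof -
      have l1: "0 < l" using l by (simp add: admissible_def[OF hyps])
      have d0: "0 < l / (c * \<kappa>)" using l1 c \<kappa>(1) by simp
      have "?X \<le> ennreal ((l / (c * \<kappa>)) powr ?s) * ennreal C0"
        by (rule fourier_fun_weighted[OF hyps \<kappa> sh l])
      also have "\<dots> = ennreal ((l / (c * \<kappa>)) powr ?s * C0)" by (rule ennreal_mult'[symmetric]) simp
      finally have "enn_powr ?X (1 / ?s) \<le> enn_powr (ennreal ((l / (c * \<kappa>)) powr ?s * C0)) (1 / ?s)"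
        using s0 by (intro enn_powr_mono) auto
      also have "\<dots> = ennreal (((l / (c * \<kappa>)) powr ?s * C0) powr (1 / ?s))" using C0 by (simp add: enn_powr_def)
      also have "((l / (c * \<kappa>)) powr ?s * C0) powr (1 / ?s) = C * l"
        using l1 c \<kappa>(1) C0 s0 by (simp add: powr_mult powr_powr C_def)
      also have "ennreal (C * l) = ennreal C * ennreal l" using C by (intro ennreal_mult') simp
      finally show ?thesis .
    qed
    \<comment> \<open>The constant is the same for all admissible numbers, so the estimate passes to
      their infimum.\<close>
    have "enn_powr ?X (1 / ?s) \<le> ennreal C * hardy_norm A \<Delta> N p f"
      unfolding hardy_norm_def Lvar_norm_def
      by (rule ennreal_scaled_inf[OF C]) (use X in \<open>auto simp: admissible_def[OF hyps]\<close>)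
    then show ?thesis using fourier_fun_continuous[OF hyps l0] fourier_fun_dist[OF hyps l0] by blast
  qed
  with C show ?thesis by blast
qed

end
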